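(* Let $n,p\ge1$ be integers, $N=np$, and $a,b\ge0$ real. Let $\Sigma_N$ be the random spectral matrix measure associated with the $\mathrm{JUE}_N(a,b)$ distribution. Then the Hermitian canonical moments $\mathcal U_1,\dots,\mathcal U_{2n-1}$ of $\Sigma_N$ are independent and, for $k=1,2,\dots,n-1$, $$\mathcal U_{2k-1}\sim\mathrm{JUE}_p\big(p(n-k)+a,\;p(n-k)+b\big),\qquad \mathcal U_{2k}\sim\mathrm{JUE}_p\big(p(n-k-1),\;p(n-k)+a+b\big),$$ and $\mathcal U_{2n-1}\sim\mathrm{JUE}_p(a,b)$.
   Context: Jacobi ensemble. For an integer $m\ge1$ and real $a,b\ge0$, $\mathrm{JUE}_m(a,b)$ is the distribution of a random Hermitian $m\times m$ matrix $X$ with density, on the set $\{0<X<I\}$ and with respect to Lebesgue measure on the functionally independent real entries, proportional to $\det(X)^a\det(I-X)^b$. For Hermitian matrices $A<B$ means $B-A$ is positive definite. Spectral matrix measure. If $X_N$ is a random Hermitian $N\times N$ matrix ($N\ge p$), its spectral matrix measure $\Sigma_N$ is the $p\times p$ matrix-valued measure on $\mathbb R$ defined by $\int x^k\,d\Sigma_N(x)=\big((X_N^k)_{i,j}\big)_{1\le i,j\le p}$, $k\ge0$; equivalently $\Sigma_N=\sum_{j=1}^N v_jv_j^\dagger\delta_{\lambda_j}$ with $\lambda_j$ the eigenvalues of $X_N$ and $v_j\in\mathbb C^p$ the first $p$ coordinates of an orthonormal basis of eigenvectors. $\Sigma_N$ is normalized, i.e. $\Sigma_N(\mathbb R)=\mathbf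 1$, the $p\times p$ identity. Hermitian canonical moments. For a normalized $p\times p$ (Hermitian nonnegative definite) matrix measure $\Sigma$ on $[0,1]$ write $M_k=\int x^k\,d\Sigma(x)$. $\Sigma$ is nontrivial if $\operatorname{tr}\int P(x)^\dagger d\Sigma(x)P(x)>0$ for every nonzero polynomial $P$ with $p\times p$ matrix coefficients. If $M_1,\dots,M_{k-1}$ are the first $k-1$ moments of some nontrivial normalized matrix measure on $[0,1]$, there exist Hermitian matrices $M_k^-<M_k^+$, depending only on $M_1,\dots,M_{k-1}$, such that $M_1,\dots,M_{k-1},M_k$ are the first $k$ moments of some nontrivial normalized matrix measure on $[0,1]$ if and only if $M_k^-<M_k<M_k^+$. Put $R_k=M_k^+-M_k^-$, $H_k=M_k-M_k^-$. The Hermitian canonical moment is $\mathcal U_k=R_k^{-1/2}H_kR_k^{-1/2}$. For $\Sigma_N$ as in the theorem, almost surely $M_k^\pm$ exist and $M_k^-<M_k<M_k^+$ for $1\le k\le2n-1$, so that $\mathcal U_1,\dots,\mathcal U_{2n-1}$ are almost surely well defined with $\mathbf 0<\mathcal U_k<\mathbf 1$. *)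

theory Defs
  imports "HOL-Probability.Probability" "Jordan_Normal_Form.Schur_Decomposition"
begin

unbundle no inner_syntax
unbundle no vec_syntax

hide_const (open) Finite_Cartesian_Product.mat Finite_Cartesian_Product.vec
  Finite_Cartesian_Product.row Finite_Cartesian_Product.column Determinants.det

text \<open>Matrix indices run over \<open>{..<m}\<close>. The order on \<^typ>\<open>complex\<close> is the library's partial
  order, so \<open>0 < z\<close> says that \<open>z\<close> is real and positive; \<open>(A *\<^sub>v v) \<bullet>c v\<close> is the
  quadratic form of \<open>A\<close> at \<open>v\<close>.\<close>

section \<open>Hermitian matrices\<close>

definition hermitian_mat :: "nat \<Rightarrow> complex mat \<Rightarrow> bool" where
  "hermitian_mat m A \<longleftrightarrow> A \<in> carrier_mat m m \<and> mat_adjoint A = A"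

definition pos_def_mat :: "nat \<Rightarrow> complex mat \<Rightarrow> bool" where
  "pos_def_mat m A \<longleftrightarrow> hermitian_mat m A \<and>
     (\<forall>v\<in>carrier_vec m. v \<noteq> 0\<^sub>v m \<longrightarrow> 0 < (A *\<^sub>v v) \<bullet>c v)"

definition nonneg_def_mat :: "nat \<Rightarrow> complex mat \<Rightarrow> bool" where
  "nonneg_def_mat m A \<longleftrightarrow> hermitian_mat m A \<and> (\<forall>v\<in>carrier_vec m. 0 \<le> (A *\<^sub>v v) \<bullet>c v)"

definition loewner_less :: "nat \<Rightarrow> complex mat \<Rightarrow> complex mat \<Rightarrow> bool" where
  "loewner_less m A B \<longleftrightarrow> hermitian_mat m A \<and> hermitian_mat m B \<and> pos_def_mat m (B - A)"

definition inv_sqrt_mat :: "nat \<Rightarrow> complex mat \<Rightarrow> complex mat" where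
  "inv_sqrt_mat m R = (THE S. pos_def_mat m S \<and> inverts_mat R (S * S) \<and> inverts_mat (S * S) R)"


section \<open>The Jacobi ensemble\<close>

text \<open>The Borel sigma-algebra on the Hermitian matrices, generated by the matrix entries.\<close>

definition herm_borel :: "nat \<Rightarrow> complex mat measure" where
  "herm_borel m = sigma {A. hermitian_mat m A}
     {{A. hermitian_mat m A \<and> A $$ (i, j) \<in> B} | i j B. i < m \<and> j < m \<and> B \<in> sets borel}"

text \<open>The \<open>m\<^sup>2\<close> functionally independent real entries of a Hermitian matrix: \<open>x (i, j)\<close> is the
  diagonal entry for \<open>i = j\<close>, and for \<open>i < j\<close> the real and imaginary parts of the \<open>(i, j)\<close> entry
  are \<open>x (i, j)\<close> and \<open>x (j, i)\<close>.\<close>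

definition herm_of_entries :: "nat \<Rightarrow> (nat \<times> nat \<Rightarrow> real) \<Rightarrow> complex mat" where
  "herm_of_entries m x = Matrix.mat m m (\<lambda>(i, j).
     if i = j then complex_of_real (x (i, i))
     else if i < j then Complex (x (i, j)) (x (j, i))
     else Complex (x (j, i)) (- x (i, j)))"

definition herm_lebesgue :: "nat \<Rightarrow> complex mat measure" where
  "herm_lebesgue m =
     distr (\<Pi>\<^sub>M ij\<in>{..<m} \<times> {..<m}. lborel) (herm_borel m) (herm_of_entries m)"

definition JUE_weight :: "nat \<Rightarrow> real \<Rightarrow> real \<Rightarrow> complex mat \<Rightarrow> ennreal" where
  "JUE_weight m a b X =
     (if loewner_less m (0\<^sub>m m m) X \<and> loewner_less m X (1\<^sub>m m)
      then ennreal (Re (Determinant.det X) powr a * Re (Determinant.det (1\<^sub>m m - X)) powr b)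
      else 0)"

definition JUE :: "nat \<Rightarrow> real \<Rightarrow> real \<Rightarrow> complex mat measure" where
  "JUE m a b = density (herm_lebesgue m)
     (\<lambda>X. JUE_weight m a b X / (\<integral>\<^sup>+ Y. JUE_weight m a b Y \<partial>herm_lebesgue m))"


section \<open>Matrix measures\<close>

text \<open>A \<open>p \<times> p\<close> matrix measure on the real line is a set function, with the convention that it is
  zero on non-Borel sets. Vanishing on the empty set follows from countable additivity.\<close>

definition matrix_measure :: "nat \<Rightarrow> (real set \<Rightarrow> complex mat) \<Rightarrow> bool" where
  "matrix_measure p \<Sigma> \<longleftrightarrow>
     (\<forall>A. nonneg_def_mat p (\<Sigma> A)) \<and>
     (\<forall>A. A \<notin> sets borel \<longrightarrow> \<Sigma> A = 0\<^sub>m p p) \<and>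
     (\<forall>A :: nat \<Rightarrow> real set. range A \<subseteq> sets borel \<longrightarrow> disjoint_family A \<longrightarrow>
        (\<forall>i<p. \<forall>j<p. (\<lambda>n. \<Sigma> (A n) $$ (i, j)) sums (\<Sigma> (\<Union>n. A n) $$ (i, j))))"

definition normalized_matrix_measure01 :: "nat \<Rightarrow> (real set \<Rightarrow> complex mat) \<Rightarrow> bool" where
  "normalized_matrix_measure01 p \<Sigma> \<longleftrightarrow>
     matrix_measure p \<Sigma> \<and> \<Sigma> UNIV = 1\<^sub>m p \<and> \<Sigma> (- {0..1}) = 0\<^sub>m p p"

definition quad_measure :: "(real set \<Rightarrow> complex mat) \<Rightarrow> complex vec \<Rightarrow> real measure" where
  "quad_measure \<Sigma> v = measure_of UNIV (sets borel) (\<lambda>A. ennreal (Re ((\<Sigma> A *\<^sub>v v) \<bullet>c v)))"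

text \<open>The integral of \<open>f\<close> against the complex measure \<open>\<Sigma>\<^sub>k\<^sub>l\<close>. By polarization, with
  \<open>q v\<close> the quadratic form of \<open>\<Sigma> A\<close>, one has
  \<open>\<Sigma>\<^sub>k\<^sub>l A = (\<Sum>m<4. \<i> ^ m * q (\<i> ^ m e\<^sub>k + e\<^sub>l)) / 4\<close>, a combination of positive measures.\<close>

definition entry_integral ::
  "nat \<Rightarrow> (real set \<Rightarrow> complex mat) \<Rightarrow> nat \<Rightarrow> nat \<Rightarrow> (real \<Rightarrow> complex) \<Rightarrow> complex" where
  "entry_integral p \<Sigma> k l f =
     (\<Sum>m<4. \<i> ^ m *
        (\<integral>x. f x \<partial>quad_measure \<Sigma> (\<i> ^ m \<cdot>\<^sub>v unit_vec p k + unit_vec p l))) / 4"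

text \<open>The matrix \<open>\<integral> F(x) d\<Sigma>(x) G(x)\<close>.\<close>

definition matrix_integral ::
  "nat \<Rightarrow> (real set \<Rightarrow> complex mat) \<Rightarrow> (real \<Rightarrow> complex mat) \<Rightarrow> (real \<Rightarrow> complex mat) \<Rightarrow> complex mat"
where
  "matrix_integral p \<Sigma> F G = Matrix.mat p p (\<lambda>(i, j).
     \<Sum>k<p. \<Sum>l<p. entry_integral p \<Sigma> k l (\<lambda>x. F x $$ (i, k) * G x $$ (l, j)))"

definition matrix_moment :: "nat \<Rightarrow> (real set \<Rightarrow> complex mat) \<Rightarrow> nat \<Rightarrow> complex mat" where
  "matrix_moment p \<Sigma> k =
     Matrix.mat p p (\<lambda>(i, j). entry_integral p \<Sigma> i j (\<lambda>x. complex_of_real (x ^ k)))"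

text \<open>A polynomial with \<open>p \<times> p\<close> matrix coefficients is represented as a \<open>p \<times> p\<close> matrix of
  polynomials.\<close>

definition eval_poly_mat :: "complex poly mat \<Rightarrow> real \<Rightarrow> complex mat" where
  "eval_poly_mat P x = map_mat (\<lambda>q. poly q (complex_of_real x)) P"

definition nontrivial_matrix_measure :: "nat \<Rightarrow> (real set \<Rightarrow> complex mat) \<Rightarrow> bool" where
  "nontrivial_matrix_measure p \<Sigma> \<longleftrightarrow>
     (\<forall>P\<in>carrier_mat p p. P \<noteq> 0\<^sub>m p p \<longrightarrow>
        0 < (\<Sum>i<p. matrix_integral p \<Sigma>
               (\<lambda>x. mat_adjoint (eval_poly_mat P x)) (eval_poly_mat P) $$ (i, i)))"


section \<open>The spectral matrix measure\<close>

definition orthonormal_eigenbasis ::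
  "nat \<Rightarrow> complex mat \<Rightarrow> (nat \<Rightarrow> real) \<Rightarrow> (nat \<Rightarrow> complex vec) \<Rightarrow> bool" where
  "orthonormal_eigenbasis N X \<theta> u \<longleftrightarrow>
     (\<forall>j<N. u j \<in> carrier_vec N \<and> X *\<^sub>v u j = complex_of_real (\<theta> j) \<cdot>\<^sub>v u j) \<and>
     (\<forall>i<N. \<forall>j<N. u i \<bullet>c u j = (if i = j then 1 else 0))"

text \<open>The sum over \<open>j\<close> with \<open>\<theta> j \<in> A\<close> of \<open>v\<^sub>j v\<^sub>j\<^sup>\<dagger>\<close>, where \<open>v\<^sub>j\<close> consists of the first \<open>p\<close>
  coordinates of \<open>u j\<close>; it is the same for every orthonormal basis of eigenvectors.\<close>

definition spectral_matrix_measure :: "nat \<Rightarrow> nat \<Rightarrow> complex mat \<Rightarrow> real set \<Rightarrow> complex mat" where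
  "spectral_matrix_measure p N X = (THE \<Sigma>. \<exists>\<theta> u. orthonormal_eigenbasis N X \<theta> u \<and>
     \<Sigma> = (\<lambda>A. if A \<in> sets borel
               then Matrix.mat p p (\<lambda>(i, k). \<Sum>j | j < N \<and> \<theta> j \<in> A. u j $ i * cnj (u j $ k))
               else 0\<^sub>m p p))"


section \<open>Hermitian canonical moments\<close>

definition interior_moments :: "nat \<Rightarrow> nat \<Rightarrow> (nat \<Rightarrow> complex mat) \<Rightarrow> bool" where
  "interior_moments p k M \<longleftrightarrow>
     (\<exists>\<Sigma>. normalized_matrix_measure01 p \<Sigma> \<and> nontrivial_matrix_measure p \<Sigma> \<and>
          (\<forall>j\<in>{1..k}. matrix_moment p \<Sigma> j = M j))"

text \<open>\<open>L\<close> and \<open>U\<close> are the bounds \<open>M\<^sub>k\<^sup>-\<close> and \<open>M\<^sub>k\<^sup>+\<close>; only \<open>M 1, \<dots>, M (k - 1)\<close> matter here.\<close>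

definition moment_bounds ::
  "nat \<Rightarrow> nat \<Rightarrow> (nat \<Rightarrow> complex mat) \<Rightarrow> complex mat \<Rightarrow> complex mat \<Rightarrow> bool" where
  "moment_bounds p k M L U \<longleftrightarrow> interior_moments p (k - 1) M \<and> loewner_less p L U \<and>
     (\<forall>H. interior_moments p k (M(k := H)) \<longleftrightarrow> loewner_less p L H \<and> loewner_less p H U)"

definition moment_lower :: "nat \<Rightarrow> nat \<Rightarrow> (nat \<Rightarrow> complex mat) \<Rightarrow> complex mat" where
  "moment_lower p k M = (THE L. \<exists>U. moment_bounds p k M L U)"

definition moment_upper :: "nat \<Rightarrow> nat \<Rightarrow> (nat \<Rightarrow> complex mat) \<Rightarrow> complex mat" where
  "moment_upper p k M = (THE U. \<exists>L. moment_bounds p k M L U)"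

text \<open>Outside the almost sure event on which the bounds exist, the value is set to zero.\<close>

definition canonical_moment :: "nat \<Rightarrow> (real set \<Rightarrow> complex mat) \<Rightarrow> nat \<Rightarrow> complex mat" where
  "canonical_moment p \<Sigma> k =
     (let M = matrix_moment p \<Sigma>;
          R = moment_upper p k M - moment_lower p k M;
          H = M k - moment_lower p k M
      in if \<exists>L U. moment_bounds p k M L U
         then inv_sqrt_mat p R * H * inv_sqrt_mat p R
         else 0\<^sub>m p p)"

end

theory Submission imports Defs "Jordan_Normal_Form.Spectral_Radius"
begin

text \<open>The first two matrix moments are peeled off one step at a time. Write the Hermitian matrix as a
block matrix with upper left block \<open>A = M\<^sub>1\<close> and upper right block
\<open>(A (1 - A))\<^sup>1\<^sup>/\<^sup>2 Z\<close>, put \<open>W = Z Z\<^sup>\<dagger>\<close>, and replace the lower right block by the matrix \<open>Y\<close> from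
which it arises by an affine bijection depending on \<open>A\<close> and \<open>Z\<close>. Then \<open>0 < X < 1\<close> holds iff
\<open>A\<close>, \<open>W\<close> and \<open>Y\<close> lie strictly between \<open>0\<close> and \<open>1\<close>, the determinants and Jacobians factor, and \<open>Y\<close> is
again Jacobi distributed, of size smaller by \<open>p\<close>. The canonical moments of \<open>X\<close> are \<open>A\<close> and \<open>W\<close> followed by
those of \<open>Y\<close>, up to unitary conjugations depending only on the earlier data; since the Jacobi
ensembles are unitarily invariant, the conjugations do not affect the joint law. The law of \<open>W\<close> under
Lebesgue measure on \<open>Z\<close> follows from uniqueness of the invariant measure on the positive cone.\<close>

section \<open>Matrix algebra\<close>

text \<open>The canonical moments are defined through the existence of measures, so the moment
  intervals must first be made computable. An odd number 2n - 1 of moments is interior iff two block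
  Hankel matrices of size np are positive definite, and this iff the moments come from a pair (X, V)
  with 0 < X < 1, V a co-isometry and V^H cyclic. Such models can be peeled like random matrices,
  hence so can interior sequences; an even number of moments is handled by projection from the next
  odd number. For given A and Z the lower right block ranges over the interval from Z^H (1 - A) Z to
  1 - Z^H A Z, of length 1 - Z^H Z. Its Jacobian and that of Z give det(1 - W)^q and det(A (1 -
  A))^q with q the remaining size, and passing from Z to W gives det W^(q - p); this is the origin
  of the exponents. The frame in which Y is seen is the row space of Z, and the conjugation
  accumulated in the intervals depends on A and W; hence the induction covers every invertible
  conjugation D with a constant independent of D. No normalizing constant is computed: total mass
  one fixes them all.\<close>

type_synonym cmat = "complex mat"

abbreviation cx :: "real \<Rightarrow> complex" where "cx \<equiv> complex_of_real"

notation one_mat ("1m") and zero_mat ("0m")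

notation iff (infixr "<->" 25) and LIMSEQ (infixr "---->" 60) and cscalar_prod (infix ".c" 70)

abbreviation (input) "Mat \<equiv> carrier_mat"
abbreviation (input) "Vec \<equiv> carrier_vec"
abbreviation (input) "Herm \<equiv> hermitian_mat"
abbreviation (input) "pdm \<equiv> pos_def_mat"
abbreviation (input) "isqrt \<equiv> inv_sqrt_mat"
abbreviation (input) "fbm \<equiv> four_block_mat"
abbreviation (input) "bm \<equiv> borel_measurable"
abbreviation (input) "Ind \<equiv> indicator"
abbreviation (input) "nn \<equiv> nn_integral"
abbreviation (input) "eint \<equiv> entry_integral"
abbreviation (input) "imom \<equiv> interior_moments"
abbreviation (input) "mmt \<equiv> matrix_moment"
abbreviation (input) "lwl \<equiv> loewner_less"
abbreviation (input) "nr \<equiv> dim_row"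
abbreviation (input) "nc \<equiv> dim_col"
abbreviation (input) "meas \<equiv> measurable"
abbreviation (input) "jw \<equiv> JUE_weight"
abbreviation (input) "mbd \<equiv> moment_bounds"
abbreviation (input) "hoe \<equiv> herm_of_entries"

notation smult_mat (infixl ".*" 70) and mult_mat_vec (infixl "*v" 70)

lemmas bm_times = borel_measurable_times_ennreal
lemmas m_comp = measurable_compose
lemmas sp_def = scalar_prod_def
lemmas at0L = atLeast0LessThan
lemmas nn_cong = nn_integral_cong
lemmas nn_cmult = nn_integral_cmult
lemmas index_mm = index_mult_mat
lemmas mm_lr_inv = mat_mult_left_right_inverse
lemmas sum_dl = sum_distrib_left
lemmas MatD = carrier_matD
lemmas cj1 = conjunct1
lemmas cj2 = conjunct2

abbreviation adj :: "cmat => cmat" ("(_^H)" [1000] 1000) where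
 "A^H == mat_adjoint A"

lemma dim_adjoint [simp]: "nr (A^H) = nc A" "nc (A^H) = nr A" by (simp_all add: mat_adjoint_def)

lemma index_adjoint [simp]: assumes "i < nc A" "j < nr A" shows "A^H $$ (i, j) = cnj (A $$ (j, i))"
 using assms by (simp add: mat_adjoint_def mat_of_rows_index)

lemma adjoint_carrier [simp]: "A : Mat m n ==> A^H : Mat n m" by (auto intro!: carrier_matI)

lemma adjoint_adjoint [simp]: "(A^H)^H = A" by (rule eq_matI) auto

lemma adjoint_mult [simp]: "nc A = nr B ==> (A * B)^H = B^H * A^H" by (rule eq_matI) (auto simp: sp_def mult.commute)

lemma adjoint_add [simp]:
 "nr A = nr B ==> nc A = nc B ==> (A + B)^H = A^H + B^H" by (rule eq_matI) auto

lemma adjoint_minus [simp]: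
 "nr A = nr B ==> nc A = nc B ==> (A - B)^H = A^H - B^H" by (rule eq_matI) auto

lemma adjoint_smult [simp]: "(c .* A)^H = cnj c .* A^H" by (rule eq_matI) auto

lemma adjoint_one [simp]: "(1m n)^H = 1m n" by (rule eq_matI) auto

lemma adjoint_zero [simp]: "(0m m n)^H = 0m n m" by (rule eq_matI) auto

lemma carrier_iff: "A : Mat m n <-> nr A = m & nc A = n" by auto

lemma m_assoc:
 fixes A B C :: "'a::semiring_0 mat" shows "nc A = nr B ==> nc B = nr C ==> A * B * C = A * (B * C)"
 by (rule assoc_mult_mat[of A "nr A" "nr B" B "nr C" C "nc C"]) auto

lemma m_cancel:
 fixes A B C X :: "'a::semiring_0 mat" shows "A * B = C ==> nc A = nr B ==> nc B = nr X ==> A * (B * X) = C * X" by (simp flip: m_assoc)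

lemma mult_add_dim:
 fixes A B C :: "'a::semiring_0 mat" shows "nr B = nr C ==> nc B = nc C ==> nc A = nr C
  ==> A * (B + C) = A * B + A * C" by (rule mult_add_distrib_mat[of A "nr A" "nc A" B "nc B"]) auto

lemma add_mult_dim:
 fixes A B C :: "'a::semiring_0 mat" shows "nr A = nr B ==> nc A = nc B ==> nc B = nr C
  ==> (A + B) * C = A * C + B * C" by (rule add_mult_distrib_mat[of A "nr A" "nc A" B C "nc C"]) auto

lemma mult_minus_dim:
 fixes A B C :: "'a::ring mat" shows "nr B = nr C ==> nc B = nc C ==> nc A = nr C
  ==> A * (B - C) = A * B - A * C" by (rule mult_minus_distrib_mat[of A "nr A" "nc A" B "nc B"]) auto

lemma minus_mult_dim:
 fixes A B C :: "'a::ring mat" shows "nr A = nr B ==> nc A = nc B ==> nc B = nr C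
  ==> (A - B) * C = A * C - B * C" by (rule minus_mult_distrib_mat[of A "nr A" "nc A" B C "nc C"]) auto

lemma smult_mult_dim [simp]:
 fixes A B :: "'a::comm_ring_1 mat" shows "nc A = nr B ==> (c .* A) * B = c .* (A * B)" and "nc A = nr B ==> A * (c .* B) = c .* (A * B)"
 by (auto intro!: eq_matI simp: sp_def sum_dl mult_ac)

lemma one_mult_dim [simp]:
 fixes A :: "'a::semiring_1 mat" shows "nr A = n ==> 1m n * A = A" "nc A = n ==> A * 1m n = A" by (auto intro!: left_mult_one_mat right_mult_one_mat)

lemma zero_mult_dim [simp]:
 fixes A :: "'a::semiring_1 mat" shows "nr A = n ==> 0m m n * A = 0m m (nc A)"
  "nc A = n ==> A * 0m n m = 0m (nr A) m" by (auto intro!: eq_matI simp: sp_def)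

lemmas m_distrib = mult_add_dim add_mult_dim mult_minus_dim minus_mult_dim

lemma mult_vec_assoc:
 fixes A B :: "'a::semiring_0 mat" shows "nc A = nr B ==> nc B = dim_vec v ==> (A * B) *v v = A *v (B *v v)"
 by (rule assoc_mult_mat_vec[of A "nr A" "nr B" B "dim_vec v"])
   (auto intro: carrier_vecI)

lemma cinner_adjoint: assumes "nc A = dim_vec v" "nr A = dim_vec w" shows "(A *v v) .c w = v .c (A^H *v w)"
proof -
 have "(A *v v) .c w = (\<Sum>i<dim_vec w. \<Sum>j<dim_vec v. A $$ (i, j) * v $ j * cnj (w $ i))"
  using assms by (simp add: sp_def sum_distrib_right at0L)
 also have "... = (\<Sum>j<dim_vec v. \<Sum>i<dim_vec w. A $$ (i, j) * v $ j * cnj (w $ i))" by (rule sum.swap)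
 also have "... = v .c (A^H *v w)" using assms by (simp add: sp_def sum_dl at0L mult_ac)
 finally show ?thesis .
qed

section \<open>Hermitian and positive definite matrices under congruence\<close>

lemma HermD: assumes "Herm m A" shows "A : Mat m m" "A^H = A" "nr A = m" "nc A = m" using assms by (auto simp: hermitian_mat_def)

lemma HermI: "A : Mat m m ==> A^H = A ==> Herm m A" by (simp add: hermitian_mat_def)

lemma hermitian_index:
 "Herm m A ==> i < m ==> j < m ==> A $$ (i, j) = cnj (A $$ (j, i))" by (metis HermD index_adjoint)

lemma Herm_congr: assumes "Herm m A" "D : Mat k m" shows "Herm k (D * A * D^H)" using HermD[OF assms(1)] assms(2)
 by (intro HermI) (auto simp: m_assoc)

lemma hermitian_add: "Herm m A ==> Herm m B ==> Herm m (A + B)" and Herm_minus: "Herm m A ==> Herm m B ==> Herm m (A - B)"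
 and hermitian_smult: "Herm m A ==> Herm m (cx c .* A)" and hermitian_one: "Herm m (1m m)" and hermitian_zero: "Herm m (0m m m)"
 by (auto simp: hermitian_mat_def)

lemma cinner_congr: assumes "A : Mat m m" "D : Mat k m" "v : Vec k" shows "((D * A * D^H) *v v) .c v = (A *v (D^H *v v)) .c (D^H *v v)"
proof -
 have "(D * A * D^H) *v v = D *v (A *v (D^H *v v))" using assms by (simp add: mult_vec_assoc m_assoc)
 thus ?thesis using assms by (simp add: cinner_adjoint)
qed

lemma cinner_self_Re: "v .c v = cx (\<Sum>i<dim_vec v. (cmod (v $ i))^2)" by (simp add: sp_def at0L flip: complex_norm_square)

lemma cinner_hermitian_real: assumes "Herm m A" "v : Vec m" shows "Im ((A *v v) .c v) = 0"
proof -
 note [simp] = HermD[OF assms(1)]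
 have "(A *v v) .c v = v .c (A *v v)" using assms by (subst cinner_adjoint) auto
 also have "... = cnj ((A *v v) .c v)" using assms by (simp add: sp_def mult.commute)
 finally show ?thesis by (metis complex_cnj_cancel_iff complex_is_Real_iff Reals_cnj_iff)
qed

lemma pos_def_mat_iff:
 "pdm m A <-> Herm m A &
   (ALL v:Vec m. v ~= 0\<^sub>v m --> 0 < Re ((A *v v) .c v))" unfolding pos_def_mat_def using cinner_hermitian_real by (auto simp: less_complex_def)

lemma pos_def_matD:
 "pdm m A ==> v : Vec m ==> v ~= 0\<^sub>v m ==> 0 < Re ((A *v v) .c v)" by (simp add: pos_def_mat_iff)

lemma pd_herm: "pdm m A ==> Herm m A" by (simp add: pos_def_mat_def)

lemmas pd_dims = HermD[OF pd_herm]

lemma pos_def_nonneg: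
 "pdm m A ==> v : Vec m ==> 0 <= Re ((A *v v) .c v)"
 using pos_def_matD[of m A v] pd_dims(1)[of m A] by (cases "v = 0\<^sub>v m") (auto simp: less_imp_le)

lemma pos_def_add: assumes "pdm m A" "pdm m B" shows "pdm m (A + B)"
proof -
 note [simp] = pd_dims[OF assms(1)] pd_dims[OF assms(2)]
 show ?thesis unfolding pos_def_mat_iff
 proof (intro conjI ballI impI)
  fix v :: "complex vec" assume v: "v : Vec m" "v ~= 0\<^sub>v m"
  have "((A + B) *v v) .c v = (A *v v) .c v + (B *v v) .c v"
   using v by (subst add_mult_distrib_mat_vec[of A m m B]; (subst add_scalar_prod_distrib[of _ m])?)
    (auto intro!: carrier_vecI)
  thus "0 < Re (((A + B) *v v) .c v)" using assms[THEN pos_def_matD, OF v] by simp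
 qed (use hermitian_add[OF assms[THEN pd_herm]] in auto)
qed

lemma pos_def_smult: assumes "pdm m A" "c > 0" shows "pdm m (cx c .* A)"
proof -
 note [simp] = pd_dims[OF assms(1)]
 have "((cx c .* A) *v v) .c v = c * ((A *v v) .c v)" if "v : Vec m" for v using that by (simp add: sp_def sum_dl sum_distrib_right mult_ac)
 thus ?thesis unfolding pos_def_mat_iff using assms hermitian_smult[OF pd_herm[OF assms(1)]] pos_def_matD[OF assms(1)] by (auto)
qed

lemma pd_one: "pdm m (1m m)" unfolding pos_def_mat_def by (auto simp: hermitian_one)

lemma mult_vec_eq_0:
 fixes A B :: "cmat" assumes "B * A = 1m m" "nc B = nr A" "nc A = m" "v : Vec m"
  "A *v v = 0\<^sub>v (nr A)" "nr B = m" shows "v = 0\<^sub>v m"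
proof -
 have "v = (B * A) *v v" unfolding assms(1) using one_mult_mat_vec[OF assms(4)] by simp
 also have "... = B *v (A *v v)" using assms by (intro mult_vec_assoc) auto
 also have "... = 0\<^sub>v m" using assms by (auto intro!: eq_vecI simp: sp_def)
 finally show ?thesis .
qed

lemma pos_def_congr: assumes "pdm m A" "D : Mat k m" and inj: "!!v. v : Vec k ==> D^H *v v = 0\<^sub>v m ==> v = 0\<^sub>v k"
 shows "pdm k (D * A * D^H)" unfolding pos_def_mat_iff
proof (intro conjI ballI impI)
 show "Herm k (D * A * D^H)" using assms by (intro Herm_congr pd_herm)
 fix v :: "complex vec" assume v: "v : Vec k" "v ~= 0\<^sub>v k"
 hence "D^H *v v ~= 0\<^sub>v m" using inj by auto
 moreover have "D^H *v v : Vec m" using assms v by (auto intro!: carrier_vecI)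
 ultimately show "0 < Re (((D * A * D^H) *v v) .c v)" using pos_def_matD[OF assms(1)] cinner_congr[OF pd_dims(1)[OF assms(1)] assms(2) v(1)] by auto
qed

lemma pd_congr_inv: assumes "pdm m A" "D : Mat m m" "E : Mat m m" "D * E = 1m m" shows "pdm m (D * A * D^H)"
proof (rule pos_def_congr[OF assms(1,2)])
 have "E^H * D^H = (D * E)^H" using assms(2,3) by simp
 hence "E^H * D^H = 1m m" unfolding assms(4) by simp
 thus "!!v. v : Vec m ==> D^H *v v = 0\<^sub>v m ==> v = 0\<^sub>v m" using assms by (intro mult_vec_eq_0[of "E^H" "D^H" m]) auto
qed

lemma pd_congr_iff: assumes "A : Mat m m" "D : Mat m m" "E : Mat m m" "D * E = 1m m" shows "pdm m (D * A * D^H) <-> pdm m A"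
proof
 assume *: "pdm m (D * A * D^H)"
 have ED: "E * D = 1m m" using mm_lr_inv[OF assms(2,3,4)] .
 have "D^H * E^H = (E * D)^H" using assms(2,3) by simp
 hence DE': "D^H * E^H = 1m m" unfolding ED by simp
 have "pdm m (E * (D * A * D^H) * E^H)" by (rule pd_congr_inv[OF * assms(3,2) ED])
 also have "E * (D * A * D^H) * E^H = A" using assms ED DE' by (simp add: m_assoc m_cancel[OF ED])
 finally show "pdm m A" .
qed (rule pd_congr_inv[OF _ assms(2-4)])

lemma loewner_less_0_iff: "lwl m (0m m m) A <-> pdm m A"
proof -
 have "A - 0m m m = A" if "A : Mat m m" using that by auto
 thus ?thesis unfolding loewner_less_def using hermitian_zero pd_herm pd_dims by (metis HermD(1))
qed

lemma inverse_exists: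
 fixes A :: "cmat" assumes "A : Mat m m" "!!v. v : Vec m ==> A *v v = 0\<^sub>v m ==> v = 0\<^sub>v m"
 shows "EX B:Mat m m. A * B = 1m m & B * A = 1m m"
proof -
 have "det A ~= 0" using det_0_iff_vec_prod_zero_field[OF assms(1)] assms(2) by auto
 from det_non_zero_imp_unit[OF assms(1) this, of "()"]
 show ?thesis unfolding Units_def by (auto simp: ring_mat_simps)
qed

lemma det_inverse_exists:
 fixes A :: "cmat" assumes "A : Mat m m" "det A ~= 0" shows "EX B:Mat m m. A * B = 1m m & B * A = 1m m" using det_non_zero_imp_unit[OF assms, of "()"]
 unfolding Units_def by (auto simp: ring_mat_simps)

section \<open>Spectral theorem and square roots\<close>

definition unitm :: "nat => cmat => bool" where
 "unitm n U <-> U : Mat n n & U^H * U = 1m n & U * U^H = 1m n"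

lemma unitD: assumes "unitm n U" shows "U : Mat n n" "U^H * U = 1m n" "U * U^H = 1m n" "nr U = n" "nc U = n" using assms by (auto simp: unitm_def)

lemma unitary_matI: "U : Mat n n ==> U^H * U = 1m n ==> unitm n U" using mm_lr_inv[of "U^H" n U] by (auto simp: unitm_def)

lemma unitary_matI': "U : Mat n n ==> U * U^H = 1m n ==> unitm n U" using mm_lr_inv[of U n "U^H"] by (auto simp: unitm_def)

lemma unitary_adjoint: "unitm n U ==> unitm n (U^H)" by (auto simp: unitm_def)

lemma unitary_mult: "unitm n U ==> unitm n V ==> unitm n (U * V)"
proof (rule unitary_matI)
 assume *: "unitm n U" "unitm n V"
 note [simp] = unitD[OF *(1)] unitD[OF *(2)]
 show "(U * V)^H * (U * V) = 1m n" by (simp add: m_assoc m_cancel[OF unitD(2)[OF *(1)]])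
qed (auto simp: unitm_def)

lemma index_adjoint_mult: assumes "W : Mat n k" "V : Mat n l" "i < k" "j < l"
 shows "(W^H * V) $$ (i, j) = (\<Sum>r<n. cnj (W $$ (r, i)) * V $$ (r, j))" using assms by (auto simp: sp_def at0L)

text \<open>The conjugated columns of \<open>W\<close>, padded by zero rows, form a singular square
  matrix because \<open>k < n\<close>; a kernel vector is orthogonal to all columns and only has to
  be normalized.\<close>

lemma orthonormal_extend1: assumes W: "W : Mat n k" and k: "k < n"
 shows "EX u. (ALL i<k. (\<Sum>r<n. cnj (W $$ (r, i)) * u r) = 0) & (\<Sum>r<n. cnj (u r) * u r) = (1::complex)"
proof -
 define A where "A = mat n n (%(i, j). if i < k then cnj (W $$ (j, i)) else 0)"
 have A: "A : Mat n n" by (simp add: A_def)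
 have "A\<^sup>T *v unit_vec n (n - 1) = 0\<^sub>v n" using k by (intro eq_vecI) (auto simp: A_def)
 hence "det (A\<^sup>T) = 0" using det_0_iff_vec_prod_zero_field[of "A\<^sup>T" n] A k by (auto intro!: exI[of _ "unit_vec n (n - 1)"])
 hence "det A = 0" using det_transpose[OF A] by simp
 then obtain v where v: "v : Vec n" "v ~= 0\<^sub>v n" "A *v v = 0\<^sub>v n" using det_0_iff_vec_prod_zero_field[OF A] by auto
 define c where "c = sqrt (\<Sum>r<n. (cmod (v $ r))^2)"
 have "v .c v ~= 0" using v by simp
 hence c0: "c\<^sup>2 = (\<Sum>r<n. (cmod (v $ r))^2)" "c ~= 0" using v(1) by (auto simp: cinner_self_Re c_def sum_nonneg simp del: of_real_sum)
 have "(\<Sum>r<n. cnj (W $$ (r, i)) * v $ r) = 0" if "i < k" for i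
 proof -
  have "(A *v v) $ i = 0" using v(3) that k by simp
  thus ?thesis using that k v(1) by (simp add: A_def sp_def at0L)
 qed
 moreover have "(\<Sum>r<n. cnj (v $ r / c) * (v $ r / c)) = (\<Sum>r<n. cnj (v $ r) * v $ r) / (cx c)^2"
  by (simp add: sum_divide_distrib power2_eq_square)
 moreover have "(\<Sum>r<n. cnj (v $ r) * v $ r) = (cx c)^2"
  using c0 by (simp add: mult.commute[of "cnj _"] flip: complex_norm_square of_real_power of_real_sum)
 ultimately show ?thesis using c0 by (intro exI[of _ "%r. v $ r / c"]) (auto simp flip: sum_divide_distrib)
qed

text \<open>Columns are added one at a time. The completion serves to turn an arbitrary frame
  \<open>V^H\<close> into the first coordinate vectors by a unitary change of basis; with a single
  column it also drives the deflation in the spectral theorem.\<close>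

lemma isometry_extend: assumes "W : Mat n k" "W^H * W = 1m k" "k <= n" shows "EX U. unitm n U & (ALL i<n. ALL j<k. U $$ (i, j) = W $$ (i, j))"
 using assms
proof (induction "n - k" arbitrary: k W)
 case 0
 thus ?case by (intro exI[of _ W]) (auto intro: unitary_matI)
next
 case (Suc d)
 hence k: "k < n" by simp
 from orthonormal_extend1[OF Suc.prems(1) k] obtain u :: "nat => complex" where
  u: "!!i. i < k ==> (\<Sum>r<n. cnj (W $$ (r, i)) * u r) = 0" "(\<Sum>r<n. cnj (u r) * u r) = 1" by blast
 have u': "(\<Sum>r<n. cnj (u r) * W $$ (r, i)) = 0" if "i < k" for i
 proof -
  have "(\<Sum>r<n. cnj (u r) * W $$ (r, i)) = cnj (\<Sum>r<n. cnj (W $$ (r, i)) * u r)" by (simp add: mult.commute)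
  thus ?thesis using u(1)[OF that] by simp
 qed
 have WW: "(\<Sum>r<n. cnj (W $$ (r, i)) * W $$ (r, j)) = (if i = j then 1 else 0)" if "i < k" "j < k" for i j
  using index_adjoint_mult[OF Suc.prems(1) Suc.prems(1) that] that Suc.prems(2) by simp
 define W' where "W' = mat n (Suc k) (%(i, j). if j < k then W $$ (i, j) else u i)"
 have W': "W' : Mat n (Suc k)" by (simp add: W'_def)
 have "W'^H * W' = 1m (Suc k)"
 proof (rule eq_matI)
  fix i j assume ij: "i < nr (1m (Suc k) :: cmat)" "j < nc (1m (Suc k) :: cmat)"
  hence "(W'^H * W') $$ (i, j) = (\<Sum>r<n. cnj (W' $$ (r, i)) * W' $$ (r, j))" using index_adjoint_mult[OF W' W'] by simp
  also have "... = 1m (Suc k) $$ (i, j)" using ij u u' WW by (cases "i < k"; cases "j < k") (auto simp: W'_def)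
  finally show "(W'^H * W') $$ (i, j) = 1m (Suc k) $$ (i, j)" .
 qed (use W' in auto)
 with Suc.hyps(1)[OF _ W'] Suc.hyps(2) k obtain U where
  "unitm n U" "ALL i<n. ALL j<Suc k. U $$ (i, j) = W' $$ (i, j)" by force
 thus ?case by (intro exI[of _ U]) (auto simp: W'_def)
qed

section \<open>Block matrices and the spectral theorem\<close>

lemma adjoint_four_block: assumes "A : Mat p r" "B : Mat p s" "C : Mat q r" "D : Mat q s" shows "(fbm A B C D)^H = fbm (A^H) (C^H) (B^H) (D^H)"
 using assms by (intro eq_matI) auto

lemma mult_block_diag:
 fixes A A' B B' :: "cmat" assumes "A : Mat p p" "A' : Mat p p" "B : Mat q q" "B' : Mat q q"
 shows "fbm A (0m p q) (0m q p) B * fbm A' (0m p q) (0m q p) B'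
  = fbm (A * A') (0m p q) (0m q p) (B * B')" using assms by (subst mult_four_block_mat[of _ p p _ q _ q _ _ p _ q]) auto

definition block :: "nat => nat => nat => nat => cmat => cmat" where
 "block i j r s X = mat r s (%(k, l). X $$ (i + k, j + l))"

lemma block_carrier [simp]: "block i j r s X : Mat r s" "nr (block i j r s X) = r"
 "nc (block i j r s X) = s" by (auto simp: block_def)

lemma four_block_decomp: assumes "X : Mat (p + q) (r + s)" shows "X = fbm (block 0 0 p r X) (block 0 r p s X) (block p 0 q r X) (block p r q s X)"
 using assms by (intro eq_matI) (auto simp: block_def)

lemma hermitian_blocks: assumes "Herm (p + q) X" shows "Herm p (block 0 0 p p X)" "Herm q (block p p q q X)"
  "block p 0 q p X = (block 0 p p q X)^H" using HermD[OF assms]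
 by (auto simp: hermitian_mat_def block_def hermitian_index[OF assms, symmetric] intro!: eq_matI)

lemma hermitian_four_block: assumes "Herm p A" "C : Mat p q" "Herm q F" shows "Herm (p + q) (fbm A C (C^H) F)"
 using assms by (auto simp: hermitian_mat_def adjoint_four_block[of _ p p _ q _ q])

lemma eigenvalue_hermitian_real: assumes "Herm n X" "v : Vec n" "v ~= 0\<^sub>v n" "X *v v = e \<cdot>\<^sub>v v" shows "e = cx (Re e)"
proof -
 have vv: "v .c v = cx (\<Sum>i<n. (cmod (v $ i))^2)" using assms(2) by (simp add: cinner_self_Re)
 have "v .c v ~= 0" using assms by simp
 moreover have "(X *v v) .c v = e * (v .c v)" unfolding assms(4) using assms(2) by simp
 ultimately have "Im e = 0" using cinner_hermitian_real[OF assms(1,2)] unfolding vv by (auto simp del: of_real_sum)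
 thus ?thesis by (simp add: complex_eq_iff)
qed

text \<open>Deflation: a unit eigenvector is completed to a unitary matrix, so the first column of
  the conjugated matrix is \<open>e\<close> times the first unit vector, and the first row follows
  by symmetry.\<close>

lemma unitary_eigenvector_decomp: assumes X: "Herm (Suc n) X" shows "EX U e Y. unitm (Suc n) U & Herm n Y &
  U^H * X * U = fbm (mat 1 1 (%_. cx e)) (0m 1 n) (0m n 1) Y"
proof -
 note [simp] = HermD[OF X]
 obtain e where "e : spectrum X" using spectrum_non_empty[of X "Suc n"] by auto
 then obtain v0 where v0: "v0 : Vec (Suc n)" "v0 ~= 0\<^sub>v (Suc n)" "X *v v0 = e \<cdot>\<^sub>v v0"
  by (auto simp: spectrum_def eigenvalue_def eigenvector_def)
 have er: "e = cx (Re e)" by (rule eigenvalue_hermitian_real[OF X v0])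
 define c where "c = sqrt (\<Sum>r<Suc n. (cmod (v0 $ r))^2)"
 have "v0 .c v0 ~= 0" using v0 by simp
 hence c0: "c\<^sup>2 = (\<Sum>r<Suc n. (cmod (v0 $ r))^2)" "c ~= 0"
  using v0(1) by (auto simp: cinner_self_Re c_def sum_nonneg simp del: sum.lessThan_Suc of_real_sum)
 define W where "W = mat (Suc n) 1 (%(i, j). v0 $ i / c)"
 have W: "W : Mat (Suc n) 1" by (simp add: W_def)
 have cc: "(\<Sum>r<Suc n. cnj (v0 $ r) * v0 $ r) = (cx c)^2"
  using c0 by (simp add: mult.commute[of "cnj _"] flip: complex_norm_square of_real_power of_real_sum del: sum.lessThan_Suc)
 have "W^H * W = 1m 1"
 proof (rule eq_matI)
  fix i j assume "i < nr (1m 1 :: cmat)" "j < nc (1m 1 :: cmat)"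
  hence ij: "i = 0" "j = 0" by auto
  have "(W^H * W) $$ (0, 0) = (\<Sum>r<Suc n. cnj (v0 $ r / c) * (v0 $ r / c))"
   using index_adjoint_mult[OF W W] by (simp add: W_def del: sum.lessThan_Suc)
  also have "... = (\<Sum>r<Suc n. cnj (v0 $ r) * v0 $ r) / (cx c)^2" by (simp add: sum_divide_distrib power2_eq_square del: sum.lessThan_Suc)
  also have "... = 1" unfolding cc using c0 by simp
  finally show "(W^H * W) $$ (i, j) = 1m 1 $$ (i, j)" using ij by simp
 qed (use W in auto)
 from isometry_extend[OF W this] obtain U where U: "unitm (Suc n) U"
  "ALL i<Suc n. U $$ (i, 0) = v0 $ i / c" by (auto simp: W_def)
 note [simp] = unitD[OF U(1)]
 define Y where "Y = U^H * X * U"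
 have Yh: "Herm (1 + n) Y" unfolding Y_def by (intro HermI carrier_matI) (auto simp: m_assoc)
 have XU: "(X * U) $$ (i, 0) = e * U $$ (i, 0)" if "i < Suc n" for i
 proof -
  have "(X * U) $$ (i, 0) = (\<Sum>r<Suc n. X $$ (i, r) * (v0 $ r / c))" using that U(2) by (simp add: sp_def at0L del: sum.lessThan_Suc)
  also have "... = (X *v v0) $ i / c" using that v0(1) by (simp add: sp_def at0L sum_divide_distrib del: sum.lessThan_Suc)
  also have "... = e * U $$ (i, 0)" using v0 that U(2) by simp
  finally show ?thesis .
 qed
 have Y0: "Y $$ (i, 0) = (if i = 0 then e else 0)" if "i < Suc n" for i
 proof -
  have "Y $$ (i, 0) = (\<Sum>r<Suc n. cnj (U $$ (r, i)) * (X * U) $$ (r, 0))" unfolding Y_def using that by (subst m_assoc)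
    (auto simp: sp_def at0L simp del: sum.lessThan_Suc)
  also have "... = e * (\<Sum>r<Suc n. cnj (U $$ (r, i)) * U $$ (r, 0))" unfolding sum_dl by (rule sum.cong) (use XU in auto)
  also have "(\<Sum>r<Suc n. cnj (U $$ (r, i)) * U $$ (r, 0)) = (U^H * U) $$ (i, 0)"
   using that by (subst index_adjoint_mult[of _ "Suc n" "Suc n" _ "Suc n"]) auto
  finally show ?thesis using that by simp
 qed
 note H = hermitian_blocks[OF Yh]
 have "Y = fbm (block 0 0 1 1 Y) (block 0 1 1 n Y) (block 1 0 n 1 Y) (block 1 1 n n Y)" using HermD[OF Yh] by (intro four_block_decomp) auto
 moreover have B: "block 1 0 n 1 Y = 0m n 1" using Y0 by (auto simp: block_def intro!: eq_matI)
 moreover have "block 0 1 1 n Y = 0m 1 n" using H(3) B by (metis adjoint_adjoint adjoint_zero)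
 moreover have "block 0 0 1 1 Y = mat 1 1 (%_. cx (Re e))" using Y0[of 0] er by (auto simp: block_def intro!: eq_matI)
 ultimately show ?thesis using U(1) H(2) unfolding Y_def by metis
qed

definition rdiag :: "nat => (nat => real) => cmat" where
 "rdiag n t = mat_diag n (%i. cx (t i))"

lemma rdiag_simps [simp]: "nr (rdiag n t) = n" "nc (rdiag n t) = n"
 "rdiag n t : Mat n n" "(rdiag n t)^H = rdiag n t"
 "i < n ==> j < n ==> rdiag n t $$ (i, j) = (if i = j then cx (t i) else 0)" by (auto simp: rdiag_def mat_diag_def intro!: eq_matI)

lemma rdiag_mult: "rdiag n t * rdiag n h = rdiag n (%i. t i * h i)" by (simp add: rdiag_def)

lemma rdiag_one: "(!!i. i < n ==> t i = 1) ==> rdiag n t = 1m n" by (rule eq_matI) auto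

lemma rdiag_cong: "(!!i. i < n ==> t i = h i) ==> rdiag n t = rdiag n h" by (rule eq_matI) auto

lemma hermitian_rdiag: "Herm n (rdiag n t)" by (intro HermI) auto

theorem spectral_theorem: assumes "Herm n X" shows "EX U t. unitm n U & X = U * rdiag n t * U^H" using assms
proof (induction n arbitrary: X)
 case 0
 have "unitm 0 (1m 0)" by (rule unitary_matI) simp_all
 moreover have "X = 1m 0 * rdiag 0 (%_. 0) * (1m 0)^H" using HermD[OF 0] by (intro eq_matI) simp_all
 ultimately show ?case by (intro exI[of _ "1m 0"] exI[of _ "%_. 0"] conjI)
next
 case (Suc n)
 note [simp] = HermD[OF Suc.prems]
 from unitary_eigenvector_decomp[OF Suc.prems] obtain U e Y where
  U: "unitm (Suc n) U" and Y: "Herm n Y" and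
  XU: "U^H * X * U = fbm (mat 1 1 (%_. cx e)) (0m 1 n) (0m n 1) Y" by blast
 from Suc.IH[OF Y] obtain V t where V: "unitm n V" and YV: "Y = V * rdiag n t * V^H" by blast
 note [simp] = unitD[OF U] unitD[OF V] HermD[OF Y]
 define V' where "V' = fbm (1m 1) (0m 1 n) (0m n 1) V"
 have V'a: "V'^H = fbm (1m 1) (0m 1 n) (0m n 1) (V^H)" unfolding V'_def by (subst adjoint_four_block[of _ 1 1 _ n _ n]) auto
 have V'c: "V' : Mat (Suc n) (Suc n)" unfolding V'_def using four_block_carrier_mat[of _ 1 1 V n n] by simp
 have V': "unitm (Suc n) V'"
 proof (rule unitary_matI[OF V'c])
  show "V'^H * V' = 1m (Suc n)"
   unfolding V'a unfolding V'_def mult_block_diag[OF one_carrier_mat one_carrier_mat adjoint_carrier[OF unitD(1)[OF V]] unitD(1)[OF V]] by simp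
 qed
 define t' where "t' i = (if i = 0 then e else t (i - 1))" for i
 have D: "rdiag (Suc n) t' = fbm (mat 1 1 (%_. cx e)) (0m 1 n) (0m n 1) (rdiag n t)" by (rule eq_matI) (auto simp: t'_def split: nat.splits)
 have 1: "V' * rdiag (Suc n) t' * V'^H = U^H * X * U"
 proof -
  let ?E = "mat 1 1 (%_. cx e)"
  have a: "V' * rdiag (Suc n) t' = fbm (1m 1 * ?E) (0m 1 n) (0m n 1) (V * rdiag n t)" unfolding D V'_def by (rule mult_block_diag) simp_all
  have b: "fbm (1m 1 * ?E) (0m 1 n) (0m n 1) (V * rdiag n t) * V'^H
   = fbm (1m 1 * ?E * 1m 1) (0m 1 n) (0m n 1) (V * rdiag n t * V^H)"
   unfolding V'a by (rule mult_block_diag) (simp_all add: mult_carrier_mat[of _ n n])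
  have c: "1m 1 * ?E * 1m 1 = ?E" by simp
  show ?thesis unfolding XU YV a b c ..
 qed
 have "X = U * (U^H * X * U) * U^H" by (simp add: m_assoc m_cancel[OF unitD(3)[OF U]])
 also have "... = (U * V') * rdiag (Suc n) t' * (U * V')^H" unfolding 1[symmetric] using MatD[OF V'c] by (simp add: m_assoc)
 finally have "X = (U * V') * rdiag (Suc n) t' * (U * V')^H" .
 with unitary_mult[OF U V'] show ?case by (intro exI conjI)
qed

lemma spectral_mult: assumes "unitm n U" shows "(U * rdiag n t * U^H) * (U * rdiag n h * U^H) = U * rdiag n (%i. t i * h i) * U^H"
proof -
 note [simp] = unitD[OF assms]
 show ?thesis by (simp add: m_assoc m_cancel[OF unitD(2)[OF assms]] m_cancel[OF rdiag_mult])
qed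

lemma spectral_one: "unitm n U ==> U * rdiag n (%_. 1) * U^H = 1m n" using unitD[of n U] by (simp add: rdiag_one)

lemma spectral_lincomb: assumes "unitm n U" shows "U * rdiag n t * U^H + cx c .* (U * rdiag n h * U^H)
  = U * rdiag n (%i. t i + c * h i) * U^H"
proof -
 note [simp] = unitD[OF assms]
 have "rdiag n (%i. t i + c * h i) = rdiag n t + cx c .* rdiag n h" by (rule eq_matI) auto
 thus ?thesis by (simp add: m_distrib m_assoc)
qed

lemma cinner_rdiag: assumes "v : Vec n" shows "(rdiag n t *v v) .c v = cx (\<Sum>i<n. t i * (cmod (v $ i))^2)"
proof -
 have "(rdiag n t *v v) $ i = t i * v $ i" if "i < n" for i using that assms by (simp add: sp_def if_distrib[of "%x. x * _"] cong: if_cong)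
 hence "(rdiag n t *v v) .c v = (\<Sum>i<n. t i * (v $ i * cnj (v $ i)))" using assms by (auto simp: sp_def at0L intro!: sum.cong)
 thus ?thesis by (simp flip: complex_norm_square)
qed

lemma pos_def_rdiag_iff: "pdm n (rdiag n t) <-> (ALL i<n. 0 < t i)"
proof
 assume *: "pdm n (rdiag n t)"
 show "ALL i<n. 0 < t i"
 proof (intro allI impI)
  fix i assume i: "i < n"
  have "0 < Re ((rdiag n t *v unit_vec n i) .c unit_vec n i)" using i by (intro pos_def_matD[OF *]) auto
  also have "... = (\<Sum>j<n. t j * (cmod (unit_vec n i $ j))^2)" by (subst cinner_rdiag) auto
  also have "... = (\<Sum>j<n. if j = i then t i else 0)" using i by (intro sum.cong) auto
  finally show "0 < t i" using i by simp
 qed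
next
 assume *: "ALL i<n. 0 < t i"
 show "pdm n (rdiag n t)" unfolding pos_def_mat_iff
 proof (intro conjI ballI impI hermitian_rdiag)
  fix v :: "complex vec" assume v: "v : Vec n" "v ~= 0\<^sub>v n"
  then obtain i where i: "i < n" "v $ i ~= 0" by (auto simp: vec_eq_iff)
  have "0 < (\<Sum>j<n. t j * (cmod (v $ j))^2)" using * i by (intro sum_pos2[of _ i]) (auto simp: less_imp_le)
  thus "0 < Re ((rdiag n t *v v) .c v)" using v by (simp add: cinner_rdiag)
 qed
qed

lemma spectral_pd_iff:
 "unitm n U ==> pdm n (U * rdiag n t * U^H) <-> (ALL i<n. 0 < t i)" by (subst pd_congr_iff[of _ _ _ "U^H"]) (auto simp: unitD pos_def_rdiag_iff)

lemma pos_def_spectral: assumes "pdm n X"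
 obtains U t where "unitm n U" "ALL i<n. 0 < t i" "X = U * rdiag n t * U^H"
proof -
 obtain U t where U: "unitm n U" "X = U * rdiag n t * U^H" using spectral_theorem[OF pd_herm[OF assms]] by (elim exE conjE)
 have "ALL i<n. 0 < t i" using assms unfolding U(2) spectral_pd_iff[OF U(1)] .
 thus thesis using that U by simp
qed

lemma det_unitary: "unitm n U ==> det U * det (U^H) = 1" using det_mult[of U n "U^H"] unitD[of n U] by simp

lemma det_rdiag: "det (rdiag n t) = cx (\<Prod>i<n. t i)" by (subst det_upper_triangular[of _ n])
  (auto simp: diag_mat_def prod.list_conv_set_nth at0L)

lemma det_spectral: assumes "unitm n U" shows "det (U * rdiag n t * U^H) = cx (\<Prod>i<n. t i)"
proof -
 note [simp] = unitD[OF assms]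
 have "det (U * rdiag n t * U^H) = det (U * rdiag n t) * det (U^H)" by (rule det_mult[of _ n]) (auto intro!: mult_carrier_mat[of _ n n])
 also have "det (U * rdiag n t) = det U * det (rdiag n t)" by (rule det_mult[of _ n]) auto
 finally show ?thesis using det_unitary[OF assms] by (simp add: det_rdiag mult_ac)
qed

lemma pos_def_det: assumes "pdm n X" shows "det X = cx (Re (det X))" "0 < Re (det X)"
proof -
 obtain U t where U: "unitm n U" "ALL i<n. 0 < t i" "X = U * rdiag n t * U^H" by (rule pos_def_spectral[OF assms]) blast
 show "det X = cx (Re (det X))" unfolding U(3) det_spectral[OF U(1)] by simp
 show "0 < Re (det X)" unfolding U(3) det_spectral[OF U(1)] Re_complex_of_real using U(2) by (auto intro!: prod_pos)
qed

lemma pos_def_diag: assumes "pdm m A" "i < m" shows "0 < Re (A $$ (i, i))"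
proof -
 note [simp] = pd_dims[OF assms(1)]
 have "(A *v unit_vec m i) .c unit_vec m i = (\<Sum>j<m. if j = i then A $$ (i, i) else 0)"
  using assms(2) by (simp add: sp_def at0L if_distrib[of "%x. _ * x"] if_distrib[of cnj] cong: if_cong)
 also have "... = A $$ (i, i)" using assms(2) by simp
 finally show ?thesis using pos_def_matD[OF assms(1), of "unit_vec m i"] assms(2) by auto
qed

text \<open>From \<open>S * S = T * T\<close> follows \<open>S * (S - T) + (S - T) * T = 0\<close>.
  In an eigenbasis of the Hermitian matrix \<open>S - T\<close> the diagonal entries of this
  equation read \<open>t i * (S i i + T i i) = 0\<close>, and the diagonals of \<open>S\<close> and
  \<open>T\<close> are positive, so all eigenvalues of the difference vanish.\<close>

lemma pos_def_sqrt_unique: assumes S: "pdm n S" and T: "pdm n T" and eq: "S * S = T * T" shows "S = T"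
proof -
 note [simp] = pd_dims[OF S] pd_dims[OF T]
 have "Herm n (S - T)" by (intro Herm_minus pd_herm S T)
 from spectral_theorem[OF this] obtain U t where U: "unitm n U" "S - T = U * rdiag n t * U^H" by blast
 note [simp] = unitD[OF U(1)]
 define S' T' where "S' = U^H * S * (U^H)^H" and "T' = U^H * T * (U^H)^H"
 have S': "pdm n S'" and T': "pdm n T'" unfolding S'_def T'_def by (intro pd_congr_inv[of _ _ _ U] S T; simp)+
 note [simp] = pd_dims[OF S'] pd_dims[OF T']
 have "S * (S - T) + (S - T) * T = S * S - T * T" by (simp add: m_distrib) (rule eq_matI, simp_all del: index_mm(1))
 also have "... = 0m n n" unfolding eq by (rule eq_matI) (simp_all del: index_mm(1))
 finally have *: "U^H * (S * (S - T) + (S - T) * T) * U = 0m n n" by simp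
 have "S' * rdiag n t + rdiag n t * T' = U^H * (S * (S - T) + (S - T) * T) * U" unfolding S'_def T'_def U(2)
  by (simp add: m_distrib m_assoc m_cancel[OF unitD(2)[OF U(1)]])
 hence eq0: "S' * rdiag n t + rdiag n t * T' = 0m n n" using * by simp
 have "t i = 0" if i: "i < n" for i
 proof -
  have "(S' * rdiag n t) $$ (i, i) = S' $$ (i, i) * t i" using i by (simp add: rdiag_def mat_diag_mult_right[of _ n n])
  moreover have "(rdiag n t * T') $$ (i, i) = t i * T' $$ (i, i)" using i by (simp add: rdiag_def mat_diag_mult_left[of _ n n])
  ultimately have "S' $$ (i, i) * t i + t i * T' $$ (i, i) = 0" using arg_cong[OF eq0, of "%M. M $$ (i, i)"] i by (simp del: index_mm(1))
  hence "Re (S' $$ (i, i) * t i + t i * T' $$ (i, i)) = 0" by simp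
  hence "t i * (Re (S' $$ (i, i)) + Re (T' $$ (i, i))) = 0" by (simp add: algebra_simps)
  thus ?thesis using pos_def_diag[OF S' i] pos_def_diag[OF T' i] by auto
 qed
 hence "rdiag n t = 0m n n" by (intro eq_matI) auto
 hence 0: "S - T = 0m n n" unfolding U(2) by simp
 show ?thesis
 proof (rule eq_matI)
  fix i j assume "i < nr T" "j < nc T"
  thus "S $$ (i, j) = T $$ (i, j)" using arg_cong[OF 0, of "%M. M $$ (i, j)"] by simp
 qed auto
qed

lemma left_inverse_unique:
 fixes A :: "cmat" assumes "B * A = 1m n" "A * C = 1m n" "nr A = n" "nc A = n" "nr B = n" "nc B = n"
  "nr C = n" "nc C = n" shows "B = C"
proof -
 have "B = B * (A * C)" unfolding assms(2) using assms(6) by simp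
 also have "... = B * A * C" using assms(3-) by (simp add: m_assoc)
 also have "... = C" unfolding assms(1) using assms(7) by simp
 finally show ?thesis .
qed

text \<open>Here uniqueness of the positive square root discharges the definite description in
  \<open>inv_sqrt_mat\<close>.\<close>

lemma inv_sqrt_mat_unique: assumes R: "pdm n R" and S: "pdm n S" and RS: "R * (S * S) = 1m n" shows "isqrt n R = S" unfolding inv_sqrt_mat_def
proof (rule the_equality)
 note [simp] = pd_dims[OF R] pd_dims[OF S]
 have SR: "(S * S) * R = 1m n" using mm_lr_inv[OF _ _ RS] by (simp add: mult_carrier_mat[of _ n n])
 show "pdm n S & inverts_mat R (S * S) & inverts_mat (S * S) R" using S RS SR by (simp add: inverts_mat_def)
 fix T assume T: "pdm n T & inverts_mat R (T * T) & inverts_mat (T * T) R"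
 note [simp] = pd_dims[OF cj1[OF T]]
 have "(T * T) * R = 1m n" using T by (simp add: inverts_mat_def)
 hence "T * T = S * S" by (rule left_inverse_unique[OF _ RS]) simp_all
 thus "T = S" using T S pos_def_sqrt_unique by blast
qed

lemma inv_sqrt_spectral: assumes U: "unitm n U" and t: "ALL i<n. 0 < t i"
 shows "isqrt n (U * rdiag n t * U^H) = U * rdiag n (%i. 1 / sqrt (t i)) * U^H"
proof (rule inv_sqrt_mat_unique)
 show "pdm n (U * rdiag n t * U^H)" "pdm n (U * rdiag n (%i. 1 / sqrt (t i)) * U^H)"
  using t by (simp_all add: spectral_pd_iff[OF U] del: of_real_divide)
 have "rdiag n (%i. t i * (1 / sqrt (t i) * (1 / sqrt (t i)))) = rdiag n (%_. 1)" by (rule rdiag_cong) (use t in force)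
 thus "U * rdiag n t * U^H * (U * rdiag n (%i. 1 / sqrt (t i)) * U^H * (U * rdiag n (%i. 1 / sqrt (t i)) * U^H))
   = 1m n" by (simp only: spectral_mult[OF U] spectral_one[OF U])
qed

text \<open>The square root is written as \<open>R\<close> times its inverse square root, so that
  only the definite description in \<open>inv_sqrt_mat\<close> has to be evaluated.\<close>

definition sqrt_mat :: "nat => cmat => cmat" where
 "sqrt_mat n R = R * isqrt n R"

lemma sqrt_spectral: assumes U: "unitm n U" and t: "ALL i<n. 0 < t i" shows "sqrt_mat n (U * rdiag n t * U^H) = U * rdiag n (%i. sqrt (t i)) * U^H"
proof -
 have "rdiag n (%i. t i * (1 / sqrt (t i))) = rdiag n (%i. sqrt (t i))"
  by (rule rdiag_cong) (use t in \<open>simp add: real_div_sqrt less_imp_le\<close>)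
 thus ?thesis unfolding sqrt_mat_def by (simp only: inv_sqrt_spectral[OF U t] spectral_mult[OF U])
qed

lemma assumes R: "pdm n R" shows isqrt_pd: "pdm n (isqrt n R)" and sqrt_pd: "pdm n (sqrt_mat n R)"
  and sqrt_mult_self: "sqrt_mat n R * sqrt_mat n R = R" and sqrt_isqrt: "sqrt_mat n R * isqrt n R = 1m n"
  and isqrt_sqrt: "isqrt n R * sqrt_mat n R = 1m n" and inv_sqrt_cancel: "isqrt n R * R * isqrt n R = 1m n"
proof -
 obtain U t where U: "unitm n U" "ALL i<n. 0 < t i" "R = U * rdiag n t * U^H" by (rule pos_def_spectral[OF R]) blast
 note I = inv_sqrt_spectral[OF U(1,2), folded U(3)] and S = sqrt_spectral[OF U(1,2), folded U(3)]
 show 1: "pdm n (isqrt n R)" "pdm n (sqrt_mat n R)" using U(2) by (auto simp: I S spectral_pd_iff[OF U(1)])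
 have "rdiag n (%i. sqrt (t i) * sqrt (t i)) = rdiag n t" by (rule rdiag_cong) (use U(2) in \<open>simp add: less_imp_le\<close>)
 thus "sqrt_mat n R * sqrt_mat n R = R" by (simp only: S spectral_mult[OF U(1)] U(3)[symmetric])
 have "rdiag n (%i. sqrt (t i) * (1 / sqrt (t i))) = rdiag n (%_. 1)" by (rule rdiag_cong) (use U(2) in force)
 thus 2: "sqrt_mat n R * isqrt n R = 1m n" by (simp only: I S spectral_mult[OF U(1)] spectral_one[OF U(1)])
 note [simp] = pd_dims[OF R] pd_dims[OF 1(1)] pd_dims[OF 1(2)]
 show 3: "isqrt n R * sqrt_mat n R = 1m n" using mm_lr_inv[OF _ _ 2] by simp
 show "isqrt n R * R * isqrt n R = 1m n" using 3 unfolding sqrt_mat_def by (simp add: m_assoc)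
qed

text \<open>Conjugation by the inverse square root of \<open>A\<close> reduces the claim to
  \<open>1 - t * S B S\<close>, whose eigenvalues are \<open>1 - t * w i\<close>. The bound
  \<open>e = 1 / (1 + \<Sum> \<bar>w i\<bar>)\<close> keeps all of them positive.\<close>

lemma pos_def_perturb: assumes A: "pdm n A" and B: "Herm n B" shows "EX e>0. ALL t. 0 < t & t <= e --> pdm n (A - cx t .* B)"
proof -
 define S T where "S = isqrt n A" and "T = sqrt_mat n A"
 have S: "pdm n S" and T: "pdm n T" and TS: "T * S = 1m n" and ST: "S * T = 1m n" and TT: "T * T = A" unfolding S_def T_def
  using A by (auto simp: isqrt_pd sqrt_pd sqrt_isqrt isqrt_sqrt sqrt_mult_self)
 note [simp] = pd_dims[OF A] pd_dims[OF S] pd_dims[OF T] HermD[OF B]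
 have "Herm n (S * B * S)" using Herm_congr[OF B, of S n] by simp
 from spectral_theorem[OF this] obtain U w where U: "unitm n U" "S * B * S = U * rdiag n w * U^H" by blast
 define e where "e = 1 / (1 + (\<Sum>i<n. \<bar>w i\<bar>))"
 have s: "0 < 1 + (\<Sum>i<n. \<bar>w i\<bar>)" by (intro add_pos_nonneg sum_nonneg) auto
 have "pdm n (A - cx t .* B)" if t: "0 < t" "t <= e" for t
 proof -
  have "0 < 1 + (- t) * w i" if i: "i < n" for i
  proof -
   have "\<bar>w i\<bar> <= (\<Sum>i<n. \<bar>w i\<bar>)" using i by (intro member_le_sum) auto
   hence "t * \<bar>w i\<bar> <= e * (\<Sum>i<n. \<bar>w i\<bar>)" using t by (intro mult_mono) auto
   also have "... < 1" unfolding e_def using s by (simp add: divide_simps)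
   finally have "t * \<bar>w i\<bar> < 1" .
   moreover have "t * w i <= t * \<bar>w i\<bar>" using t by (intro mult_left_mono) auto
   ultimately show ?thesis by simp
  qed
  hence "pdm n (U * rdiag n (%i. 1 + (- t) * w i) * U^H)" by (simp add: spectral_pd_iff[OF U(1)])
  hence "pdm n (1m n + cx (- t) .* (S * B * S))" using spectral_lincomb[OF U(1), of "%_. 1" "- t" w] unfolding spectral_one[OF U(1)] U(2) by simp
  from pd_congr_inv[OF this _ _ TS]
  have "pdm n (T * (1m n + cx (- t) .* (S * B * S)) * T)" by simp
  also have "T * (1m n + cx (- t) .* (S * B * S)) * T = A + cx (- t) .* B" by (simp add: m_distrib m_assoc ST TT m_cancel[OF TS] del: of_real_minus)
  also have "... = A - cx t .* B" by (rule eq_matI) auto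
  finally show ?thesis .
 qed
 thus ?thesis using s by (intro exI[of _ e]) (auto simp: e_def)
qed

section \<open>Block matrices and Schur complements\<close>

lemma cinner_four_block: assumes "A : Mat p p" "B : Mat q q" "u : Vec p" "v : Vec q"
 shows "(fbm A (0m p q) (0m q p) B *v (u @\<^sub>v v)) .c (u @\<^sub>v v)
  = (A *v u) .c u + (B *v v) .c v"
proof -
 have "fbm A (0m p q) (0m q p) B *v (u @\<^sub>v v) = (A *v u) @\<^sub>v (B *v v)"
  using assms by (subst four_block_mat_mult_vec[of _ p p _ q _ q]) auto
 moreover have "conjugate (u @\<^sub>v v) = conjugate u @\<^sub>v conjugate v" using assms by (intro eq_vecI) auto
 ultimately show ?thesis using assms by (simp add: scalar_prod_append[of _ p _ q])
qed

lemma pos_def_block_diag_iff: assumes "A : Mat p p" "B : Mat q q" shows "pdm (p + q) (fbm A (0m p q) (0m q p) B) <-> pdm p A & pdm q B"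
proof (intro iffI conjI)
 let ?X = "fbm A (0m p q) (0m q p) B"
 have adj: "?X^H = fbm (A^H) (0m p q) (0m q p) (B^H)" using assms by (subst adjoint_four_block[of _ p p _ q _ q]) auto
 { assume *: "pdm (p + q) ?X"
  note H = pd_herm[OF *]
  have "A = block 0 0 p p ?X" "B = block p p q q ?X" using assms by (auto simp: block_def intro!: eq_matI)
  hence h: "Herm p A" "Herm q B" using hermitian_blocks[OF H] by auto
  have nz: "u @\<^sub>v v ~= 0\<^sub>v (p + q)" if "u : Vec p" "v : Vec q" "u ~= 0\<^sub>v p | v ~= 0\<^sub>v q" for u v :: "complex vec"
  proof
   assume eq: "u @\<^sub>v v = 0\<^sub>v (p + q)"
   have "0\<^sub>v p @\<^sub>v 0\<^sub>v q = (0\<^sub>v (p + q) :: complex vec)" by auto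
   with eq have "u = 0\<^sub>v p & v = 0\<^sub>v q" using that by (metis append_vec_eq zero_carrier_vec)
   thus False using that by blast
  qed
  show "pdm p A" unfolding pos_def_mat_iff
  proof (intro conjI ballI impI h)
   fix u :: "complex vec" assume u: "u : Vec p" "u ~= 0\<^sub>v p"
   have "0 < Re ((?X *v (u @\<^sub>v 0\<^sub>v q)) .c (u @\<^sub>v 0\<^sub>v q))" using u nz[of u "0\<^sub>v q"] by (intro pos_def_matD[OF *]) auto
   also have "B *v 0\<^sub>v q = 0\<^sub>v q" using assms by (intro eq_vecI) (auto simp: sp_def)
   hence "(?X *v (u @\<^sub>v 0\<^sub>v q)) .c (u @\<^sub>v 0\<^sub>v q) = (A *v u) .c u" using u assms by (subst cinner_four_block) auto
   finally show "0 < Re ((A *v u) .c u)" .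
  qed
  show "pdm q B" unfolding pos_def_mat_iff
  proof (intro conjI ballI impI h)
   fix u :: "complex vec" assume u: "u : Vec q" "u ~= 0\<^sub>v q"
   have "0 < Re ((?X *v (0\<^sub>v p @\<^sub>v u)) .c (0\<^sub>v p @\<^sub>v u))" using u nz[of "0\<^sub>v p" u] by (intro pos_def_matD[OF *]) auto
   also have "A *v 0\<^sub>v p = 0\<^sub>v p" using assms by (intro eq_vecI) (auto simp: sp_def)
   hence "(?X *v (0\<^sub>v p @\<^sub>v u)) .c (0\<^sub>v p @\<^sub>v u) = (B *v u) .c u" using u assms by (subst cinner_four_block) auto
   finally show "0 < Re ((B *v u) .c u)" .
  qed }
 assume *: "pdm p A & pdm q B"
 show "pdm (p + q) ?X" unfolding pos_def_mat_iff
 proof (intro conjI ballI impI)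
  show "Herm (p + q) ?X" using * assms adj by (intro HermI) (auto simp: pd_dims)
  fix x :: "complex vec" assume x: "x : Vec (p + q)" "x ~= 0\<^sub>v (p + q)"
  define u v where "u = vec_first x p" and "v = vec_last x q"
  have uv: "x = u @\<^sub>v v" "u : Vec p" "v : Vec q" using x by (auto simp: u_def v_def)
  have "u ~= 0\<^sub>v p | v ~= 0\<^sub>v q"
  proof (rule ccontr)
   assume "~ ?thesis"
   hence "x = 0\<^sub>v (p + q)" unfolding uv(1) by auto
   thus False using x by blast
  qed
  hence "0 < Re ((A *v u) .c u) + Re ((B *v v) .c v)"
   using pos_def_matD[of p A u] pos_def_matD[of q B v] pos_def_nonneg[of p A u] pos_def_nonneg[of q B v] * uv by (meson add_nonneg_pos add_pos_nonneg)
  thus "0 < Re ((?X *v x) .c x)" unfolding uv(1) using uv assms by (subst cinner_four_block) auto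
 qed
qed

lemma inverse_hermitian: assumes "Herm p A" "Ai : Mat p p" "A * Ai = 1m p" shows "Ai * A = 1m p" "Ai^H = Ai"
proof -
 note [simp] = HermD[OF assms(1)]
 show 1: "Ai * A = 1m p" using mm_lr_inv[OF _ assms(2,3)] by simp
 have "Ai^H * A = (A * Ai)^H" using assms(2) by simp
 hence "Ai^H * A = 1m p" unfolding assms(3) by simp
 thus "Ai^H = Ai" by (rule left_inverse_unique[OF _ assms(3)]) (use assms(2) in simp_all)
qed

lemma mult_lower_block:
 fixes K :: "cmat" assumes "K : Mat q p" "A : Mat p p" "C : Mat p q" "D : Mat q p" "F : Mat q q" shows "fbm (1m p) (0m p q) K (1m q) * fbm A C D F
  = fbm A C (K * A + D) (K * C + F)" using assms by (subst mult_four_block_mat[of _ p p _ q _ q _ _ p _ q]) auto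

lemma mult_upper_block:
 fixes K :: "cmat" assumes "K : Mat p q" "A : Mat p p" "C : Mat p q" "D : Mat q p" "F : Mat q q" shows "fbm A C D F * fbm (1m p) K (0m q p) (1m q)
  = fbm A (A * K + C) D (D * K + F)" using assms by (subst mult_four_block_mat[of _ p p _ q _ q _ _ p _ q]) auto

lemma mat_cancel [simp]:
 fixes A B :: "cmat" shows "nr A = nr B ==> nc A = nc B ==> A + (B - A) = B"
  "nr A = nr B ==> nc A = nc B ==> B - A + A = B"
  "nr A = nr B ==> nc A = nc B ==> A + B - A = B"
  "nr A = nr B ==> nc A = nc B ==> B + A - A = B" by (auto intro!: eq_matI simp del: index_mm(1))

lemma mat_zero_add [simp]:
 fixes A :: "cmat" shows "nr A = m ==> nc A = n ==> A + 0m m n = A"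
  "nr A = m ==> nc A = n ==> 0m m n + A = A"
  "nr A = m ==> nc A = n ==> A - 0m m n = A"
  "nr A = m ==> nc A = n ==> A - A = 0m m n" by (auto intro!: eq_matI)

lemma schur_decomp: assumes A: "Herm p A" and Ai: "Ai : Mat p p" "A * Ai = 1m p" and C: "C : Mat p q" and F: "F : Mat q q"
 defines "L == fbm (1m p) (0m p q) (C^H * Ai) (1m q)" and "S == F - C^H * Ai * C" shows "fbm A C (C^H) F = L * fbm A (0m p q) (0m q p) S * L^H"
  "EX E:Mat (p + q) (p + q). L * E = 1m (p + q)" "det L = 1" "det (L^H) = 1"
  "L : Mat (p + q) (p + q)"
proof -
 note [simp] = HermD[OF A] MatD[OF Ai(1)] MatD[OF C] MatD[OF F] Ai(2)
 note AiA = inverse_hermitian[OF A Ai]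
 note cancel = m_cancel[OF Ai(2)] m_cancel[OF AiA(1)]
 have dS[simp]: "S : Mat q q" "nr S = q" "nc S = q" unfolding S_def by (auto simp: carrier_iff)
 have La: "L^H = fbm (1m p) (Ai * C) (0m q p) (1m q)" unfolding L_def by (subst adjoint_four_block[of _ p p _ q _ q]) (auto simp: AiA carrier_iff)
 have K: "C^H * Ai : Mat q p" "Ai * C : Mat p q" by (auto simp: carrier_iff)
 have "L * fbm A (0m p q) (0m q p) S = fbm A (0m p q) (C^H) S"
  unfolding L_def by (subst mult_lower_block[OF K(1)]) (auto simp: m_assoc AiA carrier_iff)
 moreover have "fbm A (0m p q) (C^H) S * L^H = fbm A C (C^H) F"
  unfolding La by (subst mult_upper_block[OF K(2)]) (auto simp: S_def m_assoc cancel carrier_iff)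
 ultimately show "fbm A C (C^H) F = L * fbm A (0m p q) (0m q p) S * L^H" by simp
 show d: "det L = 1" unfolding L_def by (subst det_four_block_mat_upper_right_zero[of _ p _ q]) (auto simp: carrier_iff)
 show "det (L^H) = 1" unfolding La by (subst det_four_block_mat_lower_left_zero[of _ p _ q]) (auto simp: carrier_iff)
 show Lc: "L : Mat (p + q) (p + q)" unfolding L_def by simp
 show "EX E:Mat (p + q) (p + q). L * E = 1m (p + q)" using det_inverse_exists[OF Lc] d by auto
qed

lemma det_congr:
 fixes L :: "cmat" assumes "L : Mat n n" "X : Mat n n" shows "det (L * X * L^H) = det L * det X * det (L^H)"
 using assms by (subst det_mult[of _ n], (auto)[2], subst det_mult[of _ n]) auto

lemma assumes A: "Herm p A" and Ai: "Ai : Mat p p" "A * Ai = 1m p" and C: "C : Mat p q" and F: "F : Mat q q"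
 shows schur_pos_def: "pdm (p + q) (fbm A C (C^H) F)
   <-> pdm p A & pdm q (F - C^H * Ai * C)" and schur_det: "det (fbm A C (C^H) F) = det A * det (F - C^H * Ai * C)"
proof -
 note S = schur_decomp[OF assms]
 note [simp] = HermD[OF A] MatD[OF Ai(1)] MatD[OF C] MatD[OF F] Ai(2)
 obtain E where E: "E : Mat (p + q) (p + q)"
  "fbm (1m p) (0m p q) (C^H * Ai) (1m q) * E = 1m (p + q)" using S(2) by blast
 have [simp]: "F - C^H * Ai * C : Mat q q" by (auto simp: carrier_iff)
 have c: "fbm A (0m p q) (0m q p) (F - C^H * Ai * C) : Mat (p + q) (p + q)" by simp
 show "pdm (p + q) (fbm A C (C^H) F)
   <-> pdm p A & pdm q (F - C^H * Ai * C)" unfolding S(1) pd_congr_iff[OF c S(5) E] by (rule pos_def_block_diag_iff) simp_all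
 show "det (fbm A C (C^H) F) = det A * det (F - C^H * Ai * C)" unfolding S(1) det_congr[OF S(5) c] S(3,4)
  by (subst det_four_block_mat_upper_right_zero[of _ p _ q]) (auto simp: carrier_iff)
qed

lemma pos_def_upper_left: assumes X: "pdm (p + q) X" shows "pdm p (block 0 0 p p X)"
proof -
 define J where "J = mat p (p + q) (%(i, j). if i = j then 1 else 0 :: complex)"
 have J: "J : Mat p (p + q)" by (simp add: J_def)
 note [simp] = pd_dims[OF X]
 have a: "(J * X) $$ (i, j) = X $$ (i, j)" if "i < p" "j < p + q" for i j
  using that by (simp add: J_def sp_def at0L if_distrib[of "%x. x * _"] cong: if_cong)
 have "(J * X * J^H) $$ (i, j) = X $$ (i, j)" if "i < p" "j < p" for i j
 proof -
  have "(J * X * J^H) $$ (i, j) = (\<Sum>k<p + q. (J * X) $$ (i, k) * cnj (J $$ (j, k)))"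
  proof -
   define K where "K = J * X"
   have "nr K = p" "nc K = p + q" using J by (auto simp: K_def)
   thus ?thesis unfolding K_def[symmetric] using that J by (simp add: sp_def at0L)
  qed
  also have "... = (\<Sum>k<p + q. if j = k then X $$ (i, j) else 0)"
   using that by (intro sum.cong) (auto simp: a simp del: index_mm(1), auto simp: J_def)
  finally show ?thesis using that by simp
 qed
 hence eq: "J * X * J^H = block 0 0 p p X" using J by (intro eq_matI) (auto simp: block_def simp del: index_mm(1))
 have "pdm p (J * X * J^H)"
 proof (rule pos_def_congr[OF X J])
  fix v :: "complex vec" assume v: "v : Vec p" "J^H *v v = 0\<^sub>v (p + q)"
  show "v = 0\<^sub>v p"
  proof (rule eq_vecI)
   fix i assume "i < dim_vec (0\<^sub>v p :: complex vec)"
   hence i: "i < p" by simp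
   have "0 = (J^H *v v) $ i" unfolding v(2) using i by simp
   also have "... = (\<Sum>k<p. if k = i then v $ i else 0)"
    using i v(1) J by (auto simp: sp_def at0L J_def if_distrib[of cnj] if_distrib[of "%x. x * _"] cong: if_cong)
   finally show "v $ i = 0\<^sub>v p $ i" using i by simp
  qed (use v in simp)
 qed
 thus ?thesis unfolding eq .
qed

section \<open>The block parametrization\<close>

abbreviation in01 :: "nat => cmat => bool" where
 "in01 p A == pdm p A & pdm p (1m p - A)"

lemma loewner_01_iff:
 "lwl p (0m p p) A & lwl p A (1m p) <-> in01 p A" unfolding loewner_less_0_iff unfolding loewner_less_def using pd_herm hermitian_one by blast

text \<open>The square root of the length \<open>A * (1 - A)\<close> of the interval for the second
  moment when the first moment is \<open>A\<close>.\<close>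

definition rsq :: "nat => cmat => cmat" where
 "rsq p A = sqrt_mat p (A * (1m p - A))"

text \<open>\<open>A\<close>, \<open>1 - A\<close> and the square root of their product are diagonal
  in one common eigenbasis, from which all claims are read off.\<close>

lemma in01_range: assumes "in01 p A" shows range_pd: "pdm p (A * (1m p - A))" and rsq_pd: "pdm p (rsq p A)"
  and rsq_self: "rsq p A * rsq p A = A * (1m p - A)" and rsq_commute: "rsq p A * A = A * rsq p A"
  and rsq_isqrt: "rsq p A * isqrt p (A * (1m p - A)) = 1m p"
   "isqrt p (A * (1m p - A)) * rsq p A = 1m p"
proof -
 obtain U t where U: "unitm p U" "ALL i<p. 0 < t i" "A = U * rdiag p t * U^H" using pos_def_spectral assms by blast
 have "1m p + cx (-1) .* A = U * rdiag p (%i. 1 + (-1) * t i) * U^H"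
  using spectral_lincomb[OF U(1), of "%_. 1" "-1" t] unfolding spectral_one[OF U(1)] U(3) by simp
 moreover have "1m p + cx (-1) .* A = 1m p - A" using pd_dims[of p A] assms by (intro eq_matI) auto
 ultimately have 1: "1m p - A = U * rdiag p (%i. 1 + (-1) * t i) * U^H" by simp
 have p1: "ALL i<p. 0 < 1 + (-1) * t i" using assms unfolding 1 spectral_pd_iff[OF U(1)] by blast
 have R: "A * (1m p - A) = U * rdiag p (%i. t i * (1 + (-1) * t i)) * U^H" unfolding 1 unfolding U(3) spectral_mult[OF U(1)] ..
 have p2: "ALL i<p. 0 < t i * (1 + (-1) * t i)" using U(2) p1 by simp
 show P: "pdm p (A * (1m p - A))" unfolding R spectral_pd_iff[OF U(1)] by (rule p2)
 show "pdm p (rsq p A)" "rsq p A * rsq p A = A * (1m p - A)"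
  "rsq p A * isqrt p (A * (1m p - A)) = 1m p"
   "isqrt p (A * (1m p - A)) * rsq p A = 1m p" unfolding rsq_def by (rule sqrt_pd[OF P] sqrt_mult_self[OF P] sqrt_isqrt[OF P]
   isqrt_sqrt[OF P])+
 show "rsq p A * A = A * rsq p A" unfolding rsq_def R sqrt_spectral[OF U(1) p2] unfolding U(3) spectral_mult[OF U(1)] by (simp only: mult.commute)
qed

lemma pos_def_inverse_exists: assumes "pdm p A" shows "EX Ai. pdm p Ai & A * Ai = 1m p & Ai * A = 1m p"
proof -
 let ?S = "isqrt p A" and ?T = "sqrt_mat p A"
 note S = isqrt_pd[OF assms] and T = sqrt_pd[OF assms]
 note e = sqrt_isqrt[OF assms] isqrt_sqrt[OF assms] sqrt_mult_self[OF assms]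
 note [simp] = pd_dims[OF assms] pd_dims[OF S] pd_dims[OF T]
 have "pdm p (?S * 1m p * ?S^H)" by (rule pd_congr_inv[OF pd_one _ _ e(2)]) simp_all
 hence "pdm p (?S * ?S)" by simp
 moreover have "?T * ?T * (?S * ?S) = 1m p" by (simp add: m_assoc m_cancel[OF e(1)] e(1))
 moreover have "?S * ?S * (?T * ?T) = 1m p" by (simp add: m_assoc m_cancel[OF e(2)] e(2))
 ultimately show ?thesis unfolding e(3) by blast
qed

text \<open>\<open>rsq p A\<close> commutes with the inverse of \<open>A\<close>. Consequently the
  Schur complement of \<open>A\<close> in a block matrix with cross block \<open>rsq p A * Z\<close>
  contains no inverse.\<close>

lemma rsq_inverse: assumes A: "in01 p A" and Ai: "Ai : Mat p p" "A * Ai = 1m p" shows "rsq p A * Ai * rsq p A = 1m p - A"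
proof -
 note a = pd_dims[OF cj1[OF A]] and r = pd_dims[OF rsq_pd[OF A]]
 note [simp] = a r MatD[OF Ai(1)]
 note AiA = inverse_hermitian(1)[OF pd_herm[OF cj1[OF A]] Ai]
 have "rsq p A * Ai = Ai * A * (rsq p A * Ai)" unfolding AiA by simp
 also have "... = Ai * (A * rsq p A) * Ai" by (simp add: m_assoc)
 also have "... = Ai * (rsq p A * A) * Ai" by (simp only: rsq_commute[OF A])
 also have "... = Ai * rsq p A" by (simp add: m_assoc Ai(2))
 finally have "rsq p A * Ai * rsq p A = Ai * (rsq p A * rsq p A)" by (simp add: m_assoc)
 also have "... = 1m p - A" unfolding rsq_self[OF A] by (simp add: m_cancel[OF AiA])
 finally show ?thesis .
qed

lemma in01_compl: "in01 p A ==> in01 p (1m p - A)"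
proof -
 assume A: "in01 p A"
 have "1m p - (1m p - A) = A" using pd_dims[OF cj1[OF A]] by (intro eq_matI) auto
 thus ?thesis using A by simp
qed

lemma rsq_compl: "in01 p A ==> rsq p (1m p - A) = rsq p A"
proof -
 assume A: "in01 p A"
 note [simp] = pd_dims[OF cj1[OF A]]
 have "1m p - (1m p - A) = A" by (intro eq_matI) auto
 moreover have "(1m p - A) * A = A * (1m p - A)" by (simp add: m_distrib)
 ultimately show ?thesis by (simp add: rsq_def)
qed

text \<open>The cross block is normalized by \<open>rsq p A\<close>, so that the condition on
  \<open>Z\<close> becomes a contraction property that does not involve \<open>A\<close>.\<close>

definition blk :: "nat => cmat => cmat => cmat => cmat" where
 "blk p A Z F = fbm A (rsq p A * Z) (Z^H * rsq p A) F"

lemma blk_pos_def: assumes A: "in01 p A" and Z: "Z : Mat p q" and F: "F : Mat q q"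
 shows "pdm (p + q) (blk p A Z F) <-> pdm q (F - Z^H * (1m p - A) * Z)" and "det (blk p A Z F) = det A * det (F - Z^H * (1m p - A) * Z)"
proof -
 note a = pd_dims[OF cj1[OF A]] and r = pd_dims[OF rsq_pd[OF A]]
 note [simp] = a r MatD[OF Z] MatD[OF F]
 obtain Ai where Ai: "Ai : Mat p p" "A * Ai = 1m p" using pos_def_inverse_exists[OF cj1[OF A]] pd_dims by blast
 note [simp] = MatD[OF Ai(1)]
 have C: "rsq p A * Z : Mat p q" by (simp add: carrier_iff)
 have Ca: "(rsq p A * Z)^H = Z^H * rsq p A" by simp
 have S: "(Z^H * rsq p A) * Ai * (rsq p A * Z) = Z^H * (1m p - A) * Z" unfolding rsq_inverse[OF A Ai, symmetric] by (simp add: m_assoc)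
 note H = schur_pos_def[OF pd_herm[OF cj1[OF A]] Ai C F, unfolded Ca S]
  schur_det[OF pd_herm[OF cj1[OF A]] Ai C F, unfolded Ca S]
 show "pdm (p + q) (blk p A Z F) <-> pdm q (F - Z^H * (1m p - A) * Z)"
  "det (blk p A Z F) = det A * det (F - Z^H * (1m p - A) * Z)" unfolding blk_def using H A by simp_all
qed

text \<open>The parametrization is symmetric under \<open>X \<mapsto> 1 - X\<close>: this map
  replaces \<open>A\<close> by \<open>1 - A\<close>, \<open>Z\<close> by \<open>- Z\<close> and
  \<open>F\<close> by \<open>1 - F\<close>, while \<open>rsq\<close> is unchanged. The claims are
  thus the positivity criterion and determinant formula for \<open>blk\<close> once more.\<close>

lemma blk_compl: assumes A: "in01 p A" and Z: "Z : Mat p q" and F: "F : Mat q q"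
 shows "pdm (p + q) (1m (p + q) - blk p A Z F) <-> pdm q (1m q - F - Z^H * A * Z)"
  and "det (1m (p + q) - blk p A Z F) = det (1m p - A) * det (1m q - F - Z^H * A * Z)"
proof -
 note a = pd_dims[OF cj1[OF A]] and r = pd_dims[OF rsq_pd[OF A]]
 note [simp] = a r MatD[OF Z] MatD[OF F]
 define Z' where "Z' = cx (-1) .* Z"
 have Z': "Z' : Mat p q" by (simp add: Z'_def carrier_iff)
 have F': "1m q - F : Mat q q" by (simp add: carrier_iff)
 have eq: "1m (p + q) - blk p A Z F = blk p (1m p - A) Z' (1m q - F)" unfolding blk_def rsq_compl[OF A] Z'_def
  by (rule eq_matI) (auto simp del: index_mm(1))
 have AA: "1m p - (1m p - A) = A" by (intro eq_matI) auto
 have "(-1) .* ((-1) .* M) = M" for M :: "cmat" by (intro eq_matI) auto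
 hence ZZ: "Z'^H * A * Z' = Z^H * A * Z" by (simp add: Z'_def)
 show "pdm (p + q) (1m (p + q) - blk p A Z F) <-> pdm q (1m q - F - Z^H * A * Z)"
  "det (1m (p + q) - blk p A Z F) = det (1m p - A) * det (1m q - F - Z^H * A * Z)"
  unfolding eq using blk_pos_def[OF in01_compl[OF A] Z' F'] unfolding AA ZZ by auto
qed

text \<open>The two Schur complements, of the block matrix and of its complement, add up to
  \<open>1 - Z^H * Z\<close>.\<close>

lemma blk_imp_contraction: assumes A: "in01 p A" and Z: "Z : Mat p q" and F: "F : Mat q q"
  and "pdm (p + q) (blk p A Z F)" "pdm (p + q) (1m (p + q) - blk p A Z F)" shows "pdm q (1m q - Z^H * Z)"
proof -
 note [simp] = pd_dims[OF cj1[OF A]] MatD[OF Z] MatD[OF F]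
 have "pdm q ((F - Z^H * (1m p - A) * Z) + (1m q - F - Z^H * A * Z))"
  using assms blk_pos_def[OF A Z F] blk_compl[OF A Z F] by (intro pos_def_add) auto
 also have "(F - Z^H * (1m p - A) * Z) + (1m q - F - Z^H * A * Z) = 1m q - Z^H * Z"
  by (simp add: m_distrib) (intro eq_matI, auto simp del: index_mm(1))
 finally show ?thesis .
qed

lemma pos_def_one_plus_congr: assumes "pdm q G" "Z : Mat p q" shows "pdm p (1m p + Z * G * Z^H)" unfolding pos_def_mat_iff
proof (intro conjI ballI impI)
 note [simp] = pd_dims[OF assms(1)] MatD[OF assms(2)]
 show "Herm p (1m p + Z * G * Z^H)" by (intro hermitian_add hermitian_one Herm_congr[OF pd_herm[OF assms(1)] assms(2)])
 fix v :: "complex vec" assume v: "v : Vec p" "v ~= 0\<^sub>v p"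
 have "((1m p + Z * G * Z^H) *v v) .c v = (1m p *v v) .c v + ((Z * G * Z^H) *v v) .c v"
  using v by (subst add_mult_distrib_mat_vec[of _ p p]; (subst add_scalar_prod_distrib[of _ p])?)
   (auto intro!: carrier_vecI simp: carrier_iff)
 also have "((Z * G * Z^H) *v v) .c v = (G *v (Z^H *v v)) .c (Z^H *v v)" by (rule cinner_congr) (use assms v in auto)
 finally have *: "((1m p + Z * G * Z^H) *v v) .c v = (1m p *v v) .c v + (G *v (Z^H *v v)) .c (Z^H *v v)" .
 have "Z^H *v v : Vec q" by (intro carrier_vecI) simp
 from pos_def_nonneg[OF assms(1) this] pos_def_matD[OF pd_one v]
 show "0 < Re (((1m p + Z * G * Z^H) *v v) .c v)" unfolding * plus_complex.sel by linarith
qed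

text \<open>With \<open>G\<close> the inverse of \<open>1 - Z^H * Z\<close>, the matrix
  \<open>1 + Z * G * Z^H\<close> is positive definite and is the inverse of
  \<open>1 - Z * Z^H\<close>.\<close>

lemma contraction_adjoint: assumes Z: "Z : Mat p q" and P: "pdm q (1m q - Z^H * Z)" shows "pdm p (1m p - Z * Z^H)"
proof -
 obtain G where G: "pdm q G" "(1m q - Z^H * Z) * G = 1m q" using pos_def_inverse_exists[OF P] by blast
 note [simp] = MatD[OF Z] pd_dims[OF G(1)]
 obtain H where H: "pdm p H" "(1m p + Z * G * Z^H) * H = 1m p" using pos_def_inverse_exists[OF pos_def_one_plus_congr[OF G(1) Z]] by blast
 note [simp] = pd_dims[OF H(1)]
 have "(1m p - Z * Z^H) * (1m p + Z * G * Z^H)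
  = 1m p - Z * Z^H + Z * ((1m q - Z^H * Z) * G) * Z^H" by (simp add: m_distrib m_assoc)
 also have "... = 1m p" unfolding G(2) by simp
 finally have "1m p - Z * Z^H = H" by (rule left_inverse_unique[OF _ H(2)]) simp_all
 thus ?thesis using H by simp
qed

text \<open>The block matrix with unit diagonal blocks and cross block \<open>Z\<close> is evaluated
  twice, by eliminating either diagonal block.\<close>

lemma sylvester_det: assumes Z: "Z : Mat p q" shows "det (1m q - Z^H * Z) = det (1m p - Z * Z^H)"
proof -
 let ?a = "1m p - Z * Z^H"
 note [simp] = MatD[OF Z]
 have c: "1m p - Z * Z^H : Mat p p" "Z^H : Mat q p" by (auto simp: carrier_iff)
 have 1: "det (fbm (1m p) Z (Z^H) (1m q)) = det (1m q - Z^H * Z)" using schur_det[OF hermitian_one, of "1m p" p Z q "1m q"] Z by simp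
 have "fbm (1m p) Z (Z^H) (1m q) =
  fbm (1m p) Z (0m q p) (1m q) * fbm ?a (0m p q) (Z^H) (1m q)"
  using c by (subst mult_four_block_mat[of _ p p _ q _ q _ _ p _ q]) (auto simp: carrier_iff)
 also have "det ... = det (fbm (1m p) Z (0m q p) (1m q)) *
   det (fbm ?a (0m p q) (Z^H) (1m q))" using c by (intro det_mult[of _ "p + q"]) auto
 also have "det (fbm (1m p) Z (0m q p) (1m q)) = 1" using Z by (subst det_four_block_mat_lower_left_zero[of _ p _ q]) auto
 also have "det (fbm ?a (0m p q) (Z^H) (1m q)) = det ?a" using c by (subst det_four_block_mat_upper_right_zero[of _ p _ q]) auto
 finally show ?thesis using 1 by simp
qed

section \<open>Co-isometries and the root of the contraction defect\<close>

definition coiso :: "nat => nat => cmat => bool" where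
 "coiso p q V <-> V : Mat p q & V * V^H = 1m p"

lemma coisoD: assumes "coiso p q V" shows "V : Mat p q" "nr V = p" "nc V = q" "V * V^H = 1m p" using assms by (auto simp: coiso_def)

definition bmat :: "nat => nat => cmat => cmat => cmat" where
 "bmat p q W V = 1m q - V^H * (1m p - sqrt_mat p (1m p - W)) * V"

lemma bmat_props: assumes W: "in01 p W" and V: "coiso p q V" shows "Herm q (bmat p q W V)" and "bmat p q W V * bmat p q W V = 1m q - V^H * W * V"
  and "EX C:Mat q q. bmat p q W V * C = 1m q"
proof -
 define w w' where "w = sqrt_mat p (1m p - W)" and "w' = isqrt p (1m p - W)"
 note b = sqrt_pd[OF cj2[OF W], folded w_def] and b' = isqrt_pd[OF cj2[OF W], folded w'_def]
 note bb = sqrt_mult_self[OF cj2[OF W], folded w_def] sqrt_isqrt[OF cj2[OF W], folded w_def w'_def]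
 note [simp] = coisoD[OF V] pd_dims[OF b] pd_dims[OF b'] pd_dims[OF cj1[OF W]]
 note c = m_cancel[OF coisoD(4)[OF V]] m_cancel[OF bb(1)] m_cancel[OF bb(2)]
 show "Herm q (bmat p q W V)" unfolding bmat_def w_def[symmetric] by (intro HermI) (auto simp: carrier_iff m_assoc)
 show "bmat p q W V * bmat p q W V = 1m q - V^H * W * V" unfolding bmat_def w_def[symmetric]
  by (simp add: m_distrib m_assoc c) (intro eq_matI, auto simp del: index_mm(1))
 have "bmat p q W V * (1m q - V^H * (1m p - w') * V) = 1m q" unfolding bmat_def w_def[symmetric]
  by (simp add: m_distrib m_assoc c) (intro eq_matI, auto simp del: index_mm(1))
 moreover have "1m q - V^H * (1m p - w') * V : Mat q q" by (simp add: carrier_iff)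
 ultimately show "EX C:Mat q q. bmat p q W V * C = 1m q" by blast
qed

declare MatD [simp del] carrier_iff [simp]

section \<open>Moments of the block parametrization\<close>

primrec mpow :: "nat => cmat => nat => cmat" where
 "mpow n X 0 = 1m n"
| "mpow n X (Suc k) = X * mpow n X k"

lemma mpow_dim [simp]: "nr X = n ==> nr (mpow n X k) = n" "nc (mpow n X k) = n" by (induction k) auto

text \<open>The moments of \<open>Y\<close> in the frame \<open>V^H\<close>; up to a unitary change
  of basis these are moments of a spectral matrix measure.\<close>

definition vmom :: "nat => cmat => cmat => nat => cmat" where
 "vmom q V Y i = V * mpow q Y i * V^H"

lemma block_four_block: assumes "A : Mat p r" "B : Mat p s" "C : Mat q r" "D : Mat q s"
 shows "block 0 0 p r (fbm A B C D) = A" "block p 0 q r (fbm A B C D) = C" using assms by (auto simp: block_def intro!: eq_matI)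

lemma block_mult: assumes "A : Mat p p" "B : Mat p q" "C : Mat q p" "D : Mat q q" and "Y : Mat (p + q) (p + q)"
 shows "block 0 0 p p (fbm A B C D * Y) = A * block 0 0 p p Y + B * block p 0 q p Y"
  "block p 0 q p (fbm A B C D * Y) = C * block 0 0 p p Y + D * block p 0 q p Y"
proof -
 let ?a = "A * block 0 0 p p Y + B * block p 0 q p Y"
 let ?b = "A * block 0 p p q Y + B * block p p q q Y"
 let ?c = "C * block 0 0 p p Y + D * block p 0 q p Y"
 let ?d = "C * block 0 p p q Y + D * block p p q q Y"
 have "fbm A B C D * Y = fbm A B C D *
  fbm (block 0 0 p p Y) (block 0 p p q Y) (block p 0 q p Y) (block p p q q Y)" by (rule arg_cong[OF four_block_decomp[OF assms(5)]])
 also have "... = fbm ?a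
   ?b ?c
   ?d" using assms by (intro mult_four_block_mat[of _ p p _ q _ q _ _ p _ q]) auto
 finally have *: "fbm A B C D * Y = fbm ?a
   ?b ?c
   ?d" .
 show "block 0 0 p p (fbm A B C D * Y) = A * block 0 0 p p Y + B * block p 0 q p Y"
  "block p 0 q p (fbm A B C D * Y) = C * block 0 0 p p Y + D * block p 0 q p Y"
  unfolding * by (rule block_four_block[of _ p p _ q _ q]; use assms in \<open>simp\<close>)+
qed

text \<open>The blocks of the powers of \<open>X = blk p A (W\<^sup>1\<^sup>/\<^sup>2 V) F\<close>: with \<open>U\<^sub>j\<close> and \<open>L\<^sub>j\<close> the upper
  left and lower left blocks of \<open>X\<^sup>j\<close>, the pair of \<open>U\<^sub>j\<close> and \<open>i \<mapsto> V Y\<^sup>i L\<^sub>j\<close> obeys a recursion in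
  \<open>j\<close> that involves only the moments \<open>V Y\<^sup>i V\<^sup>\<dagger>\<close>.\<close>

primrec phi :: "nat => cmat => cmat => (nat => cmat) => nat
  => cmat \<times> (nat => cmat)" where
 "phi p A W m 0 = (1m p, %i. 0m p p)"
| "phi p A W m (Suc j) =
   (let w = sqrt_mat p W * rsq p A; a = sqrt_mat p W * (1m p - A) * sqrt_mat p W;
     d = 1m p - sqrt_mat p (1m p - W); U = fst (phi p A W m j); g = snd (phi p A W m j)
   in (A * U + w^H * g 0,
     %i. m i * w * U + m i * a * g 0 + g (Suc i) - m i * d * g 1 - m (Suc i) * d * g 0
       + m i * d * m 1 * d * g 0))"

abbreviation Phi :: "nat => cmat => cmat => (nat => cmat) => nat => cmat" where
 "Phi p A W m j == fst (phi p A W m j)"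

text \<open>The affine map from \<open>Y\<close> to the lower right block. For given
  \<open>A\<close> and \<open>Z = sqrt_mat p W * V\<close> the admissible blocks lie between
  \<open>Z^H * (1 - A) * Z\<close> and \<open>1 - Z^H * A * Z\<close>. The length of this interval
  is \<open>1 - Z^H * Z\<close>, the square of \<open>bmat\<close>, and \<open>Y\<close> is the
  position inside it after rescaling to the unit interval.\<close>

definition lowb :: "nat => nat => cmat => cmat => cmat => cmat => cmat" where
 "lowb p q A W V Y = (sqrt_mat p W * V)^H * (1m p - A) * (sqrt_mat p W * V)
   + bmat p q W V * Y * bmat p q W V"

text \<open>Comparison of the first block columns in \<open>X^(j + 1) = X * X^j\<close>. Expanding
  \<open>B = 1 - V^H * d * V\<close> produces the terms of the recursion, and every product
  \<open>V * Y^i * V^H\<close> that arises is a moment; \<open>V\<close> and \<open>Y\<close> enter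
  in no other way.\<close>

lemma phi_blk: assumes A: "in01 p A" and W: "in01 p W" and V: "coiso p q V" and Y: "Y : Mat q q"
 defines "X == blk p A (sqrt_mat p W * V) (lowb p q A W V Y)" shows "Phi p A W (vmom q V Y) j = block 0 0 p p (mpow (p + q) X j)"
  "snd (phi p A W (vmom q V Y) j) i = V * mpow q Y i * block p 0 q p (mpow (p + q) X j)"
proof -
 define t r w where "t = sqrt_mat p (1m p - W)" and "r = rsq p A" and "w = sqrt_mat p W"
 define a d where "a = w * (1m p - A) * w" and "d = 1m p - t"
 note b = sqrt_pd[OF cj2[OF W], folded t_def] and o = sqrt_pd[OF cj1[OF W], folded w_def]
 note rr = rsq_pd[OF A, folded r_def]
 note [simp] = pd_dims[OF b] pd_dims[OF o] pd_dims[OF rr] pd_dims[OF cj1[OF A]]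
   coisoD[OF V] MatD[OF Y]
 have ad[simp]: "nr a = p" "nc a = p" "nr d = p" "nc d = p" by (auto simp: a_def d_def)
 define B F where "B = bmat p q W V" and "F = lowb p q A W V Y"
 have B: "B = 1m q - V^H * d * V" by (simp add: B_def bmat_def d_def t_def)
 have F: "F = V^H * a * V + B * Y * B" by (simp add: F_def lowb_def a_def B_def w_def[symmetric] m_assoc)
 have [simp]: "nr B = q" "nc B = q" "nr F = q" "nc F = q" by (auto simp: B F)
 have X: "X = fbm A (r * (w * V)) ((w * V)^H * r) F" unfolding X_def blk_def r_def w_def F_def ..
 have [simp]: "X : Mat (p + q) (p + q)" "nr X = p + q" "nc X = p + q" by (auto simp: X)
 define U L where "U j = block 0 0 p p (mpow (p + q) X j)" and "L j = block p 0 q p (mpow (p + q) X j)" for j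
 have [simp]: "nr (U j) = p" "nc (U j) = p" "nr (L j) = q" "nc (L j) = p" for j by (auto simp: U_def L_def)
 have c: "A : Mat p p" "r * (w * V) : Mat p q" "(w * V)^H * r : Mat q p"
  "F : Mat q q" "!!j. mpow (p + q) X j : Mat (p + q) (p + q)" by auto
 have U: "U (Suc j) = A * U j + r * (w * V) * L j" and L: "L (Suc j) = (w * V)^H * r * U j + F * L j" for j
 proof -
  have XX: "X * M = fbm A (r * (w * V)) ((w * V)^H * r) F * M" for M by (simp only: X[symmetric])
  show "U (Suc j) = A * U j + r * (w * V) * L j" "L (Suc j) = (w * V)^H * r * U j + F * L j"
   unfolding U_def L_def mpow.simps XX block_mult[OF c] by (rule refl)+
 qed
 have U0: "U 0 = 1m p" and L0: "L 0 = 0m q p" by (auto simp: U_def L_def block_def intro!: eq_matI)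
 note VV = m_cancel[OF coisoD(4)[OF V]]
 have pw: "mpow q Y i * (Y * Z) = mpow q Y (Suc i) * Z" if "nr Z = q" for i Z
 proof -
  have c: "mpow q Y i * Y = Y * mpow q Y i" by (induction i) (auto simp: m_assoc)
  have "mpow q Y i * (Y * Z) = mpow q Y i * Y * Z" by (rule m_assoc[symmetric]) (use that in simp_all)
  thus ?thesis by (simp only: c mpow.simps)
 qed
 have g: "V * mpow q Y i * L (Suc j) =
   vmom q V Y i * (w * r) * U j + vmom q V Y i * a * (V * mpow q Y 0 * L j) + V * mpow q Y (Suc i) * L j
   - vmom q V Y i * d * (V * mpow q Y 1 * L j) - vmom q V Y (Suc i) * d * (V * mpow q Y 0 * L j)
   + vmom q V Y i * d * vmom q V Y 1 * d * (V * mpow q Y 0 * L j)" (is "?l = ?r") for i j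
 proof -
  have 1: "?l = V * (mpow q Y i * (V^H * (w * (r * U j)))) + V * (mpow q Y i * (V^H * (a * (V * L j))))
   + V * (mpow q Y i * (B * (Y * (B * L j))))" unfolding L F by (simp add: m_distrib m_assoc)
  have 2: "V * (mpow q Y i * (B * (Y * (B * L j)))) =
   V * (mpow q Y (Suc i) * L j) - V * (mpow q Y (Suc i) * (V^H * (d * (V * L j))))
   - V * (mpow q Y i * (V^H * (d * (V * (Y * L j)))))
   + V * (mpow q Y i * (V^H * (d * (V * (Y * (V^H * (d * (V * L j))))))))" unfolding B by (simp add: m_distrib m_assoc pw del: mpow.simps)
    (intro eq_matI, simp_all del: index_mm(1) mpow.simps)
  show ?thesis unfolding 1 2 vmom_def by (simp add: m_assoc) (intro eq_matI, auto simp del: index_mm(1))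
 qed
 have "Phi p A W (vmom q V Y) j = U j & (ALL i. snd (phi p A W (vmom q V Y) j) i = V * mpow q Y i * L j)"
 proof (induction j)
  case 0
  show ?case by (simp add: U0 L0)
 next
  case (Suc j)
  show ?case unfolding phi.simps Let_def fst_conv snd_conv r_def[symmetric] w_def[symmetric] t_def[symmetric]
   a_def[symmetric] d_def[symmetric] g using Suc by (simp add: U m_assoc)
 qed
 thus "Phi p A W (vmom q V Y) j = block 0 0 p p (mpow (p + q) X j)"
  "snd (phi p A W (vmom q V Y) j) i = V * mpow q Y i * block p 0 q p (mpow (p + q) X j)" by (auto simp: U_def L_def)
qed

lemma phi_dim [simp]: assumes "in01 p A" "in01 p W" "!!i. m i : Mat p p" shows "nr (Phi p A W m j) = p" "nc (Phi p A W m j) = p"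
  "nr (snd (phi p A W m j) i) = p" "nc (snd (phi p A W m j) i) = p"
proof -
 note [simp] = pd_dims[OF sqrt_pd] pd_dims[OF rsq_pd] pd_dims[of p A]
  MatD[OF assms(3)]
 have "nr (Phi p A W m j) = p & nc (Phi p A W m j) = p &
  (ALL i. nr (snd (phi p A W m j) i) = p & nc (snd (phi p A W m j) i) = p)" by (induction j) (use assms in \<open>auto simp: Let_def\<close>)
 thus "nr (Phi p A W m j) = p" "nc (Phi p A W m j) = p"
  "nr (snd (phi p A W m j) i) = p" "nc (snd (phi p A W m j) i) = p" by auto
qed

declare phi.simps(2) [simp del]

text \<open>The factor through which a moment of \<open>Y\<close> enters the moment of
  \<open>X\<close> whose order is larger by two. The successive factors of this kind build up the
  lengths of the moment intervals.\<close>

definition dmat :: "nat => cmat => cmat => cmat" where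
 "dmat p A W = rsq p A * sqrt_mat p W * sqrt_mat p (1m p - W)"

text \<open>Triangular dependence: the moment of order \<open>k + 2\<close> involves the moments
  \<open>m\<close> up to order \<open>k\<close>, the last one affinely and with leading factor
  \<open>dmat\<close>. This makes the passage between the two moment sequences invertible and
  transports moment intervals from one to the other.\<close>

lemma phi_diff: assumes A: "in01 p A" and W: "in01 p W" and k: "k >= 1"
  and m: "!!i. m i : Mat p p" "!!i. m' i : Mat p p" "m 0 = 1m p" "!!i. i < k ==> m i = m' i" shows "j <= k + 1 ==> Phi p A W m j = Phi p A W m' j"
  and "Phi p A W m (k + 2) = Phi p A W m' (k + 2) + dmat p A W * (m k - m' k) * (dmat p A W)^H"
proof -
 define t w where "t = sqrt_mat p (1m p - W)" and "w = sqrt_mat p W * rsq p A"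
 define a d where "a = sqrt_mat p W * (1m p - A) * sqrt_mat p W" and "d = 1m p - t"
 note b = sqrt_pd[OF cj2[OF W], folded t_def] and o = sqrt_pd[OF cj1[OF W]]
 note rr = rsq_pd[OF A]
 note [simp] = pd_dims[OF b] pd_dims[OF o] pd_dims[OF rr] pd_dims[OF cj1[OF A]]
   MatD[OF m(1)] MatD[OF m(2)]
 have ad[simp]: "nr a = p" "nc a = p" "nr d = p" "nc d = p" "nr w = p" "nc w = p" by (auto simp: a_def d_def w_def)
 note pd[simp] = phi_dim[OF A W m(1)] phi_dim[OF A W m(2)]
 have m'0: "m' 0 = 1m p" using m(3) m(4)[of 0] k by simp
 define \<Delta> where "\<Delta> = m k - m' k"
 have [simp]: "nr \<Delta> = p" "nc \<Delta> = p" by (auto simp: \<Delta>_def)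
 have bd: "t = 1m p - d" unfolding d_def by (intro eq_matI) simp_all
 have mk: "m k = m' k + \<Delta>" unfolding \<Delta>_def by simp
 define g g' where "g j = snd (phi p A W m j)" and "g' j = snd (phi p A W m' j)" for j
 have gd[simp]: "nr (g j i) = p" "nc (g j i) = p" "nr (g' j i) = p" "nc (g' j i) = p" for i j by (auto simp: g_def g'_def)
 \<comment> \<open>\<open>e i j\<close> is the defect of \<open>g j i\<close> on the antidiagonal
   \<open>i + j = k + 1\<close>. It equals \<open>\<Delta> * w\<close> at \<open>j = 1\<close>,
   acquires one factor \<open>t\<close> in the following step and a second one when \<open>i\<close>
   reaches 0; for \<open>k = 1\<close> both happen at once.\<close>
 define e where "e i j = (if i = 0 then t * \<Delta> * t * w else if j = 1 then \<Delta> * w else \<Delta> * t * w)" for i j :: nat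
 have ed[simp]: "nr (e i j) = p" "nc (e i j) = p" for i j by (auto simp: e_def)
 have gS: "g (Suc j) i = m i * w * Phi p A W m j + m i * a * g j 0 + g j (Suc i) - m i * d * g j 1
    - m (Suc i) * d * g j 0 + m i * d * m 1 * d * g j 0"
  and gS': "g' (Suc j) i = m' i * w * Phi p A W m' j + m' i * a * g' j 0 + g' j (Suc i) - m' i * d * g' j 1
    - m' (Suc i) * d * g' j 0 + m' i * d * m' 1 * d * g' j 0" for i j
  unfolding g_def g'_def by (simp_all add: Let_def a_def d_def t_def w_def phi.simps(2))
 have US: "Phi p A W m (Suc j) = A * Phi p A W m j + w^H * g j 0" and US': "Phi p A W m' (Suc j) = A * Phi p A W m' j + w^H * g' j 0" for j
  unfolding g_def g'_def by (simp_all add: Let_def w_def phi.simps(2))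
 have g0: "g 0 i = 0m p p" "g' 0 i = 0m p p" for i by (simp_all add: g_def g'_def)
 have g1: "g 1 i = m i * w" "g' 1 i = m' i * w" for i unfolding One_nat_def gS gS' g0 by simp_all
 \<comment> \<open>Only \<open>g j 0\<close> enters \<open>Phi\<close> at \<open>Suc j\<close>, so
   agreement of \<open>g\<close> for \<open>i + j <= k\<close> gives agreement of \<open>Phi\<close>
   up to \<open>k + 1\<close>, and the defect first shows at \<open>k + 2\<close>.\<close>
 have main: "(j <= k + 1 --> Phi p A W m j = Phi p A W m' j) & (ALL i. i + j <= k --> g j i = g' j i)
   & (ALL i. j >= 1 --> i + j = k + 1 --> g j i = g' j i + e i j)" for j
 proof (induction j)
  case 0
  show ?case by (simp add: g0)
 next
  case (Suc j)
  have U: "Phi p A W m (Suc j) = Phi p A W m' (Suc j)" if "Suc j <= k + 1" unfolding US US' using Suc that by simp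
  have 1: "g (Suc j) i = g' (Suc j) i" if "i + Suc j <= k" for i
  proof (cases "j = 0")
   case True
   thus ?thesis using g1 m(4)[of i] that by simp
  next
   case False
   have "m i = m' i" "m 1 = m' 1" "m (Suc i) = m' (Suc i)" using that False by (auto intro!: m(4))
   moreover have "g j 0 = g' j 0" "g j 1 = g' j 1" "g j (Suc i) = g' j (Suc i)" using Suc that by auto
   ultimately show ?thesis unfolding gS gS' using Suc that by simp
  qed
  have 2: "g (Suc j) i = g' (Suc j) i + e i (Suc j)" if ij: "i + Suc j = k + 1" for i
  proof (cases "j = 0")
   case True
   hence "i = k" "i ~= 0" using ij k by auto
   thus ?thesis using True g1[of i] by (simp add: e_def mk m_distrib)
  next
   case j0: False
   have Ueq: "Phi p A W m j = Phi p A W m' j" and gj0: "g j 0 = g' j 0" using Suc ij by auto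
   have gi: "g j (Suc i) = g' j (Suc i) + e (Suc i) j" using Suc ij j0 by auto
   have mi: "m i = m' i" using ij j0 by (intro m(4)) auto
   have mi0: "m' i = 1m p" if "i = 0" using that m'0 by simp
   show ?thesis
   proof (cases "j = 1")
    case j1: True
    have gj0w: "g' j 0 = w" using g1 j1 m'0 by simp
    have mSi: "m (Suc i) = m' (Suc i) + \<Delta>" using ij j1 mk by simp
    show ?thesis
    proof (cases "i = 0")
     case True
     hence k1: "k = 1" using ij j1 by simp
     have m1: "m (Suc 0) = m' (Suc 0) + \<Delta>" using mSi True by simp
     have g11: "g (Suc 0) (Suc 0) = g' (Suc 0) (Suc 0) + \<Delta> * w" using gi True j1 by (simp add: e_def)
     show ?thesis unfolding gS gS' Ueq gj0 gj0w unfolding True j1 One_nat_def m(3) m'0 m1 g11 by (simp add: e_def m_distrib m_assoc bd)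
        (intro eq_matI, simp_all del: index_mm(1))
    next
     case False
     hence "g j 1 = g' j 1" "m 1 = m' 1" using Suc ij j1 by (auto intro!: m(4))
     thus ?thesis unfolding gS gS' Ueq gj0 gj0w using mi False gi mSi j1 by (simp add: e_def m_distrib m_assoc bd)
        (intro eq_matI, simp_all del: index_mm(1))
    qed
   next
    case j1: False
    have mSi: "m (Suc i) = m' (Suc i)" "m 1 = m' 1" using ij j1 j0 by (auto intro!: m(4))
    show ?thesis
    proof (cases "i = 0")
     case True
     show ?thesis unfolding gS gS' Ueq gj0 using mi mi0 True gi mSi j1 j0 by (simp add: e_def m_distrib m_assoc bd)
        (intro eq_matI, simp_all del: index_mm(1))
    next
     case False
     hence "g j 1 = g' j 1" using Suc ij by auto
     thus ?thesis unfolding gS gS' Ueq gj0 using mi False gi mSi j1 j0 by (simp add: e_def m_distrib m_assoc bd)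
        (intro eq_matI, simp_all del: index_mm(1))
    qed
   qed
  qed
  show ?case using U 1 2 by blast
 qed
 show "j <= k + 1 ==> Phi p A W m j = Phi p A W m' j" using main[of j] by blast
 have "Phi p A W m (Suc (k + 1)) = Phi p A W m' (Suc (k + 1)) + w^H * e 0 (k + 1)" unfolding US US' using main[of "k + 1"] by (simp add: m_distrib)
 also have "w^H * e 0 (k + 1) = dmat p A W * (m k - m' k) * (dmat p A W)^H"
  unfolding dmat_def w_def e_def \<Delta>_def[symmetric] t_def[symmetric] by (simp add: m_assoc)
 finally show "Phi p A W m (k + 2) = Phi p A W m' (k + 2) + dmat p A W * (m k - m' k) * (dmat p A W)^H" by simp
qed

section \<open>Block Hankel matrices and finite models\<close>

lemma inverse_exists':
 fixes A :: "cmat" assumes A: "A : Mat m m" and inj: "!!u. u : Mat m 1 ==> A * u = 0m m 1 ==> u = 0m m 1"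
 shows "EX B:Mat m m. A * B = 1m m & B * A = 1m m"
proof (rule inverse_exists[OF A])
 fix v :: "complex vec" assume v: "v : Vec m" "A *v v = 0\<^sub>v m"
 let ?u = "mat m 1 (%(i, _). v $ i)"
 have "(A * ?u) $$ (i, j) = 0" if "i < m" "j < 1" for i j
 proof -
  have "(A * ?u) $$ (i, j) = (A *v v) $ i" using that A v(1) by (simp add: sp_def)
  thus ?thesis using v(2) that by simp
 qed
 hence z: "A * ?u = 0m m 1" using A by (intro eq_matI) (simp_all del: index_mm(1))
 have u: "?u = 0m m 1" by (rule inj[OF _ z]) simp
 have "v $ i = 0" if "i < m" for i using arg_cong[OF u, of "%M. M $$ (i, 0)"] that by simp
 thus "v = 0\<^sub>v m" using v(1) by (intro eq_vecI) auto
qed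

lemma mult_vec_inj:
 fixes D E :: "cmat" assumes "E * D = 1m k" "D : Mat m k" "E : Mat k m" "v : Vec k" "D *v v = 0\<^sub>v m" shows "v = 0\<^sub>v k"
 by (rule mult_vec_eq_0[OF assms(1)]) (use assms in simp_all)

text \<open>The \<open>j\<close>-th block column of the identity matrix. In the Hankel setting it
  stands for the monomial \<open>x^j\<close>.\<close>

definition jcol :: "nat => nat => nat => cmat" where
 "jcol N p j = mat N p (%(r, c). if r = j * p + c then 1 else 0)"

lemma jcol_dim [simp]: "nr (jcol N p j) = N" "nc (jcol N p j) = p" by (simp_all add: jcol_def)

lemma block_index_less: "j < n ==> c < p ==> j * p + c < n * (p::nat)"
 by (metis add.commute add_less_cancel_left less_le_trans mult.commute mult_Suc_right mult_le_mono2 Suc_leI)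

lemma mult_jcol: assumes "A : Mat m (n * p)" "j < n" "r < m" "c < p" shows "(A * jcol (n * p) p j) $$ (r, c) = A $$ (r, j * p + c)"
proof -
 have "(A * jcol (n * p) p j) $$ (r, c) = (\<Sum>k<n * p. if k = j * p + c then A $$ (r, j * p + c) else 0)"
  using assms by (simp add: sp_def at0L jcol_def if_distrib[of "%x. _ * x"] cong: if_cong)
 thus ?thesis using block_index_less[OF assms(2,4)] by simp
qed

lemma jcol_mult: assumes "A : Mat (n * p) m" "j < n" "r < p" "c < m" shows "((jcol (n * p) p j)^H * A) $$ (r, c) = A $$ (j * p + r, c)"
proof -
 have "((jcol (n * p) p j)^H * A) $$ (r, c) = (\<Sum>k<n * p. if k = j * p + r then A $$ (j * p + r, c) else 0)"
  using assms by (simp add: sp_def at0L jcol_def if_distrib[of "%x. x * _"]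
    if_distrib[of cnj] cong: if_cong)
 thus ?thesis using block_index_less[OF assms(2,3)] by simp
qed

lemma jcol_jcol: assumes "i < n" "j < n" shows "(jcol (n * p) p i)^H * jcol (n * p) p j = (if i = j then 1m p else 0m p p)"
proof (rule eq_matI)
 fix r c assume "r < nr (if i = j then 1m p else 0m p p :: cmat)"
  "c < nc (if i = j then 1m p else 0m p p :: cmat)"
 hence rc: "r < p" "c < p" by (auto split: if_splits)
 have eq: "i * p + r = j * p + c <-> i = j & r = c"
 proof
  assume e: "i * p + r = j * p + c"
  have "(i * p + r) div p = i" "(j * p + c) div p = j" "(i * p + r) mod p = r" "(j * p + c) mod p = c" using rc by simp_all
  thus "i = j & r = c" unfolding e by simp
 qed simp
 have "((jcol (n * p) p i)^H * jcol (n * p) p j) $$ (r, c) = jcol (n * p) p j $$ (i * p + r, c)" using assms rc by (intro jcol_mult) simp_all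
 thus "((jcol (n * p) p i)^H * jcol (n * p) p j) $$ (r, c) = (if i = j then 1m p else 0m p p) $$ (r, c)"
  using rc block_index_less[OF assms(1) rc(1)] eq by (simp add: jcol_def)
qed simp_all

text \<open>Block positions are flattened by \<open>div\<close> and \<open>mod\<close> with respect
  to \<open>p\<close>. The shift \<open>s\<close> is the exponent of the weight \<open>x^s\<close>
  in the associated quadratic form on polynomials of degree below \<open>n\<close>.\<close>

definition hankel :: "nat => nat => nat => (nat => cmat) => cmat" where
 "hankel s n p M = mat (n * p) (n * p) (%(r, c). M (r div p + c div p + s) $$ (r mod p, c mod p))"

lemma hankel_dim [simp]: "nr (hankel s n p M) = n * p" "nc (hankel s n p M) = n * p" by (simp_all add: hankel_def)

lemma jcol_hankel_jcol: assumes "i < n" "j < n" "M (i + j + s) : Mat p p"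
 shows "(jcol (n * p) p i)^H * hankel s n p M * jcol (n * p) p j = M (i + j + s)"
proof (rule eq_matI)
 fix r c assume rc: "r < nr (M (i + j + s))" "c < nc (M (i + j + s))"
 hence r: "r < p" "c < p" using assms(3) by auto
 have "((jcol (n * p) p i)^H * hankel s n p M * jcol (n * p) p j) $$ (r, c) = hankel s n p M $$ (i * p + r, j * p + c)"
  using assms r block_index_less[OF assms(2) r(2)] by (subst mult_jcol, (simp_all)[4], subst jcol_mult) simp_all
 also have "... = M (i + j + s) $$ (r, c)" using r block_index_less[OF assms(1) r(1)] block_index_less[OF assms(2) r(2)] by (simp add: hankel_def)
 finally show "((jcol (n * p) p i)^H * hankel s n p M * jcol (n * p) p j) $$ (r, c) = M (i + j + s) $$ (r, c)" .
qed (use assms in auto)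

text \<open>Multiplication by \<open>x\<close> takes the monomial \<open>x^j\<close> to
  \<open>x^(j + 1)\<close>, as long as the degree stays below \<open>n\<close>.\<close>

lemma hankel_shift: assumes "Suc j < n" shows "hankel 1 n p M * jcol (n * p) p j = hankel 0 n p M * jcol (n * p) p (Suc j)"
proof (rule eq_matI)
 fix r c assume "r < nr (hankel 0 n p M * jcol (n * p) p (Suc j))"
  "c < nc (hankel 0 n p M * jcol (n * p) p (Suc j))"
 hence rc: "r < n * p" "c < p" by auto
 have j: "j < n" using assms by simp
 have "(hankel 1 n p M * jcol (n * p) p j) $$ (r, c) = hankel 1 n p M $$ (r, j * p + c)" using rc j by (intro mult_jcol) simp_all
 also have "... = hankel 0 n p M $$ (r, Suc j * p + c)"
 proof -
  have "(Suc j * p + c) div p = Suc j" "(Suc j * p + c) mod p = c"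
   using div_mult_self1[of p c "Suc j"] mod_mult_self1[of c "Suc j" p] rc by (simp_all only: add.commute) simp_all
  moreover have "(j * p + c) div p = j" "(j * p + c) mod p = c" using rc by simp_all
  ultimately show ?thesis using rc block_index_less[OF j rc(2)] block_index_less[OF assms rc(2)] unfolding hankel_def by simp
 qed
 also have "... = (hankel 0 n p M * jcol (n * p) p (Suc j)) $$ (r, c)" using rc assms by (subst mult_jcol) simp_all
 finally show "(hankel 1 n p M * jcol (n * p) p j) $$ (r, c) = (hankel 0 n p M * jcol (n * p) p (Suc j)) $$ (r, c)" .
qed auto

text \<open>Positivity of the weights \<open>x\<close> and \<open>1 - x\<close> on polynomials of
  degree below \<open>n\<close>. Exactly the moments up to order \<open>2 * n - 1\<close> enter,
  which makes an odd number of moments the natural case.\<close>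

definition hank_pos :: "nat => nat => (nat => cmat) => bool" where
 "hank_pos n p M <-> pdm (n * p) (hankel 1 n p M) & pdm (n * p) (hankel 0 n p M - hankel 1 n p M)"

text \<open>A finite-dimensional operator with the prescribed moments in the frame
  \<open>V^H\<close>. The last clause is cyclicity: the columns of \<open>X^i * V^H\<close> with
  \<open>i < n\<close> span the whole space, expressed as triviality of their orthogonal
  complement.\<close>

definition is_model :: "nat => nat => (nat => cmat) => cmat => cmat => bool" where
 "is_model n p M X V <-> in01 (n * p) X & coiso p (n * p) V &
   (ALL j. 1 <= j --> j <= 2 * n - 1 --> M j = vmom (n * p) V X j) &
   (ALL u:Mat (n * p) 1. (ALL i<n. V * mpow (n * p) X i * u = 0m p 1) --> u = 0m (n * p) 1)"

lemma mpow_adjoint: assumes "X : Mat n n" "X^H = X" shows "(mpow n X k)^H = mpow n X k" and "X * mpow n X k = mpow n X k * X"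
proof -
 note [simp] = assms(1)[unfolded carrier_iff, THEN cj1] assms(1)[unfolded carrier_iff, THEN cj2] assms(2)
 show c: "X * mpow n X k = mpow n X k * X" for k
 proof (induction k)
  case (Suc k)
  have "mpow n X (Suc k) * X = X * (mpow n X k * X)" by (simp add: m_assoc)
  thus ?case using Suc by simp
 qed simp
 show "(mpow n X k)^H = mpow n X k" by (induction k) (simp_all add: c)
qed

lemma mpow_add: assumes "X : Mat n n" shows "mpow n X (i + j) = mpow n X i * mpow n X j"
proof -
 have [simp]: "nr X = n" "nc X = n" using assms by auto
 show ?thesis by (induction i) (simp_all add: m_assoc)
qed

text \<open>The Gelfand-Naimark-Segal construction on polynomials of degree below \<open>n\<close>.
  The Hankel matrix \<open>G\<close> is the Gram matrix of the monomials and \<open>T\<close>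
  represents the form with weight \<open>x\<close>. In orthonormal coordinates multiplication by
  \<open>x\<close> becomes \<open>G^(-1/2) * T * G^(-1/2)\<close>, and the constants become the
  first block column of \<open>G^(1/2)\<close>.\<close>

lemma hank_pos_imp_model: assumes H: "hank_pos n p M" and n: "n >= 1" and M: "!!j. M j : Mat p p" "M 0 = 1m p" shows "EX X V. is_model n p M X V"
proof -
 define N G T where "N = n * p" and "G = hankel 0 n p M" and "T = hankel 1 n p M"
 have T: "pdm N T" and GT: "pdm N (G - T)" using H by (auto simp: hank_pos_def N_def G_def T_def)
 have Gd[simp]: "nr G = N" "nc G = N" by (simp_all add: G_def N_def)
 note [simp] = pd_dims(2-4)[OF T]
 have "G - T + T = G" by simp
 hence G: "pdm N G" using pos_def_add[OF GT T] by simp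
 define S Q where "S = isqrt N G" and "Q = sqrt_mat N G"
 note S = isqrt_pd[OF G, folded S_def] and Q = sqrt_pd[OF G, folded Q_def]
 note QS = sqrt_isqrt[OF G, folded S_def Q_def] and SQ = isqrt_sqrt[OF G, folded S_def Q_def] and QQ = sqrt_mult_self[OF G, folded Q_def]
 note [simp] = pd_dims(2-4)[OF S] pd_dims(2-4)[OF Q] pd_dims(2)[OF G]
 define J where "J = jcol N p"
 have Jd[simp]: "nr (J j) = N" "nc (J j) = p" for j by (simp_all add: J_def)
 define X V where "X = S * T * S" and "V = (J 0)^H * Q"
 have Vd[simp]: "nr V = p" "nc V = N" by (simp_all add: V_def)
 have "pdm N (S * T * S^H)" by (rule pd_congr_inv[OF T _ _ SQ]) simp_all
 hence X: "pdm N X" by (simp add: X_def)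
 note [simp] = pd_dims(2-4)[OF X]
 have "pdm N (S * (G - T) * S^H)" by (rule pd_congr_inv[OF GT _ _ SQ]) simp_all
 moreover have SG: "S * G = Q" unfolding QQ[symmetric] by (simp add: m_cancel[OF SQ])
 ultimately have X1: "pdm N (1m N - X)" by (simp add: X_def m_distrib QS)
 have JJ: "(J i)^H * hankel s n p M * J j = M (i + j + s)" if "i < n" "j < n" for i j s unfolding J_def N_def by (rule jcol_hankel_jcol[OF that M(1)])
 have V: "coiso p N V" unfolding coiso_def V_def using JJ[of 0 0 0] n M(2) by (simp add: m_assoc m_cancel[OF QQ] G_def[symmetric])
 have XJ: "mpow N X j * V^H = Q * J j" if "j < n" for j using that
 proof (induction j)
  case 0
  show ?case by (simp add: V_def)
 next
  case (Suc j)
  have "mpow N X (Suc j) * V^H = X * (Q * J j)" using Suc by (simp add: m_assoc)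
  also have "... = S * (T * J j)" by (simp add: X_def m_assoc m_cancel[OF SQ])
  also have "T * J j = G * J (Suc j)" unfolding T_def G_def J_def N_def by (rule hankel_shift[OF Suc.prems])
  also have "S * (G * J (Suc j)) = Q * J (Suc j)" by (simp add: m_cancel[OF SG])
  finally show ?case .
 qed
 have XJa: "V * mpow N X i = (J i)^H * Q" if "i < n" for i
 proof -
  have "(V * mpow N X i)^H = Q * J i" using XJ[OF that] by (simp add: mpow_adjoint)
  hence "((V * mpow N X i)^H)^H = (Q * J i)^H" by simp
  thus ?thesis unfolding adjoint_adjoint by simp
 qed
 have mom: "M j = vmom N V X j" if j: "1 <= j" "j <= 2 * n - 1" for j
 proof -
  \<comment> \<open>One factor \<open>X\<close> is kept in the middle; the other
    \<open>j - 1\<close> are divided so that each side receives at most \<open>n - 1\<close>, the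
    range in which powers act as shifts.\<close>
  define i where "i = min (j - 1) (n - 1)"
  define k where "k = j - 1 - i"
  have ik: "i < n" "k < n" "j = i + Suc k" using j n by (auto simp: i_def k_def)
  have "vmom N V X j = V * mpow N X i * (X * (mpow N X k * V^H))" unfolding vmom_def ik(3) by (subst mpow_add) (simp_all add: m_assoc)
  also have "... = (J i)^H * Q * (X * (Q * J k))" using ik XJ XJa by simp
  also have "... = (J i)^H * T * J k" by (simp add: X_def m_assoc m_cancel[OF SQ] m_cancel[OF QS])
  also have "... = M (i + k + 1)" unfolding T_def using JJ ik by blast
  finally show ?thesis using ik by simp
 qed
 have cyc: "u = 0m N 1" if u: "u : Mat N 1" "ALL i<n. V * mpow N X i * u = 0m p 1" for u
 proof -
  have [simp]: "nr u = N" "nc u = 1" using u by auto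
  have "Q * u = 0m N 1"
  proof (rule eq_matI)
   fix r c assume "r < nr (0m N 1 :: cmat)" "c < nc (0m N 1 :: cmat)"
   hence rc: "r < n * p" "c = 0" by (auto simp: N_def)
   define i k where "i = r div p" and "k = r mod p"
   have p: "p > 0" using rc by (cases p) auto
   have ik: "i < n" "k < p" "r = i * p + k" using rc p by (auto simp: i_def k_def less_mult_imp_div_less)
   have "(J i)^H * Q * u = 0m p 1" unfolding XJa[OF ik(1), symmetric] using u(2) ik by blast
   hence "(J i)^H * (Q * u) = 0m p 1" by (simp add: m_assoc)
   hence "((J i)^H * (Q * u)) $$ (k, 0) = 0" using ik by simp
   moreover have "((J i)^H * (Q * u)) $$ (k, 0) = (Q * u) $$ (i * p + k, 0)"
    unfolding J_def N_def by (rule jcol_mult[of _ n p 1]) (use ik in \<open>simp_all add: N_def\<close>)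
   ultimately show "(Q * u) $$ (r, c) = 0m N 1 $$ (r, c)" using ik rc by (simp add: N_def del: index_mm(1))
  qed simp_all
  hence "S * (Q * u) = 0m N 1" by simp
  thus ?thesis by (simp add: m_cancel[OF SQ])
 qed
 show ?thesis unfolding is_model_def using X X1 V mom cyc unfolding N_def by blast
qed

text \<open>With \<open>K\<close> the matrix of block columns \<open>X^j * V^H\<close>, the Hankel
  matrices are the congruences \<open>K^H * X^s * K\<close>. Cyclicity says that \<open>K^H\<close>
  is injective, so positivity of \<open>X\<close> and \<open>1 - X\<close> carries over.\<close>

lemma model_imp_hank_pos: assumes H: "is_model n p M X V" and n: "n >= 1" and M: "M 0 = 1m p" shows "hank_pos n p M"
proof -
 define N where "N = n * p"
 have X: "in01 N X" and V: "coiso p N V" and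
  mom: "!!j. 1 <= j ==> j <= 2 * n - 1 ==> M j = vmom N V X j" and
  cyc: "!!u. u : Mat N 1 ==> ALL i<n. V * mpow N X i * u = 0m p 1 ==> u = 0m N 1" using H unfolding is_model_def N_def by blast+
 note [simp] = pd_dims(2-4)[OF cj1[OF X]] coisoD(2-4)[OF V]
 have mom0: "M j = vmom N V X j" if "j <= 2 * n - 1" for j using mom[of j] that M by (cases "j = 0") (simp_all add: vmom_def)
 define K where "K = mat N N (%(r, c). (mpow N X (c div p) * V^H) $$ (r, c mod p))"
 have [simp]: "nr K = N" "nc K = N" by (simp_all add: K_def)
 have Kadj: "(K^H * u) $$ (r, c) = (V * mpow N X (r div p) * u) $$ (r mod p, c)" if "r < N" "nr u = N" "c < nc u" for u r c
 proof -
  have p: "p > 0" using that by (cases p) (auto simp: N_def)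
  have a: "(V * mpow N X (r div p)) = (mpow N X (r div p) * V^H)^H" by (simp add: mpow_adjoint)
  define L where "L = mpow N X (r div p) * V^H"
  have [simp]: "nr L = N" "nc L = p" by (simp_all add: L_def)
  have "(K^H * u) $$ (r, c) = (\<Sum>l<N. cnj (L $$ (l, r mod p)) * u $$ (l, c))"
   using that p by (simp add: sp_def at0L K_def L_def[symmetric] del: index_mm(1)) (simp add: sp_def at0L L_def)
  also have "... = (L^H * u) $$ (r mod p, c)" using that p by (simp add: sp_def at0L)
  finally show ?thesis unfolding a L_def[symmetric] .
 qed
 have prod: "hankel s n p M = K^H * (mpow N X s * K)" if s: "s <= 1" for s
 proof (rule eq_matI)
  fix r c assume "r < nr (K^H * (mpow N X s * K))" "c < nc (K^H * (mpow N X s * K))"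
  hence rc: "r < N" "c < N" by auto
  have p: "p > 0" using rc by (cases p) (auto simp: N_def)
  define i j where "i = r div p" and "j = c div p"
  have ij: "i < n" "j < n" using rc by (auto simp: i_def j_def N_def less_mult_imp_div_less)
  define R where "R = V * mpow N X i * mpow N X s"
  have [simp]: "nr R = p" "nc R = N" by (simp_all add: R_def)
  define L where "L = mpow N X j * V^H"
  have [simp]: "nr L = N" "nc L = p" by (simp_all add: L_def)
  have "(K^H * (mpow N X s * K)) $$ (r, c) = (V * mpow N X i * (mpow N X s * K)) $$ (r mod p, c)" using rc by (subst Kadj) (simp_all add: i_def)
  also have "V * mpow N X i * (mpow N X s * K) = R * K" by (simp add: R_def m_assoc)
  also have "(R * K) $$ (r mod p, c) = (R * L) $$ (r mod p, c mod p)" using rc p by (simp add: sp_def at0L K_def j_def[symmetric] L_def[symmetric])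
  also have "R * L = vmom N V X (i + s + j)" unfolding R_def L_def vmom_def by (simp add: mpow_add m_assoc)
  also have "vmom N V X (i + s + j) = M (i + j + s)" using mom0[of "i + j + s"] ij s by (simp add: ac_simps)
  finally show "hankel s n p M $$ (r, c) = (K^H * (mpow N X s * K)) $$ (r, c)" using rc by (simp add: hankel_def N_def i_def j_def)
 qed (simp_all add: N_def)
 have "EX B:Mat N N. K^H * B = 1m N & B * K^H = 1m N"
 proof (rule inverse_exists')
  fix u assume u: "u : Mat N 1" "K^H * u = 0m N 1"
  have [simp]: "nr u = N" "nc u = 1" using u by auto
  show "u = 0m N 1"
  proof (rule cyc[OF u(1)], intro allI impI eq_matI)
   fix i k c assume i: "i < n" and "k < nr (0m p 1 :: cmat)" "c < nc (0m p 1 :: cmat)"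
   hence k: "k < p" "c = 0" by auto
   have l: "i * p + k < N" unfolding N_def by (rule block_index_less[OF i k(1)])
   have "(V * mpow N X i * u) $$ (k, 0) = (K^H * u) $$ (i * p + k, 0)" using l k by (subst Kadj) simp_all
   thus "(V * mpow N X i * u) $$ (k, c) = 0m p 1 $$ (k, c)" unfolding u(2) using k l by simp
  qed simp_all
 qed simp
 then obtain B where B: "B : Mat N N" "K^H * B = 1m N" by blast
 have 1: "pdm N (K^H * X * (K^H)^H)" by (rule pd_congr_inv[OF cj1[OF X] _ B]) simp
 have 2: "pdm N (K^H * (1m N - X) * (K^H)^H)" by (rule pd_congr_inv[OF cj2[OF X] _ B]) simp
 show ?thesis unfolding hank_pos_def N_def[symmetric] using 1 2 prod[of 0] prod[of 1] by (simp add: m_distrib m_assoc)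
qed

lemma hankel_lincomb: assumes "!!j. M j : Mat p p" "!!j. M' j : Mat p p"
 shows "hankel s n p (%j. c .* (M j - e .* M' j)) = c .* (hankel s n p M - e .* hankel s n p M')"
proof (rule eq_matI)
 fix r k assume "r < nr (c .* (hankel s n p M - e .* hankel s n p M'))"
  "k < nc (c .* (hankel s n p M - e .* hankel s n p M'))"
 hence rk: "r < n * p" "k < n * p" by auto
 hence "p > 0" by (cases p) auto
 hence *: "r mod p < p" "k mod p < p" by auto
 show "hankel s n p (%j. c .* (M j - e .* M' j)) $$ (r, k) = (c .* (hankel s n p M - e .* hankel s n p M')) $$ (r, k)"
  using rk * assms by (simp add: hankel_def)
qed auto

lemma hankel_hermitian: assumes "!!j. Herm p (M j)" shows "Herm (n * p) (hankel s n p M)"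
proof (intro HermI eq_matI)
 fix r c assume "r < nr (hankel s n p M)" "c < nc (hankel s n p M)"
 hence rc: "r < n * p" "c < n * p" by auto
 hence "p > 0" by (cases p) auto
 hence *: "r mod p < p" "c mod p < p" by auto
 show "(hankel s n p M)^H $$ (r, c) = hankel s n p M $$ (r, c)" using rc hermitian_index[OF assms *, of "r div p + c div p + s"]
  by (simp add: hankel_def add.commute)
qed simp_all

text \<open>Positive definiteness is an open condition, so a small multiple of another Hermitian
  sequence may be subtracted; the factor \<open>1 / (1 - e)\<close> restores the zeroth moment when
  both sequences start with the identity. It is used to reserve room for a nontrivial auxiliary
  measure.\<close>

lemma hank_pos_perturb: assumes H: "hank_pos n p M" and M: "!!j. M j : Mat p p" and M': "!!j. Herm p (M' j)"
 shows "EX e. 0 < e & e < 1 & hank_pos n p (%j. cx (1 / (1 - e)) .* (M j - cx e .* M' j))"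
proof -
 let ?a = "hankel 0 n p M' - hankel 1 n p M'"
 let ?N = "n * p"
 have P: "pdm ?N (hankel 1 n p M)" "pdm ?N (hankel 0 n p M - hankel 1 n p M)" using H by (auto simp: hank_pos_def)
 have h: "Herm ?N (hankel 1 n p M')" "Herm ?N ?a" by (intro Herm_minus hankel_hermitian M')+
 obtain e1 where e1: "e1 > 0" "!!t. 0 < t ==> t <= e1 ==> pdm ?N (hankel 1 n p M - cx t .* hankel 1 n p M')"
  using pos_def_perturb[OF P(1) h(1)] by blast
 obtain e2 where e2: "e2 > 0" "!!t. 0 < t ==> t <= e2 ==> pdm ?N (hankel 0 n p M - hankel 1 n p M - cx t .* ?a)"
  using pos_def_perturb[OF P(2) h(2)] by blast
 define e where "e = min (1/2) (min e1 e2)"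
 have e: "0 < e" "e < 1" "e <= e1" "e <= e2" using e1(1) e2(1) by (auto simp: e_def)
 define c where "c = 1 / (1 - e)"
 have c: "c > 0" using e by (simp add: c_def)
 have M'c: "M' j : Mat p p" for j using HermD(1)[OF M'] .
 have "hank_pos n p (%j. cx c .* (M j - cx e .* M' j))" unfolding hank_pos_def hankel_lincomb[OF M M'c]
 proof
  show "pdm ?N (cx c .* (hankel 1 n p M - cx e .* hankel 1 n p M'))" by (intro pos_def_smult e1 c e)
  have "pdm ?N (cx c .* (hankel 0 n p M - hankel 1 n p M - cx e .* ?a))" by (intro pos_def_smult e2 c e)
  also have "cx c .* (hankel 0 n p M - hankel 1 n p M - cx e .* ?a)
   = cx c .* (hankel 0 n p M - cx e .* hankel 0 n p M')
    - cx c .* (hankel 1 n p M - cx e .* hankel 1 n p M')" by (intro eq_matI) (simp_all add: algebra_simps)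
  finally show "pdm ?N (cx c .* (hankel 0 n p M - cx e .* hankel 0 n p M')
    - cx c .* (hankel 1 n p M - cx e .* hankel 1 n p M'))" .
 qed
 thus ?thesis using e unfolding c_def by blast
qed

text \<open>The matrix in question is the Gram matrix of the polynomial \<open>x - M 1\<close>,
  obtained by compressing the Hankel matrix with the coefficient row \<open>D\<close>.\<close>

lemma hank_pos_two: assumes H: "hank_pos (n + 1) p M" and n: "n >= 1" and M: "!!j. M j : Mat p p" "M 0 = 1m p" and h: "(M 1)^H = M 1"
 shows "pdm p (M 2 - M 1 * M 1)"
proof -
 define N G where "N = (n + 1) * p" and "G = hankel 0 (n + 1) p M"
 have eq: "hankel 0 (n + 1) p M - hankel 1 (n + 1) p M + hankel 1 (n + 1) p M = G" by (simp add: G_def)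
 have "pdm N (hankel 0 (n + 1) p M - hankel 1 (n + 1) p M + hankel 1 (n + 1) p M)" using H unfolding hank_pos_def N_def by (intro pos_def_add) blast+
 hence G: "pdm N G" unfolding eq .
 define J where "J = jcol N p"
 have Jd[simp]: "nr (J j) = N" "nc (J j) = p" for j by (simp_all add: J_def)
 have [simp]: "nr (M j) = p" "nc (M j) = p" for j using M(1)[of j] by auto
 note [simp] = pd_dims(2-4)[OF G]
 have JJ: "(J i)^H * G * J j = M (i + j)" if "i < n + 1" "j < n + 1" for i j
  unfolding J_def N_def G_def using jcol_hankel_jcol[OF that, of M 0] M by simp
 define D where "D = (J 1)^H - M 1 * (J 0)^H"
 have [simp]: "nr D = p" "nc D = N" by (simp_all add: D_def)
 have Da: "D^H = J 1 - J 0 * M 1" by (simp add: D_def h del: One_nat_def)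
 have "pdm p (D * G * D^H)"
 proof (rule pos_def_congr[OF G])
  fix v :: "complex vec" assume v: "v : Vec p" "D^H *v v = 0\<^sub>v N"
  have JJ1: "(J 1)^H * D^H = 1m p"
  proof -
   have a: "(J 1)^H * J 1 = 1m p" and b: "(J 1)^H * J 0 = 0m p p"
    unfolding J_def N_def using jcol_jcol[of 1 "n + 1" 1 p] jcol_jcol[of 1 "n + 1" 0 p] n by auto
   show ?thesis unfolding Da by (simp add: m_distrib a m_cancel[OF b] del: One_nat_def)
  qed
  show "v = 0\<^sub>v p" by (rule mult_vec_inj[OF JJ1 _ _ v]) simp_all
 qed simp
 also have "D * G * D^H = M 2 - M 1 * M 1"
 proof -
  have J': "(J i)^H * (G * J j) = M (i + j)" if "i < n + 1" "j < n + 1" for i j using JJ[OF that] by (simp add: m_assoc)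
  have J'': "(J i)^H * (G * (J j * M 1)) = M (i + j) * M 1" if "i < n + 1" "j < n + 1" for i j unfolding J'[OF that, symmetric] by (simp add: m_assoc)
  show ?thesis unfolding Da using n M(2) by (simp add: D_def m_distrib m_assoc J' J'' one_add_one[symmetric] del: One_nat_def one_add_one)
 qed
 finally show ?thesis .
qed

declare One_nat_def [simp del]

section \<open>Peeling off the first two moments\<close>

text \<open>The second canonical moment, the bounds for \<open>M 2\<close> being
  \<open>M 1 * M 1\<close> and \<open>M 1\<close>. For the block parametrization it returns
  \<open>W\<close>.\<close>

definition wmat :: "nat => (nat => cmat) => cmat" where
 "wmat p M = (let S = isqrt p (M 1 * (1m p - M 1)) in S * (M 2 - M 1 * M 1) * S)"

definition dinv :: "nat => cmat => cmat => cmat" where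
 "dinv p A W = isqrt p (1m p - W) * isqrt p W * isqrt p (A * (1m p - A))"

text \<open>The moments left after peeling, as the solution of a triangular system: by
  \<open>phi_diff\<close> the unknown \<open>m j\<close> enters \<open>M (j + 2)\<close> affinely
  with factor \<open>dmat\<close>, so it is recovered by inserting zero for it, subtracting, and
  conjugating with the inverse \<open>dinv\<close>. The guard \<open>i < j\<close> inside the
  abstraction makes the recursion well founded.\<close>

function mtil :: "nat => (nat => cmat) => nat => cmat" where
 "mtil p M j = (if j = 0 then 1m p
   else dinv p (M 1) (wmat p M) * (M (j + 2) - Phi p (M 1) (wmat p M) (%i. if i < j then mtil p M i else 0m p p) (j + 2))
    * (dinv p (M 1) (wmat p M))^H)" by pat_completeness auto
termination by (relation "inv_image less_than (%(p, M, j). j)") auto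

declare mtil.simps [simp del]

lemma dinv_props: assumes A: "in01 p A" and W: "in01 p W"
 shows "nr (dinv p A W) = p" "nc (dinv p A W) = p" "nr (dmat p A W) = p" "nc (dmat p A W) = p"
  "dinv p A W * dmat p A W = 1m p" "dmat p A W * dinv p A W = 1m p"
proof -
 note R = range_pd[OF A]
 note [simp] = pd_dims(2-4)[OF isqrt_pd[OF cj1[OF W]]] pd_dims(2-4)[OF isqrt_pd[OF cj2[OF W]]]
  pd_dims(2-4)[OF isqrt_pd[OF R]] pd_dims(2-4)[OF sqrt_pd[OF cj1[OF W]]]
  pd_dims(2-4)[OF sqrt_pd[OF cj2[OF W]]] pd_dims(2-4)[OF rsq_pd[OF A]]
 show 1: "nr (dinv p A W) = p" "nc (dinv p A W) = p" "nr (dmat p A W) = p" "nc (dmat p A W) = p" by (simp_all add: dinv_def dmat_def)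
 show 2: "dinv p A W * dmat p A W = 1m p" unfolding dinv_def dmat_def by (simp add: m_assoc m_cancel[OF rsq_isqrt(2)[OF A]]
    m_cancel[OF isqrt_sqrt[OF cj1[OF W]]] isqrt_sqrt[OF cj2[OF W]])
 show "dmat p A W * dinv p A W = 1m p" using mm_lr_inv[OF _ _ 2] 1 by simp
qed

lemma mtil_dim: assumes "in01 p (M 1)" "in01 p (wmat p M)" shows "mtil p M j : Mat p p" using dinv_props[OF assms] by (subst mtil.simps) simp

text \<open>Comparing \<open>m\<close> with its truncation below \<open>j\<close> by means of
  \<open>phi_diff\<close> isolates the contribution of \<open>m j\<close>, which \<open>dinv\<close>
  then inverts.\<close>

lemma mtil_unique: assumes A: "in01 p (M 1)" and W: "in01 p (wmat p M)" and m: "!!i. m i : Mat p p" "m 0 = 1m p"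
  and M: "!!i. i <= k ==> 1 <= i ==> M (i + 2) = Phi p (M 1) (wmat p M) m (i + 2)" shows "j <= k ==> mtil p M j = m j"
proof (induction j rule: less_induct)
 case (less j)
 show ?case
 proof (cases "j = 0")
  case True
  thus ?thesis by (subst mtil.simps) (simp add: m)
 next
  case False
  note D = dinv_props[OF A W]
  note [simp] = D m(1)[unfolded carrier_iff, THEN cj1] m(1)[unfolded carrier_iff, THEN cj2]
  define m' where "m' i = (if i < j then m i else 0m p p)" for i
  have m'[simp]: "nr (m' i) = p" "nc (m' i) = p" for i by (auto simp: m'_def)
  have e: "(%i. if i < j then mtil p M i else 0m p p) = m'" using less by (auto simp: m'_def)
  have P: "Phi p (M 1) (wmat p M) m (j + 2) = Phi p (M 1) (wmat p M) m' (j + 2)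
    + dmat p (M 1) (wmat p M) * (m j - m' j) * (dmat p (M 1) (wmat p M))^H"
   by (rule phi_diff(2)[OF A W]) (use False m in \<open>auto simp: m'_def\<close>)
  have m'j: "m j - m' j = m j" by (simp add: m'_def)
  note [simp] = phi_dim[OF A W, of m'] phi_dim[OF A W, of m]
  have "M (j + 2) - Phi p (M 1) (wmat p M) m' (j + 2) = dmat p (M 1) (wmat p M) * m j * (dmat p (M 1) (wmat p M))^H"
   using M[of j] less.prems False unfolding P m'j by simp
  hence "mtil p M j = dinv p (M 1) (wmat p M) * (dmat p (M 1) (wmat p M) * m j * (dmat p (M 1) (wmat p M))^H)
    * (dinv p (M 1) (wmat p M))^H" using False by (subst mtil.simps) (simp only: e if_False)
  also have "... = m j * (dinv p (M 1) (wmat p M) * dmat p (M 1) (wmat p M))^H" by (simp add: m_assoc m_cancel[OF D(5)] del: D(5))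
  finally show ?thesis unfolding D(5) by simp
 qed
qed

lemma phi_012: assumes A: "in01 p A" and W: "in01 p W" and m: "m 0 = 1m p" "!!i. m i : Mat p p" shows "Phi p A W m 0 = 1m p" "Phi p A W m 1 = A"
  "Phi p A W m 2 = A * A + rsq p A * W * rsq p A"
proof -
 note [simp] = pd_dims(2-4)[OF sqrt_pd[OF cj1[OF W]]] pd_dims(2-4)[OF cj1[OF A]]
  pd_dims(2-4)[OF sqrt_pd[OF cj2[OF W]]] pd_dims(2-4)[OF rsq_pd[OF A]]
  pd_dims(2-4)[OF cj1[OF W]]
 have [simp]: "nr (m i) = p" "nc (m i) = p" for i using m(2)[of i] by auto
 show "Phi p A W m 0 = 1m p" by simp
 show "Phi p A W m 1 = A" by (simp add: phi.simps Let_def One_nat_def)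
 show "Phi p A W m 2 = A * A + rsq p A * W * rsq p A" unfolding numeral_2_eq_2 by (simp add: phi.simps Let_def m(1) m_assoc One_nat_def
    m_cancel[OF sqrt_mult_self[OF cj1[OF W]]])
qed

text \<open>The converse direction: \<open>mtil\<close> does solve the system. Orders up to two are
  the definitions of the first moment and of \<open>wmat\<close>; from order three on the solving
  step is undone.\<close>

lemma Phi_mtil: assumes A: "in01 p (M 1)" and W: "in01 p (wmat p M)" and M: "!!i. M i : Mat p p" "M 0 = 1m p"
 shows "Phi p (M 1) (wmat p M) (mtil p M) j = M j"
proof -
 note D = dinv_props[OF A W]
 have m0: "mtil p M 0 = 1m p" by (subst mtil.simps) simp
 note md = mtil_dim[of p M, OF A W]
 have [simp]: "nr (M i) = p" "nc (M i) = p" for i using M(1)[of i] by auto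
 consider "j = 0" | "j = 1" | "j = 2" | "j >= 3" by linarith
 thus ?thesis
 proof cases
  case 3
  note R = range_pd[OF A]
  note [simp] = pd_dims(2-4)[OF isqrt_pd[OF R]] pd_dims(2-4)[OF rsq_pd[OF A]]
  have "rsq p (M 1) * wmat p M * rsq p (M 1) = M 2 - M 1 * M 1" by (simp add: wmat_def Let_def m_assoc m_cancel[OF rsq_isqrt(1)[OF A]]
     rsq_isqrt(2)[OF A] del: One_nat_def)
  thus ?thesis using phi_012(3)[where m = "mtil p M", OF A W m0 md] 3 by (simp del: One_nat_def)
 next
  case 4
  define i where "i = j - 2"
  have 4: "j = i + 2" "i >= 1" using 4 by (auto simp: i_def)
  define m' where "m' l = (if l < i then mtil p M l else 0m p p)" for l
  have [simp]: "nr (mtil p M l) = p" "nc (mtil p M l) = p" for l using md[of l] by auto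
  have m'd: "m' l : Mat p p" for l by (auto simp: m'_def)
  note [simp] = D(1-4) phi_dim[OF A W m'd]
  have P: "Phi p (M 1) (wmat p M) (mtil p M) (i + 2) = Phi p (M 1) (wmat p M) m' (i + 2)
    + dmat p (M 1) (wmat p M) * (mtil p M i - m' i) * (dmat p (M 1) (wmat p M))^H"
   by (rule phi_diff(2)[OF A W]) (use 4 md m0 m'd in \<open>auto simp: m'_def\<close>)
  have m'j: "mtil p M i - m' i = mtil p M i" by (simp add: m'_def)
  have "mtil p M i = dinv p (M 1) (wmat p M) * (M (i + 2) - Phi p (M 1) (wmat p M) m' (i + 2)) * (dinv p (M 1) (wmat p M))^H"
  proof -
   have e: "(%l. if l < i then mtil p M l else 0m p p) = m'" by (auto simp: m'_def)
   show ?thesis using 4 by (subst mtil.simps) (simp add: e)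
  qed
  hence "dmat p (M 1) (wmat p M) * mtil p M i * (dmat p (M 1) (wmat p M))^H
   = (M (i + 2) - Phi p (M 1) (wmat p M) m' (i + 2)) * (dmat p (M 1) (wmat p M) * dinv p (M 1) (wmat p M))^H"
   by (simp add: m_assoc m_cancel[OF D(6)] del: One_nat_def)
  also have "... = M (i + 2) - Phi p (M 1) (wmat p M) m' (i + 2)" unfolding D(6) by simp
  finally show ?thesis unfolding 4 P m'j by simp
 qed (use phi_012[where m = "mtil p M", OF A W m0 md] M in simp_all)
qed

lemma phi_cong: assumes A: "in01 p A" and W: "in01 p W" and m: "!!i. m i : Mat p p" "!!i. m' i : Mat p p" "m 0 = 1m p"
   "!!i. i + 2 <= j | i = 0 ==> m i = m' i" shows "Phi p A W m j = Phi p A W m' j"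
proof (rule phi_diff(1)[OF A W, of "max 1 (j - 1)"])
 fix i assume "i < max 1 (j - 1)"
 thus "m i = m' i" by (intro m(4)) auto
qed (use m in auto)

text \<open>Once \<open>u\<close> is orthogonal to the earlier \<open>V * Y^k\<close>, the block
  sees only \<open>V * Y^j * u\<close>, through an invertible factor. On vectors killed by
  \<open>V\<close> the matrix \<open>B\<close> acts as the identity; it contributes only once,
  through \<open>V * B = t * V\<close> with \<open>t\<close> the root of \<open>1 - W\<close>. This
  is the mechanism by which cyclicity passes between \<open>X\<close> and \<open>Y\<close>.\<close>

lemma lower_block_annihilate: assumes A: "in01 p A" and W: "in01 p W" and V: "coiso p q V" and Y: "Herm q Y"
 defines "X == blk p A (sqrt_mat p W * V) (lowb p q A W V Y)" assumes u: "u : Mat q 1" "ALL k<j. V * mpow q Y k * u = 0m p 1"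
 shows "(block p 0 q p (mpow (p + q) X (Suc j)))^H * u =
  rsq p A * sqrt_mat p W * (if j = 0 then 1m p else sqrt_mat p (1m p - W)) * (V * mpow q Y j * u)"
proof -
 define t r w where "t = sqrt_mat p (1m p - W)" and "r = rsq p A" and "w = sqrt_mat p W"
 define d where "d = 1m p - t"
 note b = sqrt_pd[OF cj2[OF W], folded t_def] and o = sqrt_pd[OF cj1[OF W], folded w_def]
 note rr = rsq_pd[OF A, folded r_def]
 note [simp] = pd_dims(2-4)[OF b] pd_dims(2-4)[OF o] pd_dims(2-4)[OF rr] pd_dims(2-4)[OF cj1[OF A]]
   coisoD(2-4)[OF V] HermD(2-4)[OF Y]
 have [simp]: "nr d = p" "nc d = p" "d^H = d" by (auto simp: d_def)
 define B F where "B = bmat p q W V" and "F = lowb p q A W V Y"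
 have B: "B = 1m q - V^H * d * V" by (simp add: B_def bmat_def d_def t_def)
 have F: "F = V^H * (w * (1m p - A) * w) * V + B * Y * B" by (simp add: F_def lowb_def B_def w_def[symmetric] m_assoc)
 have Bd[simp]: "nr B = q" "nc B = q" "B^H = B" by (simp_all add: B m_assoc)
 have Fd[simp]: "nr F = q" "nc F = q" "F^H = F" by (simp_all add: F m_assoc)
 have X: "X = fbm A (r * (w * V)) ((w * V)^H * r) F" unfolding X_def blk_def r_def w_def F_def ..
 have [simp]: "nr X = p + q" "nc X = p + q" by (auto simp: X)
 define U L where "U j = block 0 0 p p (mpow (p + q) X j)" and "L j = block p 0 q p (mpow (p + q) X j)" for j
 have [simp]: "nr (U j) = p" "nc (U j) = p" "nr (L j) = q" "nc (L j) = p" for j by (auto simp: U_def L_def)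
 have c: "A : Mat p p" "r * (w * V) : Mat p q" "(w * V)^H * r : Mat q p"
  "F : Mat q q" "!!j. mpow (p + q) X j : Mat (p + q) (p + q)" by simp_all
 have L: "L (Suc j) = (w * V)^H * r * U j + F * L j" for j
 proof -
  have XX: "X * M = fbm A (r * (w * V)) ((w * V)^H * r) F * M" for M by (simp only: X[symmetric])
  show ?thesis unfolding U_def L_def mpow.simps XX block_mult[OF c] by (rule refl)
 qed
 have U0: "U 0 = 1m p" and L0: "L 0 = 0m q p" by (auto simp: U_def L_def block_def intro!: eq_matI)
 have BV: "V * B = t * V" by (simp add: B m_distrib m_assoc m_cancel[OF coisoD(4)[OF V]])
    (simp add: d_def m_distrib, intro eq_matI, simp_all del: index_mm(1))
 have main: "(L (Suc j))^H * u = r * w * (if j = 0 then 1m p else t) * (V * mpow q Y j * u)"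
  if "u : Mat q 1" "ALL k<j. V * mpow q Y k * u = 0m p 1" for u using that
 proof (induction j arbitrary: u)
  case 0
  have [simp]: "nr u = q" using 0 by auto
  show ?case by (simp add: L U0 L0 m_assoc)
 next
  case (Suc j)
  have [simp]: "nr u = q" "nc u = 1" using Suc.prems by auto
  have Vu: "V * u = 0m p 1" using Suc.prems(2)[rule_format, of 0] by simp
  have Bu: "B * u = u" by (simp add: B m_distrib m_assoc Vu)
  have Lu: "(L (Suc (Suc j)))^H * u = (L (Suc j))^H * (B * (Y * u))" unfolding L[of "Suc j"] by (simp add: F m_distrib m_assoc Vu Bu)
  have sh: "V * mpow q Y k * (Y * u) = V * mpow q Y (Suc k) * u" for k
  proof -
   have c: "mpow q Y (Suc k) = mpow q Y k * Y" using mpow_adjoint(2)[of Y q k] by simp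
   show ?thesis unfolding c by (simp add: m_assoc del: mpow.simps)
  qed
  show ?case
  proof (cases "j = 0")
   case True
   have "(L (Suc 0))^H * (B * (Y * u)) = r * w * (V * B * (Y * u))" by (simp add: L U0 L0 m_assoc)
   thus ?thesis unfolding Lu unfolding True BV by (simp add: m_assoc)
  next
   case False
   have "V * mpow q Y 1 * u = 0m p 1" by (rule Suc.prems(2)[rule_format]) (use False in simp)
   moreover have "mpow q Y 1 = Y" by (simp add: One_nat_def)
   ultimately have VYu: "V * (Y * u) = 0m p 1" by (simp add: m_assoc)
   have BYu: "B * (Y * u) = Y * u" by (simp add: B m_distrib m_assoc VYu)
   have "(L (Suc j))^H * (Y * u) = r * w * (if j = 0 then 1m p else t) * (V * mpow q Y j * (Y * u))"
   proof (rule Suc.IH)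
    show "ALL k<j. V * mpow q Y k * (Y * u) = 0m p 1"
    proof (intro allI impI)
     fix k assume "k < j"
     hence "Suc k < Suc j" by simp
     thus "V * mpow q Y k * (Y * u) = 0m p 1" unfolding sh using Suc.prems(2) by blast
    qed
   qed simp
   thus ?thesis unfolding Lu BYu sh using False by simp
  qed
 qed
 show ?thesis using main[OF u] unfolding L_def r_def w_def t_def .
qed

declare One_nat_def [simp]

text \<open>These identities exhibit \<open>Y\<close> and \<open>1 - Y\<close> as the normalized
  distances of the lower right block from the two ends of its interval. The determinant of the
  scaling is reduced from size \<open>q\<close> to size \<open>p\<close> by
  \<open>sylvester_det\<close>.\<close>

lemma step_identities: assumes A: "in01 p A" and W: "in01 p W" and V: "coiso p q V" and Y: "Herm q Y"
 defines "Z == sqrt_mat p W * V" and "B == bmat p q W V" and "F == lowb p q A W V Y"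
 shows "F - Z^H * (1m p - A) * Z = B * Y * B^H" "1m q - F - Z^H * A * Z = B * (1m q - Y) * B^H"
  "Z^H * Z = V^H * W * V" "Z * Z^H = W"
  "det B * det (B^H) = det (1m p - W)" "EX C:Mat q q. B * C = 1m q"
  "Z : Mat p q" "B : Mat q q" "Herm q F"
proof -
 note o = sqrt_pd[OF cj1[OF W]]
 note b = bmat_props[OF W V, folded B_def]
 note [simp] = pd_dims(2-4)[OF o] pd_dims(2-4)[OF cj1[OF A]] pd_dims(2-4)[OF cj1[OF W]]
   coisoD(2-4)[OF V] HermD(2-4)[OF Y] HermD(2-4)[OF b(1)]
 have Zd[simp]: "nr Z = p" "nc Z = q" by (simp_all add: Z_def)
 thus "Z : Mat p q" by simp
 show "B : Mat q q" by simp
 show "EX C:Mat q q. B * C = 1m q" by (rule b(3))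
 show ZZ: "Z^H * Z = V^H * W * V" by (simp add: Z_def m_assoc m_cancel[OF sqrt_mult_self[OF cj1[OF W]]])
 show ZZ': "Z * Z^H = W" by (simp add: Z_def m_assoc m_cancel[OF coisoD(4)[OF V]] sqrt_mult_self[OF cj1[OF W]])
 have F: "F = Z^H * (1m p - A) * Z + B * Y * B" by (simp add: F_def lowb_def Z_def B_def)
 show "Herm q F" unfolding F by (rule HermI) (simp_all add: m_assoc)
 show "F - Z^H * (1m p - A) * Z = B * Y * B^H" unfolding F by simp
 have "1m q - F - Z^H * A * Z = 1m q - Z^H * Z - B * Y * B" unfolding F by (simp add: m_distrib) (intro eq_matI, simp_all del: index_mm(1))
 also have "1m q - Z^H * Z = B * B" unfolding ZZ b(2) ..
 also have "B * B - B * Y * B = B * (1m q - Y) * B^H" by (simp add: m_distrib m_assoc)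
 finally show "1m q - F - Z^H * A * Z = B * (1m q - Y) * B^H" .
 have "det B * det (B^H) = det (B * B)" using det_mult[of B q B] by simp
 also have "... = det (1m q - Z^H * Z)" unfolding b(2) ZZ ..
 also have "... = det (1m p - Z * Z^H)" by (rule sylvester_det) simp
 finally show "det B * det (B^H) = det (1m p - W)" unfolding ZZ' .
qed

lemma blk_step_in01: assumes A: "in01 p A" and W: "in01 p W" and V: "coiso p q V" and Y: "Herm q Y"
 defines "X == blk p A (sqrt_mat p W * V) (lowb p q A W V Y)" shows "in01 (p + q) X <-> in01 q Y" "Herm (p + q) X"
proof -
 let ?a = "sqrt_mat p W * V"
 note S = step_identities[OF A W V Y]
 obtain C where C: "C : Mat q q" "bmat p q W V * C = 1m q" using S(6) by blast
 note [simp] = HermD(2-4)[OF Y] pd_dims(2-4)[OF rsq_pd[OF A]]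
 have d: "Y : Mat q q" "1m q - Y : Mat q q" by simp_all
 have F: "lowb p q A W V Y : Mat q q" using HermD(1)[OF S(9)] .
 show "in01 (p + q) X <-> in01 q Y" unfolding X_def blk_pos_def(1)[OF A S(7) F] blk_compl(1)[OF A S(7) F] S(1,2)
   pd_congr_iff[OF d(1) S(8) C] pd_congr_iff[OF d(2) S(8) C] ..
 have z: "nr ?a = p" "nc ?a = q" using S(7) by auto
 have "(rsq p A * ?a)^H = ?a^H * rsq p A" by (subst adjoint_mult) (use z in simp_all)
 thus "Herm (p + q) X" using hermitian_four_block[OF pd_herm[OF cj1[OF A]] _ S(9), of "rsq p A * ?a"] z unfolding X_def blk_def by simp
qed

text \<open>The parameters are read off in turn: \<open>Z\<close> from the cross block,
  \<open>W = Z * Z^H\<close>, \<open>V\<close> as the polar part of \<open>Z\<close>, and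
  \<open>Y\<close> by undoing the affine map. The hypothesis on \<open>X * X\<close> says that the
  cross block has full row rank, which is what makes \<open>W\<close> positive definite.\<close>

lemma blk_exists: assumes X: "in01 (p + q) X" and A: "A = block 0 0 p p X" and P: "pdm p (block 0 0 p p (X * X) - A * A)"
 shows "EX W V Y. in01 p A & in01 p W & coiso p q V & Herm q Y &
  X = blk p A (sqrt_mat p W * V) (lowb p q A W V Y)"
proof -
 note Xh = pd_herm[OF cj1[OF X]]
 note [simp] = HermD(2-4)[OF Xh]
 have "block 0 0 p p (1m (p + q) - X) = 1m p - A" unfolding A by (rule eq_matI) (simp_all add: block_def)
 hence A01: "in01 p A" using pos_def_upper_left[OF cj1[OF X]] pos_def_upper_left[OF cj2[OF X]] A by simp
 define C F where "C = block 0 p p q X" and "F = block p p q q X"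
 note hb = hermitian_blocks[OF Xh]
 have [simp]: "nr C = p" "nc C = q" "nr F = q" "nc F = q" "F^H = F" using HermD[OF hb(2)] by (simp_all add: C_def F_def)
 have X4: "X = fbm A C (C^H) F" using four_block_decomp[of X p q p q] hb(3) unfolding A C_def F_def by simp
 note [simp] = pd_dims(2-4)[OF cj1[OF A01]] pd_dims(2-4)[OF rsq_pd[OF A01]]
 define S where "S = isqrt p (A * (1m p - A))"
 note S = isqrt_pd[OF range_pd[OF A01], folded S_def]
 note rS = rsq_isqrt[OF A01, folded S_def]
 note [simp] = pd_dims(2-4)[OF S]
 define Z where "Z = S * C"
 have [simp]: "nr Z = p" "nc Z = q" by (simp_all add: Z_def)
 have C: "C = rsq p A * Z" by (simp add: Z_def m_cancel[OF rS(1)])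
 have Xb: "X = blk p A Z F" unfolding blk_def X4 unfolding C by simp
 have con: "pdm q (1m q - Z^H * Z)" by (rule blk_imp_contraction[OF A01, of _ _ F]) (use X Xb in simp_all)
 define W where "W = Z * Z^H"
 have "pdm p (1m p - W)" unfolding W_def by (rule contraction_adjoint[OF _ con]) simp
 moreover have "pdm p W"
 proof -
  have "block 0 0 p p (X * X) = A * A + C * C^H"
  proof -
   have "block 0 0 p p (fbm A C (C^H) F * X) = A * block 0 0 p p X + C * block p 0 q p X" by (rule block_mult) simp_all
   thus ?thesis unfolding X4[symmetric] A[symmetric] hb(3) C_def[symmetric] .
  qed
  hence "block 0 0 p p (X * X) - A * A = C * C^H" by simp
  hence "pdm p (S * (C * C^H) * S^H)" using P pd_congr_inv[OF _ _ _ rS(2), of "C * C^H"] by simp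
  thus ?thesis by (simp add: W_def Z_def m_assoc)
 qed
 ultimately have W: "in01 p W" by simp
 define T where "T = isqrt p W"
 note T = isqrt_pd[OF cj1[OF W], folded T_def]
 note [simp] = pd_dims(2-4)[OF T] pd_dims(2-4)[OF sqrt_pd[OF cj1[OF W]]]
 note wT = sqrt_isqrt[OF cj1[OF W], folded T_def]
 define V where "V = T * Z"
 have Z: "Z = sqrt_mat p W * V" by (simp add: V_def m_cancel[OF wT])
 have V: "coiso p q V" using inv_sqrt_cancel[OF cj1[OF W], folded T_def] by (simp add: coiso_def V_def W_def m_assoc)
 define B where "B = bmat p q W V"
 note b = bmat_props[OF W V, folded B_def]
 obtain E where E: "E : Mat q q" "B * E = 1m q" using b(3) by blast
 note EB = inverse_hermitian[OF b(1) E]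
 note [simp] = HermD(2-4)[OF b(1)] EB(2)
 have [simp]: "nr E = q" "nc E = q" using E by auto
 define Y where "Y = E * (F - Z^H * (1m p - A) * Z) * E"
 have Y: "Herm q Y" unfolding Y_def by (rule HermI) (simp_all add: m_assoc)
 have "B * Y * B = F - Z^H * (1m p - A) * Z"
 proof -
  define G where "G = F - Z^H * (1m p - A) * Z"
  have [simp]: "nr G = q" "nc G = q" by (simp_all add: G_def)
  show ?thesis unfolding Y_def G_def[symmetric] by (simp add: m_assoc m_cancel[OF E(2)] EB(1))
 qed
 hence "F = lowb p q A W V Y" unfolding lowb_def Z[symmetric] B_def[symmetric] by simp
 thus ?thesis using A01 W V Y Xb Z by blast
qed

section \<open>The coordinate frame and cyclicity under peeling\<close>

definition ecol :: "nat => nat => cmat" where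
 "ecol p N = mat p N (%(i, j). if i = j then 1 else 0)"

lemma ecol_dim [simp]: "nr (ecol p N) = p" "nc (ecol p N) = N" by (simp_all add: ecol_def)

lemma ecol_mult: assumes "H : Mat N m" "i < p" "j < m" "p <= N" shows "(ecol p N * H) $$ (i, j) = H $$ (i, j)"
proof -
 have "(ecol p N * H) $$ (i, j) = (\<Sum>k<N. if k = i then H $$ (i, j) else 0)"
  using assms by (simp add: sp_def at0L ecol_def if_distrib[of "%x. x * _"] eq_commute cong: if_cong)
 thus ?thesis using assms by simp
qed

lemma mult_ecol_adj: assumes "H : Mat m N" "i < m" "j < p" "p <= N" shows "(H * (ecol p N)^H) $$ (i, j) = H $$ (i, j)"
proof -
 have "(H * (ecol p N)^H) $$ (i, j) = (\<Sum>k<N. if k = j then H $$ (i, j) else 0)"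
  using assms by (simp add: sp_def at0L ecol_def if_distrib[of "%x. _ * x"] if_distrib[of cnj] eq_commute cong: if_cong)
 thus ?thesis using assms by simp
qed

lemma vmom_ecol: "X : Mat N N ==> p <= N ==> vmom N (ecol p N) X j = block 0 0 p p (mpow N X j)" unfolding vmom_def
 by (rule eq_matI) (simp_all add: mult_ecol_adj[of _ N N] ecol_mult[of _ N p] block_def del: index_mm(1))

lemma coisometry_ecol: "p <= N ==> coiso p N (ecol p N)" unfolding coiso_def
 by (intro conjI eq_matI) (simp_all add: mult_ecol_adj[of _ p] del: index_mm(1), simp_all add: ecol_def)

lemma sum_lessThan_add: "(\<Sum>k<p + q. f k) = (\<Sum>k<p. f k) + (\<Sum>k<q. f (p + k :: nat) :: complex)"
 by (induction q) (simp_all add: add.assoc)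

lemma ecol_mult_split: assumes H: "Herm (p + q) H" and u: "u : Mat (p + q) 1"
 shows "ecol p (p + q) * H * u = (block 0 0 p p H)^H * block 0 0 p 1 u + (block p 0 q p H)^H * block p 0 q 1 u"
proof (rule eq_matI)
 note [simp] = HermD(2-4)[OF H]
 have [simp]: "nr u = p + q" "nc u = 1" using u by auto
 fix i j assume "i < nr ((block 0 0 p p H)^H * block 0 0 p 1 u + (block p 0 q p H)^H * block p 0 q 1 u)"
  "j < nc ((block 0 0 p p H)^H * block 0 0 p 1 u + (block p 0 q p H)^H * block p 0 q 1 u)"
 hence ij: "i < p" "j = 0" by auto
 have "(ecol p (p + q) * H * u) $$ (i, j) = (\<Sum>k<p + q. H $$ (i, k) * u $$ (k, 0))"
 proof -
  have "(ecol p (p + q) * H * u) $$ (i, j) = (ecol p (p + q) * (H * u)) $$ (i, j)" by (simp add: m_assoc)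
  also have "... = (H * u) $$ (i, j)" using ij by (subst ecol_mult[of _ "p + q" 1]) simp_all
  finally show ?thesis using ij by (simp add: sp_def at0L)
 qed
 also have "... = ((block 0 0 p p H)^H * block 0 0 p 1 u + (block p 0 q p H)^H * block p 0 q 1 u) $$ (i, j)"
  using ij by (simp add: sum_lessThan_add sp_def at0L block_def hermitian_index[OF H, symmetric])
 finally show "(ecol p (p + q) * H * u) $$ (i, j) = ((block 0 0 p p H)^H * block 0 0 p 1 u + (block p 0 q p H)^H * block p 0 q 1 u) $$ (i, j)" .
qed (use u in simp_all)

lemma hermitian_mpow: "Herm n X ==> Herm n (mpow n X k)" using HermD[of n X] mpow_adjoint(1)[of X n k] by (intro HermI) simp_all

text \<open>The zeroth power forces the upper part of \<open>u\<close> to vanish, and the lower part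
  is controlled by \<open>lower_block_annihilate\<close>. The power \<open>j + 1\<close> of
  \<open>X\<close> corresponds to the power \<open>j\<close> of \<open>Y\<close>, hence
  \<open>n + 1\<close> against \<open>n\<close>.\<close>

lemma blk_cyclic_iff: assumes A: "in01 p A" and W: "in01 p W" and V: "coiso p q V" and Y: "Herm q Y"
 defines "X == blk p A (sqrt_mat p W * V) (lowb p q A W V Y)"
 shows "(ALL u:Mat (p + q) 1. (ALL i<n + 1. ecol p (p + q) * mpow (p + q) X i * u = 0m p 1) --> u = 0m (p + q) 1)
  <-> (ALL u:Mat q 1. (ALL i<n. V * mpow q Y i * u = 0m p 1) --> u = 0m q 1)" (is "?l <-> ?r")
proof -
 define L where "L j = block p 0 q p (mpow (p + q) X j)" for j
 define D where "D j = rsq p A * sqrt_mat p W * (if j = 0 then 1m p else sqrt_mat p (1m p - W))" for j :: nat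
 have ann: "(L (Suc j))^H * u = D j * (V * mpow q Y j * u)" if "u : Mat q 1" "ALL k<j. V * mpow q Y k * u = 0m p 1" for u j
  using lower_block_annihilate[OF A W V Y that] unfolding L_def D_def X_def .
 have Xh: "Herm (p + q) X" unfolding X_def by (rule blk_step_in01(2)[OF A W V Y])
 note [simp] = HermD(2-4)[OF Xh] HermD(2-4)[OF Y] coisoD(2-3)[OF V]
 have [simp]: "nr (L j) = q" "nc (L j) = p" for j by (simp_all add: L_def)
 note [simp] = pd_dims(2-4)[OF rsq_pd[OF A]] pd_dims(2-4)[OF sqrt_pd[OF cj1[OF W]]]
  pd_dims(2-4)[OF sqrt_pd[OF cj2[OF W]]]
 have Dd[simp]: "nr (D j) = p" "nc (D j) = p" for j by (simp_all add: D_def)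
 have Dinj: "x = 0m p 1" if "D j * x = 0m p 1" "nr x = p" "nc x = 1" for j x
 proof -
  define D' where "D' = (if j = 0 then 1m p else isqrt p (1m p - W)) * isqrt p W * isqrt p (A * (1m p - A))"
  note [simp] = pd_dims(2-4)[OF isqrt_pd[OF range_pd[OF A]]]
   pd_dims(2-4)[OF isqrt_pd[OF cj1[OF W]]] pd_dims(2-4)[OF isqrt_pd[OF cj2[OF W]]]
  have "D' * D j = 1m p" unfolding D'_def D_def by (simp add: m_assoc m_cancel[OF rsq_isqrt(2)[OF A]] m_cancel[OF isqrt_sqrt[OF cj1[OF W]]]
     isqrt_sqrt[OF cj1[OF W]] isqrt_sqrt[OF cj2[OF W]])
  moreover have "nr D' = p" "nc D' = p" by (simp_all add: D'_def)
  ultimately have "D' * (D j * x) = 1m p * x" using that by (intro m_cancel) simp_all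
  thus ?thesis unfolding that(1) using that(2,3) \<open>nr D' = p\<close> \<open>nc D' = p\<close> by simp
 qed
 have split: "ecol p (p + q) * mpow (p + q) X i * u
   = (block 0 0 p p (mpow (p + q) X i))^H * block 0 0 p 1 u + (L i)^H * block p 0 q 1 u" if "u : Mat (p + q) 1" for i u
  unfolding L_def by (rule ecol_mult_split[OF hermitian_mpow[OF Xh] that])
 have L0: "L 0 = 0m q p" and U0: "block 0 0 p p (mpow (p + q) X 0) = 1m p" by (auto simp: L_def block_def intro!: eq_matI)
 show ?thesis
 proof
  assume l: ?l
  show ?r
  proof (intro ballI impI)
   fix u2 assume u2: "u2 : Mat q 1" "ALL i<n. V * mpow q Y i * u2 = 0m p 1"
   have [simp]: "nr u2 = q" "nc u2 = 1" using u2(1) by auto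
   define u where "u = mat (p + q) 1 (%(i, j). if i < p then 0 else u2 $$ (i - p, 0))"
   have u: "u : Mat (p + q) 1" by (simp add: u_def)
   have b: "block 0 0 p 1 u = 0m p 1" "block p 0 q 1 u = u2" by (auto simp: u_def block_def intro!: eq_matI)
   have "ecol p (p + q) * mpow (p + q) X i * u = 0m p 1" if "i < n + 1" for i
   proof (cases i)
    case 0
    show ?thesis unfolding split[OF u] b 0 L0 by simp
   next
    case (Suc j)
    have "ALL k<j. V * mpow q Y k * u2 = 0m p 1" using u2(2) that Suc by simp
    from ann[OF u2(1) this] show ?thesis unfolding split[OF u] b Suc using u2(2) that Suc by simp
   qed
   hence "u = 0m (p + q) 1" using l u by blast
   hence "u2 = block p 0 q 1 (0m (p + q) 1)" using b(2) by simp
   thus "u2 = 0m q 1" by (auto simp: block_def intro!: eq_matI)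
  qed
 next
  assume r: ?r
  show ?l
  proof (intro ballI impI)
   fix u assume u: "u : Mat (p + q) 1" "ALL i<n + 1. ecol p (p + q) * mpow (p + q) X i * u = 0m p 1"
   define u1 u2 where "u1 = block 0 0 p 1 u" and "u2 = block p 0 q 1 u"
   have [simp]: "nr u1 = p" "nc u1 = 1" "nr u2 = q" "nc u2 = 1" by (simp_all add: u1_def u2_def)
   have "ecol p (p + q) * mpow (p + q) X 0 * u = 0m p 1" by (rule u(2)[rule_format]) simp
   hence u1: "u1 = 0m p 1" unfolding split[OF u(1)] L0 U0 u1_def[symmetric] u2_def[symmetric] by simp
   have Lu: "(L i)^H * u2 = 0m p 1" if "i < n + 1" for i
   proof -
    have "ecol p (p + q) * mpow (p + q) X i * u = 0m p 1" using u(2) that by blast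
    thus ?thesis unfolding split[OF u(1)] u1_def[symmetric] u2_def[symmetric] u1 by simp
   qed
   have "V * mpow q Y j * u2 = 0m p 1" if "j < n" for j using that
   proof (induction j rule: less_induct)
    case (less j)
    have "ALL k<j. V * mpow q Y k * u2 = 0m p 1" using less by simp
    from ann[OF _ this] have "D j * (V * mpow q Y j * u2) = 0m p 1" using Lu[of "Suc j"] less.prems by simp
    thus ?case by (rule Dinj) simp_all
   qed
   hence u2: "u2 = 0m q 1" using r by simp
   show "u = 0m (p + q) 1"
   proof (rule eq_matI)
    fix i j assume "i < nr (0m (p + q) 1 :: cmat)" "j < nc (0m (p + q) 1 :: cmat)"
    hence ij: "i < p + q" "j = 0" by auto
    show "u $$ (i, j) = 0m (p + q) 1 $$ (i, j)"
    proof (cases "i < p")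
     case True
     have "u1 $$ (i, 0) = 0" unfolding u1 using True by simp
     thus ?thesis using True ij by (simp add: u1_def block_def)
    next
     case False
     have "u2 $$ (i - p, 0) = 0" unfolding u2 using False ij by simp
     thus ?thesis using False ij by (simp add: u2_def block_def)
    qed
   qed (use u in simp_all)
  qed
 qed
qed

text \<open>The proof goes through models. Positivity yields a model of the longer sequence, which
  is cut into \<open>A\<close>, \<open>W\<close>, \<open>V\<close> and \<open>Y\<close>, and
  \<open>(Y, V)\<close> is then a model of the peeled sequence. Conversely a model of the peeled
  sequence is enlarged by the block construction.\<close>

lemma hank_pos_Suc: assumes n: "n >= 1" and M: "!!j. M j : Mat p p" "M 0 = 1m p"
 shows "hank_pos (n + 1) p M <-> in01 p (M 1) & in01 p (wmat p M) & hank_pos n p (mtil p M)"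
proof
 define q where "q = n * p"
 have N: "(n + 1) * p = p + q" by (simp add: q_def)
 assume H: "hank_pos (n + 1) p M"
 then obtain X0 V0 where model: "is_model (n + 1) p M X0 V0" using hank_pos_imp_model[OF H _ M] by auto
 have X0: "in01 (p + q) X0" and V0: "coiso p (p + q) V0" and
  mom0: "!!j. 1 <= j ==> j <= 2 * n + 1 ==> M j = vmom (p + q) V0 X0 j" and
  cyc0: "!!u. u : Mat (p + q) 1 ==> ALL i<n + 1. V0 * mpow (p + q) X0 i * u = 0m p 1 ==> u = 0m (p + q) 1"
  using model unfolding is_model_def N by auto
 note X0h = pd_herm[OF cj1[OF X0]]
 note [simp] = HermD(2-4)[OF X0h] coisoD(2-4)[OF V0]
 \<comment> \<open>A unitary change of basis turns the frame \<open>V0^H\<close> into the first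
   \<open>p\<close> coordinate vectors, so that the moments become upper left blocks of
   powers.\<close>
 obtain U where U: "unitm (p + q) U" "ALL i<p + q. ALL j<p. U $$ (i, j) = V0^H $$ (i, j)" using isometry_extend[of "V0^H" "p + q" p] by auto
 note [simp] = unitD(2-5)[OF U(1)]
 let ?E = "ecol p (p + q)"
 have UE: "U * ?E^H = V0^H" using U(2) by (intro eq_matI) (simp_all add: mult_ecol_adj[of _ "p + q" "p + q"] del: index_mm(1))
 have EU: "?E * U^H = V0"
 proof -
  have "(U * ?E^H)^H = (V0^H)^H" by (simp only: UE)
  thus ?thesis by simp
 qed
 define X where "X = U^H * X0 * (U^H)^H"
 have Xd[simp]: "nr X = p + q" "nc X = p + q" by (simp_all add: X_def)
 have X1: "1m (p + q) - X = U^H * (1m (p + q) - X0) * (U^H)^H" by (simp add: X_def m_distrib)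
 have XX: "in01 (p + q) X" unfolding X1 unfolding X_def
  by (intro conjI pd_congr_inv[OF cj1[OF X0], of _ U] pd_congr_inv[OF cj2[OF X0], of _ U]) simp_all
 note c = m_cancel[OF unitD(3)[OF U(1)]] m_cancel[OF unitD(2)[OF U(1)]]
 have pw: "mpow (p + q) X j = U^H * mpow (p + q) X0 j * U" for j by (induction j) (simp_all add: X_def m_assoc c)
 have vm: "?E * mpow (p + q) X j = V0 * mpow (p + q) X0 j * U" for j unfolding pw EU[symmetric] by (simp add: m_assoc)
 have mom: "block 0 0 p p (mpow (p + q) X j) = M j" if "1 <= j" "j <= 2 * n + 1" for j
 proof -
  have "block 0 0 p p (mpow (p + q) X j) = ?E * mpow (p + q) X j * ?E^H" using vmom_ecol[of X "p + q" p j] by (simp add: vmom_def)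
  also have "... = V0 * mpow (p + q) X0 j * (U * ?E^H)" unfolding vm by (simp add: m_assoc)
  finally show ?thesis unfolding UE mom0[OF that] vmom_def .
 qed
 have cyc: "u = 0m (p + q) 1" if u: "u : Mat (p + q) 1" "ALL i<n + 1. ?E * mpow (p + q) X i * u = 0m p 1" for u
 proof -
  have [simp]: "nr u = p + q" "nc u = 1" using u by auto
  have "U * u = 0m (p + q) 1"
  proof (rule cyc0, goal_cases)
   case 2
   show ?case
   proof (intro allI impI)
    fix i assume "i < n + 1"
    hence "?E * mpow (p + q) X i * u = 0m p 1" using u(2) by blast
    thus "V0 * mpow (p + q) X0 i * (U * u) = 0m p 1" unfolding vm by (simp add: m_assoc)
   qed
  qed simp
  hence "U^H * (U * u) = 0m (p + q) 1" by simp
  thus ?thesis by (simp add: c)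
 qed
 have M1: "block 0 0 p p X = M 1" using mom[of 1] by simp
 have M2: "block 0 0 p p (X * X) = M 2" using mom[of 2] n by (simp add: numeral_2_eq_2)
 have M1h: "(M 1)^H = M 1" using hermitian_blocks(1)[OF pd_herm[OF cj1[OF XX]]] unfolding M1 by (rule HermD(2))
 have "pdm p (block 0 0 p p (X * X) - M 1 * M 1)" unfolding M2 by (rule hank_pos_two[OF H n M M1h])
 from blk_exists[OF XX M1[symmetric] this] obtain W V Y where
  A: "in01 p (M 1)" and W: "in01 p W" and V: "coiso p q V" and Y: "Herm q Y" and
  Xb: "X = blk p (M 1) (sqrt_mat p W * V) (lowb p q (M 1) W V Y)" by blast
 note [simp] = HermD(2-4)[OF Y] coisoD(2-4)[OF V]
 have md: "vmom q V Y i : Mat p p" for i by (simp add: vmom_def)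
 have m0: "vmom q V Y 0 = 1m p" by (simp add: vmom_def)
 have Mphi: "M j = Phi p (M 1) W (vmom q V Y) j" if "1 <= j" "j <= 2 * n + 1" for j
  unfolding phi_blk(1)[OF A W V HermD(1)[OF Y]] Xb[symmetric] using mom[OF that] by simp
 have Wm: "wmat p M = W"
 proof -
  note [simp] = pd_dims(2-4)[OF rsq_pd[OF A]] pd_dims(2-4)[OF isqrt_pd[OF range_pd[OF A]]]
   pd_dims(2-4)[OF cj1[OF A]] pd_dims(2-4)[OF cj1[OF W]]
  have "M 2 = M 1 * M 1 + rsq p (M 1) * W * rsq p (M 1)" using Mphi[of 2] phi_012(3)[where m = "vmom q V Y", OF A W m0 md] n by simp
  hence eq: "M 2 - M 1 * M 1 = rsq p (M 1) * W * rsq p (M 1)" by (simp del: One_nat_def)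
  show ?thesis unfolding wmat_def Let_def eq by (simp add: m_assoc m_cancel[OF rsq_isqrt(2)[OF A]] rsq_isqrt(1)[OF A] del: One_nat_def)
 qed
 have W': "in01 p (wmat p M)" using W Wm by simp
 have mt: "mtil p M j = vmom q V Y j" if "j <= 2 * n - 1" for j
  by (rule mtil_unique[where m = "vmom q V Y", OF A W' md m0 _ that]) (use n in \<open>unfold Wm, intro Mphi, auto\<close>)
 have "is_model n p (mtil p M) Y V" unfolding is_model_def q_def[symmetric]
 proof (intro conjI)
  show "pdm q Y" "pdm q (1m q - Y)" using blk_step_in01(1)[OF A W V Y] XX unfolding Xb by blast+
  show "ALL u:Mat q 1. (ALL i<n. V * mpow q Y i * u = 0m p 1) --> u = 0m q 1" using blk_cyclic_iff[OF A W V Y, of n] cyc unfolding Xb by blast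
 qed (use V mt in auto)
 from model_imp_hank_pos[OF this n] have "hank_pos n p (mtil p M)" by (simp add: mtil.simps[of p M 0])
 thus "in01 p (M 1) & in01 p (wmat p M) & hank_pos n p (mtil p M)" using A W' by blast
next
 define q where "q = n * p"
 have N: "(n + 1) * p = p + q" by (simp add: q_def)
 assume H: "in01 p (M 1) & in01 p (wmat p M) & hank_pos n p (mtil p M)"
 hence A: "in01 p (M 1)" and W: "in01 p (wmat p M)" and Hm: "hank_pos n p (mtil p M)" by blast+
 note md = mtil_dim[of p M, OF A W]
 have m0: "mtil p M 0 = 1m p" by (subst mtil.simps) simp
 obtain Y V where model: "is_model n p (mtil p M) Y V" using hank_pos_imp_model[OF Hm n md m0] by blast
 have Y: "in01 q Y" and V: "coiso p q V" and
  mom: "!!j. 1 <= j ==> j <= 2 * n - 1 ==> mtil p M j = vmom q V Y j" and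
  cyc: "ALL u:Mat q 1. (ALL i<n. V * mpow q Y i * u = 0m p 1) --> u = 0m q 1" using model unfolding is_model_def q_def[symmetric] by auto
 note Yh = pd_herm[OF cj1[OF Y]]
 note [simp] = HermD(2-4)[OF Yh] coisoD(2-4)[OF V]
 define X where "X = blk p (M 1) (sqrt_mat p (wmat p M) * V) (lowb p q (M 1) (wmat p M) V Y)"
 have Xc: "X : Mat (p + q) (p + q)" unfolding X_def using HermD(1)[OF blk_step_in01(2)[OF A W V Yh]] .
 have vd: "vmom q V Y i : Mat p p" for i by (simp add: vmom_def)
 have mom0: "mtil p M j = vmom q V Y j" if "j <= 2 * n - 1" for j using mom[of j] that m0 by (cases "j = 0") (simp_all add: vmom_def)
 have "is_model (n + 1) p M X (ecol p (p + q))" unfolding is_model_def N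
 proof (intro conjI allI impI)
  show "pdm (p + q) X" "pdm (p + q) (1m (p + q) - X)" using blk_step_in01(1)[OF A W V Yh] Y unfolding X_def by blast+
  show "coiso p (p + q) (ecol p (p + q))" by (rule coisometry_ecol) simp
  show "ALL u:Mat (p + q) 1. (ALL i<n + 1. ecol p (p + q) * mpow (p + q) X i * u = 0m p 1) --> u = 0m (p + q) 1"
   using blk_cyclic_iff[OF A W V Yh, of n] cyc unfolding X_def by blast
  fix j assume j: "1 <= j" "j <= 2 * (n + 1) - 1"
  have "M j = Phi p (M 1) (wmat p M) (mtil p M) j" by (rule Phi_mtil[OF A W M, symmetric])
  also have "... = Phi p (M 1) (wmat p M) (vmom q V Y) j"
   by (rule phi_cong[where m = "mtil p M" and m' = "vmom q V Y", OF A W md vd m0]) (use j n in \<open>intro mom0, auto\<close>)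
  also have "... = vmom (p + q) (ecol p (p + q)) X j" unfolding phi_blk(1)[OF A W V HermD(1)[OF Yh]] X_def[symmetric]
   by (rule vmom_ecol[OF Xc, symmetric]) simp
  finally show "M j = vmom (p + q) (ecol p (p + q)) X j" .
 qed
 thus "hank_pos (n + 1) p M" by (rule model_imp_hank_pos) (use M in auto)
qed

section \<open>Measurability of matrix operations\<close>

text \<open>The carrier \<open>S\<close> is a parameter so that one set of measurability rules
  covers both rectangular and Hermitian matrices.\<close>

definition mbs :: "nat => nat => cmat set => cmat measure" where
 "mbs m n S = sigma S {{A : S. A $$ (i, j) : B} | i j B. i < m & j < n & B : sets borel}"

abbreviation mm :: "nat => nat => cmat measure" where
 "mm m n == mbs m n (Mat m n)"

lemma herm_borel_mbs: "herm_borel m = mbs m m {A. Herm m A}" by (simp add: herm_borel_def mbs_def)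

lemma space_mbs [simp]: "space (mbs m n S) = S" by (simp add: mbs_def space_measure_of_conv)

lemma measurable_entry: assumes "i < m" "j < n" shows "(%A. A $$ (i, j)) : bm (mbs m n S)"
proof (rule measurableI)
 fix B :: "complex set" assume "B : sets borel"
 hence "{A : S. A $$ (i, j) : B} : {{A : S. A $$ (i, j) : B} | i j B. i < m & j < n & B : sets borel}" using assms by blast
 hence "{A : S. A $$ (i, j) : B} : sets (mbs m n S)" unfolding mbs_def by (subst sets_measure_of) auto
 moreover have "(%A. A $$ (i, j)) -` B Int space (mbs m n S) = {A : S. A $$ (i, j) : B}" by auto
 ultimately show "(%A. A $$ (i, j)) -` B Int space (mbs m n S) : sets (mbs m n S)" by simp
qed simp

lemma measurable_mbs_iff:
 "f : meas M (mbs m n S) <-> f : space M \<rightarrow> S & (ALL i<m. ALL j<n. (%w. f w $$ (i, j)) : bm M)"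
proof (intro iffI conjI allI impI)
 assume f: "f : meas M (mbs m n S)"
 thus "f : space M \<rightarrow> S" using measurable_space[OF f] by auto
 show "(%w. f w $$ (i, j)) : bm M" if "i < m" "j < n" for i j by (rule m_comp[OF f measurable_entry[OF that]])
next
 assume f: "f : space M \<rightarrow> S & (ALL i<m. ALL j<n. (%w. f w $$ (i, j)) : bm M)"
 show "f : meas M (mbs m n S)" unfolding mbs_def
 proof (rule measurable_measure_of)
  fix G assume "G : {{A : S. A $$ (i, j) : B} | i j B. i < m & j < n & B : sets borel}"
  then obtain i j B where G: "G = {A : S. A $$ (i, j) : B}" "i < m" "j < n" "B : sets borel" by blast
  have "f -` G Int space M = (%w. f w $$ (i, j)) -` B Int space M" using f G(1) by auto
  moreover have "(%w. f w $$ (i, j)) : bm M" using f G(2,3) by blast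
  ultimately show "f -` G Int space M : sets M" using measurable_sets G(4) by metis
 qed (use f in auto)
qed

lemma mbsI: "(!!w. w : space M ==> f w : S) ==> (!!i j. i < m ==> j < n ==> (%w. f w $$ (i, j)) : bm M)
  ==> f : meas M (mbs m n S)" by (auto simp: measurable_mbs_iff)

lemma mbsD: "f : meas M (mbs m n S) ==> i < m ==> j < n ==> (%w. f w $$ (i, j)) : bm M"
 "f : meas M (mbs m n S) ==> w : space M ==> f w : S" by (auto simp: measurable_mbs_iff)

lemma mmD: assumes "f : meas M (mm m n)" "w : space M" shows "nr (f w) = m" "nc (f w) = n" using mbsD(2)[OF assms] by auto

lemma mbs_subset: "S <= T ==> f : meas M (mbs m n S) ==> f : meas M (mbs m n T)" by (auto simp: measurable_mbs_iff)

lemma mbs_superset: "f : meas M (mbs m n T) ==> (!!w. w : space M ==> f w : S) ==> f : meas M (mbs m n S)" by (auto simp: measurable_mbs_iff)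

lemma herm_borel_mm: "f : meas M (herm_borel m) ==> f : meas M (mm m m)"
 unfolding herm_borel_mbs by (rule mbs_subset[rotated]) (auto dest: HermD(3,4))

lemma mm_herm_borel: "f : meas M (mm m m) ==> (!!w. w : space M ==> Herm m (f w)) ==> f : meas M (herm_borel m)"
 unfolding herm_borel_mbs by (rule mbs_superset) auto

lemma mm_const: "C : Mat m n ==> (%w. C) : meas M (mm m n)" by (rule mbsI) auto

lemma mm_binop: assumes f: "f : meas M (mm m k)" and g: "g : meas M (mm k' n)" shows mm_mult: "k = k' ==> (%w. f w * g w) : meas M (mm m n)"
  and mm_add: "m = k' ==> k = n ==> (%w. f w + g w) : meas M (mm m n)" and mm_minus: "m = k' ==> k = n ==> (%w. f w - g w) : meas M (mm m n)"
  and mm_adj: "(%w. (f w)^H) : meas M (mm k m)" and mm_block: "i + r <= m ==> j + s <= k ==> (%w. block i j r s (f w)) : meas M (mm r s)"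
proof -
 note [simp] = mmD[OF f] mmD[OF g]
 note [measurable] = mbsD(1)[OF f] mbsD(1)[OF g]
 show "(%w. f w * g w) : meas M (mm m n)" if [simp]: "k = k'"
 proof (rule mbsI)
  fix i j assume ij: "i < m" "j < n"
  have "(%w. \<Sum>r<k'. f w $$ (i, r) * g w $$ (r, j)) : bm M"
   by (intro borel_measurable_sum borel_measurable_times mbsD(1)[OF f] mbsD(1)[OF g]) (use ij in auto)
  moreover have "(f w * g w) $$ (i, j) = (\<Sum>r<k'. f w $$ (i, r) * g w $$ (r, j))" if "w : space M" for w
   using that ij mmD[OF f that] mmD[OF g that] by (simp add: sp_def at0L)
  ultimately show "(%w. (f w * g w) $$ (i, j)) : bm M" by (subst measurable_cong) (assumption | simp)+
 qed simp
 show "(%w. f w + g w) : meas M (mm m n)" if [simp]: "m = k'" "k = n"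
 proof (rule mbsI)
  fix i j assume ij: "i < m" "j < n"
  have "(%w. f w $$ (i, j) + g w $$ (i, j)) : bm M" by (intro borel_measurable_add mbsD(1)[OF f] mbsD(1)[OF g]) (use ij in auto)
  thus "(%w. (f w + g w) $$ (i, j)) : bm M" by (subst measurable_cong) (use ij in \<open>(assumption | simp)+\<close>)
 qed simp
 show "(%w. f w - g w) : meas M (mm m n)" if [simp]: "m = k'" "k = n"
 proof (rule mbsI)
  fix i j assume ij: "i < m" "j < n"
  have "(%w. f w $$ (i, j) - g w $$ (i, j)) : bm M" by (intro borel_measurable_diff mbsD(1)[OF f] mbsD(1)[OF g]) (use ij in auto)
  thus "(%w. (f w - g w) $$ (i, j)) : bm M" by (subst measurable_cong) (use ij in \<open>(assumption | simp)+\<close>)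
 qed simp
 show "(%w. (f w)^H) : meas M (mm k m)"
 proof (rule mbsI)
  fix i j assume ij: "i < k" "j < m"
  have "(%w. cnj (f w $$ (j, i))) : bm M" by (rule borel_measurable_continuous_on[OF _ mbsD(1)[OF f ij(2,1)]]) (intro continuous_intros)
  thus "(%w. (f w)^H $$ (i, j)) : bm M" by (subst measurable_cong) (use ij in \<open>(assumption | simp)+\<close>)
 qed simp
 show "(%w. block i j r s (f w)) : meas M (mm r s)" if "i + r <= m" "j + s <= k"
  by (rule mbsI) (use that in \<open>auto simp: block_def intro!: mbsD(1)[OF f]\<close>)
qed

lemma mm_if: "Measurable.pred M P ==> f : meas M (mm m n) ==> g : meas M (mm m n) ==>
  (%w. if P w then f w else g w) : meas M (mm m n)" by (rule measurable_If) auto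

lemma measurable_det: assumes f: "f : meas M (mm m m)" shows "(%w. det (f w)) : bm M"
proof -
 have "(%w. \<Sum>v | v permutes {0..<m}. signof v * (\<Prod>i = 0..<m. f w $$ (i, v i))) : bm M"
  by (intro borel_measurable_sum borel_measurable_times borel_measurable_const borel_measurable_prod mbsD(1)[OF f])
   (auto dest: permutes_in_image)
 thus ?thesis by (subst measurable_cong) (assumption | simp add: det_def mmD[OF f])+
qed

lemma pred_hermitian: assumes f: "f : meas M (mm m m)" shows "Measurable.pred M (%w. Herm m (f w))"
proof -
 have e: "Measurable.pred M (%w. f w $$ (i, j) = cnj (f w $$ (j, i)))" if "i < m" "j < m" for i j
 proof -
  have c: "(%w. cnj (f w $$ (j, i))) : bm M" by (rule borel_measurable_continuous_on[OF _ mbsD(1)[OF f that(2,1)]]) (intro continuous_intros)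
  have [measurable]: "(%w. cmod (f w $$ (i, j) - cnj (f w $$ (j, i)))) : bm M"
   by (intro m_comp[OF _ borel_measurable_norm] borel_measurable_diff c mbsD(1)[OF f that])
  have "Measurable.pred M (%w. cmod (f w $$ (i, j) - cnj (f w $$ (j, i))) = 0)" by measurable
  thus ?thesis by simp
 qed
 have P: "Measurable.pred M (%w. ALL i:{..<m}. ALL j:{..<m}. f w $$ (i, j) = cnj (f w $$ (j, i)))" by (intro pred_intros_finite e) auto
 have E: "Herm m (f w) <-> (ALL i:{..<m}. ALL j:{..<m}. f w $$ (i, j) = cnj (f w $$ (j, i)))" if "w : space M" for w
 proof
  assume "Herm m (f w)"
  thus "ALL i:{..<m}. ALL j:{..<m}. f w $$ (i, j) = cnj (f w $$ (j, i))" using hermitian_index by blast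
 next
  assume h: "ALL i:{..<m}. ALL j:{..<m}. f w $$ (i, j) = cnj (f w $$ (j, i))"
  show "Herm m (f w)"
  proof (rule HermI)
   show "(f w)^H = f w"
   proof (rule eq_matI)
    fix i j assume ij: "i < nr (f w)" "j < nc (f w)"
    hence "i < m" "j < m" by (simp_all add: mmD[OF f that])
    hence "f w $$ (i, j) = cnj (f w $$ (j, i))" using h by blast
    thus "(f w)^H $$ (i, j) = f w $$ (i, j)" using ij by (subst index_adjoint) (simp_all add: mmD[OF f that])
   qed (simp_all add: mmD[OF f that])
  qed (rule mbsD(2)[OF f that])
 qed
 show ?thesis by (rule measurable_cong[THEN iffD2, OF E P])
qed

text \<open>The inductive form of the criterion by leading minors: the Schur complement of the
  leading block is a real number with the sign of the full determinant. It reduces measurability of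
  positive definiteness to that of determinants.\<close>

lemma pos_def_Suc_iff:
 "pdm (Suc m) X <-> Herm (Suc m) X & pdm m (block 0 0 m m X) & 0 < Re (det X)"
proof (cases "Herm (Suc m) X & pdm m (block 0 0 m m X)")
 case True
 define A C F where "A = block 0 0 m m X" and "C = block 0 m m 1 X" and "F = block m m 1 1 X"
 have X: "Herm (m + 1) X" using True by simp
 have A: "pdm m A" using True by (simp add: A_def)
 from pos_def_inverse_exists[OF A] obtain Ai where Ai: "pdm m Ai" "A * Ai = 1m m" by blast
 have Fh: "Herm 1 F" unfolding F_def by (rule hermitian_blocks(2)[OF X])
 have Xe: "X = fbm A C (C^H) F" using four_block_decomp[of X m 1 m 1] HermD(1)[OF X] hermitian_blocks(3)[OF X] by (simp add: A_def C_def F_def)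
 have c: "C : Mat m 1" "F : Mat 1 1" by (simp_all add: C_def F_def)
 define S where "S = F - C^H * Ai * C"
 note [simp] = pd_dims(2-4)[OF Ai(1)] HermD(2-4)[OF Fh]
 have Cd[simp]: "nr C = m" "nc C = 1" using c by auto
 have S: "Herm 1 S" unfolding S_def by (rule HermI) (simp_all add: m_assoc)
 define s where "s = Re (S $$ (0, 0))"
 have Sr: "S = rdiag 1 (%_. s)"
 proof (rule eq_matI)
  have "S $$ (0, 0) = cnj (S $$ (0, 0))" using hermitian_index[OF S, of 0 0] by simp
  hence "S $$ (0, 0) = cx s" unfolding s_def by (simp add: complex_eq_iff)
  thus "S $$ (i, j) = rdiag 1 (%_. s) $$ (i, j)" if "i < nr (rdiag 1 (%_. s))" "j < nc (rdiag 1 (%_. s))" for i j using that by simp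
 qed (use HermD(3,4)[OF S] in simp_all)
 have pd: "pdm (m + 1) X <-> 0 < s" unfolding Xe schur_pos_def[OF pd_herm[OF A] HermD(1)[OF pd_herm[OF Ai(1)]] Ai(2) c]
   S_def[symmetric] Sr pos_def_rdiag_iff using A by simp
 have "det X = det A * det S" unfolding Xe schur_det[OF pd_herm[OF A] HermD(1)[OF pd_herm[OF Ai(1)]] Ai(2) c] S_def ..
 also have "... = cx (Re (det A) * s)" unfolding Sr det_rdiag using pos_def_det(1)[OF A] by simp
 finally have "Re (det X) = Re (det A) * s" by simp
 thus ?thesis using pd True pos_def_det(2)[OF A] by (simp add: zero_less_mult_iff)
next
 case False
 moreover have "Herm (Suc m) X & pdm m (block 0 0 m m X)" if "pdm (Suc m) X" using pd_herm[OF that] pos_def_upper_left[of m 1 X] that by simp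
 ultimately show ?thesis by blast
qed

lemma pred_pos_def:
 "f : meas M (mm m m) ==> Measurable.pred M (%w. pdm m (f w))"
proof (induction m arbitrary: f)
 case 0
 have "pdm 0 (f w)" if "w : space M" for w
 proof -
  have "f w = 1m 0" by (rule eq_matI) (use mmD[OF 0 that] in auto)
  thus ?thesis by (simp add: pd_one)
 qed
 thus ?case by (subst measurable_cong[where g = "%_. True"]) auto
next
 case (Suc m)
 note [measurable] = measurable_det[OF Suc.prems] pred_hermitian[OF Suc.prems]
  Suc.IH[OF mm_block[OF Suc.prems Suc.prems, of 0 m 0 m]]
 show ?case unfolding pos_def_Suc_iff by measurable
qed

lemma mm_mpow: "f : meas M (mm m m) ==> (%w. mpow m (f w) k) : meas M (mm m m)" by (induction k) (auto intro!: mm_mult mm_const)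

lemma spectral_entry: assumes "U : Mat m n" "k < m" "l < m"
 shows "(U * rdiag n t * U^H) $$ (k, l) = (\<Sum>r<n. cx (t r) * U $$ (k, r) * cnj (U $$ (l, r)))"
proof -
 have UD: "(U * rdiag n t) $$ (k, r) = U $$ (k, r) * cx (t r)" if "r < n" for r
  using assms that by (simp add: sp_def if_distrib[of "%x. _ * x"] cong: if_cong)
 define T where "T = U * rdiag n t"
 have T: "T : Mat m n" using assms by (simp add: T_def)
 have "(T * U^H) $$ (k, l) = (\<Sum>r<n. T $$ (k, r) * cnj (U $$ (l, r)))" using assms T by (simp add: sp_def at0L)
 also have "... = (\<Sum>r<n. cx (t r) * U $$ (k, r) * cnj (U $$ (l, r)))" by (rule sum.cong[OF refl]) (simp only: T_def UD lessThan_iff mult.commute)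
 finally show ?thesis unfolding T_def .
qed

lemma spectral_mpow:
 "unitm n U ==> mpow n (U * rdiag n t * U^H) k = U * rdiag n (%i. t i ^ k) * U^H"
proof (induction k)
 case 0
 thus ?case using spectral_one[of n U] by simp
next
 case (Suc k)
 thus ?case using spectral_mult[of n U t "%i. t i ^ k"] spectral_mult[of n U "%i. t i ^ k" t] by (simp add: mult.commute)
qed

text \<open>\<open>inv_sqrt_mat\<close> is a definite description with uncontrolled values off the
  positive cone; setting these to zero gives a function that is measurable everywhere.\<close>

definition isq :: "nat => cmat => cmat" where
 "isq m R = (if pdm m R then isqrt m R else 0m m m)"

text \<open>Weierstrass approximation on intervals growing to the whole positive axis, with error
  tending to zero, so that the polynomials converge at every positive point. Applied to matrices
  they show that \<open>isq\<close> is a pointwise limit of polynomials in its argument, hence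
  measurable.\<close>

lemma inv_sqrt_poly:
 "EX a N. ALL x:{1 / real (Suc n)..real (Suc n)}. \<bar>1 / sqrt x - (\<Sum>i\<le>N. a i * x ^ i)\<bar> < 1 / real (Suc n)"
proof -
 have "continuous_on {1 / real (Suc n)..real (Suc n)} (%x. 1 / sqrt x)"
  by (intro continuous_intros) (auto simp: divide_simps dest: order_less_le_trans[OF divide_pos_pos[of 1 "real (Suc n)"], rotated 2])
 from Stone_Weierstrass_real_polynomial_function[OF compact_Icc this, of "1 / real (Suc n)"]
 obtain g where g: "real_polynomial_function g" "!!x. x : {1 / real (Suc n)..real (Suc n)} ==> \<bar>1 / sqrt x - g x\<bar> < 1 / real (Suc n)"
  by auto
 then obtain a N where "g = (%x. \<Sum>i\<le>N. a i * x ^ i)" using real_polynomial_function_iff_sum by blast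
 thus ?thesis using g(2) by blast
qed

lemma mm_isq: assumes f: "f : meas M (mm m m)" shows "(%w. isq m (f w)) : meas M (mm m m)"
proof (rule mbsI)
 fix w
 show "isq m (f w) : Mat m m" using pd_dims(3,4)[OF isqrt_pd] by (auto simp: isq_def)
next
 fix k l assume kl: "k < m" "l < m"
 have "EX a :: nat => nat => real. EX N :: nat => nat. ALL n. ALL x:{1 / real (Suc n)..real (Suc n)}. \<bar>1 / sqrt x - (\<Sum>i\<le>N n. a n i * x ^ i)\<bar> < 1 / real (Suc n)"
  using inv_sqrt_poly by metis
 then obtain a :: "nat => nat => real" and N :: "nat => nat" where
  aN: "!!n x. x : {1 / real (Suc n)..real (Suc n)} ==> \<bar>1 / sqrt x - (\<Sum>i\<le>N n. a n i * x ^ i)\<bar> < 1 / real (Suc n)" by metis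
 define P where "P n x = (\<Sum>i\<le>N n. a n i * x ^ i)" for n x
 have lim: "(%n. P n x) ----> 1 / sqrt x" if x: "0 < x" for x
 proof -
  obtain n0 where n0: "max x (1 / x) < real n0" using reals_Archimedean2 by blast
  have "(%n. 1 / sqrt x - P n x) ----> 0"
  proof (rule Lim_null_comparison)
   show "\<forall>\<^sub>F n in sequentially. norm (1 / sqrt x - P n x) <= 1 / real (Suc n)"
   proof (rule eventually_sequentiallyI)
    fix n assume "n0 <= n"
    hence n: "x < real (Suc n)" "1 / x < real (Suc n)" using n0 by auto
    hence "1 / real (Suc n) <= x" using x by (simp add: field_simps)
    thus "norm (1 / sqrt x - P n x) <= 1 / real (Suc n)" using aN[of x n] n unfolding P_def by simp
   qed
   show "(%n. 1 / real (Suc n)) ----> 0" by (rule lim_inverse_n'[THEN LIMSEQ_Suc])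
  qed
  from tendsto_diff[OF tendsto_const[of "1 / sqrt x"] this] show ?thesis by simp
 qed
 \<comment> \<open>On the positive cone this is the \<open>(k, l)\<close> entry of the approximating
   polynomial evaluated at the matrix \<open>f w\<close>; the spectral decomposition reduces its
   convergence to that at the eigenvalues.\<close>
 define g where "g n w = (if pdm m (f w) then \<Sum>i\<le>N n. cx (a n i) * mpow m (f w) i $$ (k, l) else 0)" for n w
 show "(%w. isq m (f w) $$ (k, l)) : bm M"
 proof (rule borel_measurable_LIMSEQ_metric)
  fix n
  note [measurable] = pred_pos_def[OF f] mbsD(1)[OF mm_mpow[OF f] kl]
  show "g n : bm M" unfolding g_def by measurable
 next
  fix w assume "w : space M"
  show "(%n. g n w) ----> isq m (f w) $$ (k, l)"
  proof (cases "pdm m (f w)")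
   case True
   from pos_def_spectral[OF True] obtain U t where U: "unitm m U" and t: "ALL i<m. 0 < t i" and F: "f w = U * rdiag m t * U^H" by blast
   note Uc = unitD(1)[OF U]
   have g: "g n w = (\<Sum>r<m. cx (P n (t r)) * U $$ (k, r) * cnj (U $$ (l, r)))" for n
   proof -
    have "g n w = (\<Sum>i\<le>N n. cx (a n i) * mpow m (f w) i $$ (k, l))" using True by (simp add: g_def)
    also have "... = (\<Sum>i\<le>N n. \<Sum>r<m. cx (a n i) * (cx (t r ^ i) * U $$ (k, r) * cnj (U $$ (l, r))))"
     unfolding F spectral_mpow[OF U] spectral_entry[OF Uc kl] sum_dl ..
    also have "... = (\<Sum>r<m. \<Sum>i\<le>N n. cx (a n i) * (cx (t r ^ i) * U $$ (k, r) * cnj (U $$ (l, r))))" by (rule sum.swap)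
    also have "... = (\<Sum>r<m. cx (P n (t r)) * U $$ (k, r) * cnj (U $$ (l, r)))"
     unfolding P_def of_real_sum of_real_mult sum_distrib_right mult.assoc ..
    finally show ?thesis .
   qed
   have "isq m (f w) $$ (k, l) = (\<Sum>r<m. cx (1 / sqrt (t r)) * U $$ (k, r) * cnj (U $$ (l, r)))"
    using True unfolding isq_def F inv_sqrt_spectral[OF U t] by (simp only: if_True spectral_entry[OF Uc kl])
   thus ?thesis unfolding g by (simp only:) (intro tendsto_sum tendsto_mult tendsto_const tendsto_of_real lim, use t in auto)
  qed (use kl in \<open>simp add: g_def isq_def\<close>)
 qed
qed

section \<open>Integration against a matrix measure\<close>

lemma quad_form_sum: assumes "H : Mat p p" "v : Vec p" shows "(H *v v) .c v = (\<Sum>i<p. \<Sum>j<p. H $$ (i, j) * v $ j * cnj (v $ i))"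
 using assms by (simp add: sp_def at0L sum_distrib_right)

definition pvec :: "nat => nat => nat => nat => complex vec" where
 "pvec p m k l = \<i> ^ m \<cdot>\<^sub>v unit_vec p k + unit_vec p l"

lemma pvec_carrier [simp]: "pvec p m k l : Vec p" by (simp add: pvec_def)

lemma sum_two_delta:
 fixes f :: "nat => complex" assumes "k < p" "l < p"
 shows "(\<Sum>j<p. f j * ((if j = k then a else 0) + (if j = l then b else 0))) = f k * a + f l * b"
 using assms by (simp add: distrib_left sum.distrib if_distrib[of "%x. _ * x"] cong: if_cong)

lemma quad_form_pvec: assumes "k < p" "l < p" shows "(\<Sum>i<p. \<Sum>j<p. H i j * pvec p m k l $ j * cnj (pvec p m k l $ i))
  = H k k * \<i> ^ m * cnj (\<i> ^ m) + H k l * cnj (\<i> ^ m) + H l k * \<i> ^ m + H l l"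
proof -
 have pv: "pvec p m k l $ j = (if j = k then \<i> ^ m else 0) + (if j = l then 1 else 0)" if "j < p" for j using assms that by (simp add: pvec_def)
 have pc: "cnj (pvec p m k l $ j) = (if j = k then cnj (\<i> ^ m) else 0) + (if j = l then 1 else 0)" if "j < p" for j unfolding pv[OF that] by simp
 have inner: "(\<Sum>j<p. H i j * pvec p m k l $ j) = H i k * \<i> ^ m + H i l" for i
  using sum_two_delta[OF assms, of "H i" "\<i> ^ m" 1] by (simp add: pv)
 have "(\<Sum>i<p. \<Sum>j<p. H i j * pvec p m k l $ j * cnj (pvec p m k l $ i))
  = (\<Sum>i<p. (H i k * \<i> ^ m + H i l) * cnj (pvec p m k l $ i))" by (simp only: sum_distrib_right[symmetric] inner)
 also have "... = (H k k * \<i> ^ m + H k l) * cnj (\<i> ^ m) + (H l k * \<i> ^ m + H l l)"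
  using sum_two_delta[OF assms, of "%i. H i k * \<i> ^ m + H i l" "cnj (\<i> ^ m)" 1] by (simp add: pc del: complex_cnj_power)
 finally show ?thesis by (simp add: algebra_simps)
qed

text \<open>Orthogonality of the characters of the cyclic group of order four: after multiplication
  by \<open>\<i> ^ m\<close> and summation over \<open>m\<close>, only the term with
  \<open>H k l\<close> survives.\<close>

lemma polarization: assumes "k < p" "l < p"
 shows "(\<Sum>m<4. \<i> ^ m * (\<Sum>i<p. \<Sum>j<p. H i j * pvec p m k l $ j * cnj (pvec p m k l $ i))) / 4 = H k l"
proof -
 have s: "(\<Sum>m<4. f m) = f 0 + f 1 + f 2 + f 3" for f :: "nat => complex" by (simp add: eval_nat_numeral)
 show ?thesis unfolding quad_form_pvec[OF assms] s by (simp add: power3_eq_cube algebra_simps)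
qed

lemma entry_integral_pvec:
 "eint p S k l f = (\<Sum>m<4. \<i> ^ m * (\<integral>x. f x \<partial>quad_measure S (pvec p m k l))) / 4" by (simp add: entry_integral_def pvec_def)

text \<open>A bound is asked for on the unit interval only, where the measures live; polynomials are
  thereby included.\<close>

definition bnd01 :: "(real => complex) => bool" where
 "bnd01 f <-> f : bm borel & (EX C. ALL x:{0..1}. norm (f x) <= C)"

lemma bnd01_continuous: "continuous_on UNIV f ==> bnd01 f"
proof -
 assume c: "continuous_on UNIV f"
 hence "compact (f ` {0..1})" by (intro compact_continuous_image) (auto intro: continuous_on_subset)
 hence "bounded (f ` {0..1})" by (rule compact_imp_bounded)
 thus ?thesis using c borel_measurable_continuous_onI unfolding bnd01_def bounded_iff by blast
qed

lemma nonneg_def_hermitian: "nonneg_def_mat p H ==> Herm p H" by (simp add: nonneg_def_mat_def)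

locale matrix_measure01 =
 fixes p :: nat and G :: "real set => cmat" assumes norm01: "normalized_matrix_measure01 p G"
begin

lemma sums_entry:
 fixes A :: "nat => real set"
 shows "[|range A <= sets borel; disjoint_family A; i < p; j < p|] ==> (%n. G (A n) $$ (i, j)) sums (G (\<Union>n. A n) $$ (i, j))"
 using norm01 unfolding normalized_matrix_measure01_def matrix_measure_def by blast

lemma nn: "nonneg_def_mat p (G A)" and total: "G UNIV = 1m p" and outside: "G (- {0..1}) = 0m p p"
 using norm01 unfolding normalized_matrix_measure01_def matrix_measure_def by blast+

lemma sigma_dim [simp]: "nr (G A) = p" "nc (G A) = p" using HermD(3,4)[OF nonneg_def_hermitian[OF nn]] by auto

definition qf :: "complex vec => real set => real" where
 "qf v A = Re ((G A *v v) .c v)"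

lemma qf_nonneg: "v : Vec p ==> 0 <= qf v A" using nn[of A] unfolding nonneg_def_mat_def qf_def by (auto simp: less_eq_complex_def)

lemma qf_eq: "v : Vec p ==> cx (qf v A) = (\<Sum>i<p. \<Sum>j<p. G A $$ (i, j) * v $ j * cnj (v $ i))"
proof -
 assume v: "v : Vec p"
 have "cx (Re ((G A *v v) .c v)) = (G A *v v) .c v" by (rule complex_eqI) (simp_all add: cinner_hermitian_real[OF nonneg_def_hermitian[OF nn] v])
 also have "... = (\<Sum>i<p. \<Sum>j<p. G A $$ (i, j) * v $ j * cnj (v $ i))" by (rule quad_form_sum) (use v in simp_all)
 finally show ?thesis unfolding qf_def .
qed

lemma qf_sums: assumes "range A <= sets borel" "disjoint_family A" "v : Vec p" shows "(%n. qf v (A n)) sums qf v (\<Union>n. A n)"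
proof -
 have "(%n. cx (qf v (A n))) sums cx (qf v (\<Union>n. A n))" unfolding qf_eq[OF assms(3)] by (intro sums_sum sums_mult2 sums_entry assms) auto
 from sums_Re[OF this] show ?thesis by simp
qed

lemma qf_empty: "v : Vec p ==> qf v {} = 0"
 using qf_sums[of "%_. {}" v] by (auto simp: disjoint_family_on_def summable_const_iff dest!: sums_summable)

lemma sets_qm [simp, measurable_cong]: "sets (quad_measure G v) = sets borel" by (simp add: quad_measure_def sets.sigma_sets_eq[of borel, simplified])

lemma space_qm [simp]: "space (quad_measure G v) = UNIV" by (simp add: quad_measure_def space_measure_of_conv)

lemma bm_qm: "f : bm borel ==> f : bm (quad_measure G v)" by (simp only: measurable_cong_sets[OF sets_qm refl])

lemma emeasure_qm: assumes "v : Vec p" "A : sets borel" shows "emeasure (quad_measure G v) A = ennreal (qf v A)" unfolding quad_measure_def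
proof (subst emeasure_measure_of_sigma)
 show "sigma_algebra UNIV (sets (borel :: real measure))" using sets.sigma_algebra_axioms[of "borel :: real measure"] by simp
 show "positive (sets borel) (%A. ennreal (Re ((G A *v v) .c v)))" using qf_empty[OF assms(1)] by (simp add: positive_def qf_def)
 show "countably_additive (sets borel) (%A. ennreal (Re ((G A *v v) .c v)))"
 proof (rule countably_additiveI)
  fix A :: "nat => real set" assume A: "range A <= sets borel" "disjoint_family A" "(\<Union>n. A n) : sets borel"
  show "(\<Sum>i. ennreal (Re ((G (A i) *v v) .c v))) = ennreal (Re ((G (\<Union>i. A i) *v v) .c v))"
   using qf_sums[OF A(1,2) assms(1)] qf_nonneg[OF assms(1)] unfolding qf_def by (intro suminf_ennreal_eq) auto
 qed
qed (use assms in \<open>simp_all add: qf_def\<close>)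

lemma finite_qm: "v : Vec p ==> finite_measure (quad_measure G v)" by (rule finite_measureI) (simp add: emeasure_qm)

lemma AE_qm: "v : Vec p ==> AE x in quad_measure G v. x : {0..1}"
proof (rule AE_I[of _ _ "- {0..1}"])
 assume v: "v : Vec p"
 have "cx (qf v (- {0..1})) = 0" unfolding qf_eq[OF v] outside by simp
 hence "qf v (- {0..1}) = 0" by simp
 thus "emeasure (quad_measure G v) (- {0..1}) = 0" using v by (simp add: emeasure_qm)
qed auto

lemma integrable_qm: "v : Vec p ==> bnd01 f ==> integrable (quad_measure G v) f"
proof -
 assume v: "v : Vec p" and f: "bnd01 f"
 then obtain C where C: "!!x. x : {0..1} ==> norm (f x) <= C" unfolding bnd01_def by blast
 have "AE x in quad_measure G v. norm (f x) <= C" by (rule eventually_mono[OF AE_qm[OF v]]) (rule C)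
 moreover have "f : bm (quad_measure G v)" using f by (simp add: bnd01_def bm_qm)
 ultimately show ?thesis by (rule finite_measure.integrable_const_bound[OF finite_qm[OF v]])
qed

lemma ei_add: "bnd01 f ==> bnd01 g ==> eint p G k l (%x. f x + g x) = eint p G k l f + eint p G k l g" unfolding entry_integral_pvec
 by (subst Bochner_Integration.integral_add) (auto simp: integrable_qm sum.distrib algebra_simps add_divide_distrib)

lemma ei_cmult: "eint p G k l (%x. c * f x) = c * eint p G k l f" unfolding entry_integral_pvec by (simp add: sum_dl mult_ac)

lemma ei_zero: "eint p G k l (%x. 0) = 0" by (simp add: entry_integral_pvec)

lemma bnd01_add: "bnd01 f ==> bnd01 g ==> bnd01 (%x. f x + g x)"
 unfolding bnd01_def by (auto intro!: exI order_trans[OF norm_triangle_ineq] add_mono)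

lemma bnd01_zero: "bnd01 (%x. 0)" by (auto simp: bnd01_def)

lemma bnd01_sum: "finite I ==> (!!i. i : I ==> bnd01 (f i)) ==> bnd01 (%x. \<Sum>i\<in>I. f i x)"
 by (induction I rule: finite_induct) (auto intro: bnd01_add bnd01_zero)

lemma ei_sum: "finite I ==> (!!i. i : I ==> bnd01 (f i)) ==>
 eint p G k l (%x. \<Sum>i\<in>I. f i x) = (\<Sum>i\<in>I. eint p G k l (f i))"
 by (induction I rule: finite_induct) (auto simp: ei_zero ei_add bnd01_sum)

text \<open>Dominated convergence for each of the four positive measures of the
  polarization.\<close>

lemma ei_limit: assumes "!!n. s n : bm borel" "f : bm borel"
  "!!n x. x : {0..1} ==> norm (s n x) <= C" "!!x. x : {0..1} ==> (%n. s n x) ----> f x" shows "(%n. eint p G k l (s n)) ----> eint p G k l f"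
 unfolding entry_integral_pvec
proof (intro tendsto_divide tendsto_sum tendsto_mult tendsto_const)
 fix m
 have v: "pvec p m k l : Vec p" by simp
 interpret finite_measure "quad_measure G (pvec p m k l)" by (rule finite_qm[OF v])
 show "(%n. LINT x|quad_measure G (pvec p m k l). s n x) ----> (LINT x|quad_measure G (pvec p m k l). f x)"
 proof (rule integral_dominated_convergence[where w = "%_. C"])
  show "AE x in quad_measure G (pvec p m k l). (%n. s n x) ----> f x" by (rule eventually_mono[OF AE_qm[OF v]]) (rule assms(4))
  show "AE x in quad_measure G (pvec p m k l). norm (s n x) <= C" for n by (rule eventually_mono[OF AE_qm[OF v]]) (rule assms(3))
 qed (use assms in \<open>auto intro!: bm_qm\<close>)
qed simp

lemma ei_cong01: assumes "f : bm borel" "g : bm borel" "!!x. x : {0..1} ==> f x = g x" shows "eint p G k l f = eint p G k l g"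
proof -
 have "(LINT x|quad_measure G (pvec p m k l). f x) = (LINT x|quad_measure G (pvec p m k l). g x)" for m
 proof (rule integral_cong_AE)
  show "AE x in quad_measure G (pvec p m k l). f x = g x" by (rule eventually_mono[OF AE_qm]) (simp, rule assms(3))
 qed (use assms in \<open>auto intro!: bm_qm\<close>)
 thus ?thesis by (simp add: entry_integral_pvec)
qed

lemma ei_indicator: assumes "A : sets borel" "k < p" "l < p" shows "eint p G k l (%x. Ind A x) = G A $$ (k, l)"
proof -
 have "(LINT x|quad_measure G (pvec p m k l). Ind A x) = cx (qf (pvec p m k l) A)" for m
 proof -
  interpret finite_measure "quad_measure G (pvec p m k l)" by (rule finite_qm) simp
  have "(LINT x|quad_measure G (pvec p m k l). Ind A x :: complex) = cx (LINT x|quad_measure G (pvec p m k l). Ind A x)"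
  proof -
   have "(LINT x|quad_measure G (pvec p m k l). Ind A x :: complex) = (LINT x|quad_measure G (pvec p m k l). cx (Ind A x))"
    by (rule Bochner_Integration.integral_cong) (simp_all add: indicator_def)
   thus ?thesis by (simp only: integral_complex_of_real)
  qed
  thus ?thesis using assms qf_nonneg[of "pvec p m k l" A] by (simp add: measure_def emeasure_qm)
 qed
 thus ?thesis unfolding entry_integral_pvec using polarization[OF assms(2,3), of "%i j. G A $$ (i, j)"] by (simp add: qf_eq)
qed

definition cell :: "nat => nat => real set" where
 "cell n r = {x. \<lfloor>real (Suc n) * x\<rfloor> = int r}"

text \<open>Transfers positivity and symmetry from the values of \<open>G\<close> to its integrals.\<close>

lemma ei_riemann: assumes g: "continuous_on UNIV g" and kl: "k < p" "l < p"
 shows "(%n. \<Sum>r\<le>Suc n. g (real r / real (Suc n)) * G (cell n r) $$ (k, l)) ----> eint p G k l g"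
proof -
 \<comment> \<open>The left end of the cell of length \<open>1 / (n + 1)\<close> that contains
   \<open>x\<close>. The point 1 is the left end of a further cell, for which reason the sums run up
   to \<open>Suc n\<close>.\<close>
 define c where "c n x = real_of_int \<lfloor>real (Suc n) * x\<rfloor> / real (Suc n)" for n x
 have c01: "c n x : {0..1}" if "x : {0..1}" for n x
 proof -
  have "0 <= \<lfloor>real (Suc n) * x\<rfloor>" using that by simp
  hence "0 <= real_of_int \<lfloor>real (Suc n) * x\<rfloor>" by simp
  moreover have "real_of_int \<lfloor>real (Suc n) * x\<rfloor> <= real (Suc n)"
   using order_trans[OF of_int_floor_le mult_left_mono[of x 1 "real (Suc n)"]] that by simp
  ultimately show ?thesis unfolding c_def by (simp add: divide_simps)
 qed
 have cl: "(%n. c n x) ----> x" for x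
 proof (rule tendsto_sandwich)
  show "\<forall>\<^sub>F n in sequentially. x - 1 / real (Suc n) <= c n x"
  proof (rule always_eventually, rule allI)
   fix n
   have "real (Suc n) * x - 1 <= real_of_int \<lfloor>real (Suc n) * x\<rfloor>" by linarith
   hence "(real (Suc n) * x - 1) / real (Suc n) <= c n x" unfolding c_def by (rule divide_right_mono) simp
   moreover have "(real (Suc n) * x - 1) / real (Suc n) = x - 1 / real (Suc n)" by (simp add: diff_divide_distrib)
   ultimately show "x - 1 / real (Suc n) <= c n x" by simp
  qed
  show "\<forall>\<^sub>F n in sequentially. c n x <= x"
  proof (rule always_eventually, rule allI)
   fix n
   have "real_of_int \<lfloor>real (Suc n) * x\<rfloor> / real (Suc n) <= real (Suc n) * x / real (Suc n)" by (rule divide_right_mono) simp_all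
   thus "c n x <= x" unfolding c_def by simp
  qed
  show "(%n. x - 1 / real (Suc n)) ----> x" using tendsto_diff[OF tendsto_const[of x] lim_inverse_n'[THEN LIMSEQ_Suc]] by simp
 qed simp
 have cm[measurable]: "c n : bm borel" for n unfolding c_def by measurable
 have gm[measurable]: "g : bm borel" using g by (rule borel_measurable_continuous_onI)
 have lim: "(%n. eint p G k l (%x. g (c n x))) ----> eint p G k l g" for k l
 proof -
  obtain C where C: "!!x. x : {0..1} ==> norm (g x) <= C" using bnd01_continuous[OF g] unfolding bnd01_def by blast
  show ?thesis
  proof (rule ei_limit)
   show "norm (g (c n x)) <= C" if "x : {0..1}" for n x using C[OF c01[OF that]] .
   show "(%n. g (c n x)) ----> g x" for x using g cl[of x] by (intro continuous_on_tendsto_compose[OF g]) auto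
  qed measurable
 qed
 have eq: "eint p G k l (%x. g (c n x)) = (\<Sum>r\<le>Suc n. g (real r / real (Suc n)) * G (cell n r) $$ (k, l))" for n
 proof -
  define y where "y r = real r / real (Suc n)" for r
  have J[measurable]: "cell n r : sets borel" for r unfolding cell_def by measurable
  have "eint p G k l (%x. g (c n x)) = (\<Sum>r\<le>Suc n. g (y r) * G (cell n r) $$ (k, l))"
  proof -
   have "eint p G k l (%x. g (c n x)) = eint p G k l (%x. \<Sum>r\<le>Suc n. g (y r) * Ind (cell n r) x)"
   proof (rule ei_cong01)
    fix x :: real assume x: "x : {0..1}"
    define r where "r = nat \<lfloor>real (Suc n) * x\<rfloor>"
    have r0: "int r = \<lfloor>real (Suc n) * x\<rfloor>" using x by (simp add: r_def)
    have "c n x = y r" unfolding c_def y_def r0[symmetric] by simp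
    have "c n x <= 1" using c01[OF x] by simp
    hence rn: "r <= Suc n" unfolding \<open>c n x = y r\<close> y_def by simp
    have ind: "Ind (cell n r') x = (if r' = r then 1 else 0 :: complex)" for r' using r0 by (auto simp: cell_def indicator_def)
    have "(\<Sum>r'\<le>Suc n. g (y r') * Ind (cell n r') x) = (\<Sum>r'\<le>Suc n. if r' = r then g (y r) else 0)"
     unfolding ind by (intro sum.cong) auto
    also have "... = g (y r)" using rn by simp
    finally show "g (c n x) = (\<Sum>r\<le>Suc n. g (y r) * Ind (cell n r) x)" using \<open>c n x = y r\<close> by simp
   qed measurable
   also have "... = (\<Sum>r\<le>Suc n. eint p G k l (%x. g (y r) * Ind (cell n r) x))"
   proof (rule ei_sum)
    fix r
    have "norm (g (y r) * Ind (cell n r) x) <= norm (g (y r))" for x by (simp add: indicator_def)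
    thus "bnd01 (%x. g (y r) * Ind (cell n r) x)" unfolding bnd01_def by (intro conjI exI[of _ "norm (g (y r))"]) auto
   qed simp
   finally show ?thesis using kl by (simp add: ei_cmult ei_indicator)
  qed
  thus ?thesis unfolding y_def .
 qed
 show ?thesis using lim[of k l] unfolding eq .
qed

text \<open>Each cell of the Riemann sum contributes a value of the quadratic form of
  \<open>G (cell n r)\<close>, weighted by \<open>h\<close> at a point of the unit interval;
  nonnegativity survives the limit.\<close>

lemma ei_nonneg:
 fixes F :: "nat => real => complex" and h :: "real => real"
 assumes F: "!!k. continuous_on UNIV (F k)" and h: "continuous_on UNIV h" "!!x. x : {0..1} ==> 0 <= h x"
 shows "0 <= Re (\<Sum>k<p. \<Sum>l<p. eint p G k l (%x. h x * cnj (F k x) * F l x))"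
proof -
 define g where "g k l x = cx (h x) * cnj (F k x) * F l x" for k l x
 have g: "continuous_on UNIV (g k l)" for k l unfolding g_def by (intro continuous_intros F h)
 have nonneg: "0 <= Re (\<Sum>k<p. \<Sum>l<p. \<Sum>r\<le>Suc n. g k l (real r / real (Suc n)) * G (cell n r) $$ (k, l))" for n
 proof -
  define y where "y r = real r / real (Suc n)" for r
  have "(\<Sum>k<p. \<Sum>l<p. \<Sum>r\<le>Suc n. g k l (y r) * G (cell n r) $$ (k, l)) = (\<Sum>r\<le>Suc n. \<Sum>k<p. \<Sum>l<p. g k l (y r) * G (cell n r) $$ (k, l))"
   by (subst sum.swap[of _ "{..Suc n}"], subst sum.swap[of _ "{..Suc n}"]) (rule refl)
  also have "... = (\<Sum>r\<le>Suc n. cx (h (y r) * qf (vec p (%k. F k (y r))) (cell n r)))"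
   unfolding of_real_mult by (subst qf_eq, simp, intro sum.cong refl) (simp add: g_def sum_dl mult_ac)
  finally have eq: "Re (\<Sum>k<p. \<Sum>l<p. \<Sum>r\<le>Suc n. g k l (y r) * G (cell n r) $$ (k, l))
    = (\<Sum>r\<le>Suc n. h (y r) * qf (vec p (%k. F k (y r))) (cell n r))" by (simp only: of_real_sum[symmetric] Re_complex_of_real)
  have pos: "0 <= h (y r)" if "r <= Suc n" for r using that by (intro h(2)) (simp add: y_def divide_simps)
  show ?thesis unfolding eq[unfolded y_def] by (intro sum_nonneg mult_nonneg_nonneg qf_nonneg pos[unfolded y_def]) simp_all
 qed
 have "(%n. Re (\<Sum>k<p. \<Sum>l<p. \<Sum>r\<le>Suc n. g k l (real r / real (Suc n)) * G (cell n r) $$ (k, l)))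
   ----> Re (\<Sum>k<p. \<Sum>l<p. eint p G k l (g k l))" by (intro tendsto_Re tendsto_sum ei_riemann g) auto
 hence "0 <= Re (\<Sum>k<p. \<Sum>l<p. eint p G k l (g k l))" by (rule LIMSEQ_le_const) (use nonneg in auto)
 thus ?thesis unfolding g_def .
qed

lemma ei_hermitian: assumes h: "continuous_on UNIV (h :: real => real)" and kl: "k < p" "l < p"
 shows "cnj (eint p G k l (%x. cx (h x))) = eint p G l k (%x. cx (h x))"
proof (rule LIMSEQ_unique)
 have c: "continuous_on UNIV (%x. cx (h x))" by (intro continuous_intros h)
 show "(%n. \<Sum>r\<le>Suc n. h (real r / real (Suc n)) * G (cell n r) $$ (l, k)) ----> eint p G l k (%x. cx (h x))"
  by (rule ei_riemann[OF c kl(2,1)])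
 have "cnj (\<Sum>r\<le>Suc n. h (real r / real (Suc n)) * G (cell n r) $$ (k, l)) = (\<Sum>r\<le>Suc n. h (real r / real (Suc n)) * G (cell n r) $$ (l, k))" for n
  using hermitian_index[OF nonneg_def_hermitian[OF nn] kl(2,1)] by (simp del: sum.atMost_Suc)
 thus "(%n. \<Sum>r\<le>Suc n. h (real r / real (Suc n)) * G (cell n r) $$ (l, k)) ----> cnj (eint p G k l (%x. cx (h x)))"
  using tendsto_cnj[OF ei_riemann[OF c kl]] by simp
qed

end

lemma sum_block_index: "(\<Sum>r<n * p. f r) = (\<Sum>i<n. \<Sum>k<p. f (i * p + k :: nat) :: complex)"
proof (induction n)
 case (Suc n)
 have "(\<Sum>r<Suc n * p. f r) = (\<Sum>r<n * p + p. f r)" by (simp add: add.commute)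
 thus ?case using Suc by (simp add: sum_lessThan_add)
qed simp

context matrix_measure01
begin

lemma moment_entry: "k < p ==> l < p ==> mmt p G j $$ (k, l) = eint p G k l (%x. cx (x ^ j))" by (simp add: matrix_moment_def)

lemma moment_dim [simp]: "nr (mmt p G j) = p" "nc (mmt p G j) = p" by (simp_all add: matrix_moment_def)

lemma moment_hermitian: "Herm p (mmt p G j)"
proof (intro HermI eq_matI)
 fix k l assume "k < nr (mmt p G j)" "l < nc (mmt p G j)"
 hence kl: "k < p" "l < p" by auto
 have "continuous_on UNIV (%x::real. x ^ j)" by (intro continuous_intros)
 from ei_hermitian[OF this kl(2,1)]
 show "(mmt p G j)^H $$ (k, l) = mmt p G j $$ (k, l)" using kl by (simp only: index_adjoint moment_dim moment_entry)
qed simp_all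

lemma moment_0: "mmt p G 0 = 1m p"
proof (rule eq_matI)
 fix k l assume "k < nr (1m p :: cmat)" "l < nc (1m p :: cmat)"
 hence kl: "k < p" "l < p" by auto
 thus "mmt p G 0 $$ (k, l) = 1m p $$ (k, l)" using ei_indicator[of UNIV k l] total by (simp add: moment_entry)
qed simp_all

definition pform :: "(real => real) => (nat => complex poly) => real" where
 "pform w f = Re (\<Sum>k<p. \<Sum>l<p. eint p G k l (%x. w x * cnj (poly (f k) x) * poly (f l) x))"

lemma continuous_poly: "continuous_on UNIV (%x::real. poly q (cx x))" by (intro continuous_intros)

lemma pform_nonneg:
 "continuous_on UNIV w ==> (!!x. x : {0..1} ==> 0 <= w x) ==> 0 <= pform w f"
 unfolding pform_def by (rule ei_nonneg[where F = "%k x. poly (f k) (cx x)"]) (auto intro: continuous_poly)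

lemma pform_add: assumes "continuous_on UNIV v" "continuous_on UNIV w" shows "pform (%x. v x + w x) f = pform v f + pform w f"
proof -
 have b: "bnd01 (%x. v x * cnj (poly (f k) x) * poly (f l) x)" if "continuous_on UNIV v" for k l and v :: "real => real"
  by (intro bnd01_continuous continuous_intros that)
 have "eint p G k l (%x. cx (v x + w x) * cnj (poly (f k) x) * poly (f l) x) =
  eint p G k l (%x. v x * cnj (poly (f k) x) * poly (f l) x) + eint p G k l (%x. w x * cnj (poly (f k) x) * poly (f l) x)" for k l
  using ei_add[OF b[OF assms(1)] b[OF assms(2)], of k l k l] by (simp add: algebra_simps)
 thus ?thesis unfolding pform_def by (simp only: sum.distrib plus_complex.sel)
qed

text \<open>The vector of polynomials is placed in the first column of an otherwise zero matrix
  polynomial, so that the trace in the definition of nontriviality has a single nonzero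
  term.\<close>

lemma pform_pos: assumes nt: "nontrivial_matrix_measure p G" and f: "k0 < p" "f k0 ~= 0" shows "0 < pform (%x. 1) f"
proof -
 define P where "P = mat p p (%(r, c). if c = 0 then f r else 0)"
 have P: "P : Mat p p" "P ~= 0m p p"
 proof -
  show "P ~= 0m p p"
  proof
   assume "P = 0m p p"
   hence "P $$ (k0, 0) = 0" using f by simp
   thus False using f by (simp add: P_def)
  qed
 qed (simp add: P_def)
 have ev: "eval_poly_mat P x = mat p p (%(r, c). if c = 0 then poly (f r) x else 0)" for x by (rule eq_matI) (auto simp: eval_poly_mat_def P_def)
 have e0: "matrix_integral p G (%x. mat_adjoint (eval_poly_mat P x)) (eval_poly_mat P) $$ (i, i) =
  (if i = 0 then \<Sum>k<p. \<Sum>l<p. eint p G k l (%x. cx 1 * cnj (poly (f k) x) * poly (f l) x) else 0)" if "i < p" for i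
  using that by (simp add: matrix_integral_def ev ei_zero)
 have "0 < (\<Sum>i<p. matrix_integral p G (%x. mat_adjoint (eval_poly_mat P x)) (eval_poly_mat P) $$ (i, i))"
  using nt P unfolding nontrivial_matrix_measure_def by blast
 also have "... = (\<Sum>i<p. if i = 0 then \<Sum>k<p. \<Sum>l<p. eint p G k l (%x. cx 1 * cnj (poly (f k) x) * poly (f l) x) else 0)"
  by (intro sum.cong) (use e0 in auto)
 also have "... = (\<Sum>k<p. \<Sum>l<p. eint p G k l (%x. cx 1 * cnj (poly (f k) x) * poly (f l) x))" using f by simp
 finally show ?thesis unfolding pform_def by (simp only: less_complex_def zero_complex.sel)
qed

text \<open>A squared real weight is absorbed into the polynomials. This carries strict positivity
  from the constant weight to other weights.\<close>

lemma pform_square: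
 "pform (%x. (poly q x)^2) f = pform (%x. 1) (%k. map_poly cx q * f k)"
proof -
 have "poly (map_poly cx q) (cx x) = cx (poly q x)" for x by (induction q) (simp_all add: map_poly_pCons)
 thus ?thesis unfolding pform_def by (simp add: power2_eq_square mult_ac)
qed

text \<open>A vector of \<open>n\<close> blocks of length \<open>p\<close> is read as
  \<open>p\<close> polynomials of degree below \<open>n\<close>, block \<open>i\<close> holding the
  coefficients of \<open>x^i\<close>; the Hankel form is then the integral form.\<close>

lemma hankel_form: assumes v: "v : Vec (n * p)"
 defines "f == %k. \<Sum>i<n. monom (v $ (i * p + k)) i" shows "Re ((hankel s n p (mmt p G) *v v) .c v) = pform (%x. x ^ s) f"
proof -
 define a where "a i k = v $ (i * p + k)" for i k
 have pf: "poly (f k) x = (\<Sum>i<n. a i k * x ^ i)" for k x by (simp add: f_def a_def poly_sum poly_monom)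
 have H: "hankel s n p M $$ (i * p + k, j * p + l) = M (i + j + s) $$ (k, l)" if "i < n" "k < p" "j < n" "l < p" for i j k l and M :: "nat => cmat"
  using that block_index_less[of i n k p] block_index_less[of j n l p] by (simp add: hankel_def)
 have mono: "bnd01 (%x. c * cx (x ^ m))" for c m by (intro bnd01_continuous continuous_intros)
 have ei: "eint p G k l (%x. cx (x ^ s) * cnj (poly (f k) x) * poly (f l) x) =
   (\<Sum>i<n. \<Sum>j<n. cnj (a i k) * a j l * mmt p G (i + j + s) $$ (k, l))" if "k < p" "l < p" for k l
 proof -
  have "cx (x ^ s) * cnj (poly (f k) x) * poly (f l) x = (\<Sum>i<n. \<Sum>j<n. (cnj (a i k) * a j l) * cx (x ^ (i + j + s)))" for x
   unfolding pf by (simp add: sum_product sum_dl power_add mult_ac)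
  hence "eint p G k l (%x. cx (x ^ s) * cnj (poly (f k) x) * poly (f l) x) =
   eint p G k l (%x. \<Sum>i<n. \<Sum>j<n. (cnj (a i k) * a j l) * cx (x ^ (i + j + s)))" by (simp only:)
  also have "... = (\<Sum>i<n. \<Sum>j<n. eint p G k l (%x. (cnj (a i k) * a j l) * cx (x ^ (i + j + s))))"
   by (subst ei_sum, simp, rule bnd01_sum, simp, rule mono, intro sum.cong refl, subst ei_sum, simp, rule mono, rule refl)
  finally show ?thesis using that by (simp only: ei_cmult moment_entry)
 qed
 have "(hankel s n p (mmt p G) *v v) .c v =
  (\<Sum>r<n * p. \<Sum>c<n * p. hankel s n p (mmt p G) $$ (r, c) * v $ c * cnj (v $ r))" by (rule quad_form_sum) (use v in simp_all)
 also have "... = (\<Sum>i<n. \<Sum>k<p. \<Sum>j<n. \<Sum>l<p. cnj (a i k) * a j l * mmt p G (i + j + s) $$ (k, l))"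
  unfolding sum_block_index by (intro sum.cong refl) (simp add: H a_def)
 also have "... = (\<Sum>i<n. \<Sum>k<p. \<Sum>l<p. \<Sum>j<n. cnj (a i k) * a j l * mmt p G (i + j + s) $$ (k, l))"
  by (rule sum.cong[OF refl], rule sum.cong[OF refl], rule sum.swap)
 also have "... = (\<Sum>k<p. \<Sum>i<n. \<Sum>l<p. \<Sum>j<n. cnj (a i k) * a j l * mmt p G (i + j + s) $$ (k, l))" by (rule sum.swap)
 also have "... = (\<Sum>k<p. \<Sum>l<p. \<Sum>i<n. \<Sum>j<n. cnj (a i k) * a j l * mmt p G (i + j + s) $$ (k, l))"
  by (rule sum.cong[OF refl], rule sum.swap)
 also have "... = (\<Sum>k<p. \<Sum>l<p. eint p G k l (%x. cx (x ^ s) * cnj (poly (f k) x) * poly (f l) x))"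
  by (intro sum.cong refl) (simp only: ei lessThan_iff)
 finally show ?thesis unfolding pform_def by (simp only:)
qed

text \<open>Both weights are squares plus a nonnegative remainder:
  \<open>x = x^2 + x * (1 - x)\<close> and \<open>1 - x = (1 - x)^2 + x * (1 - x)\<close>. The
  squares give strict positivity by nontriviality, and the remainder is nonnegative on the unit
  interval.\<close>

lemma nontrivial_imp_hank_pos: assumes nt: "nontrivial_matrix_measure p G" shows "hank_pos n p (mmt p G)"
proof -
 let ?H = "%s. hankel s n p (mmt p G)"
 have Hh: "Herm (n * p) (?H s)" for s by (rule hankel_hermitian[OF moment_hermitian])
 have cont: "continuous_on UNIV (%x::real. x ^ s)" "continuous_on UNIV (%x::real. (poly q x)^2)" "continuous_on UNIV (%x::real. x * (1 - x))" for s q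
  by (intro continuous_intros)+
 have key: "0 < pform (%x. x) f & 0 < pform (%x. 1 - x) f" if "k0 < p" "f k0 ~= 0" for k0 f
 proof -
  have sq: "0 < pform (%x. (poly q x)^2) f" if "q ~= 0" for q :: "real poly"
  proof -
   have "map_poly cx q ~= 0" using that by (simp add: map_poly_eq_0_iff)
   thus ?thesis unfolding pform_square using \<open>f k0 ~= 0\<close> by (intro pform_pos[OF nt \<open>k0 < p\<close>]) simp
  qed
  have nn: "0 <= pform (%x. x * (1 - x)) f" by (rule pform_nonneg) (auto intro!: cont)
  have e1: "(%x. x) = (%x::real. (poly [:0, 1:] x)^2 + x * (1 - x))" and
   e2: "(%x. 1 - x) = (%x::real. (poly [:1, -1:] x)^2 + x * (1 - x))" by (auto simp: power2_eq_square algebra_simps)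
  have "pform (%x. x) f = pform (%x. (poly [:0, 1:] x)^2) f + pform (%x. x * (1 - x)) f" by (subst e1, rule pform_add[OF cont(2,3)])
  moreover have "pform (%x. 1 - x) f = pform (%x. (poly [:1, -1:] x)^2) f + pform (%x. x * (1 - x)) f" by (subst e2, rule pform_add[OF cont(2,3)])
  ultimately show ?thesis using sq[of "[:0, 1:]"] sq[of "[:1, -1:]"] nn by simp
 qed
 have nz: "EX k0<p. (\<Sum>i<n. monom (v $ (i * p + k0)) i) ~= 0" if v: "v : Vec (n * p)" "v ~= 0\<^sub>v (n * p)" for v
 proof -
  obtain r where r: "r < n * p" "v $ r ~= 0" using v by (auto simp: vec_eq_iff)
  hence p: "p > 0" by (cases p) auto
  define i k where "i = r div p" and "k = r mod p"
  have ik: "i < n" "k < p" "r = i * p + k" using r p by (auto simp: i_def k_def less_mult_imp_div_less)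
  have "coeff (\<Sum>j<n. monom (v $ (j * p + k)) j) i = v $ r" using ik by (simp add: coeff_sum coeff_monom)
  hence "(\<Sum>j<n. monom (v $ (j * p + k)) j) ~= 0" using r(2) by auto
  thus ?thesis using ik by blast
 qed
 show ?thesis unfolding hank_pos_def pos_def_mat_iff
 proof (intro conjI ballI impI Hh Herm_minus)
  fix v :: "complex vec" assume v: "v : Vec (n * p)" "v ~= 0\<^sub>v (n * p)"
  from nz[OF v] obtain k0 where k0: "k0 < p" "(\<Sum>i<n. monom (v $ (i * p + k0)) i) ~= 0" by (elim exE conjE)
  note K = key[of k0 "%k. \<Sum>i<n. monom (v $ (i * p + k)) i", OF k0]
  show "0 < Re ((?H 1 *v v) .c v)" unfolding hankel_form[OF v(1)] power_one_right by (rule cj1[OF K])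
  have "(?H 0 - ?H 1) *v v = ?H 0 *v v - ?H 1 *v v" by (rule minus_mult_distrib_mat_vec[of _ "n * p" "n * p"]) (use v in simp_all)
  hence "((?H 0 - ?H 1) *v v) .c v = (?H 0 *v v) .c v - (?H 1 *v v) .c v"
   by (simp only:) (rule minus_scalar_prod_distrib[of _ "n * p"], rule mult_mat_vec_carrier[OF HermD(1)[OF Hh] v(1)],
    rule mult_mat_vec_carrier[OF HermD(1)[OF Hh] v(1)], use v(1) in simp)
  hence "Re (((?H 0 - ?H 1) *v v) .c v) = pform (%x. x ^ 0) (%k. \<Sum>i<n. monom (v $ (i * p + k)) i) - pform (%x. x ^ 1) (%k. \<Sum>i<n. monom (v $ (i * p + k)) i)"
   by (simp only: minus_complex.sel hankel_form[OF v(1)])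
  also have "pform (%x. x ^ 0) f = pform (%x. 1 - x) f + pform (%x. x ^ 1) f" for f
  proof -
   have "pform (%x. (1 - x) + x ^ 1) f = pform (%x. 1 - x) f + pform (%x. x ^ 1) f" by (rule pform_add[OF _ cont(1)]) (intro continuous_intros)
   thus ?thesis by simp
  qed
  finally have "Re (((?H 0 - ?H 1) *v v) .c v) = pform (%x. 1 - x) (%k. \<Sum>i<n. monom (v $ (i * p + k)) i)" by linarith
  thus "0 < Re (((?H 0 - ?H 1) *v v) .c v)" using cj2[OF K] by (simp only:)
 qed
qed

end

section \<open>Matrix measures given by densities\<close>

text \<open>A matrix measure presented as the image under \<open>t\<close> of a nonnegative
  Hermitian density on an auxiliary measure space. It is instantiated twice, with discrete spaces:
  for the measure that realizes interior moments and for the spectral measure of a matrix.\<close>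

locale matrix_density =
 fixes p :: nat and \<mu> :: "'w measure" and t :: "'w => real" and h :: "'w => nat => nat => complex" assumes theta [measurable]: "t : bm \<mu>"
  and h_int: "!!k l. k < p ==> l < p ==> integrable \<mu> (%z. h z k l)" and h_herm: "!!z k l. k < p ==> l < p ==> h z k l = cnj (h z l k)"
  and h_nonneg: "!!z v. 0 <= (\<Sum>k<p. \<Sum>l<p. h z k l * v l * cnj (v k))"
begin

definition S :: "real set => cmat" where
 "S A = (if A : sets borel then mat p p (%(k, l). \<integral>z. Ind A (t z) * h z k l \<partial>\<mu>) else 0m p p)"

lemma S_dim [simp]: "nr (S A) = p" "nc (S A) = p" by (simp_all add: S_def)

definition q :: "(nat => complex) => 'w => real" where
 "q v z = Re (\<Sum>k<p. \<Sum>l<p. h z k l * v l * cnj (v k))"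

lemma q_nonneg: "0 <= q v z" using h_nonneg[of z v] by (simp add: q_def less_eq_complex_def)

lemma q_eq: "cx (q v z) = (\<Sum>k<p. \<Sum>l<p. h z k l * v l * cnj (v k))"
 using h_nonneg[of z v] unfolding q_def less_eq_complex_def by (intro complex_eqI) auto

lemma bounded_int: assumes "f : bm borel" "!!z. norm (f (t z)) <= C" "k < p" "l < p" shows "integrable \<mu> (%z. f (t z) * h z k l :: complex)"
proof (rule Bochner_Integration.integrable_bound)
 show "integrable \<mu> (%z. cx C * h z k l)" using h_int[OF assms(3,4)] by simp
 have [measurable]: "(%z. h z k l) : bm \<mu>" using h_int[OF assms(3,4)] by (rule borel_measurable_integrable)
 have [measurable]: "f : bm borel" by fact
 show "(%z. f (t z) * h z k l) : bm \<mu>" by measurable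
 have "norm (f (t z)) <= \<bar>C\<bar>" for z using assms(2)[of z] by linarith
 thus "AE z in \<mu>. norm (f (t z) * h z k l) <= norm (cx C * h z k l)" by (intro AE_I2) (simp add: norm_mult mult_right_mono)
qed

lemma ind_int: assumes "A : sets borel" "k < p" "l < p" shows "integrable \<mu> (%z. Ind A (t z) * h z k l)"
 by (rule bounded_int[of "Ind A" 1]) (use assms in \<open>auto simp: indicator_def\<close>)

lemma q_int: "integrable \<mu> (q v)"
proof -
 have "integrable \<mu> (%z. cx (q v z))" unfolding q_eq by (intro Bochner_Integration.integrable_sum integrable_mult_left h_int) auto
 from integrable_Re[OF this] show ?thesis by simp
qed

lemma quad_S: assumes "A : sets borel" "v : Vec p" shows "(S A *v v) .c v = cx (\<integral>z. Ind A (t z) * q (vec_index v) z \<partial>\<mu>)"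
proof -
 have "(S A *v v) .c v = (\<Sum>k<p. \<Sum>l<p. S A $$ (k, l) * v $ l * cnj (v $ k))" by (rule quad_form_sum) (use assms in simp_all)
 also have "... = (\<Sum>k<p. \<Sum>l<p. \<integral>z. Ind A (t z) * h z k l * v $ l * cnj (v $ k) \<partial>\<mu>)"
  using assms by (intro sum.cong refl) (simp add: S_def)
 also have "... = (\<integral>z. (\<Sum>k<p. \<Sum>l<p. Ind A (t z) * h z k l * v $ l * cnj (v $ k)) \<partial>\<mu>)"
  by (subst Bochner_Integration.integral_sum, (intro Bochner_Integration.integrable_sum integrable_mult_left ind_int assms, auto)[1],
    intro sum.cong refl, subst Bochner_Integration.integral_sum, (intro integrable_mult_left ind_int assms, auto)[1], rule refl)
 also have "... = (\<integral>z. cx (Ind A (t z) * q (vec_index v) z) \<partial>\<mu>)"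
 proof (rule Bochner_Integration.integral_cong[OF refl])
  fix z
  show "(\<Sum>k<p. \<Sum>l<p. Ind A (t z) * h z k l * v $ l * cnj (v $ k)) = cx (Ind A (t z) * q (vec_index v) z)"
   unfolding of_real_mult q_eq by (simp add: sum_dl mult_ac indicator_def)
 qed
 finally show ?thesis by (simp only: integral_complex_of_real)
qed

lemma nonneg_S: "nonneg_def_mat p (S A)"
proof (cases "A : sets borel")
 case True
 have "Herm p (S A)"
 proof (intro HermI eq_matI)
  fix k l assume "k < nr (S A)" "l < nc (S A)"
  hence kl: "k < p" "l < p" by auto
  have "cnj (\<integral>z. Ind A (t z) * h z l k \<partial>\<mu>) = (\<integral>z. cnj (Ind A (t z) * h z l k) \<partial>\<mu>)"
   by (rule Bochner_Integration.integral_cnj[symmetric])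
  also have "... = (\<integral>z. Ind A (t z) * h z k l \<partial>\<mu>)"
   using kl by (intro Bochner_Integration.integral_cong) (auto simp: indicator_def h_herm[OF kl])
  finally show "(S A)^H $$ (k, l) = S A $$ (k, l)" using kl True by (simp add: S_def)
 qed simp_all
 moreover have "0 <= (S A *v v) .c v" if "v : Vec p" for v
  unfolding quad_S[OF True that] by (simp add: less_eq_complex_def q_nonneg integral_nonneg_AE)
 ultimately show ?thesis by (simp add: nonneg_def_mat_def)
next
 case False
 have "0m p p *v v = 0\<^sub>v p" if "v : Vec p" for v :: "complex vec" using that by (intro eq_vecI) auto
 thus ?thesis using False by (auto simp: S_def nonneg_def_mat_def hermitian_zero)
qed

lemma matrix_measure_S: "matrix_measure p S" unfolding matrix_measure_def
proof (intro conjI)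
 show "ALL A. nonneg_def_mat p (S A)" by (simp add: nonneg_S)
 show "ALL A. A \<notin> sets borel --> S A = 0m p p" by (simp add: S_def)
 have "(%n. S (A n) $$ (k, l)) sums (S (\<Union>n. A n) $$ (k, l))"
  if A: "range A <= sets borel" "disjoint_family A" and kl: "k < p" "l < p" for A :: "nat => real set" and k l
 proof -
 have A': "A n : sets borel" "(\<Union>n. A n) : sets borel" for n using A(1) by auto
 have [measurable]: "(%z. h z k l) : bm \<mu>" using h_int[OF kl] by (rule borel_measurable_integrable)
 have [measurable]: "A n : sets borel" for n by (rule A')
 have [measurable]: "(\<Union>n. A n) : sets borel" by (rule A')
 have disj: "i ~= j ==> A i Int A j = {}" for i j using A(2) by (auto simp: disjoint_family_on_def)
 have "(%n. \<integral>z. (\<Sum>i<n. Ind (A i) (t z)) * h z k l \<partial>\<mu>) ----> (\<integral>z. Ind (\<Union>n. A n) (t z) * h z k l \<partial>\<mu>)"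
 proof (rule integral_dominated_convergence[where w = "%z. norm (h z k l)"])
  have s: "(%i. Ind (A i) x :: real) sums Ind (\<Union>n. A n) x" for x by (rule indicator_sums[OF disj])
  have s': "(%i. Ind (A i) x :: complex) sums Ind (\<Union>n. A n) x" for x
  proof -
   have r: "Ind B x = cx (Ind B x)" for B :: "real set" by (simp add: indicator_def)
   show ?thesis unfolding r by (rule sums_of_real[OF s])
  qed
  show "AE z in \<mu>. (%n. (\<Sum>i<n. Ind (A i) (t z)) * h z k l) ----> Ind (\<Union>n. A n) (t z) * h z k l"
   using s' unfolding sums_def by (intro AE_I2 tendsto_mult_right) auto
  fix n
  have "norm (\<Sum>i<n. Ind (A i) x :: complex) <= 1" for x
  proof -
   have "(\<Sum>i<n. Ind (A i) x :: real) <= Ind (\<Union>n. A n) x"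
    using s[of x] sum_le_suminf[of "%i. Ind (A i) x :: real" "{..<n}"] by (auto simp: sums_iff)
   moreover have "(\<Sum>i<n. Ind (A i) x :: complex) = cx (\<Sum>i<n. Ind (A i) x)"
    unfolding of_real_sum by (intro sum.cong) (auto simp: indicator_def)
   moreover have "0 <= (\<Sum>i<n. Ind (A i) x :: real)" by (intro sum_nonneg) auto
   moreover have "Ind (\<Union>n. A n) x <= (1::real)" by (simp add: indicator_def)
   ultimately show ?thesis by (simp only: norm_of_real abs_of_nonneg)
  qed
  thus "AE z in \<mu>. norm ((\<Sum>i<n. Ind (A i) (t z)) * h z k l) <= norm (h z k l)" by (intro AE_I2) (simp add: norm_mult mult_left_le_one_le)
 qed (use h_int[OF kl] in \<open>auto intro!: integrable_norm\<close>)
 moreover have "(\<integral>z. (\<Sum>i<n. Ind (A i) (t z)) * h z k l \<partial>\<mu>) = (\<Sum>i<n. S (A i) $$ (k, l))" for n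
  unfolding sum_distrib_right using kl A' by (subst Bochner_Integration.integral_sum) (auto intro!: ind_int simp: S_def)
 ultimately show ?thesis using kl A' by (simp add: sums_def S_def)
 qed
 thus "ALL A :: nat => real set. range A <= sets borel --> disjoint_family A -->
   (ALL i<p. ALL j<p. (%n. S (A n) $$ (i, j)) sums (S (\<Union>n. A n) $$ (i, j)))" by blast
qed

lemma quad_measure_S: assumes v: "v : Vec p" shows "quad_measure S v = distr (density \<mu> (%z. ennreal (q (vec_index v) z))) borel t" (is "_ = ?D")
proof -
 have qm[measurable]: "q (vec_index v) : bm \<mu>" using q_int by (rule borel_measurable_integrable)
 have "ennreal (Re ((S A *v v) .c v)) = emeasure ?D A" if A[measurable]: "A : sets borel" for A
 proof -
  have i: "integrable \<mu> (%z. Ind A (t z) * q (vec_index v) z)"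
   by (rule Bochner_Integration.integrable_bound[OF q_int[of "vec_index v"]]) (auto simp: indicator_def)
  have "emeasure ?D A = nn \<mu> (%z. ennreal (q (vec_index v) z) * Ind (t -` A Int space \<mu>) z)"
   by (subst emeasure_distr, simp, simp, subst emeasure_density) auto
  also have "... = nn \<mu> (%z. ennreal (Ind A (t z) * q (vec_index v) z))" by (intro nn_cong) (auto simp: indicator_def)
  also have "... = ennreal (\<integral>z. Ind A (t z) * q (vec_index v) z \<partial>\<mu>)"
   by (rule nn_integral_eq_integral[OF i]) (simp add: q_nonneg)
  finally show ?thesis unfolding quad_S[OF A v] by simp
 qed
 hence "quad_measure S v = measure_of UNIV (sets borel) (emeasure ?D)"
  unfolding quad_measure_def by (intro measure_of_eq) (auto simp: sets.sigma_sets_eq[of borel, simplified])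
 also have "... = ?D" using measure_of_of_measure[of ?D] by simp
 finally show ?thesis .
qed

text \<open>The four scalar measures of the polarization have densities with respect to \<mu>, and
  under the integral sign their combination collapses to \<open>h z k l\<close>.\<close>

lemma entry_integral_S: assumes f[measurable]: "f : bm borel" and C: "!!z. norm (f (t z)) <= C" and kl: "k < p" "l < p"
 shows "eint p S k l f = (\<integral>z. f (t z) * h z k l \<partial>\<mu>)"
proof -
 have eq: "(\<integral>x. f x \<partial>quad_measure S (pvec p m k l)) = (\<integral>z. f (t z) * cx (q (vec_index (pvec p m k l)) z) \<partial>\<mu>)" for m
 proof -
  have [measurable]: "q v : bm \<mu>" for v using q_int by (rule borel_measurable_integrable)
  show ?thesis unfolding quad_measure_S[OF pvec_carrier] by (subst integral_distr, simp, simp, subst integral_density)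
     (auto simp: q_nonneg scaleR_conv_of_real mult.commute)
 qed
 have i: "integrable \<mu> (%z. f (t z) * cx (q v z))" for v unfolding q_eq sum_dl mult.assoc[symmetric]
  by (intro Bochner_Integration.integrable_sum integrable_mult_left bounded_int[OF f C]) auto
 have "eint p S k l f = (\<Sum>m<4. \<integral>z. \<i> ^ m * (f (t z) * cx (q (vec_index (pvec p m k l)) z)) \<partial>\<mu>) / 4"
  unfolding entry_integral_pvec eq using i by simp
 also have "... = (\<integral>z. (\<Sum>m<4. \<i> ^ m * (f (t z) * cx (q (vec_index (pvec p m k l)) z))) / 4 \<partial>\<mu>)"
  using i by (subst Bochner_Integration.integral_sum[symmetric]) auto
 also have "... = (\<integral>z. f (t z) * h z k l \<partial>\<mu>)"
 proof (rule Bochner_Integration.integral_cong[OF refl])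
  fix z
  have "(\<Sum>m<4. \<i> ^ m * (f (t z) * cx (q (vec_index (pvec p m k l)) z))) / 4
   = f (t z) * ((\<Sum>m<4. \<i> ^ m * cx (q (vec_index (pvec p m k l)) z)) / 4)" by (simp add: sum_dl mult_ac)
  also have "(\<Sum>m<4. \<i> ^ m * cx (q (vec_index (pvec p m k l)) z)) / 4 = h z k l" unfolding q_eq by (rule polarization[OF kl])
  finally show "(\<Sum>m<4. \<i> ^ m * (f (t z) * cx (q (vec_index (pvec p m k l)) z))) / 4 = f (t z) * h z k l" .
 qed
 finally show ?thesis .
qed

end

section \<open>Interior moment sequences\<close>

lemma hank_cong: assumes "!!j. j <= 2 * n - 1 ==> M j = M' j" shows "hank_pos n p M <-> hank_pos n p M'"
proof -
 have "hankel s n p M = hankel s n p M'" if s: "s <= 1" for s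
 proof (rule eq_matI)
  fix i j assume "i < nr (hankel s n p M')" "j < nc (hankel s n p M')"
  hence ij: "i < n * p" "j < n * p" by auto
  hence "i div p < n" "j div p < n" by (simp_all add: less_mult_imp_div_less)
  hence "M (i div p + j div p + s) = M' (i div p + j div p + s)" using s by (intro assms) linarith
  thus "hankel s n p M $$ (i, j) = hankel s n p M' $$ (i, j)" using ij by (simp add: hankel_def)
 qed simp_all
 thus ?thesis by (simp add: hank_pos_def)
qed

text \<open>A model alone yields a finitely supported measure, and polynomials vanishing on its
  atoms defeat nontriviality. Therefore a small multiple \<open>e\<close> of an auxiliary measure
  with infinitely many atoms is split off first, the remainder is realized by a model, and the two
  are added with weights \<open>1 - e\<close> and \<open>e\<close>.\<close>

lemma hank_pos_interior: assumes H: "hank_pos n p M" and n: "n >= 1" and M: "!!j. M j : Mat p p" "M 0 = 1m p" shows "imom p (2 * n - 1) M"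
proof -
 note [simp] = MatD[OF M(1)]
 \<comment> \<open>The auxiliary probability measure has mass \<open>w k\<close> at
   \<open>1 / (k + 1)\<close>. The masses sum to one, and there are infinitely many atoms, all in
   the unit interval.\<close>
 define w :: "nat => real" where "w k = (1 / 2) ^ Suc k" for k
 define y :: "nat => real" where "y k = 1 / real (Suc k)" for k
 define s where "s j = (\<Sum>k. w k * y k ^ j)" for j
 have w: "0 < w k" "w sums 1" for k using power_half_series by (simp_all add: w_def[abs_def])
 have y: "0 < y k" "y k <= 1" for k by (simp_all add: y_def)
 have y_inj: "inj y" by (rule injI) (simp add: y_def)
 have ys: "(%k. w k * y k ^ j) sums s j" for j
 proof -
  have "summable (%k. w k * y k ^ j)" by (rule summable_comparison_test'[OF sums_summable[OF w(2)], of 0])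
    (use w(1) y in \<open>simp add: abs_mult power_le_one mult_left_le less_imp_le\<close>)
  thus ?thesis unfolding s_def by (rule summable_sums)
 qed
 have s0: "s 0 = 1" using sums_unique2[OF ys[of 0]] w(2) by simp
 define M' where "M' j = cx (s j) .* 1m p" for j
 have M'h: "Herm p (M' j)" for j unfolding M'_def by (rule hermitian_smult[OF hermitian_one])
 from hank_pos_perturb[where M' = M', OF H M(1) M'h] obtain e where e: "0 < e" "e < 1"
  and hp: "hank_pos n p (%j. cx (1 / (1 - e)) .* (M j - cx e .* M' j))" by (elim exE conjE)
 define K where "K j = cx (1 / (1 - e)) .* (M j - cx e .* M' j)" for j
 have K: "K j : Mat p p" for j by (simp add: K_def M'_def)
 have "cx (1 - e) ~= 0" using e by (simp only: of_real_eq_0_iff)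
 hence cK: "cx (1 / (1 - e)) * (1 - cx e) = 1" by simp
 have K0: "K 0 = 1m p" by (rule eq_matI) (use cK in \<open>simp_all add: K_def M'_def M(2) s0\<close>)
 from hank_pos_imp_model[OF hp[folded K_def] n K K0] obtain X V where mod: "is_model n p K X V" by blast
 define N where "N = n * p"
 have X: "in01 N X" and V: "coiso p N V" and KX: "!!j. 1 <= j ==> j <= 2 * n - 1 ==> K j = vmom N V X j"
  using mod unfolding is_model_def N_def by blast+
 from pos_def_spectral[OF cj1[OF X]] obtain U u0 where U: "unitm N U" and u0: "ALL i<N. 0 < u0 i" and XU: "X = U * rdiag N u0 * U^H" by blast
 have "1m N - X = U * rdiag N (%i. 1 + (- 1) * u0 i) * U^H" unfolding spectral_lincomb[OF U, symmetric] XU spectral_one[OF U]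
  by (rule eq_matI) (use unitD[OF U] in \<open>simp_all del: index_mm(1)\<close>)
 hence u1: "u0 i < 1" if "i < N" for i using cj2[OF X] spectral_pd_iff[OF U, of "%i. 1 + (- 1) * u0 i"] that by auto
 define G where "G = V * U"
 have Gc: "G : Mat p N" using coisoD[OF V] unitD[OF U] by (simp add: G_def)
 have vm: "vmom N V X j $$ (k, l) = (\<Sum>r<N. cx (u0 r ^ j) * G $$ (k, r) * cnj (G $$ (l, r)))" if "k < p" "l < p" for j k l
 proof -
  have "vmom N V X j = G * rdiag N (%i. u0 i ^ j) * G^H" unfolding vmom_def XU spectral_mpow[OF U] G_def using coisoD[OF V] unitD[OF U]
   by (simp add: m_assoc)
  thus ?thesis using spectral_entry[OF Gc that] by simp
 qed
 \<comment> \<open>Indices below \<open>N\<close> carry the atoms of the model at its eigenvalues,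
   the remaining indices those of the auxiliary measure.\<close>
 define u where "u t = (if t < N then u0 t else y (t - N))" for t
 define h where "h t k l = (if t < N then cx (1 - e) * (G $$ (k, t) * cnj (G $$ (l, t)))
   else if k = l then cx (e * w (t - N)) else 0)" for t k l
 have u01: "u t : {0..1}" for t using u0 u1 y[of "t - N"] by (auto simp: u_def intro: less_imp_le)
 let ?g = "count_space (UNIV :: nat set)"
 have hq: "(\<Sum>k<p. \<Sum>l<p. h t k l * v l * cnj (v k)) = cx (if t < N then (1 - e) * (cmod (\<Sum>k<p. G $$ (k, t) * cnj (v k)))^2
   else e * w (t - N) * (\<Sum>k<p. (cmod (v k))^2))" for t and v :: "nat => complex"
 proof (cases "t < N")
  case True
  define c where "c = (\<Sum>k<p. G $$ (k, t) * cnj (v k))"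
  have "(\<Sum>k<p. \<Sum>l<p. h t k l * v l * cnj (v k)) = cx (1 - e) * (c * cnj c)" using True by (simp add: h_def c_def sum_product sum_dl mult_ac)
  also have "c * cnj c = cx ((cmod c)^2)" by (rule complex_norm_square[symmetric])
  finally show ?thesis using True by (simp add: c_def)
 next
  case False
  have "(\<Sum>l<p. h t k l * v l * cnj (v k)) = cx (e * w (t - N) * (cmod (v k))^2)" if "k < p" for k
  proof -
   have "(\<Sum>l<p. h t k l * v l * cnj (v k)) = (\<Sum>l<p. if l = k then cx (e * w (t - N)) * v k * cnj (v k) else 0)"
    using False by (intro sum.cong) (auto simp: h_def)
   also have "... = cx (e * w (t - N)) * (v k * cnj (v k))" using that by (simp add: mult_ac)
   also have "v k * cnj (v k) = cx ((cmod (v k))^2)" by (rule complex_norm_square[symmetric])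
   finally show ?thesis by simp
  qed
  thus ?thesis using False by (simp add: sum_dl)
 qed
 have int: "integrable ?g (%t. h t k l)" and
  mom: "(\<integral>t. cx (u t ^ j) * h t k l \<partial>?g) = cx (1 - e) * vmom N V X j $$ (k, l) + cx e * M' j $$ (k, l)"
  if kl: "k < p" "l < p" for k l j
 proof -
  have sm: "summable (%t. norm (cx (u t ^ i) * h t k l))" for i
  proof -
   have "summable (%t. norm (cx (u (t + N) ^ i) * h (t + N) k l))" using summable_mult[OF sums_summable[OF ys[of i]], of e] e w(1) y(1)
    by (cases "k = l") (simp_all add: u_def h_def norm_mult norm_power abs_mult less_imp_le mult_ac)
   thus ?thesis by (subst (asm) summable_iff_shift)
  qed
  from sm[of 0] show "integrable ?g (%t. h t k l)" by (simp add: integrable_count_space_nat_iff)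
  have "(\<integral>t. cx (u t ^ j) * h t k l \<partial>?g) = (\<Sum>t. cx (u t ^ j) * h t k l)"
   using sm[of j] by (intro integral_count_space_nat) (simp add: integrable_count_space_nat_iff)
  also have "... = (\<Sum>t. cx (u (t + N) ^ j) * h (t + N) k l) + (\<Sum>t<N. cx (u t ^ j) * h t k l)"
   by (rule suminf_split_initial_segment[OF summable_norm_cancel[OF sm]])
  also have "(\<Sum>t. cx (u (t + N) ^ j) * h (t + N) k l) = cx e * M' j $$ (k, l)"
  proof (cases "k = l")
   case True
   have "(%t. cx (e * (w t * y t ^ j))) sums cx (e * s j)" by (rule sums_of_real[OF sums_mult[OF ys]])
   moreover have "cx (u (t + N) ^ j) * h (t + N) k l = cx (e * (w t * y t ^ j))" for t using True by (simp add: u_def h_def mult_ac)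
   ultimately have "(%t. cx (u (t + N) ^ j) * h (t + N) k l) sums cx (e * s j)" by (simp only:)
   from sums_unique[OF this] show ?thesis using True kl by (simp add: M'_def)
  qed (use kl in \<open>simp add: h_def M'_def\<close>)
  also have "(\<Sum>t<N. cx (u t ^ j) * h t k l) = cx (1 - e) * vmom N V X j $$ (k, l)"
   unfolding vm[OF kl] sum_dl by (intro sum.cong refl) (simp add: u_def h_def mult_ac)
  finally show "(\<integral>t. cx (u t ^ j) * h t k l \<partial>?g) = cx (1 - e) * vmom N V X j $$ (k, l) + cx e * M' j $$ (k, l)" by simp
 qed
 interpret matrix_density p ?g u h
 proof
  show "h t k l = cnj (h t l k)" for t k l by (auto simp: h_def)
  show "0 <= (\<Sum>k<p. \<Sum>l<p. h t k l * v l * cnj (v k))" for t v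
   unfolding hq using e w(1)[of "t - N"] by (auto simp: less_eq_complex_def intro!: mult_nonneg_nonneg sum_nonneg)
 qed (auto intro: int)
 have vm0: "vmom N V X 0 = 1m p" using coisoD[OF V] by (simp add: vmom_def)
 have KM: "cx (1 - e) * K j $$ (k, l) + cx e * M' j $$ (k, l) = M j $$ (k, l)" if "k < p" "l < p" for j k l
 proof -
  have "cx (1 - e) * K j $$ (k, l) = (cx (1 - e) * cx (1 / (1 - e))) * (M j $$ (k, l) - cx e * M' j $$ (k, l))"
   using that by (simp add: K_def M'_def del: of_real_divide of_real_diff)
  also have "cx (1 - e) * cx (1 / (1 - e)) = 1" using e by (simp flip: of_real_mult)
  finally show ?thesis by simp
 qed
 have momM: "(\<integral>t. cx (u t ^ j) * h t k l \<partial>?g) = M j $$ (k, l)" if "k < p" "l < p" "j <= 2 * n - 1" for j k l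
 proof -
  have "vmom N V X j = K j" using KX[of j] that(3) vm0 K0 by (cases "j = 0") auto
  thus ?thesis using mom[OF that(1,2)] KM[OF that(1,2)] by simp
 qed
 have S1: "S UNIV = 1m p" by (rule eq_matI) (use momM[of _ _ 0] M(2) in \<open>simp_all add: S_def\<close>)
 have S0: "S (- {0..1}) = 0m p p"
 proof (rule eq_matI)
  fix i j assume ij: "i < nr (0m p p :: cmat)" "j < nc (0m p p :: cmat)"
  have "Ind (- {0..1}) (u t) = (0 :: complex)" for t using u01[of t] by (simp add: indicator_def)
  thus "S (- {0..1}) $$ (i, j) = 0m p p $$ (i, j)" using ij by (simp add: S_def)
 qed simp_all
 have nm: "normalized_matrix_measure01 p S" unfolding normalized_matrix_measure01_def using matrix_measure_S S1 S0 by simp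
 have bd: "EX C. ALL t. norm (f (u t)) <= C" if "continuous_on UNIV f" for f :: "real => complex"
  using bnd01_continuous[OF that] u01 unfolding bnd01_def by blast
 have ei: "eint p S k l f = (\<integral>t. f (u t) * h t k l \<partial>?g)" and ii: "integrable ?g (%t. f (u t) * h t k l)"
  if f: "continuous_on UNIV f" and kl: "k < p" "l < p" for f k l
 proof -
  from bd[OF f] obtain C where "!!t. norm (f (u t)) <= C" by blast
  thus "eint p S k l f = (\<integral>t. f (u t) * h t k l \<partial>?g)" "integrable ?g (%t. f (u t) * h t k l)"
   using entry_integral_S[OF borel_measurable_continuous_onI[OF f] _ kl] bounded_int[OF borel_measurable_continuous_onI[OF f] _ kl] by blast+
 qed
 have "ALL j:{1..2 * n - 1}. mmt p S j = M j"
 proof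
  fix j assume j: "j : {1..2 * n - 1}"
  show "mmt p S j = M j"
  proof (rule eq_matI)
   fix k l assume "k < nr (M j)" "l < nc (M j)"
   hence kl: "k < p" "l < p" by auto
   have c: "continuous_on UNIV (%x. cx (x ^ j))" by (intro continuous_intros)
   show "mmt p S j $$ (k, l) = M j $$ (k, l)" using kl j by (simp add: matrix_moment_def ei[OF c kl, simplified] momM[OF kl, simplified])
  qed (simp_all add: matrix_moment_def)
 qed
 moreover have "nontrivial_matrix_measure p S" unfolding nontrivial_matrix_measure_def
 proof (intro ballI impI)
  fix P :: "complex poly mat" assume P: "P : Mat p p" "P ~= 0m p p"
  have dP[simp]: "nr P = p" "nc P = p" using P(1) by auto
  have "EX k i. k < p & i < p & P $$ (k, i) ~= 0"
  proof (rule ccontr)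
   assume "~ ?thesis"
   hence "P = 0m p p" by (intro eq_matI) auto
   thus False using P(2) by simp
  qed
  then obtain k0 i0 where ki: "k0 < p" "i0 < p" "P $$ (k0, i0) ~= 0" by blast
  define f where "f k i x = poly (P $$ (k, i)) (cx x)" for k i x
  have fc: "continuous_on UNIV (%x. cnj (f k i x) * f l i x)" for k l i unfolding f_def by (intro continuous_intros)
  define d where "d t = (\<Sum>i<p. q (%k. f k i (u t)) t)" for t
  have d: "cx (d t) = (\<Sum>i<p. \<Sum>k<p. \<Sum>l<p. (cnj (f k i (u t)) * f l i (u t)) * h t k l)" for t
   unfolding d_def of_real_sum q_eq by (simp add: mult_ac)
  have intd: "integrable ?g (%t. cx (d t))" unfolding d by (intro Bochner_Integration.integrable_sum ii fc) auto
  have "(\<Sum>i<p. matrix_integral p S (%x. mat_adjoint (eval_poly_mat P x)) (eval_poly_mat P) $$ (i, i))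
   = (\<Sum>i<p. \<Sum>k<p. \<Sum>l<p. \<integral>t. (cnj (f k i (u t)) * f l i (u t)) * h t k l \<partial>?g)"
  proof (rule sum.cong[OF refl])
   fix i assume i: "i : {..<p}"
   have "matrix_integral p S (%x. mat_adjoint (eval_poly_mat P x)) (eval_poly_mat P) $$ (i, i)
    = (\<Sum>k<p. \<Sum>l<p. eint p S k l (%x. cnj (f k i x) * f l i x))" using i by (simp add: matrix_integral_def eval_poly_mat_def f_def)
   also have "... = (\<Sum>k<p. \<Sum>l<p. \<integral>t. (cnj (f k i (u t)) * f l i (u t)) * h t k l \<partial>?g)"
    by (intro sum.cong refl ei[OF fc]) auto
   finally show "matrix_integral p S (%x. mat_adjoint (eval_poly_mat P x)) (eval_poly_mat P) $$ (i, i)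
    = (\<Sum>k<p. \<Sum>l<p. \<integral>t. (cnj (f k i (u t)) * f l i (u t)) * h t k l \<partial>?g)" .
  qed
  also have "... = (\<integral>t. cx (d t) \<partial>?g)"
  proof -
   have i3: "integrable ?g (%t. (cnj (f k i (u t)) * f l i (u t)) * h t k l)" if "k : {..<p}" "l : {..<p}" for i k l using that by (intro ii fc) auto
   show ?thesis unfolding d by (subst Bochner_Integration.integral_sum, intro Bochner_Integration.integrable_sum i3, assumption+,
      rule sum.cong[OF refl], subst Bochner_Integration.integral_sum, intro Bochner_Integration.integrable_sum i3, assumption+,
      rule sum.cong[OF refl], subst Bochner_Integration.integral_sum, intro i3, assumption+, rule refl)
  qed
  also have "... = cx (\<integral>t. d t \<partial>?g)" by (simp only: integral_complex_of_real)
  finally have eq: "(\<Sum>i<p. matrix_integral p S (%x. mat_adjoint (eval_poly_mat P x)) (eval_poly_mat P) $$ (i, i)) = cx (\<integral>t. d t \<partial>?g)" .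
  \<comment> \<open>A nonzero polynomial entry has finitely many roots, so it is nonzero at some
    atom of the auxiliary measure, and that atom alone makes the trace positive.\<close>
  have "finite {z. poly (P $$ (k0, i0)) z = 0}" by (rule poly_roots_finite[OF ki(3)])
  hence "finite ((%k. cx (y k)) -` {z. poly (P $$ (k0, i0)) z = 0})" by (rule finite_vimageI) (use y_inj in \<open>auto simp: inj_def\<close>)
  hence "EX k. k \<notin> (%k. cx (y k)) -` {z. poly (P $$ (k0, i0)) z = 0}" by (rule ex_new_if_finite[OF infinite_UNIV_nat])
  then obtain k1 where k1: "f k0 i0 (y k1) ~= 0" by (auto simp: f_def)
  have "0 < q (%k. f k i0 (u (N + k1))) (N + k1)"
  proof -
   have "0 < (\<Sum>k<p. (cmod (f k i0 (y k1)))^2)" by (rule sum_pos2[of _ k0]) (use ki k1 in auto)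
   moreover have "q (%k. f k i0 (u (N + k1))) (N + k1) = e * w k1 * (\<Sum>k<p. (cmod (f k i0 (y k1)))^2)" unfolding q_def hq by (simp add: u_def)
   ultimately show ?thesis using e w(1)[of k1] by simp
  qed
  hence pos: "0 < d (N + k1)" unfolding d_def by (intro sum_pos2[of _ i0]) (use ki q_nonneg in auto)
  have intd': "integrable ?g d" using integrable_Re[OF intd] by simp
  have sm: "summable d" using intd' summable_norm_cancel[of d] by (simp add: integrable_count_space_nat_iff)
  have nn: "0 <= d t" for t unfolding d_def by (intro sum_nonneg q_nonneg)
  have "0 < suminf d" by (rule suminf_pos2[OF sm nn pos])
  moreover have "(\<integral>t. d t \<partial>?g) = suminf d" by (rule integral_count_space_nat[OF intd'])
  ultimately show "0 < (\<Sum>i<p. matrix_integral p S (%x. mat_adjoint (eval_poly_mat P x)) (eval_poly_mat P) $$ (i, i))"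
   unfolding eq by (simp add: less_complex_def)
 qed
 ultimately show ?thesis unfolding interior_moments_def using nm by blast
qed

lemma interior_hank_pos: assumes I: "imom p (2 * n - 1) M" and M: "M 0 = 1m p" shows "hank_pos n p M"
proof -
 from I obtain w where S: "normalized_matrix_measure01 p w" "nontrivial_matrix_measure p w"
  "ALL j:{1..2 * n - 1}. mmt p w j = M j" unfolding interior_moments_def by blast
 interpret matrix_measure01 p w by unfold_locales (rule S)
 have "M j = mmt p w j" if "j <= 2 * n - 1" for j using S(3) that M moment_0 by (cases "j = 0") auto
 from hank_cong[OF this] nontrivial_imp_hank_pos[OF S(2)] show ?thesis by simp
qed

lemma interior_odd_iff: assumes "n >= 1" "!!j. M j : Mat p p" "M 0 = 1m p" shows "imom p (2 * n - 1) M <-> hank_pos n p M"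
 using interior_hank_pos hank_pos_interior assms by blast

lemma interior_moment_hermitian:
 "imom p k M ==> 1 <= j ==> j <= k ==> Herm p (M j)"
proof -
 assume "imom p k M" and j: "1 <= j" "j <= k"
 then obtain w where S: "normalized_matrix_measure01 p w" "ALL j:{1..k}. mmt p w j = M j" unfolding interior_moments_def by blast
 interpret matrix_measure01 p w by unfold_locales (rule S)
 show ?thesis using moment_hermitian[of j] S(2) j by simp
qed

lemma interior_cong: "(!!j. 1 <= j ==> j <= k ==> M j = M' j) ==> imom p k M <-> imom p k M'" unfolding interior_moments_def by simp

text \<open>Hankel positivity describes odd numbers of moments; the even case is reduced to it by
  adjoining one further moment.\<close>

lemma interior_next:
 "imom p k M <-> (EX H:Mat p p. imom p (Suc k) (M(Suc k := H)))"
proof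
 assume "imom p k M"
 then obtain w where S: "normalized_matrix_measure01 p w" "nontrivial_matrix_measure p w" "ALL j:{1..k}. mmt p w j = M j"
  unfolding interior_moments_def by blast
 have "imom p (Suc k) (M(Suc k := mmt p w (Suc k)))" unfolding interior_moments_def by (rule exI[of _ w]) (use S in auto)
 thus "EX H:Mat p p. imom p (Suc k) (M(Suc k := H))" by (rule bexI) (simp add: matrix_moment_def)
next
 assume "EX H:Mat p p. imom p (Suc k) (M(Suc k := H))"
 then obtain H w where S: "normalized_matrix_measure01 p w" "nontrivial_matrix_measure p w" "ALL j:{1..Suc k}. mmt p w j = (M(Suc k := H)) j"
  unfolding interior_moments_def by blast
 show "imom p k M" unfolding interior_moments_def by (rule exI[of _ w]) (use S in auto)
qed

text \<open>Existence of some nontrivial normalized measure. A sequence with first moment one half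
  passes the Hankel test for \<open>n = 1\<close>.\<close>

lemma interior_0: "imom p 0 M"
proof -
 define K :: "nat => cmat" where "K j = (if j = 0 then 1m p else if j = 1 then cx (1 / 2) .* 1m p else 0m p p)" for j
 have K: "K j : Mat p p" "K 0 = 1m p" for j by (simp_all add: K_def)
 have "1m p - K 1 = cx (1 / 2) .* 1m p" by (rule eq_matI) (simp_all add: K_def)
 hence "in01 p (K 1)" using pos_def_smult[OF pd_one, of "1 / 2"] by (simp add: K_def)
 moreover have "hankel 1 1 p K = K 1" "hankel 0 1 p K = 1m p" by (rule eq_matI; simp add: hankel_def K_def)+
 ultimately have "hank_pos 1 p K" unfolding hank_pos_def by simp
 from hank_pos_interior[OF this _ K] have "imom p 1 K" by simp
 thus ?thesis unfolding interior_moments_def by auto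
qed

lemma interior_1_iff: assumes "!!j. M j : Mat p p" "M 0 = 1m p" shows "imom p 1 M <-> in01 p (M 1)"
proof -
 have "hankel 1 1 p M = M 1" "hankel 0 1 p M = 1m p" by (rule eq_matI; use MatD[OF assms(1)] assms(2) in \<open>simp add: hankel_def\<close>)+
 thus ?thesis using interior_odd_iff[of 1 M p] assms by (simp add: hank_pos_def)
qed

declare One_nat_def [simp del] add_2_eq_Suc' [simp del]

lemma wmat_cong: "M 1 = M' 1 ==> M 2 = M' 2 ==> wmat p M = wmat p M'" by (simp add: wmat_def)

lemma mtil_cong: assumes "!!i. i <= j + 2 ==> M i = M' i" shows "mtil p M j = mtil p M' j" using assms
proof (induction j rule: less_induct)
 case (less j)
 have e: "wmat p M = wmat p M'" "M 1 = M' 1" using less.prems by (auto intro!: wmat_cong)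
 have "(%i. if i < j then mtil p M i else 0m p p) = (%i. if i < j then mtil p M' i else 0m p p)" using less by (intro ext) auto
 thus ?case unfolding mtil.simps[of p M j] mtil.simps[of p M' j] e using less.prems by simp
qed

text \<open>The part of \<open>M (k + 2)\<close> already determined by the earlier moments, obtained
  by inserting zero for the peeled moment of order \<open>k\<close>. As a constant the name is
  unrelated to the type of complex matrices.\<close>

definition cmat :: "nat => (nat => cmat) => nat => cmat" where
 "cmat p M k = Phi p (M 1) (wmat p M) (%i. if i < k then mtil p M i else 0m p p) (k + 2)"

lemma mtil_step:
 "k >= 1 ==> mtil p M k = dinv p (M 1) (wmat p M) * (M (k + 2) - cmat p M k) * (dinv p (M 1) (wmat p M))^H" by (subst mtil.simps) (simp add: cmat_def)

lemma cmat_cong: "k >= 1 ==> (!!i. i < k + 2 ==> M i = M' i) ==> cmat p M k = cmat p M' k"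
proof -
 assume k: "k >= 1" and h: "!!i. i < k + 2 ==> M i = M' i"
 have e: "wmat p M = wmat p M'" "M 1 = M' 1" using k h by (auto intro!: wmat_cong)
 have "(%i. if i < k then mtil p M i else 0m p p) = (%i. if i < k then mtil p M' i else 0m p p)" using h by (intro ext) (auto intro!: mtil_cong)
 thus ?thesis by (simp add: cmat_def e)
qed

lemma cmat_dim: assumes "in01 p (M 1)" "in01 p (wmat p M)" shows "nr (cmat p M k) = p" "nc (cmat p M k) = p"
 using phi_dim[OF assms, of "%i. if i < k then mtil p M i else 0m p p"] mtil_dim[of p M, OF assms] unfolding cmat_def by auto

lemma moment_from_mtil: assumes A: "in01 p (M 1)" and W: "in01 p (wmat p M)" and k: "k >= 1" and M: "M (k + 2) : Mat p p"
 shows "M (k + 2) = cmat p M k + dmat p (M 1) (wmat p M) * mtil p M k * (dmat p (M 1) (wmat p M))^H"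
proof -
 let ?a = "dmat p (M 1) (wmat p M)"
 note D = dinv_props[OF A W]
 note [simp] = D(1-4) cmat_dim[OF A W] MatD[OF M]
 have "(dinv p (M 1) (wmat p M))^H * ?a^H = (dmat p (M 1) (wmat p M) * dinv p (M 1) (wmat p M))^H" by simp
 hence d: "(dinv p (M 1) (wmat p M))^H * ?a^H = 1m p" by (simp only: D(6) adjoint_one)
 have "dmat p (M 1) (wmat p M) * mtil p M k * ?a^H = M (k + 2) - cmat p M k" unfolding mtil_step[OF k] by (simp add: m_assoc m_cancel[OF D(6)] d)
 thus ?thesis by simp
qed

text \<open>By this the next peeled moment can be prescribed at will while all earlier ones stay
  fixed.\<close>

lemma mtil_upd: assumes A: "in01 p (M 1)" and W: "in01 p (wmat p M)" and k: "k >= 1" and H: "H : Mat p p"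
 shows "mtil p (M(k + 2 := cmat p M k + dmat p (M 1) (wmat p M) * H * (dmat p (M 1) (wmat p M))^H)) k = H"
proof -
 let ?a = "dmat p (M 1) (wmat p M)"
 let ?b = "dinv p (M 1) (wmat p M)"
 note D = dinv_props[OF A W]
 note [simp] = D(1-4) cmat_dim[OF A W] MatD[OF H]
 define T where "T = dmat p (M 1) (wmat p M) * H * ?a^H"
 define M' where "M' = M(k + 2 := cmat p M k + T)"
 have e: "cmat p M' k = cmat p M k" "M' 1 = M 1" "wmat p M' = wmat p M" using k by (auto simp: M'_def intro!: cmat_cong wmat_cong)
 have "?a^H * ?b^H = (dinv p (M 1) (wmat p M) * dmat p (M 1) (wmat p M))^H" by simp
 hence d: "?a^H * ?b^H = 1m p" by (simp only: D(5) adjoint_one)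
 have "M' (k + 2) - cmat p M' k = T" unfolding e(1) by (simp add: M'_def T_def)
 hence "mtil p M' k = dinv p (M 1) (wmat p M) * T * ?b^H" unfolding mtil_step[OF k] e by simp
 also have "... = H" by (simp add: T_def m_assoc m_cancel[OF D(5)] d)
 finally show ?thesis unfolding M'_def T_def .
qed

lemma interior_odd_step: assumes "n >= 1" "!!j. M j : Mat p p" "M 0 = 1m p"
 shows "imom p (2 * n + 1) M <-> in01 p (M 1) & in01 p (wmat p M) & imom p (2 * n - 1) (mtil p M)"
proof -
 have "imom p (2 * n + 1) M <-> hank_pos (n + 1) p M"
 proof -
  have e: "2 * (n + 1) - 1 = 2 * n + 1" "1 <= n + 1" by simp_all
  show ?thesis using interior_odd_iff[of "n + 1" M p, OF e(2) assms(2,3)] unfolding e .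
 qed
 also have "... <-> in01 p (M 1) & in01 p (wmat p M) & hank_pos n p (mtil p M)" by (rule hank_pos_Suc[where n = n and M = M and p = p, OF assms])
 also have "... <-> in01 p (M 1) & in01 p (wmat p M) & imom p (2 * n - 1) (mtil p M)"
  using interior_odd_iff[of n "mtil p M" p] assms(1) mtil_dim[of p M] by (auto simp: mtil.simps[of p M 0])
 finally show ?thesis .
qed

text \<open>Odd \<open>k\<close> is the Hankel statement. For even \<open>k\<close> a further moment
  is adjoined on either side, and \<open>mtil_upd\<close> translates the adjoined peeled moment into
  a moment of the original sequence.\<close>

lemma interior_step: assumes M: "!!j. M j : Mat p p" "M 0 = 1m p" shows "imom p (k + 2) M <-> in01 p (M 1) & in01 p (wmat p M) & imom p k (mtil p M)"
proof (cases "odd k")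
 case True
 then obtain j where "k = 2 * j + 1" by (elim oddE)
 hence e: "2 * (j + 1) + 1 = k + 2" "2 * (j + 1) - 1 = k" "1 <= j + 1" by simp_all
 show ?thesis using interior_odd_step[of "j + 1" M p, OF e(3) M] unfolding e .
next
 case False
 hence "even k" by simp
 then obtain j where k: "k = 2 * j" by (elim evenE)
 have st: "imom p (Suc (k + 2)) (M(Suc (k + 2) := H)) <-> in01 p (M 1) & in01 p (wmat p M) & imom p (Suc k) (mtil p (M(Suc (k + 2) := H)))"
  if "H : Mat p p" for H
 proof -
  have "wmat p (M(Suc (k + 2) := H)) = wmat p M" by (rule wmat_cong) auto
  moreover have "(M(Suc (k + 2) := H)) i : Mat p p" for i using M(1) that by simp
  moreover have e: "2 * (j + 1) + 1 = Suc (k + 2)" "2 * (j + 1) - 1 = Suc k" "1 <= j + 1" using k by simp_all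
  ultimately show ?thesis using interior_odd_step[of "j + 1" "M(Suc (k + 2) := H)" p] M(2) unfolding e by simp
 qed
 have mt: "mtil p (M(Suc (k + 2) := H)) i = mtil p M i" if "i <= k" for i H by (rule mtil_cong) (use that in auto)
 show ?thesis
 proof
  assume "imom p (k + 2) M"
  then obtain H where H: "H : Mat p p" "imom p (Suc (k + 2)) (M(Suc (k + 2) := H))" using iffD1[OF interior_next] by blast
  hence s: "in01 p (M 1)" "in01 p (wmat p M)" "imom p (Suc k) (mtil p (M(Suc (k + 2) := H)))" using st by blast+
  have "imom p k (mtil p (M(Suc (k + 2) := H)))" using s(3) unfolding interior_moments_def by auto
  thus "in01 p (M 1) & in01 p (wmat p M) & imom p k (mtil p M)" using s interior_cong[of k "mtil p (M(Suc (k + 2) := H))" "mtil p M" p] mt by blast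
 next
  assume s: "in01 p (M 1) & in01 p (wmat p M) & imom p k (mtil p M)"
  then obtain H where H: "H : Mat p p" "imom p (Suc k) ((mtil p M)(Suc k := H))" using iffD1[OF interior_next] by blast
  define C where "C = cmat p M (Suc k) + dmat p (M 1) (wmat p M) * H * (dmat p (M 1) (wmat p M))^H"
  have A: "in01 p (M 1)" and W: "in01 p (wmat p M)" using s by blast+
  have C: "C : Mat p p" using cmat_dim[of p M "Suc k", OF A W] dinv_props(3,4)[OF A W] by (simp add: C_def)
  have "mtil p (M(Suc (k + 2) := C)) (Suc k) = H" unfolding C_def using mtil_upd[of p M "Suc k" H, OF A W _ H(1)] by simp
  hence "mtil p (M(Suc (k + 2) := C)) i = ((mtil p M)(Suc k := H)) i" if "i <= Suc k" for i using mt[of i C] that by (cases "i = Suc k") auto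
  hence "imom p (Suc k) (mtil p (M(Suc (k + 2) := C)))"
   using H(2) interior_cong[of "Suc k" "mtil p (M(Suc (k + 2) := C))" "(mtil p M)(Suc k := H)" p] by blast
  hence "imom p (Suc (k + 2)) (M(Suc (k + 2) := C))" using st[OF C] A W by blast
  thus "imom p (k + 2) M" using iffD2[OF interior_next] C by blast
 qed
qed

declare One_nat_def [simp] add_2_eq_Suc' [simp]

section \<open>Canonical moments\<close>

lemma nonneg_form_limit: assumes D: "D : Mat p p" and P: "P : Mat p p" and v: "v : Vec p" and pd: "!!t. 0 < t ==> t < 1 ==> pdm p (D + cx t .* P)"
 shows "0 <= Re ((D *v v) .c v)"
proof (rule tendsto_lowerbound)
 have e: "Re (((D + cx t .* P) *v v) .c v) = Re ((D *v v) .c v) + t * Re ((P *v v) .c v)" for t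
  by (subst quad_form_sum[of _ p], use D P v in simp, use v in simp, subst quad_form_sum[OF D v], subst quad_form_sum[OF P v])
   (use D P in \<open>simp add: algebra_simps sum.distrib sum_dl\<close>)
 show "(%n. Re ((D *v v) .c v) + 1 / real (Suc (Suc n)) * Re ((P *v v) .c v)) ----> Re ((D *v v) .c v)"
  using tendsto_add[OF tendsto_const tendsto_mult_left_zero[OF lim_inverse_n'[THEN LIMSEQ_Suc, THEN LIMSEQ_Suc]]] by simp
 show "\<forall>\<^sub>F n in sequentially. 0 <= Re ((D *v v) .c v) + 1 / real (Suc (Suc n)) * Re ((P *v v) .c v)"
  unfolding e[symmetric] by (intro always_eventually allI pos_def_nonneg[OF pd v]) auto
qed simp

lemma form_zero: assumes A: "Herm p A" and B: "Herm p B"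
  and z: "!!v. v : Vec p ==> 0 <= Re (((A - B) *v v) .c v)" "!!v. v : Vec p ==> 0 <= Re (((B - A) *v v) .c v)" shows "A = B"
proof -
 note [simp] = HermD(3,4)[OF A] HermD(3,4)[OF B]
 have H: "Herm p (A - B)" by (rule Herm_minus[OF A B])
 have 0: "((A - B) *v v) .c v = 0" if v: "v : Vec p" for v
 proof -
  have "Re (((B - A) *v v) .c v) = - Re (((A - B) *v v) .c v)"
   by (subst quad_form_sum[of _ p], simp, use v in simp, subst quad_form_sum[of _ p], simp, use v in simp)
    (simp add: sum_negf[symmetric] algebra_simps)
  thus ?thesis using z[OF v] cinner_hermitian_real[OF H v] by (simp add: complex_eq_iff)
 qed
 have "(A - B) $$ (k, l) = 0" if "k < p" "l < p" for k l using polarization[OF that, of "%i j. (A - B) $$ (i, j)"] 0[OF pvec_carrier]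
   quad_form_sum[OF HermD(1)[OF H] pvec_carrier] by simp
 thus ?thesis by (intro eq_matI) auto
qed

text \<open>The open segment from \<open>L\<close> to \<open>U\<close> lies in the first interval,
  hence in the second. Letting it run to its ends gives \<open>L' \<le> L\<close> and
  \<open>U \<le> U'\<close> as quadratic forms, and the situation is symmetric. This makes the
  definite descriptions of the moment bounds meaningful.\<close>

lemma loewner_interval_unique: assumes LU: "lwl p L U" and LU': "lwl p L' U'" and eq: "!!H. lwl p L H & lwl p H U <-> lwl p L' H & lwl p H U'"
 shows "L = L' & U = U'"
proof -
 have half: "0 <= Re (((L - L') *v v) .c v) & 0 <= Re (((U' - U) *v v) .c v)" if LU: "lwl p L U" and LU': "lwl p L' U'"
   and eq: "ALL H. lwl p L H & lwl p H U --> lwl p L' H & lwl p H U'" and v: "v : Vec p" for L U L' U' v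
 proof -
  have h: "Herm p L" "Herm p U" "Herm p L'" "Herm p U'" and pd: "pdm p (U - L)" using LU LU' by (auto simp: loewner_less_def)
  note [simp] = HermD(3,4)[OF h(1)] HermD(3,4)[OF h(2)] HermD(3,4)[OF h(3)] HermD(3,4)[OF h(4)]
  define H where "H t = L + cx t .* (U - L)" for t
  have Hh: "Herm p (H t)" for t unfolding H_def by (intro hermitian_add hermitian_smult Herm_minus h)
  have "lwl p L' (H t) & lwl p (H t) U'" if t: "0 < t" "t < 1" for t
  proof (rule eq[rule_format])
   have "H t - L = cx t .* (U - L)" "U - H t = cx (1 - t) .* (U - L)" by (rule eq_matI; simp add: H_def algebra_simps)+
   thus "lwl p L (H t) & lwl p (H t) U" using pos_def_smult[OF pd, of t] pos_def_smult[OF pd, of "1 - t"] t h Hh by (simp add: loewner_less_def)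
  qed
  hence 1: "pdm p (H t - L')" "pdm p (U' - H t)" if "0 < t" "t < 1" for t using that by (auto simp: loewner_less_def)
  have e: "H t - L' = (L - L') + cx t .* (U - L)" "U' - H (1 - t) = (U' - U) + cx t .* (U - L)" for t
   by (rule eq_matI; simp add: H_def algebra_simps)+
  show ?thesis
  proof
   show "0 <= Re (((L - L') *v v) .c v)" by (rule nonneg_form_limit[of _ p "U - L"]) (use v 1(1) in \<open>simp_all flip: e(1)\<close>)
   show "0 <= Re (((U' - U) *v v) .c v)" by (rule nonneg_form_limit[of _ p "U - L"]) (use v 1(2)[of "1 - _"] in \<open>simp_all flip: e(2)\<close>)
  qed
 qed
 have h: "Herm p L" "Herm p U" "Herm p L'" "Herm p U'" using LU LU' by (auto simp: loewner_less_def)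
 have e1: "ALL H. lwl p L H & lwl p H U --> lwl p L' H & lwl p H U'"
  and e2: "ALL H. lwl p L' H & lwl p H U' --> lwl p L H & lwl p H U" using eq by blast+
 note a = half[OF LU LU' e1] and b = half[OF LU' LU e2]
 show ?thesis by (intro conjI form_zero[OF h(1,3)] form_zero[OF h(2,4)] cj1[OF a] cj2[OF a] cj1[OF b] cj2[OF b])
qed

lemma moment_bounds_unique:
 "mbd p k M L U ==> mbd p k M L' U' ==> L = L' & U = U'" unfolding moment_bounds_def by (elim conjE, rule loewner_interval_unique) blast+

lemma moment_lower_upper: assumes "mbd p k M L U" shows "moment_lower p k M = L" "moment_upper p k M = U"
 unfolding moment_lower_def moment_upper_def using assms moment_bounds_unique by (blast intro: the_equality)+

lemma bounds_interior: "mbd p (Suc k) M L U ==> imom p k M" by (simp add: moment_bounds_def)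

text \<open>Moments of measures on the unit interval are Hermitian, so only Hermitian candidates
  have to be tested.\<close>

lemma moment_boundsI: assumes "imom p (k - 1) M" "lwl p L U" "k >= 1"
  "!!H. Herm p H ==> imom p k (M(k := H)) <-> pdm p (H - L) & pdm p (U - H)" shows "mbd p k M L U"
proof -
 have "imom p k (M(k := H)) <-> lwl p L H & lwl p H U" for H
 proof (cases "Herm p H")
  case True
  thus ?thesis using assms(2) assms(4)[OF True] by (auto simp: loewner_less_def)
 next
  case False
  thus ?thesis using interior_moment_hermitian[of p k "M(k := H)" k] assms(3) by (auto simp: loewner_less_def)
 qed
 thus ?thesis using assms(1,2) unfolding moment_bounds_def by blast
qed

declare One_nat_def [simp del] add_2_eq_Suc' [simp del]

lemma moment_bounds_1: assumes M: "!!j. M j : Mat p p" "M 0 = 1m p" shows "mbd p 1 M (0m p p) (1m p)"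
proof (rule moment_boundsI)
 show "imom p (1 - 1) M" by (simp add: interior_0)
 have "(1m p :: cmat) - 0m p p = 1m p" by (rule eq_matI) auto
 thus "lwl p (0m p p) (1m p)" by (simp add: loewner_less_def hermitian_zero hermitian_one pd_one)
 fix H assume H: "Herm p H"
 have "(M(1 := H)) j : Mat p p" for j using M(1) HermD[OF H] by simp
 hence "imom p 1 (M(1 := H)) <-> in01 p H" using interior_1_iff[of "M(1 := H)" p] M(2) by simp
 moreover have "H - 0m p p = H" using HermD[OF H] by simp
 ultimately show "imom p 1 (M(1 := H)) <-> pdm p (H - 0m p p) & pdm p (1m p - H)" by simp
qed simp

text \<open>By peeling, the condition on the second moment is \<open>0 < W < 1\<close> for
  \<open>W = wmat\<close>; undoing the congruence by the inverse root of \<open>A * (1 - A)\<close>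
  turns it into an interval for the moment itself.\<close>

lemma moment_bounds_2: assumes M: "!!j. M j : Mat p p" "M 0 = 1m p" and A: "in01 p (M 1)" shows "mbd p 2 M (M 1 * M 1) (M 1)"
proof (rule moment_boundsI)
 note [simp] = pd_dims(2-4)[OF cj1[OF A]]
 show "imom p (2 - 1) M" using interior_1_iff[of M p] M A by (simp add: One_nat_def)
 have R: "M 1 - M 1 * M 1 = M 1 * (1m p - M 1)" by (simp add: m_distrib)
 have hA: "Herm p (M 1 * M 1)" by (rule HermI) simp_all
 show "lwl p (M 1 * M 1) (M 1)" unfolding loewner_less_def R using hA pd_herm[OF cj1[OF A]] range_pd[OF A] by blast
 fix H assume H: "Herm p H"
 note [simp] = HermD(2-4)[OF H]
 define S where "S = isqrt p (M 1 * (1m p - M 1))"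
 note S = isqrt_pd[OF range_pd[OF A], folded S_def]
 note rs = rsq_isqrt[OF A, folded S_def]
 note [simp] = pd_dims(2-4)[OF S] pd_dims(2-4)[OF rsq_pd[OF A]]
 have M': "(M(2 := H)) j : Mat p p" for j using M(1) HermD[OF H] by simp
 have W0: "wmat p (M(2 := H)) = S * (H - M 1 * M 1) * S" by (simp add: wmat_def Let_def S_def)
 have W: "wmat p (M(2 := H)) = S * (H - M 1 * M 1) * S^H" by (simp only: W0 pd_dims(2)[OF S])
 have W1: "1m p - wmat p (M(2 := H)) = S * (M 1 - H) * S^H"
 proof -
  have "S * (M 1 * (1m p - M 1)) * S = 1m p" unfolding S_def by (rule inv_sqrt_cancel[OF range_pd[OF A]])
  hence "1m p - wmat p (M(2 := H)) = S * (M 1 - M 1 * M 1) * S - S * (H - M 1 * M 1) * S" unfolding W R by simp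
  also have "... = S * (M 1 - H) * S^H" by (simp add: m_distrib) (intro eq_matI, simp_all del: index_mm(1))
  finally show ?thesis .
 qed
 have cg: "pdm p (S * Q * S^H) <-> pdm p Q" if "Q : Mat p p" for Q by (rule pd_congr_iff[OF that _ _ rs(2)]) simp_all
 have "imom p 2 (M(2 := H)) <-> in01 p (wmat p (M(2 := H)))" using interior_step[of "M(2 := H)" p 0, OF M'] M(2) A interior_0 by simp
 thus "imom p 2 (M(2 := H)) <-> pdm p (H - M 1 * M 1) & pdm p (M 1 - H)"
  unfolding W1 unfolding W using cg[of "H - M 1 * M 1"] cg[of "M 1 - H"] by simp
qed simp

text \<open>The moment of order \<open>k + 2\<close> is \<open>cmat\<close> plus the congruence by
  \<open>D\<close> of the peeled moment of order \<open>k\<close>. An invertible congruence and a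
  Hermitian shift preserve the Loewner order in both directions, so one interval is mapped onto the
  other.\<close>

lemma moment_bounds_step: assumes M: "!!j. M j : Mat p p" "M 0 = 1m p" and A: "in01 p (M 1)" and W: "in01 p (wmat p M)" and k: "k >= 1"
  and B: "mbd p k (mtil p M) L U"
 defines "D == dmat p (M 1) (wmat p M)" shows "mbd p (k + 2) M (cmat p M k + D * L * D^H) (cmat p M k + D * U * D^H)"
proof -
 define C where "C = cmat p M k"
 define E where "E = dinv p (M 1) (wmat p M)"
 note D = dinv_props[OF A W, folded D_def E_def]
 have LU: "lwl p L U" and I: "imom p (k - 1) (mtil p M)" and H': "!!H. imom p k ((mtil p M)(k := H)) <-> lwl p L H & lwl p H U"
  using B unfolding moment_bounds_def by blast+
 have h: "Herm p L" "Herm p U" and pd: "pdm p (U - L)" using LU by (auto simp: loewner_less_def)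
 note [simp] = D(1-4) HermD(2-4)[OF h(1)] HermD(2-4)[OF h(2)] cmat_dim[OF A W, of k, folded C_def]
 have key: "imom p (k + 2) (M(k + 2 := C + D * G * D^H)) <-> lwl p L G & lwl p G U" if G: "G : Mat p p" for G
 proof -
  note [simp] = MatD[OF G]
  define M' where "M' = M(k + 2 := C + D * G * D^H)"
  have M': "M' j : Mat p p" "M' 0 = 1m p" "M' 1 = M 1" "wmat p M' = wmat p M" for j using M k by (auto simp: M'_def intro!: wmat_cong)
  have mt: "mtil p M' i = ((mtil p M)(k := G)) i" if "i <= k" for i
  proof (cases "i = k")
   case True
   thus ?thesis using mtil_upd[OF A W k G] unfolding M'_def C_def D_def by simp
  next
   case False
   thus ?thesis using that by (auto simp: M'_def intro!: mtil_cong)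
  qed
  have "imom p (k + 2) M' <-> imom p k (mtil p M')" using interior_step[of M' p k, OF M'(1,2)] A W unfolding M'(3,4) by blast
  also have "... <-> imom p k ((mtil p M)(k := G))" by (rule interior_cong) (rule mt)
  finally show ?thesis unfolding H' M'_def .
 qed
 \<comment> \<open>The symmetry of \<open>C\<close> is inferred from attainability: the midpoint of
   \<open>L\<close> and \<open>U\<close> corresponds to an attained moment, which is Hermitian, and
   subtracting its congruence part leaves \<open>C\<close>.\<close>
 have Ch: "Herm p C"
 proof -
  define G where "G = L + cx (1 / 2) .* (U - L)"
  have Gh: "Herm p G" unfolding G_def by (intro hermitian_add hermitian_smult Herm_minus h)
  note [simp] = HermD(2-4)[OF Gh]
  have "G - L = cx (1 / 2) .* (U - L)" "U - G = cx (1 / 2) .* (U - L)" by (rule eq_matI; simp add: G_def algebra_simps)+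
  hence "lwl p L G & lwl p G U" using pos_def_smult[OF pd, of "1 / 2"] h Gh by (simp add: loewner_less_def)
  hence "imom p (k + 2) (M(k + 2 := C + D * G * D^H))" using key[of G] HermD(1)[OF Gh] by blast
  from interior_moment_hermitian[OF this, of "k + 2"] have "Herm p (C + D * G * D^H)" by simp
  from Herm_minus[OF this Herm_congr[OF Gh, of D p]] show ?thesis by simp
 qed
 note [simp] = HermD(2-4)[OF Ch]
 have cg: "pdm p (D * Q * D^H) <-> pdm p Q" if "Q : Mat p p" for Q by (rule pd_congr_iff[OF that _ _ D(6)]) simp_all
 have df: "C + D * X * D^H - (C + D * Y * D^H) = D * (X - Y) * D^H" if "X : Mat p p" "Y : Mat p p" for X Y
  using that by (simp add: m_distrib) (intro eq_matI, simp_all del: index_mm(1))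
 have "E^H * D^H = (D * E)^H" by simp
 hence ED: "E^H * D^H = 1m p" unfolding D(6) by simp
 show ?thesis unfolding C_def[symmetric]
 proof (rule moment_boundsI)
  have "k + 2 - 1 = (k - 1) + 2" using k by simp
  thus "imom p (k + 2 - 1) M" using interior_step[of M p "k - 1", OF M] A W I by simp
  show "lwl p (C + D * L * D^H) (C + D * U * D^H)"
   unfolding loewner_less_def using df[of U L] cg[of "U - L"] pd hermitian_add[OF Ch Herm_congr[OF h(1), of D p]]
    hermitian_add[OF Ch Herm_congr[OF h(2), of D p]] by simp
  fix H assume H: "Herm p H"
  note [simp] = HermD(2-4)[OF H]
  define G where "G = E * (H - C) * E^H"
  have Gh: "Herm p G" unfolding G_def by (rule Herm_congr[OF Herm_minus[OF H Ch]]) simp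
  note [simp] = HermD(2-4)[OF Gh]
  have "D * G * D^H = H - C" by (simp add: G_def m_assoc m_cancel[OF D(6)] ED)
  hence HG: "H = C + D * G * D^H" by simp
  have Gc: "G : Mat p p" by simp
  have 1: "H - (C + D * L * D^H) = D * (G - L) * D^H" "C + D * U * D^H - H = D * (U - G) * D^H" by (subst HG, rule df; simp)+
  show "imom p (k + 2) (M(k + 2 := H)) <-> pdm p (H - (C + D * L * D^H)) & pdm p (C + D * U * D^H - H)"
   unfolding 1 using key[OF Gc, folded HG] cg[of "G - L"] cg[of "U - G"] h Gh by (simp add: loewner_less_def)
 qed simp
qed

definition sandwich :: "nat => cmat => cmat => cmat" where
 "sandwich p R H = isq p R * H * isq p R"

text \<open>Canonical moments conjugated by \<open>D\<close>: peeling off two moments only changes \<open>D\<close> and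
  replaces \<open>M\<close> by \<open>mtil p M\<close>.\<close>

fun cm :: "nat => cmat => (nat => cmat) => nat => cmat" where
 "cm p D M 0 = 0m p p"
| "cm p D M (Suc 0) = sandwich p (D * D^H) (D * M 1 * D^H)"
| "cm p D M (Suc (Suc 0)) = (if in01 p (M 1)
   then sandwich p (D * (M 1 * (1m p - M 1)) * D^H) (D * (M 2 - M 1 * M 1) * D^H) else 0m p p)"
| "cm p D M (Suc (Suc (Suc k))) = (if in01 p (M 1) & in01 p (wmat p M)
   then cm p (D * dmat p (M 1) (wmat p M)) (mtil p M) (Suc k) else 0m p p)"

text \<open>\<open>D\<close> collects the factors \<open>dmat\<close> of the steps already taken, by
  which lengths and offsets of the intervals are conjugated. The second alternative mirrors the
  default value in \<open>canonical_moment\<close>, so that the two functions agree even where no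
  bounds exist.\<close>

lemma cm_eq: assumes "!!j. M j : Mat p p" "M 0 = 1m p" "D : Mat p p" "E : Mat p p" "D * E = 1m p" "k >= 1"
 shows "(EX L U. mbd p k M L U & cm p D M k = sandwich p (D * (U - L) * D^H) (D * (M k - L) * D^H))
  | (~ (EX L U. mbd p k M L U) & cm p D M k = 0m p p)" using assms
proof (induction p D M k arbitrary: E rule: cm.induct)
 case (2 p D M)
 note [simp] = MatD[OF "2.prems"(1)] MatD[OF "2.prems"(3)]
 have e: "(1m p :: cmat) - 0m p p = 1m p" "M 1 - 0m p p = M 1" by (rule eq_matI; auto)+
 have "mbd p (Suc 0) M (0m p p) (1m p)" using moment_bounds_1[of M p, OF "2.prems"(1,2)] by (simp only: One_nat_def)
 moreover have "D * 1m p * D^H = D * D^H" by simp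
 ultimately show ?case
  by (intro disjI1, rule_tac exI[of _ "0m p p"], rule_tac exI[of _ "1m p"]) (simp only: cm.simps One_nat_def e[unfolded One_nat_def] simp_thms)
next
 case (3 p D M)
 note [simp] = MatD[OF "3.prems"(1)] MatD[OF "3.prems"(3)]
 have 2: "Suc (Suc 0) = 2" by simp
 show ?case
 proof (cases "in01 p (M 1)")
  case True
  have e: "M 1 - M 1 * M 1 = M 1 * (1m p - M 1)" by (simp add: m_distrib)
  have c: "cm p D M (Suc (Suc 0)) = sandwich p (D * (M 1 * (1m p - M 1)) * D^H) (D * (M 2 - M 1 * M 1) * D^H)"
   unfolding cm.simps using True by (rule if_P)
  show ?thesis using moment_bounds_2[of M p, OF "3.prems"(1,2) True]
   by (intro disjI1, rule_tac exI[of _ "M 1 * M 1"], rule_tac exI[of _ "M 1"]) (simp only: 2[symmetric] c e simp_thms)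
 next
  case False
  have "~ mbd p (Suc (Suc 0)) M L U" for L U
  proof
   assume "mbd p (Suc (Suc 0)) M L U"
   hence "imom p 1 M" unfolding One_nat_def by (rule bounds_interior)
   thus False using False interior_1_iff[of M p] "3.prems"(1,2) by blast
  qed
  moreover have "cm p D M (Suc (Suc 0)) = 0m p p" unfolding cm.simps using False by (rule if_not_P)
  ultimately show ?thesis by blast
 qed
next
 case (4 p D M k)
 have e: "Suc (Suc (Suc k)) = Suc k + 2" "Suc (Suc (Suc k)) = Suc (k + 2)" by simp_all
 note [simp] = MatD[OF "4.prems"(1)] MatD[OF "4.prems"(3)] MatD[OF "4.prems"(4)]
 show ?case
 proof (cases "in01 p (M 1) & in01 p (wmat p M)")
  case True
  hence A: "in01 p (M 1)" and W: "in01 p (wmat p M)" by blast+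
  define K where "K = dmat p (M 1) (wmat p M)"
  note D = dinv_props[OF A W, folded K_def]
  note [simp] = D(1-4)
  have inv: "D * K * (dinv p (M 1) (wmat p M) * E) = 1m p" by (simp add: m_assoc m_cancel[OF D(6)] "4.prems"(5))
  have mt: "mtil p M j : Mat p p" "mtil p M 0 = 1m p" for j using mtil_dim[of p M, OF A W] by (simp_all add: mtil.simps[of p M 0])
  note [simp] = MatD[OF mt(1)]
  have c: "cm p D M (Suc (Suc (Suc k))) = cm p (D * K) (mtil p M) (Suc k)" unfolding cm.simps K_def using True by (rule if_P)
  have "(EX L U. mbd p (Suc k) (mtil p M) L U &
    cm p (D * K) (mtil p M) (Suc k) = sandwich p (D * K * (U - L) * (D * K)^H) (D * K * (mtil p M (Suc k) - L) * (D * K)^H))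
   | (~ (EX L U. mbd p (Suc k) (mtil p M) L U) & cm p (D * K) (mtil p M) (Suc k) = 0m p p)"
   by (rule "4.IH"[OF True mt, folded K_def, where E = "dinv p (M 1) (wmat p M) * E"], simp, simp, rule inv, simp add: One_nat_def)
  thus ?thesis
  proof (elim disjE exE conjE)
   fix L U assume 1: "mbd p (Suc k) (mtil p M) L U"
    "cm p (D * K) (mtil p M) (Suc k) = sandwich p (D * K * (U - L) * (D * K)^H) (D * K * (mtil p M (Suc k) - L) * (D * K)^H)"
   have h: "Herm p L" "Herm p U" using 1(1) by (auto simp: moment_bounds_def loewner_less_def)
   note [simp] = HermD(3,4)[OF h(1)] HermD(3,4)[OF h(2)] cmat_dim[OF A W]
   define C where "C = cmat p M (Suc k)"
   have [simp]: "nr C = p" "nc C = p" by (simp_all add: C_def)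
   have b: "mbd p (Suc k + 2) M (C + K * L * K^H) (C + K * U * K^H)"
    unfolding K_def C_def by (rule moment_bounds_step[OF "4.prems"(1,2) A W _ 1(1)]) (simp add: One_nat_def)
   have Mk: "M (Suc k + 2) = C + K * mtil p M (Suc k) * K^H"
    unfolding K_def C_def by (rule moment_from_mtil[OF A W _ "4.prems"(1)]) (simp add: One_nat_def)
   have df: "C + K * X * K^H - (C + K * Y * K^H) = K * (X - Y) * K^H" if "X : Mat p p" "Y : Mat p p" for X Y
    using that by (simp add: m_distrib) (intro eq_matI, simp_all del: index_mm(1))
   have cg: "D * (K * Q * K^H) * D^H = D * K * Q * (D * K)^H" if "Q : Mat p p" for Q using that by (simp add: m_assoc)
   have cr: "U : Mat p p" "L : Mat p p" "U - L : Mat p p" "mtil p M (Suc k) - L : Mat p p" by simp_all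
   have "cm p D M (Suc (Suc (Suc k))) = sandwich p (D * (C + K * U * K^H - (C + K * L * K^H)) * D^H) (D * (M (Suc k + 2) - (C + K * L * K^H)) * D^H)"
    unfolding Mk c 1(2) df[OF cr(1,2)] df[OF mt(1) cr(2)] cg[OF cr(3)] cg[OF cr(4)] ..
   thus ?thesis using b unfolding e(1) by blast
  next
   assume 2: "~ (EX L U. mbd p (Suc k) (mtil p M) L U)" "cm p (D * K) (mtil p M) (Suc k) = 0m p p"
   have "~ mbd p (Suc (k + 2)) M L U" for L U
   proof
    assume "mbd p (Suc (k + 2)) M L U"
    hence "imom p (k + 2) M" by (rule bounds_interior)
    hence "imom p k (mtil p M)" using interior_step[of M p k, OF "4.prems"(1,2)] by blast
    hence I: "imom p (Suc k - 1) (mtil p M)" by simp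
    \<comment> \<open>Bounds exist as soon as the first \<open>j - 1\<close> moments are interior.
      This converse carries the absence of bounds from \<open>mtil p M\<close> over to
      \<open>M\<close>.\<close>
    have "EX L U. mbd p j M L U" if "!!j. M j : Mat p p" "M 0 = 1m p" "imom p (j - 1) M" "j >= 1" for j M using that
    proof (induction j arbitrary: M rule: less_induct)
     case (less j)
     consider "j = 1" | "j = 2" | i where "j = i + 2" "i >= 1" using less.prems(4) by (metis One_nat_def Suc_1 add_2_eq_Suc' not_less_eq_eq old.nat.exhaust le0 Suc_le_mono)
     thus ?case
     proof cases
      case 1
      thus ?thesis using moment_bounds_1[of M p] less.prems by blast
     next
      case 2
      hence "imom p 1 M" using less.prems(3) by (simp add: One_nat_def)
      hence "in01 p (M 1)" using interior_1_iff[of M p] less.prems by blast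
      thus ?thesis using moment_bounds_2[of M p] less.prems 2 by blast
     next
      case (3 i)
      hence "imom p ((i - 1) + 2) M" using less.prems(3) by (simp add: numeral_2_eq_2 One_nat_def)
      hence s: "in01 p (M 1)" "in01 p (wmat p M)" "imom p (i - 1) (mtil p M)" using interior_step[of M p "i - 1"] less.prems by blast+
      have "EX L U. mbd p i (mtil p M) L U" by (rule less.IH) (use 3 s mtil_dim[of p M] in \<open>auto simp: mtil.simps[of p M 0]\<close>)
      then obtain L U where "mbd p i (mtil p M) L U" by (elim exE)
      from moment_bounds_step[OF less.prems(1,2) s(1,2) 3(2) this] show ?thesis unfolding 3(1) by blast
     qed
    qed
    from this[of "mtil p M" "Suc k", OF mt I] 2(1) show False by (simp add: One_nat_def)
   qed
   moreover have "cm p D M (Suc (Suc (Suc k))) = 0m p p" using c 2(2) by simp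
   ultimately show ?thesis unfolding e(2) by blast
  qed
 next
  case False
  have "~ mbd p (Suc (k + 2)) M L U" for L U
  proof
   assume "mbd p (Suc (k + 2)) M L U"
   hence "imom p (k + 2) M" by (rule bounds_interior)
   thus False using interior_step[of M p k, OF "4.prems"(1,2)] False by blast
  qed
  moreover have "cm p D M (Suc (Suc (Suc k))) = 0m p p" unfolding cm.simps using False by (rule if_not_P)
  ultimately show ?thesis unfolding e(2) by blast
 qed
qed simp

lemma canonical_moment_cm: assumes M: "!!j. mmt p S j : Mat p p" "mmt p S 0 = 1m p" and k: "k >= 1"
 shows "canonical_moment p S k = cm p (1m p) (mmt p S) k"
proof -
 note [simp] = MatD[OF M(1)]
 have "(EX L U. mbd p k (mmt p S) L U &
   cm p (1m p) (mmt p S) k = sandwich p (1m p * (U - L) * (1m p)^H) (1m p * (mmt p S k - L) * (1m p)^H))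
  | (~ (EX L U. mbd p k (mmt p S) L U) & cm p (1m p) (mmt p S) k = 0m p p)"
  by (rule cm_eq[where E = "1m p" and M = "mmt p S", OF M]) (use k in simp_all)
 thus ?thesis
 proof (elim disjE exE conjE)
  fix L U assume 1: "mbd p k (mmt p S) L U"
   "cm p (1m p) (mmt p S) k = sandwich p (1m p * (U - L) * (1m p)^H) (1m p * (mmt p S k - L) * (1m p)^H)"
  have h: "Herm p L" "Herm p U" "pdm p (U - L)" using 1(1) by (auto simp: moment_bounds_def loewner_less_def)
  note [simp] = HermD(3,4)[OF h(1)] HermD(3,4)[OF h(2)]
  have "EX L U. mbd p k (mmt p S) L U" using 1(1) by blast
  thus ?thesis using 1(2) h(3) unfolding canonical_moment_def Let_def moment_lower_upper[OF 1(1)] by (simp add: sandwich_def isq_def)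
 next
  assume 2: "~ (EX L U. mbd p k (mmt p S) L U)" "cm p (1m p) (mmt p S) k = 0m p p"
  show ?thesis unfolding canonical_moment_def Let_def by (simp only: if_not_P[OF 2(1)] 2(2))
 qed
qed

declare One_nat_def [simp] add_2_eq_Suc' [simp]

section \<open>Moments of the spectral measure\<close>

text \<open>\<open>T = U^H * V\<close> intertwines the two diagonal matrices, so its
  \<open>(i, j)\<close> entry vanishes unless the eigenvalues \<open>t i\<close> and
  \<open>h j\<close> coincide; then it intertwines every function of them. With indicators for
  \<open>f\<close> this is the independence of the spectral measure from the eigenbasis.\<close>

lemma spectral_fun_unique: assumes U: "unitm N U" and V: "unitm N V" and eq: "U * rdiag N t * U^H = V * rdiag N h * V^H"
 shows "U * rdiag N (%j. f (t j)) * U^H = V * rdiag N (%j. f (h j)) * V^H"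
proof -
 note [simp] = unitD(4,5)[OF U] unitD(4,5)[OF V]
 define T where "T = U^H * V"
 have [simp]: "nr T = N" "nc T = N" by (simp_all add: T_def)
 have l: "(rdiag N a * T) $$ (i, j) = cx (a i) * T $$ (i, j)" and r: "(T * rdiag N a) $$ (i, j) = T $$ (i, j) * cx (a j)" if "i < N" "j < N" for i j a
  using that by (simp_all add: sp_def if_distrib[of "%x. x * _"] if_distrib[of "%x. _ * x"] cong: if_cong)
 have "rdiag N t * T = U^H * (U * rdiag N t * U^H) * V" by (simp add: T_def m_assoc m_cancel[OF unitD(2)[OF U]])
 also have "... = T * rdiag N h" unfolding eq by (simp add: T_def m_assoc unitD(2)[OF V])
 finally have e: "rdiag N t * T = T * rdiag N h" .
 have e': "T $$ (i, j) = 0 | t i = h j" if "i < N" "j < N" for i j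
  using arg_cong[OF e, of "%A. A $$ (i, j)"] l[OF that, of t] r[OF that, of h] by (simp del: index_mm(1))
 have fe: "rdiag N (%j. f (t j)) * T = T * rdiag N (%j. f (h j))"
 proof (rule eq_matI)
  fix i j assume "i < nr (T * rdiag N (%j. f (h j)))" "j < nc (T * rdiag N (%j. f (h j)))"
  hence ij: "i < N" "j < N" by simp_all
  show "(rdiag N (%j. f (t j)) * T) $$ (i, j) = (T * rdiag N (%j. f (h j))) $$ (i, j)" unfolding l[OF ij] r[OF ij] using e'[OF ij] by auto
 qed simp_all
 have TV: "T * V^H = U^H" by (simp add: T_def m_assoc unitD(3)[OF V])
 have "U * rdiag N (%j. f (t j)) * U^H = U * (rdiag N (%j. f (t j)) * T) * V^H" by (simp add: m_assoc TV)
 also have "... = V * rdiag N (%j. f (h j)) * V^H" unfolding fe by (simp add: T_def m_assoc m_cancel[OF unitD(3)[OF U]])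
 finally show ?thesis .
qed

lemma eigenbasis_unitary: assumes X: "X : Mat N N" and e: "orthonormal_eigenbasis N X t u"
 defines "U == mat N N (%(i, j). u j $ i)" shows "unitm N U" "X = U * rdiag N t * U^H"
proof -
 let ?a = "U * rdiag N t"
 have u: "u j : Vec N" "X *v u j = cx (t j) \<cdot>\<^sub>v u j" if "j < N" for j using e that by (simp_all add: orthonormal_eigenbasis_def)
 have o: "u i .c u j = (if i = j then 1 else 0)" if "i < N" "j < N" for i j using e that by (simp add: orthonormal_eigenbasis_def)
 have Uc: "U : Mat N N" by (simp add: U_def)
 note [simp] = MatD[OF Uc] MatD[OF X]
 show U: "unitm N U"
 proof (rule unitary_matI[OF Uc], rule eq_matI)
  fix i j assume "i < nr (1m N :: cmat)" "j < nc (1m N :: cmat)"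
  hence ij: "i < N" "j < N" by simp_all
  have "(U^H * U) $$ (i, j) = (\<Sum>r<N. cnj (U $$ (r, i)) * U $$ (r, j))" by (rule index_adjoint_mult[OF Uc Uc ij])
  also have "... = u j .c u i" using ij u(1)[OF ij(1)] u(1)[OF ij(2)] by (simp add: U_def sp_def at0L mult.commute)
  finally show "(U^H * U) $$ (i, j) = 1m N $$ (i, j)" using o[OF ij(2,1)] ij by auto
 qed simp_all
 have "X * U = U * rdiag N t"
 proof (rule eq_matI)
  fix i j assume "i < nr ?a" "j < nc ?a"
  hence ij: "i < N" "j < N" by simp_all
  have c: "col U j = u j" using ij u(1)[OF ij(2)] by (intro eq_vecI) (simp_all add: U_def)
  have "(X * U) $$ (i, j) = (X *v u j) $ i" using ij c by simp
  also have "... = cx (t j) * u j $ i" using u[OF ij(2)] ij by simp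
  also have "... = U $$ (i, j) * cx (t j)" using ij by (simp add: U_def)
  also have "... = ?a $$ (i, j)" using ij by (simp add: sp_def if_distrib[of "%x. _ * x"] cong: if_cong)
  finally show "(X * U) $$ (i, j) = ?a $$ (i, j)" .
 qed simp_all
 hence "X * U * U^H = U * rdiag N t * U^H" by simp
 thus "X = U * rdiag N t * U^H" by (simp add: m_assoc unitD(3)[OF U])
qed

lemma eigenbasis_exists: assumes X: "Herm N X" shows "EX t u. orthonormal_eigenbasis N X t u"
proof -
 from spectral_theorem[OF X] obtain U t where U: "unitm N U" and XU: "X = U * rdiag N t * U^H" by blast
 note [simp] = unitD(4,5)[OF U]
 note Uc = unitD(1)[OF U]
 have XU': "X * U = U * rdiag N t" unfolding XU by (simp add: m_assoc unitD(2)[OF U])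
 have "X *v col U j = cx (t j) \<cdot>\<^sub>v col U j" if j: "j < N" for j
 proof (rule eq_vecI)
  fix i assume "i < dim_vec (cx (t j) \<cdot>\<^sub>v col U j)"
  hence i: "i < N" by simp
  have "(X *v col U j) $ i = (X * U) $$ (i, j)" using i j HermD(3,4)[OF X] by simp
  also have "... = U $$ (i, j) * cx (t j)" unfolding XU' using i j by (simp add: sp_def if_distrib[of "%x. _ * x"] cong: if_cong)
  finally show "(X *v col U j) $ i = (cx (t j) \<cdot>\<^sub>v col U j) $ i" using i j by simp
 qed (use HermD(3,4)[OF X] in simp)
 moreover have "col U i .c col U j = (if i = j then 1 else 0)" if ij: "i < N" "j < N" for i j
 proof -
  have "col U i .c col U j = (U^H * U) $$ (j, i)" unfolding index_adjoint_mult[OF Uc Uc ij(2,1)] using ij by (simp add: sp_def at0L mult.commute)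
  thus ?thesis unfolding unitD(2)[OF U] using ij by auto
 qed
 ultimately have "orthonormal_eigenbasis N X t (col U)" unfolding orthonormal_eigenbasis_def using Uc by auto
 thus ?thesis by blast
qed

text \<open>After the definite description is resolved, the spectral measure is a density over
  counting measure on \<open>N\<close> points, and its moments are entries of the functional
  calculus for powers.\<close>

lemma spectral_measure_moment: assumes X: "Herm N X" and pN: "p <= N" shows "mmt p (spectral_matrix_measure p N X) j = block 0 0 p p (mpow N X j)"
proof -
 define y where "y t u = (%A. if A : sets borel
   then mat p p (%(i, k). \<Sum>j | j < N & t j : A. u j $ i * cnj (u j $ k)) else 0m p p)" for t :: "nat => real" and u :: "nat => complex vec"
 note Xc = HermD(1)[OF X]
 have rep: "(\<Sum>j | j < N & t j : A. u j $ i * cnj (u j $ k)) = (mat N N (%(i, j). u j $ i) * rdiag N (%j. Ind A (t j)) * (mat N N (%(i, j). u j $ i))^H) $$ (i, k)"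
  if "i < N" "k < N" for t u A i k
 proof -
  have "(mat N N (%(i, j). u j $ i) * rdiag N (%j. Ind A (t j)) * (mat N N (%(i, j). u j $ i))^H) $$ (i, k)
   = (\<Sum>r<N. cx (Ind A (t r)) * mat N N (%(i, j). u j $ i) $$ (i, r) * cnj (mat N N (%(i, j). u j $ i) $$ (k, r)))"
   by (rule spectral_entry) (use that in simp_all)
  also have "... = (\<Sum>r<N. if t r : A then u r $ i * cnj (u r $ k) else 0)" using that by (intro sum.cong refl) (simp add: indicator_def)
  also have "... = (\<Sum>j | j < N & t j : A. u j $ i * cnj (u j $ k))" by (simp add: sum.inter_filter[symmetric])
  finally show ?thesis by simp
 qed
 have uniq: "y t u = y z v" if e: "orthonormal_eigenbasis N X t u" "orthonormal_eigenbasis N X z v" for t z u v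
 proof
  fix A
  note 1 = eigenbasis_unitary[OF Xc e(1)] and 2 = eigenbasis_unitary[OF Xc e(2)]
  have "(\<Sum>j | j < N & t j : A. u j $ i * cnj (u j $ k)) = (\<Sum>j | j < N & z j : A. v j $ i * cnj (v j $ k))" if "i < p" "k < p" for i k
   using that pN spectral_fun_unique[OF 1(1) 2(1), of t z "Ind A"] 1(2) 2(2) by (simp add: rep del: index_mm(1))
  thus "y t u A = y z v A" unfolding y_def by (auto intro!: cong_mat)
 qed
 from eigenbasis_exists[OF X] obtain t u where e: "orthonormal_eigenbasis N X t u" by blast
 have sp: "spectral_matrix_measure p N X = y t u" unfolding spectral_matrix_measure_def
 proof (rule the_equality)
  show "EX t' u'. orthonormal_eigenbasis N X t' u' & y t u = (%A. if A : sets borel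
    then mat p p (%(i, k). \<Sum>j | j < N & t' j : A. u' j $ i * cnj (u' j $ k)) else 0m p p)" using e unfolding y_def by blast
  fix S assume "EX t' u'. orthonormal_eigenbasis N X t' u' & S = (%A. if A : sets borel
    then mat p p (%(i, k). \<Sum>j | j < N & t' j : A. u' j $ i * cnj (u' j $ k)) else 0m p p)"
  then obtain t' u' where e': "orthonormal_eigenbasis N X t' u'" and S: "S = y t' u'" unfolding y_def by blast
  show "S = y t u" unfolding S by (rule uniq[OF e' e])
 qed
 define U where "U = mat N N (%(i, j). u j $ i)"
 note U = eigenbasis_unitary[OF Xc e, folded U_def]
 \<comment> \<open>The value 0 beyond \<open>N\<close> gives a bound on the node function over all
   indices, as \<open>entry_integral_S\<close> demands.\<close>
 define t' where "t' j = (if j < N then t j else 0)" for j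
 define h where "h j k l = U $$ (k, j) * cnj (U $$ (l, j))" for j k l
 let ?s = "count_space {..<N}"
 have int: "integrable ?s f" for f :: "nat => complex" by (rule integrable_count_space) simp
 interpret matrix_density p ?s t' h
 proof
  show "0 <= (\<Sum>k<p. \<Sum>l<p. h w k l * v l * cnj (v k))" for w v
  proof -
   define c where "c = (\<Sum>k<p. U $$ (k, w) * cnj (v k))"
   have "(\<Sum>k<p. \<Sum>l<p. h w k l * v l * cnj (v k)) = c * cnj c"
   proof -
    have "c * cnj c = (\<Sum>k<p. \<Sum>l<p. (U $$ (k, w) * cnj (v k)) * (cnj (U $$ (l, w)) * v l))"
     by (simp only: c_def cnj_sum complex_cnj_mult complex_cnj_cnj sum_product)
    thus ?thesis by (simp add: h_def mult_ac)
   qed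
   also have "... = cx ((cmod c)^2)" by (rule complex_norm_square[symmetric])
   finally show ?thesis by (simp add: less_eq_complex_def del: of_real_power)
  qed
 qed (auto simp: h_def intro: int)
 have S: "y t u = S"
 proof
  fix A
  have "(\<Sum>j | j < N & t j : A. u j $ i * cnj (u j $ k)) = (\<integral>j. Ind A (t' j) * h j i k \<partial>?s)" if "i < p" "k < p" for i k
  proof -
   have "(\<integral>j. Ind A (t' j) * h j i k \<partial>?s) = (\<Sum>j<N. Ind A (t' j) * h j i k)"
    by (rule lebesgue_integral_count_space_finite) simp
   also have "... = (\<Sum>j<N. if t j : A then u j $ i * cnj (u j $ k) else 0)"
    using that pN by (intro sum.cong refl) (simp add: indicator_def t'_def h_def U_def)
   also have "... = (\<Sum>j | j < N & t j : A. u j $ i * cnj (u j $ k))" by (simp add: sum.inter_filter[symmetric])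
   finally show ?thesis by simp
  qed
  thus "y t u A = S A" unfolding y_def S_def by (auto intro!: cong_mat)
 qed
 show ?thesis unfolding sp S
 proof (rule eq_matI)
  fix k l assume "k < nr (block 0 0 p p (mpow N X j))" "l < nc (block 0 0 p p (mpow N X j))"
  hence kl: "k < p" "l < p" by simp_all
  hence kN: "k < N" "l < N" using pN by auto
  have bd: "norm (cx (t' w ^ j)) <= 1 + (\<Sum>r<N. \<bar>t r\<bar> ^ j)" for w
  proof (cases "w < N")
   case True
   have "\<bar>t w\<bar> ^ j <= (\<Sum>r<N. \<bar>t r\<bar> ^ j)" by (rule member_le_sum[of w "{..<N}" "%r. \<bar>t r\<bar> ^ j"]) (use True in auto)
   thus ?thesis using True by (simp add: t'_def norm_power)
  next
   case False
   have "0 <= (\<Sum>r<N. \<bar>t r\<bar> ^ j)" by (intro sum_nonneg) simp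
   thus ?thesis using False by (cases j) (simp_all add: t'_def)
  qed
  have m: "(%x::real. cx (x ^ j)) : bm borel" by measurable
  have "mmt p S j $$ (k, l) = eint p S k l (%x. cx (x ^ j))" using kl by (simp add: matrix_moment_def)
  also have "... = (\<integral>w. cx (t' w ^ j) * h w k l \<partial>?s)" by (rule entry_integral_S[OF m bd kl])
  also have "... = (\<Sum>w<N. cx (t' w ^ j) * h w k l)" by (rule lebesgue_integral_count_space_finite) simp
  also have "... = (\<Sum>w<N. cx (t w ^ j) * U $$ (k, w) * cnj (U $$ (l, w)))" by (intro sum.cong refl) (simp add: t'_def h_def)
  also have "... = mpow N X j $$ (k, l)" unfolding U(2) spectral_mpow[OF U(1)] spectral_entry[OF unitD(1)[OF U(1)] kN] ..
  finally show "mmt p S j $$ (k, l) = block 0 0 p p (mpow N X j) $$ (k, l)" using kl by (simp add: block_def)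
 qed (simp_all add: matrix_moment_def)
qed

lemma canonical_moment_spectral: assumes X: "Herm N X" and pN: "p <= N" and k: "k >= 1"
 shows "canonical_moment p (spectral_matrix_measure p N X) k = cm p (1m p) (%j. block 0 0 p p (mpow N X j)) k"
proof -
 have e: "mmt p (spectral_matrix_measure p N X) = (%j. block 0 0 p p (mpow N X j))" using spectral_measure_moment[OF X pN] by blast
 have "block 0 0 p p (1m N :: cmat) = 1m p" by (rule eq_matI) (use pN in \<open>auto simp: block_def\<close>)
 thus ?thesis using canonical_moment_cm[of p "spectral_matrix_measure p N X" k] k unfolding e by simp
qed

section \<open>Lebesgue measure on spaces of matrices\<close>

lemma product_lborel: "product_sigma_finite (%_. lborel :: real measure)" by unfold_locales

text \<open>The two measures are compared on boxes. Coordinatewise scaling is used for diagonal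
  matrices, the relabelling \<open>w\<close> for moving a diagonal block to the index
  origin.\<close>

lemma nn_integral_PiM_affine:
 fixes c t :: "'i => real" and w :: "'i => 'j" assumes I: "finite I" and w: "bij_betw w I J" and c: "!!i. i : I ==> c i ~= 0"
  and f: "f : bm (PiM I (%_. lborel))"
 shows "ennreal (\<Prod>i\<in>I. \<bar>c i\<bar>) * nn (PiM J (%_. lborel)) (%x. f (\<lambda>i\<in>I. t i + c i * x (w i))) = nn (PiM I (%_. lborel)) (%x. f x)"
proof -
 let ?a = "\<Prod>i\<in>I. \<bar>c i\<bar>"
 let ?b = "PiM J (%_. lborel)"
 let ?c = "PiM I (%_. lborel)"
 interpret product_sigma_finite "%_::'i. lborel :: real measure" by (rule product_lborel)
 interpret J: product_sigma_finite "%_::'j. lborel :: real measure" by (rule product_lborel)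
 have J: "finite J" using w I bij_betw_finite by blast
 define g where "g x = (\<lambda>i\<in>I. t i + c i * x (w i))" for x
 have wJ: "w i : J" if "i : I" for i using w that by (auto simp: bij_betw_def)
 have g[measurable]: "g : meas ?b ?c" unfolding g_def
 proof (rule measurable_restrict)
  fix i assume i: "i : I"
  have "(%y. t i + c i * y) : measurable lborel lborel" by simp
  from m_comp[OF measurable_component_singleton[OF wJ[OF i], of "%_. lborel :: real measure"] this]
  show "(%x. t i + c i * x (w i)) : meas ?b lborel" .
 qed
 define D where "D = distr ?b ?c g"
 have "density D (%_. ennreal ?a) = PiM I (%_. lborel)"
 proof (rule PiM_eqI[OF I])
  show "sets (density D (%_. ennreal ?a)) = sets ?c" by (simp add: D_def)
  fix A :: "'i => real set" assume A: "!!i. i : I ==> A i : sets lborel"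
  define V where "V i = (%y. t i + c i * y) -` A i" for i
  have V[measurable]: "V i : sets borel" if "i : I" for i
   using measurable_sets[of "%y. t i + c i * y" borel borel "A i"] A[OF that] by (simp add: V_def)
  have lV: "emeasure lborel (A i) = ennreal \<bar>c i\<bar> * emeasure lborel (V i)" if i: "i : I" for i
  proof -
   have [measurable]: "A i : sets borel" using A[OF i] by simp
   have "emeasure lborel (A i) = emeasure (density (distr lborel borel (%x. t i + c i * x)) (%_. ennreal \<bar>c i\<bar>)) (A i)"
    using lborel_real_affine[OF c[OF i], of "t i"] by simp
   also have "... = ennreal \<bar>c i\<bar> * emeasure lborel (V i)" by (subst emeasure_density) (auto simp: nn_cmult emeasure_distr V_def)
   finally show ?thesis .
  qed
  define s where "s = inv_into I w"
  have s: "s j : I" "w (s j) = j" if "j : J" for j using w that by (auto simp: s_def bij_betw_def inv_into_into f_inv_into_f)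
  have sw: "s (w i) = i" if "i : I" for i using w that by (auto simp: s_def bij_betw_def)
  have pre: "g -` Pi\<^sub>E I A Int space ?b = Pi\<^sub>E J (%j. V (s j))"
  proof (intro equalityI subsetI)
   fix x assume x: "x : g -` Pi\<^sub>E I A Int space ?b"
   hence "g x i : A i" if "i : I" for i using that by (auto simp: PiE_iff)
   hence "t i + c i * x (w i) : A i" if "i : I" for i using that by (simp add: g_def)
   hence "x j : V (s j)" if "j : J" for j using s[OF that] unfolding V_def by (metis vimageI)
   thus "x : Pi\<^sub>E J (%j. V (s j))" using x by (auto simp: space_PiM PiE_iff)
  next
   fix x assume x: "x : Pi\<^sub>E J (%j. V (s j))"
   have "x (w i) : V i" if "i : I" for i using PiE_mem[OF x wJ[OF that]] sw[OF that] by simp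
   thus "x : g -` Pi\<^sub>E I A Int space ?b" using x by (auto simp: space_PiM PiE_iff g_def V_def extensional_def)
  qed
  have "emeasure (density D (%_. ennreal ?a)) (Pi\<^sub>E I A) = ennreal ?a * emeasure D (Pi\<^sub>E I A)"
   using A I by (subst emeasure_density) (auto simp: nn_cmult D_def intro!: sets_PiM_I_finite)
  also have "emeasure D (Pi\<^sub>E I A) = emeasure ?b (Pi\<^sub>E J (%j. V (s j)))"
   unfolding D_def using A I by (subst emeasure_distr) (auto simp: pre intro!: sets_PiM_I_finite)
  also have "... = (\<Prod>j\<in>J. emeasure lborel (V (s j)))" by (rule J.emeasure_PiM[OF J]) (use V s in auto)
  also have "... = (\<Prod>i\<in>I. emeasure lborel (V i))"
   using prod.reindex_bij_betw[OF w, of "%j. emeasure lborel (V (s j))"] by (simp add: sw cong: prod.cong)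
  also have "ennreal ?a * (\<Prod>i\<in>I. emeasure lborel (V i)) = (\<Prod>i\<in>I. emeasure lborel (A i))"
   by (simp add: lV prod.distrib prod_ennreal cong: prod.cong)
  finally show "emeasure (density D (%_. ennreal ?a)) (Pi\<^sub>E I A) = (\<Prod>i\<in>I. emeasure lborel (A i))" .
 qed
 hence "nn ?c (%x. f x) = (nn (density D (%_. ennreal ?a)) (%x. f x))" by simp
 also have "... = ennreal ?a * nn D (%x. f x)" using f by (subst nn_integral_density) (auto simp: D_def nn_cmult)
 also have "nn D (%x. f x) = nn ?b (%x. f (g x))" unfolding D_def by (rule nn_integral_distr[OF g]) (use f in simp)
 finally show ?thesis unfolding g_def by simp
qed

abbreviation PL :: "(nat \<times> nat) set => (nat \<times> nat => real) measure" where
 "PL I == PiM I (%_. lborel)"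

definition frob :: "nat => nat => cmat => real" where
 "frob m n Z = (\<Sum>i<m. \<Sum>j<n. (cmod (Z $$ (i, j)))^2)"

text \<open>Hermitian matrices and rectangular matrices are treated at once: \<open>e\<close> is a
  chart from real coordinates and the inverse chart \<open>r\<close> is additive. The two bounds
  compare boxes of coordinates with entrywise bounded sets of matrices; the factor 2 accounts for
  real and imaginary parts.\<close>

locale mat_coords =
 fixes I :: "(nat \<times> nat) set" and m n :: nat and S :: "cmat set"
  and e :: "(nat \<times> nat => real) => cmat" and r :: "cmat => nat \<times> nat => real" assumes fin: "finite I" and S_carrier: "S <= Mat m n"
  and e_S: "!!x. e x : S" and r_ext: "!!Z. r Z : extensional I"
  and r_e: "!!x. x : extensional I ==> r (e x) = x" and e_r: "!!Z. Z : S ==> e (r Z) = Z"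
  and e_meas: "e : meas (PL I) (mbs m n S)" and r_meas: "r : meas (mbs m n S) (PL I)"
  and S_add: "!!Z Y. Z : S ==> Y : S ==> Z + Y : S" and S_minus: "!!Z Y. Z : S ==> Y : S ==> Z - Y : S"
  and r_add: "!!Z Y k. Z : S ==> Y : S ==> k : I ==> r (Z + Y) k = r Z k + r Y k"
  and e_bound: "!!x d i j. (!!k. k : I ==> \<bar>x k\<bar> <= d) ==> 0 <= d ==> i < m ==> j < n ==> cmod (e x $$ (i, j)) <= 2 * d"
  and r_bound: "!!Z d k. Z : S ==> (!!i j. i < m ==> j < n ==> cmod (Z $$ (i, j)) <= d) ==> k : I ==> \<bar>r Z k\<bar> <= d"
begin

definition L :: "cmat measure" where "L = distr (PL I) (mbs m n S) e"

lemma sets_L [measurable_cong]: "sets L = sets (mbs m n S)" and space_L [simp]: "space L = S" by (simp_all add: L_def)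

lemma mL: "meas L N = meas (mbs m n S) N" by (rule measurable_cong_sets[OF sets_L refl])

lemma S_dim: "Z : S ==> nr Z = m" "Z : S ==> nc Z = n" using S_carrier by auto

lemma nn_L: "f : bm (mbs m n S) ==> (nn L (%Z. f Z)) = nn (PL I) (%x. f (e x))" unfolding L_def by (rule nn_integral_distr[OF e_meas]) simp

lemma sigma_finite_L: "sigma_finite_measure L"
proof (rule sigma_finite_measure_distr)
 interpret product_sigma_finite "%_::nat \<times> nat. lborel :: real measure" by (rule product_lborel)
 have "distr L (PL I) r = distr (PL I) (PL I) (r \<circ> e)" unfolding L_def by (rule distr_distr[OF r_meas e_meas])
 also have "... = distr (PL I) (PL I) (%x. x)" by (rule distr_cong) (auto simp: space_PiM r_e PiE_iff)
 also have "... = PL I" by (rule distr_id2) simp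
 finally show "sigma_finite_measure (distr L (PL I) r)" using sigma_finite[OF fin] by simp
 show "r : meas L (PL I)" using r_meas by (simp add: mL)
qed

lemma nn_affine: assumes T: "T : meas (mbs m n S) (mbs m n S)" and f: "f : bm (mbs m n S)"
  and c: "!!k. k : I ==> c k ~= 0" and rT: "!!Z k. Z : S ==> k : I ==> r (T Z) k = t k + c k * r Z k"
 shows "ennreal (\<Prod>k\<in>I. \<bar>c k\<bar>) * nn L (%Z. f (T Z)) = nn L (%Z. f Z)"
proof -
 have "T (e x) = e (\<lambda>k\<in>I. t k + c k * x k)" if "x : space (PL I)" for x
 proof -
  have x: "x : extensional I" using that by (auto simp: space_PiM PiE_iff)
  have TS: "T (e x) : S" using measurable_space[OF T] e_S by simp
  have "r (T (e x)) = (\<lambda>k\<in>I. t k + c k * x k)"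
  proof
   fix k
   show "r (T (e x)) k = (\<lambda>k\<in>I. t k + c k * x k) k"
    using rT[OF e_S, of k x] by (cases "k : I") (simp_all add: r_e[OF x] extensional_arb[OF r_ext])
  qed
  thus ?thesis using e_r[OF TS] by simp
 qed
 hence "nn L (%Z. f (T Z)) = nn (PL I) (%x. f (e (\<lambda>k\<in>I. t k + c k * x (id k))))"
  using m_comp[OF T f] by (subst nn_L) (auto intro!: nn_cong)
 moreover have "ennreal (\<Prod>k\<in>I. \<bar>c k\<bar>) * ... = nn (PL I) (%x. f (e x))"
  by (rule nn_integral_PiM_affine[OF fin bij_betw_id c m_comp[OF e_meas f]])
 ultimately show ?thesis by (simp only: nn_L[OF f])
qed

lemma add_meas: "f : meas M (mbs m n S) ==> g : meas M (mbs m n S) ==> (%w. f w + g w) : meas M (mbs m n S)"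
 by (rule mbs_superset[OF mm_add[OF mbs_subset[OF S_carrier] mbs_subset[OF S_carrier]]]) (auto intro: S_add mbsD(2))

lemma minus_meas: "f : meas M (mbs m n S) ==> g : meas M (mbs m n S) ==> (%w. f w - g w) : meas M (mbs m n S)"
 by (rule mbs_superset[OF mm_minus[OF mbs_subset[OF S_carrier] mbs_subset[OF S_carrier]]]) (auto intro: S_minus mbsD(2))

lemma const_meas: "Z : S ==> (%w. Z) : meas M (mbs m n S)" by (rule measurable_const) simp

lemma nn_translate: assumes "f : bm (mbs m n S)" "Y : S" shows "nn L (%Z. f (Z + Y)) = nn L (%Z. f Z)"
 using nn_affine[OF add_meas[OF measurable_ident_sets[OF refl] const_meas[OF assms(2)]] assms(1), of "%_. 1" "r Y"] assms(2) by (simp add: r_add)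

lemma emeasure_finite: assumes G: "G : sets (mbs m n S)" and b: "!!Z i j. Z : G ==> i < m ==> j < n ==> cmod (Z $$ (i, j)) <= d"
 shows "emeasure L G < \<infinity>"
proof -
 let ?a = "%_. {-\<bar>d\<bar>..\<bar>d\<bar>}"
 interpret product_sigma_finite "%_::nat \<times> nat. lborel :: real measure" by (rule product_lborel)
 have "emeasure L G = emeasure (PL I) (e -` G Int space (PL I))" unfolding L_def using G by (intro emeasure_distr e_meas) simp
 also have "... <= emeasure (PL I) (Pi\<^sub>E I ?a)"
 proof (rule emeasure_mono)
  show "e -` G Int space (PL I) <= Pi\<^sub>E I ?a"
  proof
   fix x assume "x : e -` G Int space (PL I)"
   hence x: "e x : G" "x : extensional I" by (auto simp: space_PiM PiE_iff)
   have "\<bar>x k\<bar> <= \<bar>d\<bar>" if "k : I" for k using r_bound[OF e_S b[OF x(1)] that] r_e[OF x(2)] by simp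
   thus "x : Pi\<^sub>E I ?a" using x(2) by (auto simp: PiE_iff abs_le_iff minus_le_iff)
  qed
 qed (auto intro!: sets_PiM_I_finite fin)
 also have "... = (\<Prod>k\<in>I. emeasure lborel {-\<bar>d\<bar>..\<bar>d\<bar>})" by (rule emeasure_PiM[OF fin]) simp
 also have "... = ennreal (\<Prod>k\<in>I. 2 * \<bar>d\<bar>)" by (subst prod_ennreal[symmetric]) simp_all
 also have "... < \<infinity>" by simp
 finally show ?thesis .
qed

lemma emeasure_pos: assumes G: "G : sets (mbs m n S)" and Y: "Y : S" and d: "d > 0"
  and b: "!!Z. Z : S ==> (!!i j. i < m ==> j < n ==> cmod (Z $$ (i, j)) <= d) ==> Z + Y : G" shows "0 < emeasure L G"
proof -
 let ?a = "%_. {-(d / 2)..d / 2}"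
 interpret product_sigma_finite "%_::nat \<times> nat. lborel :: real measure" by (rule product_lborel)
 have "0 < (\<Prod>k\<in>I. emeasure lborel {-(d / 2)..d / 2})"
 proof -
  have "(\<Prod>k\<in>I. emeasure lborel {-(d / 2)..d / 2}) = ennreal (\<Prod>k\<in>I. d)" using d by (subst prod_ennreal[symmetric]) simp_all
  thus ?thesis using d by (simp add: prod_pos)
 qed
 also have "... = emeasure (PL I) (Pi\<^sub>E I ?a)" by (rule emeasure_PiM[OF fin, symmetric]) simp
 also have "... = nn (PL I) (%x. Ind (Pi\<^sub>E I ?a) x)" by (rule nn_integral_indicator[symmetric]) (auto intro!: sets_PiM_I_finite fin)
 also have "... <= nn (PL I) (%x. Ind G (e x + Y))"
 proof (rule nn_integral_mono)
  fix x
  have "e x + Y : G" if x: "x : Pi\<^sub>E I ?a"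
  proof (rule b[OF e_S])
   fix i j assume "i < m" "j < n"
   hence "cmod (e x $$ (i, j)) <= 2 * (d / 2)" by (intro e_bound) (use x d in \<open>auto simp: PiE_iff abs_le_iff\<close>)
   thus "cmod (e x $$ (i, j)) <= d" by simp
  qed
  thus "(Ind (Pi\<^sub>E I ?a) x :: ennreal) <= Ind G (e x + Y)" by (auto simp: indicator_def)
 qed
 also have "... = nn L (%Z. Ind G (Z + Y))"
  by (rule nn_L[symmetric], rule m_comp[OF add_meas[OF measurable_ident_sets[OF refl] const_meas[OF Y]]]) (use G in simp)
 also have "... = nn L (%Z. Ind G Z)" by (rule nn_translate[OF _ Y]) (use G in simp)
 also have "... = emeasure L G" using G by (simp add: L_def)
 finally show ?thesis .
qed

text \<open>Translation invariance alone determines how the measure transforms under an additive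
  bijection, up to a constant that is read off from one even function.\<close>

lemma nn_additive_ratio: assumes T: "T : meas (mbs m n S) (mbs m n S)" and T': "T' : meas (mbs m n S) (mbs m n S)"
  and TT': "!!Z. Z : S ==> T (T' Z) = Z" and add: "!!Z Y. Z : S ==> Y : S ==> T (Z + Y) = T Z + T Y"
  and f[measurable]: "f : bm (mbs m n S)" and g[measurable]: "g : bm (mbs m n S)" and even: "!!Z Y. Z : S ==> Y : S ==> g (Z - Y) = g (Y - Z)"
 shows "nn L (%Z. f (T Z)) * nn L (%Z. g Z) = nn L (%Z. f Z) * nn L (%Z. g (T Z))"
proof -
 interpret sigma_finite_measure L by (rule sigma_finite_L)
 interpret pair_sigma_finite L L ..
 note TS = measurable_space[OF T, simplified] and TS' = measurable_space[OF T', simplified]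
 note [measurable] = T T'
 have fst: "fst : meas (L \<Otimes>\<^sub>M L) (mbs m n S)" "snd : meas (L \<Otimes>\<^sub>M L) (mbs m n S)"
  using measurable_fst[of L L] measurable_snd[of L L] by (simp_all add: measurable_cong_sets[OF refl sets_L])
 have id: "(%Z. Z) : meas (mbs m n S) (mbs m n S)" by simp
 have "nn L (%Z. f (T Z)) * nn L (%Z. g Z) = nn L (%Y. (nn L (%Z. f (T Z) * g Y)))" by (simp add: nn_integral_multc nn_cmult mL)
 \<comment> \<open>Translating \<open>Z\<close> by \<open>T' Y\<close> shifts \<open>T Z\<close> by
   \<open>Y\<close>. After Fubini the shift is moved from \<open>f\<close> to \<open>g\<close>,
   where evenness and a further translation remove it.\<close>
 also have "... = nn L (%Y. (nn L (%Z. f (T Z + Y) * g Y)))"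
 proof (rule nn_cong)
  fix Y assume "Y : space L"
  hence Y: "Y : S" by simp
  have "nn L (%Z. f (T (Z + T' Y)) * g Y) = nn L (%Z. f (T Z) * g Y)" by (rule nn_translate[of "%Z. f (T Z) * g Y"]) (use TS' Y in measurable)
  moreover have "nn L (%Z. f (T (Z + T' Y)) * g Y) = nn L (%Z. f (T Z + Y) * g Y)" by (rule nn_cong) (simp add: add TS' Y TT')
  ultimately show "nn L (%Z. f (T Z) * g Y) = nn L (%Z. f (T Z + Y) * g Y)" by simp
 qed
 also have "... = nn L (%Z. (nn L (%Y. f (T Z + Y) * g Y)))"
 proof (rule Fubini')
  have "(%x. f (T (fst x) + snd x) * g (snd x)) : bm (L \<Otimes>\<^sub>M L)"
   by (intro bm_times m_comp[OF add_meas[OF m_comp[OF fst(1) T] fst(2)] f] m_comp[OF fst(2) g])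
  thus "(%(Z, Y). f (T Z + Y) * g Y) : bm (L \<Otimes>\<^sub>M L)" by (simp add: case_prod_beta')
 qed
 also have "... = nn L (%Z. (nn L (%Y. f Y * g (Y - T Z))))"
 proof (rule nn_cong)
  fix Z assume "Z : space L"
  hence Z: "T Z : S" by (simp add: TS)
  have "nn L (%Y. f (Y + T Z) * g ((Y + T Z) - T Z)) = nn L (%Y. f Y * g (Y - T Z))"
   by (rule nn_translate[OF bm_times[OF f m_comp[OF minus_meas[OF id const_meas[OF Z]] g]] Z])
  moreover have "nn L (%Y. f (Y + T Z) * g ((Y + T Z) - T Z)) = nn L (%Y. f (T Z + Y) * g Y)"
  proof (rule nn_cong)
   fix Y assume "Y : space L"
   hence Y: "Y : S" by simp
   have "Y + T Z - T Z = Y" "Y + T Z = T Z + Y" by (rule eq_matI; use S_dim[OF Y] S_dim[OF Z] in simp)+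
   thus "f (Y + T Z) * g (Y + T Z - T Z) = f (T Z + Y) * g Y" by simp
  qed
  ultimately show "nn L (%Y. f (T Z + Y) * g Y) = nn L (%Y. f Y * g (Y - T Z))" by simp
 qed
 also have "... = nn L (%Y. (nn L (%Z. f Y * g (Y - T Z))))"
 proof (rule Fubini'[symmetric])
  have "(%x. f (snd x) * g (snd x - T (fst x))) : bm (L \<Otimes>\<^sub>M L)"
   by (intro bm_times m_comp[OF minus_meas[OF fst(2) m_comp[OF fst(1) T]] g] m_comp[OF fst(2) f])
  thus "(%(Z, Y). f Y * g (Y - T Z)) : bm (L \<Otimes>\<^sub>M L)" by (simp add: case_prod_beta')
 qed
 also have "... = nn L (%Y. (nn L (%Z. f Y * g (T Z))))"
 proof (rule nn_cong)
  fix Y assume "Y : space L"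
  hence Y: "Y : S" by simp
  have "nn L (%Z. f Y * g (T (Z + T' Y) - Y)) = nn L (%Z. f Y * g (T Z - Y))"
   by (rule nn_translate[OF bm_times[OF borel_measurable_const m_comp[OF minus_meas[OF T const_meas[OF Y]] g]] TS'[OF Y]])
  moreover have "nn L (%Z. f Y * g (T (Z + T' Y) - Y)) = nn L (%Z. f Y * g (T Z))"
  proof (rule nn_cong)
   fix Z assume "Z : space L"
   hence Z: "Z : S" by simp
   have "T Z + Y - Y = T Z" by (rule eq_matI) (use S_dim[OF Y] S_dim[OF TS[OF Z]] in simp_all)
   thus "f Y * g (T (Z + T' Y) - Y) = f Y * g (T Z)" by (simp add: add[OF Z TS'[OF Y]] TT'[OF Y])
  qed
  moreover have "nn L (%Z. f Y * g (T Z - Y)) = nn L (%Z. f Y * g (Y - T Z))" by (rule nn_cong) (simp add: even[OF Y TS])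
  ultimately show "nn L (%Z. f Y * g (Y - T Z)) = nn L (%Z. f Y * g (T Z))" by simp
 qed
 also have "... = nn L (%Z. f Z) * nn L (%Z. g (T Z))" by (simp add: nn_integral_multc nn_cmult mL)
 finally show ?thesis .
qed

text \<open>The indicator of the Frobenius unit ball is an even function that \<open>T\<close>
  leaves invariant, of finite and positive integral; with it as reference the ratio in
  \<open>nn_additive_ratio\<close> equals one.\<close>

lemma nn_isometry: assumes T: "T : meas (mbs m n S) (mbs m n S)" and T': "T' : meas (mbs m n S) (mbs m n S)"
  and TT': "!!Z. Z : S ==> T (T' Z) = Z" and add: "!!Z Y. Z : S ==> Y : S ==> T (Z + Y) = T Z + T Y"
  and iso: "!!Z. Z : S ==> frob m n (T Z) = frob m n Z" and f: "f : bm (mbs m n S)" shows "nn L (%Z. f (T Z)) = nn L (%Z. f Z)"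
proof -
 define G where "G = {Z : S. frob m n Z <= 1}"
 have "frob m n : bm (mbs m n S)"
  unfolding frob_def by (intro borel_measurable_sum borel_measurable_power m_comp[OF measurable_entry borel_measurable_norm]) auto
 hence G[measurable]: "G : sets (mbs m n S)" unfolding G_def
  using measurable_sets[of "frob m n" "mbs m n S" borel "{..1}"] by (simp add: vimage_def Int_def conj_commute)
 have lt: "emeasure L G < \<infinity>"
 proof (rule emeasure_finite[OF G])
  fix Z i j assume Z: "Z : G" and ij: "i < m" "j < n"
  have "(cmod (Z $$ (i, j)))^2 <= (\<Sum>j<n. (cmod (Z $$ (i, j)))^2)" by (rule member_le_sum) (use ij in auto)
  also have "... <= frob m n Z" unfolding frob_def by (rule member_le_sum[of i "{..<m}" "%i. \<Sum>j<n. (cmod (Z $$ (i, j)))^2"]) (use ij in \<open>auto intro: sum_nonneg\<close>)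
  also have "... <= 1" using Z by (simp add: G_def)
  finally show "cmod (Z $$ (i, j)) <= 1" by (simp add: power2_eq_square abs_square_le_1[unfolded power2_eq_square] flip: abs_le_square_iff)
 qed
 \<comment> \<open>With all entries at most \<open>1 / K\<close> in modulus, the sum of the
   \<open>m * n\<close> squares is at most one; the added 1 keeps \<open>K\<close> positive in
   degenerate dimensions.\<close>
 define K where "K = real (m * n + 1)"
 have K: "1 <= K" "real m * real n <= K" by (simp_all add: K_def)
 have pos: "0 < emeasure L G"
 proof (rule emeasure_pos[OF G, of "e (%_. 0)" "1 / K"])
  show z: "e (%_. 0) : S" by (rule e_S)
  fix Z assume Z: "Z : S" and b: "!!i j. i < m ==> j < n ==> cmod (Z $$ (i, j)) <= 1 / K"
  have 0: "e (%_. 0) $$ (i, j) = 0" if "i < m" "j < n" for i j using e_bound[of "%_. 0" 0 i j] that by simp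
  have "Z + e (%_. 0) = Z" by (rule eq_matI) (use S_dim[OF Z] S_dim[OF z] 0 in simp_all)
  moreover have "frob m n Z <= 1"
  proof -
   have "(cmod (Z $$ (i, j)))^2 <= 1 / K" if "i < m" "j < n" for i j
   proof -
    have "(cmod (Z $$ (i, j)))^2 <= (1 / K)^2" by (rule power_mono[OF b[OF that]]) simp
    also have "... <= 1 / K" using K by (simp add: power2_eq_square divide_simps)
    finally show ?thesis .
   qed
   hence "frob m n Z <= (\<Sum>i<m. \<Sum>j<n. 1 / K)" unfolding frob_def by (intro sum_mono) auto
   also have "... <= 1" using K by (simp add: divide_simps)
   finally show ?thesis .
  qed
  ultimately show "Z + e (%_. 0) : G" using Z by (simp add: G_def)
 qed (use K in simp)
 have "nn L (%Z. f (T Z)) * nn L (%Z. Ind G Z) = nn L (%Z. f Z) * nn L (%Z. Ind G (T Z))"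
 proof (rule nn_additive_ratio[OF T T' TT' add f])
  fix Z Y assume ZY: "Z : S" "Y : S"
  have "frob m n (Z - Y) = frob m n (Y - Z)" unfolding frob_def
   by (intro sum.cong refl) (use S_dim[OF ZY(1)] S_dim[OF ZY(2)] in \<open>simp add: norm_minus_commute\<close>)
  thus "(Ind G (Z - Y) :: ennreal) = Ind G (Y - Z)" using S_minus[OF ZY] S_minus[OF ZY(2,1)] by (simp add: indicator_def G_def)
 qed auto
 moreover have "nn L (%Z. Ind G (T Z)) = nn L (%Z. Ind G Z)" using measurable_space[OF T] by (intro nn_cong) (simp add: indicator_def G_def iso)
 moreover have "nn L (%Z. Ind G Z) = emeasure L G" by (simp add: mL)
 ultimately show ?thesis using lt pos by (auto simp: ennreal_mult_cancel_left mult.commute[of _ "emeasure L G"])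
qed

end

definition herm_coord :: "nat => cmat => nat \<times> nat => real" where
 "herm_coord m X = (\<lambda>ij\<in>{..<m} \<times> {..<m}. if fst ij <= snd ij then Re (X $$ ij) else Im (X $$ (snd ij, fst ij)))"

lemma cmod_Complex_le: "\<bar>a\<bar> <= d ==> \<bar>b\<bar> <= d ==> cmod (Complex a b) <= 2 * d" using cmod_le[of "Complex a b"] by simp

lemma borel_measurable_Complex: assumes [measurable]: "f : bm M" "g : bm M" shows "(%x. Complex (f x) (g x)) : bm M"
 unfolding Complex_eq by measurable

lemma measurable_PL_component: "k : I ==> (%x. x k) : bm (PL I)" using measurable_component_singleton[of k I "%_. lborel :: real measure"] by simp

lemma hermitian_herm_of_entries: "Herm m (hoe m x)" by (intro HermI eq_matI) (auto simp: herm_of_entries_def complex_eq_iff)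

global_interpretation herm: mat_coords "{..<m} \<times> {..<m}" m m "{A. Herm m A}" "hoe m" "herm_coord m" for m
proof
 show "{A. Herm m A} <= Mat m m" using HermD(1) by blast
 show "hoe m x : {A. Herm m A}" for x by (simp add: hermitian_herm_of_entries)
 show "herm_coord m Z : extensional ({..<m} \<times> {..<m})" for Z by (simp add: herm_coord_def)
 show "herm_coord m (hoe m x) = x" if "x : extensional ({..<m} \<times> {..<m})" for x
 proof
  fix k show "herm_coord m (hoe m x) k = x k"
   using extensional_arb[OF that, of k] by (cases k) (auto simp: herm_coord_def herm_of_entries_def restrict_def)
 qed
 show "hoe m (herm_coord m Z) = Z" if "Z : {A. Herm m A}" for Z
 proof (rule eq_matI)
  have Z: "Herm m Z" using that by simp
  fix i j assume "i < nr Z" "j < nc Z"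
  hence ij: "i < m" "j < m" using HermD[OF Z] by auto
  thus "hoe m (herm_coord m Z) $$ (i, j) = Z $$ (i, j)"
   using hermitian_index[OF Z ij] by (auto simp: herm_of_entries_def herm_coord_def complex_eq_iff)
 qed (use that HermD in \<open>auto simp: herm_of_entries_def\<close>)
 show "hoe m : meas (PL ({..<m} \<times> {..<m})) (mbs m m {A. Herm m A})"
 proof (rule mbsI)
  fix i j assume ij: "i < m" "j < m"
  note c = measurable_PL_component[of _ "{..<m} \<times> {..<m}"]
  show "(%x. hoe m x $$ (i, j)) : bm (PL ({..<m} \<times> {..<m}))" by (cases i j rule: linorder_cases)
    (use ij in \<open>auto simp: herm_of_entries_def intro!: borel_measurable_Complex c borel_measurable_uminus borel_measurable_of_real\<close>)
 qed (simp add: hermitian_herm_of_entries)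
 show "herm_coord m : meas (mbs m m {A. Herm m A}) (PL ({..<m} \<times> {..<m}))" unfolding herm_coord_def
 proof (rule measurable_restrict)
  fix ij assume "ij : {..<m} \<times> {..<m}"
  hence ij: "fst ij < m" "snd ij < m" by auto
  note [measurable] = measurable_entry[OF ij, of "{A. Herm m A}", simplified] measurable_entry[OF ij(2,1), of "{A. Herm m A}"]
  show "(%X. if fst ij <= snd ij then Re (X $$ ij) else Im (X $$ (snd ij, fst ij))) : meas (mbs m m {A. Herm m A}) lborel" by measurable
 qed
 show "Z + Y : {A. Herm m A}" "Z - Y : {A. Herm m A}" if "Z : {A. Herm m A}" "Y : {A. Herm m A}" for Z Y using that hermitian_add Herm_minus by auto
 show "herm_coord m (Z + Y) k = herm_coord m Z k + herm_coord m Y k" if "Z : {A. Herm m A}" "Y : {A. Herm m A}" "k : {..<m} \<times> {..<m}" for Z Y k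
  using that HermD(3,4)[of m Y] by (cases k) (auto simp: herm_coord_def)
 show "cmod (hoe m x $$ (i, j)) <= 2 * d" if "!!k. k : {..<m} \<times> {..<m} ==> \<bar>x k\<bar> <= d" "0 <= d" "i < m" "j < m" for x d i j
  using that(1)[of "(i, i)"] that(1)[of "(i, j)"] that(1)[of "(j, i)"] that(2-) by (auto simp: herm_of_entries_def intro!: cmod_Complex_le)
 show "\<bar>herm_coord m Z k\<bar> <= d"
  if "Z : {A. Herm m A}" "!!i j. i < m ==> j < m ==> cmod (Z $$ (i, j)) <= d" "k : {..<m} \<times> {..<m}" for Z d k
  using that(2)[of "fst k" "snd k"] that(2)[of "snd k" "fst k"] that(3) abs_Re_le_cmod[of "Z $$ k"] abs_Im_le_cmod[of "Z $$ (snd k, fst k)"]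
  by (auto simp: herm_coord_def)
qed simp_all

lemma herm_lebesgue_L: "herm_lebesgue m = herm.L m" by (simp add: herm_lebesgue_def herm.L_def herm_borel_mbs)

text \<open>The entries of a \<open>p \<times> q\<close> matrix are stored at the off-diagonal block
  positions of a Hermitian matrix of size \<open>p + q\<close>, real parts above and imaginary parts
  below the diagonal. With this labelling the charts of the three blocks fit together to the chart
  of the whole matrix, up to a shift of the lower right block.\<close>

definition cross_idx :: "nat => nat => (nat \<times> nat) set" where
 "cross_idx p q = {..<p} \<times> {p..<p + q} Un {p..<p + q} \<times> {..<p}"

definition cross_mat :: "nat => nat => (nat \<times> nat => real) => cmat" where
 "cross_mat p q x = mat p q (%(i, j). Complex (x (i, p + j)) (x (p + j, i)))"

definition cross_coord :: "nat => nat => cmat => nat \<times> nat => real" where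
 "cross_coord p q Z = (\<lambda>ij\<in>cross_idx p q. if fst ij < snd ij then Re (Z $$ (fst ij, snd ij - p)) else Im (Z $$ (snd ij, fst ij - p)))"

global_interpretation crs: mat_coords "cross_idx p q" p q "Mat p q" "cross_mat p q" "cross_coord p q" for p q
proof
 show "finite (cross_idx p q)" by (simp add: cross_idx_def)
 show "cross_mat p q x : Mat p q" for x by (simp add: cross_mat_def)
 show "cross_coord p q Z : extensional (cross_idx p q)" for Z by (simp add: cross_coord_def)
 show "cross_coord p q (cross_mat p q x) = x" if "x : extensional (cross_idx p q)" for x
 proof
  fix k show "cross_coord p q (cross_mat p q x) k = x k"
   using extensional_arb[OF that, of k] by (cases k) (auto simp: cross_coord_def cross_mat_def restrict_def cross_idx_def)
 qed
 show "cross_mat p q (cross_coord p q Z) = Z" if "Z : Mat p q" for Z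
  by (rule eq_matI) (use that in \<open>auto simp: cross_coord_def cross_mat_def cross_idx_def complex_eq_iff\<close>)
 show "cross_mat p q : meas (PL (cross_idx p q)) (mm p q)"
 proof (rule mbsI)
  fix i j assume ij: "i < p" "j < q"
  thus "(%x. cross_mat p q x $$ (i, j)) : bm (PL (cross_idx p q))"
   by (auto simp: cross_mat_def cross_idx_def intro!: borel_measurable_Complex measurable_PL_component)
 qed (simp add: cross_mat_def)
 show "cross_coord p q : meas (mm p q) (PL (cross_idx p q))" unfolding cross_coord_def
 proof (rule measurable_restrict)
  fix ij assume ij: "ij : cross_idx p q"
  show "(%Z. if fst ij < snd ij then Re (Z $$ (fst ij, snd ij - p)) else Im (Z $$ (snd ij, fst ij - p))) : meas (mm p q) lborel"
  proof (cases "fst ij < snd ij")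
   case True
   hence "fst ij < p" "snd ij - p < q" using ij by (auto simp: cross_idx_def)
   note [measurable] = measurable_entry[OF this, of "Mat p q"]
   show ?thesis using True by simp
  next
   case False
   hence "snd ij < p" "fst ij - p < q" using ij by (auto simp: cross_idx_def)
   note [measurable] = measurable_entry[OF this, of "Mat p q"]
   show ?thesis using False by simp
  qed
 qed
 show "Z + Y : Mat p q" "Z - Y : Mat p q" if "Z : Mat p q" "Y : Mat p q" for Z Y :: "cmat" using that by auto
 show "cross_coord p q (Z + Y) k = cross_coord p q Z k + cross_coord p q Y k" if "Z : Mat p q" "Y : Mat p q" "k : cross_idx p q" for Z Y k
  using that by (cases k) (auto simp: cross_coord_def cross_idx_def)
 show "cmod (cross_mat p q x $$ (i, j)) <= 2 * d" if "!!k. k : cross_idx p q ==> \<bar>x k\<bar> <= d" "0 <= d" "i < p" "j < q" for x d i j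
  using that(1)[of "(i, p + j)"] that(1)[of "(p + j, i)"] that(2-) by (auto simp: cross_mat_def cross_idx_def intro!: cmod_Complex_le)
 show "\<bar>cross_coord p q Z k\<bar> <= d" if "Z : Mat p q" "!!i j. i < p ==> j < q ==> cmod (Z $$ (i, j)) <= d" "k : cross_idx p q" for Z d k
 proof (cases "fst k < snd k")
  case True
  hence k: "fst k < p" "snd k - p < q" using that(3) by (auto simp: cross_idx_def)
  show ?thesis using order_trans[OF abs_Re_le_cmod that(2)[OF k]] True that(3) by (simp add: cross_coord_def)
 next
  case False
  hence k: "snd k < p" "fst k - p < q" using that(3) by (auto simp: cross_idx_def)
  show ?thesis using order_trans[OF abs_Im_le_cmod that(2)[OF k]] False that(3) by (simp add: cross_coord_def)
 qed
qed auto

section \<open>Linear changes of variables\<close>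

abbreviation "hermS m == {A. Herm m A}"
abbreviation "LH m == herm.L m"
abbreviation "LC p q == crs.L p q"

lemma frob_right: assumes Z: "Z : Mat p q" and U: "unitm q U" shows "frob p q (Z * U) = frob p q Z"
proof -
 have fr: "cx (frob p q Z) = (\<Sum>i<p. (Z * Z^H) $$ (i, i))" if "Z : Mat p q" for Z
  using that by (simp add: frob_def sp_def at0L complex_norm_square del: of_real_power)
 have "(Z * U) * (Z * U)^H = Z * (U * U^H) * Z^H" using Z unitD(4,5)[OF U] by (simp add: m_assoc)
 also have "... = Z * Z^H" using Z unitD(3)[OF U] by simp
 finally have "cx (frob p q (Z * U)) = cx (frob p q Z)" using fr[of "Z * U"] fr[of Z] Z unitD(1)[OF U] by simp
 thus ?thesis by (simp only: of_real_eq_iff)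
qed

lemma frob_left: assumes Z: "Z : Mat p q" and U: "unitm p U" shows "frob p q (U * Z) = frob p q Z"
proof -
 have fr: "cx (frob p q Z) = (\<Sum>j<q. (Z^H * Z) $$ (j, j))" if "Z : Mat p q" for Z unfolding frob_def using that
  by (subst sum.swap) (simp add: sp_def at0L complex_norm_square mult.commute del: of_real_power)
 have "(U * Z)^H * (U * Z) = Z^H * (U^H * U) * Z" using Z unitD(4,5)[OF U] by (simp add: m_assoc)
 also have "... = Z^H * Z" using Z unitD(2)[OF U] by simp
 finally have "cx (frob p q (U * Z)) = cx (frob p q Z)" using fr[of "U * Z"] fr[of Z] Z unitD(1)[OF U] by simp
 thus ?thesis by (simp only: of_real_eq_iff)
qed

lemma mm_id: "(%Z. Z) : meas (mm p q) (mm p q)" by simp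

lemma mult_left_meas: "D : Mat p p ==> (%Z. D * Z) : meas (mm p q) (mm p q)" by (rule mm_mult[OF mm_const mm_id refl])

lemma mult_right_meas: "D : Mat q q ==> (%Z. Z * D) : meas (mm p q) (mm p q)" by (rule mm_mult[OF mm_id mm_const refl])

lemma congr_meas: assumes "D : Mat m m" shows "(%X. D * X * D^H) : meas (mbs m m (hermS m)) (mbs m m (hermS m))"
proof (rule mbs_superset)
 have id: "(%X. X) : meas (mbs m m (hermS m)) (mm m m)" by (rule mbs_subset[of "hermS m"]) (auto dest: HermD(3,4))
 show "(%X. D * X * D^H) : meas (mbs m m (hermS m)) (mm m m)" using assms by (intro mm_mult[of _ _ m m _ m m] mm_const id) auto
 show "D * X * D^H : hermS m" if "X : space (mbs m m (hermS m))" for X using that assms by (auto intro: Herm_congr)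
qed

lemma nn_LC_unitary_left: assumes U: "unitm p U" and f: "f : bm (mm p q)" shows "nn (LC p q) (%Z. f (U * Z)) = nn (LC p q) (%Z. f Z)"
proof (rule crs.nn_isometry[of "%Z. U * Z" p q "%Z. U^H * Z", OF _ _ _ _ _ f])
 note [simp] = unitD(4,5)[OF U]
 show "U * (U^H * Z) = Z" if "Z : Mat p q" for Z using that by (simp add: m_cancel[OF unitD(3)[OF U]])
 show "U * (Z + Y) = U * Z + U * Y" if "Z : Mat p q" "Y : Mat p q" for Z Y using that by (simp add: m_distrib)
qed (use U in \<open>auto intro!: mult_left_meas frob_left unitD(1) adjoint_carrier\<close>)

lemma nn_LC_unitary_right: assumes U: "unitm q U" and f: "f : bm (mm p q)" shows "nn (LC p q) (%Z. f (Z * U)) = nn (LC p q) (%Z. f Z)"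
proof (rule crs.nn_isometry[of "%Z. Z * U" p q "%Z. Z * U^H", OF _ _ _ _ _ f])
 note [simp] = unitD(4,5)[OF U]
 show "Z * U^H * U = Z" if "Z : Mat p q" for Z using that by (simp add: m_assoc unitD(2)[OF U])
 show "(Z + Y) * U = Z * U + Y * U" if "Z : Mat p q" "Y : Mat p q" for Z Y using that by (simp add: m_distrib)
qed (use U in \<open>auto intro!: mult_right_meas frob_right unitD(1) adjoint_carrier\<close>)

lemma nn_LH_unitary: assumes U: "unitm m U" and f: "f : bm (mbs m m (hermS m))" shows "nn (LH m) (%X. f (U * X * U^H)) = nn (LH m) (%X. f X)"
proof (rule herm.nn_isometry[of "%X. U * X * U^H" m "%X. U^H * X * (U^H)^H", OF _ _ _ _ _ f])
 note [simp] = unitD(4,5)[OF U]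
 note Uc = unitD(1)[OF U]
 show "U * (U^H * Z * (U^H)^H) * U^H = Z" if "Z : hermS m" for Z using HermD(3,4)[of m Z] that
  by (simp add: m_assoc m_cancel[OF unitD(3)[OF U]] unitD(3)[OF U])
 show "U * (Z + Y) * U^H = U * Z * U^H + U * Y * U^H" if "Z : hermS m" "Y : hermS m" for Z Y
  using HermD(3,4)[of m Z] HermD(3,4)[of m Y] that by (simp add: m_distrib)
 show "frob m m (U * Z * U^H) = frob m m Z" if "Z : hermS m" for Z
 proof -
  have Z: "Z : Mat m m" using that HermD(1) by blast
  have "frob m m (U * Z * U^H) = frob m m (U * Z)" by (rule frob_right[OF _ unitary_adjoint[OF U]]) (use Z in simp)
  also have "... = frob m m Z" by (rule frob_left[OF Z U])
  finally show ?thesis .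
 qed
 show "(%X. U^H * X * (U^H)^H) : meas (mbs m m (hermS m)) (mbs m m (hermS m))" by (rule congr_meas) simp
 show "(%X. U * X * U^H) : meas (mbs m m (hermS m)) (mbs m m (hermS m))" by (rule congr_meas[OF Uc])
qed

text \<open>With the eigenvalues \<open>h i = (t i)^2\<close> of \<open>D * D^H\<close> and its
  eigenbasis \<open>U\<close>, the matrix \<open>V = rdiag n (1 / t) * U^H * D\<close> is unitary.
  The Jacobians below reduce by this to unitary factors, which preserve the measure, and diagonal
  scalings.\<close>

lemma svd: assumes D: "D : Mat n n" and E: "E : Mat n n" "D * E = 1m n"
 shows "EX U V t. unitm n U & unitm n V & (ALL i<n. 0 < t i) & D = U * rdiag n t * V
  & Re (det (D * D^H)) = (\<Prod>i<n. t i)^2"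
proof -
 note [simp] = MatD[OF D]
 have "pdm n (D * 1m n * D^H)" by (rule pd_congr_inv[OF pd_one D E])
 hence pd: "pdm n (D * D^H)" by simp
 from pos_def_spectral[OF pd] obtain U h where U: "unitm n U" and h: "ALL i<n. 0 < h i" and DD: "D * D^H = U * rdiag n h * U^H" by blast
 note [simp] = unitD(4,5)[OF U]
 define t where "t i = sqrt (h i)" for i
 have t: "ALL i<n. 0 < t i" using h by (simp add: t_def)
 define V where "V = rdiag n (%i. 1 / t i) * U^H * D"
 have [simp]: "nr V = n" "nc V = n" by (simp_all add: V_def)
 have r1: "rdiag n t * rdiag n (%i. 1 / t i) = 1m n" unfolding rdiag_mult by (rule rdiag_one) (use t in auto)
 have "V * V^H = rdiag n (%i. 1 / t i) * (U^H * (D * D^H) * U) * rdiag n (%i. 1 / t i)" by (simp add: V_def m_assoc)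
 also have "U^H * (D * D^H) * U = rdiag n h" unfolding DD by (simp add: m_assoc unitD(2)[OF U] m_cancel[OF unitD(2)[OF U]])
 also have "rdiag n (%i. 1 / t i) * rdiag n h * rdiag n (%i. 1 / t i) = 1m n" unfolding rdiag_mult
 proof (rule rdiag_one)
  fix i assume "i < n"
  hence "0 < h i" using h by blast
  thus "1 / t i * h i * (1 / t i) = 1" by (simp add: t_def)
 qed
 finally have V: "unitm n V" by (intro unitary_matI') simp_all
 have "U * rdiag n t * V = D" by (simp add: V_def m_assoc m_cancel[OF r1] m_cancel[OF unitD(3)[OF U]])
 moreover have "Re (det (D * D^H)) = (\<Prod>i<n. t i)^2" unfolding DD det_spectral[OF U] Re_complex_of_real power2_eq_square prod.distrib[symmetric]
  using h by (intro prod.cong) (auto simp: t_def less_imp_le)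
 ultimately show ?thesis using U V t by blast
qed

lemma prod_cross_idx: "(\<Prod>k\<in>cross_idx p q. f k) = (\<Prod>i<p. \<Prod>j<q. f (i, p + j) * f (p + j, i) :: real)"
proof -
 let ?a = "\<Prod>k\<in>{..<p} \<times> {p..<p + q}. f k"
 let ?b = "\<Prod>k\<in>{p..<p + q} \<times> {..<p}. f k"
 have bij: "bij_betw (%j. p + j) {..<q} {p..<p + q}" by (rule bij_betwI[of _ _ _ "%j. j - p"]) auto
 have "(\<Prod>k\<in>cross_idx p q. f k) = ?a * ?b" unfolding cross_idx_def by (rule prod.union_disjoint) auto
 also have "?a = (\<Prod>i<p. \<Prod>j\<in>{p..<p + q}. f (i, j))" by (simp add: prod.cartesian_product)
 also have "... = (\<Prod>i<p. \<Prod>j<q. f (i, p + j))" by (simp add: prod.reindex_bij_betw[OF bij, of "%j. f (_, j)", symmetric])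
 also have "?b = (\<Prod>j\<in>{p..<p + q}. \<Prod>i<p. f (j, i))" by (simp add: prod.cartesian_product)
 also have "... = (\<Prod>j<q. \<Prod>i<p. f (p + j, i))" by (rule prod.reindex_bij_betw[OF bij, symmetric])
 also have "... = (\<Prod>i<p. \<Prod>j<q. f (p + j, i))" by (rule prod.swap)
 finally show ?thesis by (simp add: prod.distrib)
qed

text \<open>Each of the \<open>q\<close> columns is a complex vector on which \<open>D\<close> acts
  with real Jacobian \<open>|det D|^2\<close>, that is \<open>det (D * D^H)\<close>.\<close>

lemma nn_LC_left: assumes D: "D : Mat p p" "E : Mat p p" "D * E = 1m p" and f: "f : bm (mm p q)"
 shows "ennreal (Re (det (D * D^H)) ^ q) * nn (LC p q) (%Z. f (D * Z)) = nn (LC p q) (%Z. f Z)"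
proof -
 from svd[OF D] obtain U V w where U: "unitm p U" and V: "unitm p V" and w: "ALL i<p. 0 < w i"
  and De: "D = U * rdiag p w * V" and d: "Re (det (D * D^H)) = (\<Prod>i<p. w i)^2" by blast
 note [simp] = unitD(4,5)[OF U] unitD(4,5)[OF V]
 note m = mult_left_meas[OF unitD(1)[OF U]] mult_left_meas[OF rdiag_simps(3)]
 define c where "c k = (if fst k < snd k then w (fst k) else w (snd k))" for k :: "nat \<times> nat"
 have "nn (LC p q) (%Z. f (D * Z)) = nn (LC p q) (%Z. f (U * (rdiag p w * (V * Z))))" by (intro nn_cong) (simp add: De m_assoc)
 also have "... = nn (LC p q) (%Z. f (U * (rdiag p w * Z)))"
  by (rule nn_LC_unitary_left[OF V, of "%Z. f (U * (rdiag p w * Z))"]) (rule m_comp[OF m_comp[OF m(2) m(1)] f])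
 also have "ennreal (\<Prod>k\<in>cross_idx p q. \<bar>c k\<bar>) * ... = nn (LC p q) (%Z. f (U * Z))"
 proof (rule crs.nn_affine[OF m(2) m_comp[OF m(1) f], where t = "%_. 0" and c = c])
  fix k assume k: "k : cross_idx p q"
  show "c k ~= 0" using k w by (auto simp: cross_idx_def c_def)
  fix Z :: "cmat" assume Z: "Z : Mat p q"
  have "(rdiag p w * Z) $$ (i, j) = cx (w i) * Z $$ (i, j)" if "i < p" "j < q" for i j
   using that Z by (simp add: sp_def if_distrib[of "%x. x * _"] cong: if_cong)
  thus "cross_coord p q (rdiag p w * Z) k = 0 + c k * cross_coord p q Z k" using k by (auto simp: cross_coord_def c_def cross_idx_def)
 qed
 also have "... = nn (LC p q) (%Z. f Z)" by (rule nn_LC_unitary_left[OF U f])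
 also have "(\<Prod>k\<in>cross_idx p q. \<bar>c k\<bar>) = Re (det (D * D^H)) ^ q"
 proof -
  have "(\<Prod>k\<in>cross_idx p q. \<bar>c k\<bar>) = (\<Prod>i<p. \<Prod>j<q. w i * w i)"
   unfolding prod_cross_idx using w by (intro prod.cong refl) (auto simp: c_def)
  thus ?thesis unfolding d by (simp add: prod_power_distrib power2_eq_square prod.distrib power_mult_distrib)
 qed
 finally show ?thesis .
qed

lemma nn_LC_right: assumes D: "D : Mat q q" "E : Mat q q" "D * E = 1m q" and f: "f : bm (mm p q)"
 shows "ennreal (Re (det (D * D^H)) ^ p) * nn (LC p q) (%Z. f (Z * D)) = nn (LC p q) (%Z. f Z)"
proof -
 from svd[OF D] obtain U V w where U: "unitm q U" and V: "unitm q V" and w: "ALL i<q. 0 < w i"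
  and De: "D = U * rdiag q w * V" and d: "Re (det (D * D^H)) = (\<Prod>i<q. w i)^2" by blast
 note [simp] = unitD(4,5)[OF U] unitD(4,5)[OF V]
 note m = mult_right_meas[OF unitD(1)[OF V]] mult_right_meas[OF rdiag_simps(3)]
 define c where "c k = (if fst k < snd k then w (snd k - p) else w (fst k - p))" for k :: "nat \<times> nat"
 have "nn (LC p q) (%Z. f (Z * D)) = nn (LC p q) (%Z. f (Z * U * rdiag q w * V))" by (intro nn_cong) (simp add: De m_assoc)
 also have "... = nn (LC p q) (%Z. f (Z * rdiag q w * V))"
  by (rule nn_LC_unitary_right[OF U, of "%Z. f (Z * rdiag q w * V)"]) (rule m_comp[OF m_comp[OF m(2) m(1)] f])
 also have "ennreal (\<Prod>k\<in>cross_idx p q. \<bar>c k\<bar>) * ... = nn (LC p q) (%Z. f (Z * V))"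
 proof (rule crs.nn_affine[OF m(2) m_comp[OF m(1) f], where t = "%_. 0" and c = c])
  fix k assume k: "k : cross_idx p q"
  show "c k ~= 0"
  proof (cases "fst k < snd k")
   case True
   hence "snd k - p < q" using k by (auto simp: cross_idx_def)
   hence "0 < w (snd k - p)" using w by blast
   thus ?thesis using True by (simp add: c_def)
  next
   case False
   hence "fst k - p < q" using k by (auto simp: cross_idx_def)
   hence "0 < w (fst k - p)" using w by blast
   thus ?thesis using False by (simp add: c_def)
  qed
  fix Z :: "cmat" assume Z: "Z : Mat p q"
  have "(Z * rdiag q w) $$ (i, j) = Z $$ (i, j) * cx (w j)" if "i < p" "j < q" for i j
   using that Z by (simp add: sp_def if_distrib[of "%x. _ * x"] cong: if_cong)
  thus "cross_coord p q (Z * rdiag q w) k = 0 + c k * cross_coord p q Z k" using k by (auto simp: cross_coord_def c_def cross_idx_def)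
 qed
 also have "... = nn (LC p q) (%Z. f Z)" by (rule nn_LC_unitary_right[OF V f])
 also have "(\<Prod>k\<in>cross_idx p q. \<bar>c k\<bar>) = Re (det (D * D^H)) ^ p"
 proof -
  have "(\<Prod>k\<in>cross_idx p q. \<bar>c k\<bar>) = (\<Prod>i<p. \<Prod>j<q. w j * w j)"
   unfolding prod_cross_idx using w by (intro prod.cong refl) (auto simp: c_def)
  thus ?thesis unfolding d by (simp add: power2_eq_square prod.distrib power_mult_distrib)
 qed
 finally show ?thesis .
qed

text \<open>A diagonal congruence multiplies both real coordinates of the \<open>(i, j)\<close>
  entry by \<open>w i * w j\<close>; over all index pairs this gives the determinant of the scaling
  to the power \<open>2 * m\<close>.\<close>

lemma nn_LH_congr: assumes D: "D : Mat m m" "E : Mat m m" "D * E = 1m m" and f: "f : bm (mbs m m (hermS m))"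
 shows "ennreal (Re (det (D * D^H)) ^ m) * nn (LH m) (%X. f (D * X * D^H)) = nn (LH m) (%X. f X)"
proof -
 from svd[OF D] obtain U V w where U: "unitm m U" and V: "unitm m V" and w: "ALL i<m. 0 < w i"
  and De: "D = U * rdiag m w * V" and d: "Re (det (D * D^H)) = (\<Prod>i<m. w i)^2" by blast
 note [simp] = unitD(4,5)[OF U] unitD(4,5)[OF V]
 note m = congr_meas[OF unitD(1)[OF U]] congr_meas[OF rdiag_simps(3)]
 define c where "c k = w (fst k) * w (snd k)" for k :: "nat \<times> nat"
 have "nn (LH m) (%X. f (D * X * D^H)) = nn (LH m) (%X. f (U * (rdiag m w * (V * X * V^H) * (rdiag m w)^H) * U^H))"
 proof (rule nn_cong)
  fix X assume "X : space (LH m)"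
  hence X: "Herm m X" by simp
  show "f (D * X * D^H) = f (U * (rdiag m w * (V * X * V^H) * (rdiag m w)^H) * U^H)" using HermD(3,4)[OF X] by (simp add: De m_assoc)
 qed
 also have "... = nn (LH m) (%X. f (U * (rdiag m w * X * (rdiag m w)^H) * U^H))"
  by (rule nn_LH_unitary[OF V, of "%X. f (U * (rdiag m w * X * (rdiag m w)^H) * U^H)"]) (rule m_comp[OF m_comp[OF m(2) m(1)] f])
 also have "ennreal (\<Prod>k\<in>{..<m} \<times> {..<m}. \<bar>c k\<bar>) * ... = nn (LH m) (%X. f (U * X * U^H))"
 proof (rule herm.nn_affine[OF m(2) m_comp[OF m(1) f], where t = "%_. 0" and c = c])
  fix k assume k: "k : {..<m} \<times> {..<m}"
  show "c k ~= 0" using k w by (auto simp: c_def)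
  fix X :: "cmat" assume "X : hermS m"
  hence X: "Herm m X" by simp
  note [simp] = HermD(3,4)[OF X]
  have 1: "(rdiag m w * X) $$ (i, j) = cx (w i) * X $$ (i, j)" if "i < m" "j < m" for i j
   using that by (simp add: sp_def if_distrib[of "%x. x * _"] cong: if_cong)
  define Y where "Y = rdiag m w * X"
  have [simp]: "nr Y = m" "nc Y = m" by (simp_all add: Y_def)
  have "(Y * rdiag m w) $$ (i, j) = Y $$ (i, j) * cx (w j)" if "i < m" "j < m" for i j
   using that by (simp add: sp_def if_distrib[of "%x. _ * x"] cong: if_cong)
  hence "(rdiag m w * X * (rdiag m w)^H) $$ (i, j) = cx (w i * w j) * X $$ (i, j)" if "i < m" "j < m" for i j
   using that 1 by (simp add: Y_def[symmetric] del: index_mm(1))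
  thus "herm_coord m (rdiag m w * X * (rdiag m w)^H) k = 0 + c k * herm_coord m X k"
   using k by (cases k) (auto simp: herm_coord_def c_def simp del: index_mm(1) of_real_mult)
 qed
 also have "... = nn (LH m) (%X. f X)" by (rule nn_LH_unitary[OF U f])
 also have "(\<Prod>k\<in>{..<m} \<times> {..<m}. \<bar>c k\<bar>) = Re (det (D * D^H)) ^ m"
 proof -
  have "(\<Prod>k\<in>{..<m} \<times> {..<m}. \<bar>c k\<bar>) = (\<Prod>i<m. \<Prod>j<m. w i * w j)"
   unfolding prod.cartesian_product by (intro prod.cong refl) (use w in \<open>auto simp: c_def abs_mult abs_of_pos\<close>)
  thus ?thesis unfolding d by (simp add: prod.distrib prod_power_distrib power2_eq_square power_mult_distrib)
 qed
 finally show ?thesis .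
qed

section \<open>Block decomposition of Lebesgue measure and full rank\<close>

lemma mm_four_block: assumes A: "A : meas M (mm p p')" and B: "B : meas M (mm p q')" and C: "C : meas M (mm q p')" and D: "D : meas M (mm q q')"
 shows "(%w. fbm (A w) (B w) (C w) (D w)) : meas M (mm (p + q) (p' + q'))"
proof (rule mbsI)
 fix i j assume ij: "i < p + q" "j < p' + q'"
 define g where "g w = (if i < p then if j < p' then A w $$ (i, j) else B w $$ (i, j - p')
   else if j < p' then C w $$ (i - p, j) else D w $$ (i - p, j - p'))" for w
 have "g : bm M" unfolding g_def using ij by (cases "i < p"; cases "j < p'") (auto intro!: mbsD(1)[OF A] mbsD(1)[OF B] mbsD(1)[OF C] mbsD(1)[OF D])
 moreover have "fbm (A w) (B w) (C w) (D w) $$ (i, j) = g w" if "w : space M" for w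
  using ij mmD[OF A that] mmD[OF B that] mmD[OF C that] mmD[OF D that] by (simp add: g_def)
 ultimately show "(%w. fbm (A w) (B w) (C w) (D w) $$ (i, j)) : bm M" by (subst measurable_cong) auto
next
 fix w assume "w : space M"
 thus "fbm (A w) (B w) (C w) (D w) : Mat (p + q) (p' + q')" using mmD[OF A] mmD[OF D] by simp
qed

lemma herm_mm: "f : meas M (mbs m m (hermS m)) ==> f : meas M (mm m m)" by (rule mbs_subset[rotated]) (auto dest: HermD(3,4))

lemma meas_LH: "meas M (LH m) = meas M (mbs m m (hermS m))" "meas (LH m) M = meas (mbs m m (hermS m)) M"
 and meas_LC: "meas M (LC p q) = meas M (mm p q)" "meas (LC p q) M = meas (mm p q) M"
 by (rule measurable_cong_sets; simp add: herm.sets_L crs.sets_L)+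

lemma mm_hermI: "f : meas M (mm m m) ==> (!!w. w : space M ==> Herm m (f w)) ==> f : meas M (mbs m m (hermS m))" by (rule mbs_superset) auto

lemma block_meas: assumes A: "A : meas M (mbs p p (hermS p))" and Z: "Z : meas M (mm p q)" and F: "F : meas M (mbs q q (hermS q))"
 shows "(%t. fbm (A t) (Z t) ((Z t)^H) (F t)) : meas M (mbs (p + q) (p + q) (hermS (p + q)))"
proof (rule mm_hermI)
 show "(%t. fbm (A t) (Z t) ((Z t)^H) (F t)) : meas M (mm (p + q) (p + q))" by (intro mm_four_block herm_mm A F Z mm_adj[OF Z Z])
 fix t assume w: "t : space M"
 show "Herm (p + q) (fbm (A t) (Z t) ((Z t)^H) (F t))" using mbsD(2)[OF A w] mbsD(2)[OF Z w] mbsD(2)[OF F w] by (auto intro!: hermitian_four_block)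
qed

text \<open>The index square splits into two diagonal squares and the cross positions, and Fubini
  follows this splitting. The charts are matched, so no factor appears.\<close>

lemma nn_LH_block: assumes f: "f : bm (mbs (p + q) (p + q) (hermS (p + q)))"
 shows "nn (LH (p + q)) (%X. f X) = nn (LH p) (%A. (nn (LC p q) (%Z. (nn (LH q) (%F. f (fbm A Z (Z^H) F))))))"
proof -
 interpret product_sigma_finite "%_::nat \<times> nat. lborel :: real measure" by (rule product_lborel)
 interpret SF: sigma_finite_measure "LH q" by (rule herm.sigma_finite_L)
 interpret SZ: sigma_finite_measure "LC p q" by (rule crs.sigma_finite_L)
 define I1 I2 I3 :: "(nat \<times> nat) set" where "I1 = {..<p} \<times> {..<p}" and "I2 = cross_idx p q" and "I3 = {p..<p + q} \<times> {p..<p + q}"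
 have I: "{..<p + q} \<times> {..<p + q} = I1 Un (I2 Un I3)" by (auto simp: I1_def I2_def I3_def cross_idx_def)
 have fin: "finite I1" "finite I2" "finite I3" and dis: "I1 Int (I2 Un I3) = {}" "I2 Int I3 = {}" by (auto simp: I1_def I2_def I3_def cross_idx_def)
 define g where "g x = f (hoe (p + q) x)" for x
 have g[measurable]: "g : bm (PL (I1 Un (I2 Un I3)))" unfolding g_def I[symmetric] by (rule m_comp[OF herm.e_meas f])
 have G3: "(%(AZ, F). f (fbm (fst AZ) (snd AZ) ((snd AZ)^H) F)) : bm ((LH p \<Otimes>\<^sub>M LC p q) \<Otimes>\<^sub>M LH q)"
 proof -
  have 1: "(%x. fst (fst x)) : meas ((LH p \<Otimes>\<^sub>M LC p q) \<Otimes>\<^sub>M LH q) (LH p)" "(%x. snd (fst x)) : meas ((LH p \<Otimes>\<^sub>M LC p q) \<Otimes>\<^sub>M LH q) (LC p q)"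
   "snd : meas ((LH p \<Otimes>\<^sub>M LC p q) \<Otimes>\<^sub>M LH q) (LH q)" by measurable
  show ?thesis unfolding case_prod_beta' by (rule m_comp[OF block_meas f]) (use 1 in \<open>simp_all only: meas_LH meas_LC\<close>)
 qed
 define h3 where "h3 A Z = nn (LH q) (%F. f (fbm A Z (Z^H) F))" for A Z
 have h3: "(%(A, Z). h3 A Z) : bm (LH p \<Otimes>\<^sub>M LC p q)" using SF.borel_measurable_nn_integral[OF G3] by (simp add: h3_def case_prod_beta')
 define h2 where "h2 A = nn (LC p q) (%Z. h3 A Z)" for A
 have h2: "h2 : bm (mbs p p (hermS p))" using SZ.borel_measurable_nn_integral[OF h3] unfolding h2_def[abs_def] meas_LH .
 have key: "nn (PL I3) (%y. g (merge I1 (I2 Un I3) (x, merge I2 I3 (z, y)))) = h3 (hoe p x) (cross_mat p q z)"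
  if "x : space (PL I1)" "z : space (PL I2)" for x z
 proof -
  define A Z where "A = hoe p x" and "Z = cross_mat p q z"
  \<comment> \<open>Relabelling that shifts the lower right block to the index origin.\<close>
  define s where "s k = (p + fst k, p + snd k)" for k :: "nat \<times> nat"
  have s: "bij_betw s ({..<q} \<times> {..<q}) I3" by (rule bij_betwI[of _ _ _ "%k. (fst k - p, snd k - p)"]) (auto simp: s_def I3_def)
  have AZ: "A : hermS p" "Z : Mat p q" by (simp_all add: A_def Z_def hermitian_herm_of_entries cross_mat_def)
  have fb: "(%F. f (fbm A Z (Z^H) F)) : bm (mbs q q (hermS q))"
   by (rule m_comp[OF block_meas f]) (use AZ in \<open>auto intro: measurable_const\<close>)
  have eq: "hoe (p + q) (merge I1 (I2 Un I3) (x, merge I2 I3 (z, y)))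
    = fbm A Z (Z^H) (hoe q (\<lambda>k\<in>{..<q} \<times> {..<q}. 0 + 1 * y (s k)))" for y
  proof -
   define mg where "mg = merge I1 (I2 Un I3) (x, merge I2 I3 (z, y))"
   define F where "F = hoe q (\<lambda>k\<in>{..<q} \<times> {..<q}. 0 + 1 * y (s k))"
   have mg: "a < p ==> b < p ==> mg (a, b) = x (a, b)" "a < p ==> p <= b ==> b < p + q ==> mg (a, b) = z (a, b)"
    "b < p ==> p <= a ==> a < p + q ==> mg (a, b) = z (a, b)"
    "p <= a ==> a < p + q ==> p <= b ==> b < p + q ==> mg (a, b) = y (a, b)" for a b
    by (simp_all add: mg_def merge_def I1_def I2_def I3_def cross_idx_def)
   have d: "nr A = p" "nc A = p" "nr Z = p" "nc Z = q" "nr F = q" "nc F = q" using AZ(2) by (simp_all add: A_def F_def herm_of_entries_def)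
   have "hoe (p + q) mg = fbm A Z (Z^H) F"
   proof (rule eq_matI)
    fix i j assume "i < nr (fbm A Z (Z^H) F)" "j < nc (fbm A Z (Z^H) F)"
    hence ij: "i < p + q" "j < p + q" by (simp_all add: d)
    have L: "hoe (p + q) mg $$ (i, j) = (if i = j then cx (mg (i, i))
      else if i < j then Complex (mg (i, j)) (mg (j, i)) else Complex (mg (j, i)) (- mg (i, j)))" using ij by (simp add: herm_of_entries_def)
    have R: "fbm A Z (Z^H) F $$ (i, j) = (if i < p then if j < p then A $$ (i, j) else Z $$ (i, j - p)
      else if j < p then Z^H $$ (i - p, j) else F $$ (i - p, j - p))" using ij by (simp add: d)
    consider "i < p" "j < p" | "i < p" "p <= j" | "p <= i" "j < p" | "p <= i" "p <= j" by linarith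
    thus "hoe (p + q) mg $$ (i, j) = fbm A Z (Z^H) F $$ (i, j)"
    proof cases
     case 1
     thus ?thesis unfolding L R by (simp add: mg A_def herm_of_entries_def)
    next
     case 2
     thus ?thesis unfolding L R using ij by (simp add: mg Z_def cross_mat_def)
    next
     case 3
     hence "Z^H $$ (i - p, j) = cnj (Z $$ (j, i - p))" using ij by (intro index_adjoint) (simp_all add: d less_diff_conv2)
     thus ?thesis unfolding L R using ij 3 by (simp add: mg Z_def cross_mat_def complex_eq_iff less_diff_conv2)
    next
     case 4
     hence "i - p < q" "j - p < q" "(i - p = j - p) = (i = j)" "(i - p < j - p) = (i < j)" using ij by auto
     thus ?thesis unfolding L R using ij 4 by (simp add: mg F_def herm_of_entries_def s_def)
    qed
   qed (simp_all add: d herm_of_entries_def)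
   thus ?thesis unfolding mg_def F_def .
  qed
  have "nn (PL I3) (%y. g (merge I1 (I2 Un I3) (x, merge I2 I3 (z, y))))
   = nn (PL I3) (%y. f (fbm A Z (Z^H) (hoe q (\<lambda>k\<in>{..<q} \<times> {..<q}. 0 + 1 * y (s k)))))" unfolding g_def eq ..
  also have "... = nn (PL ({..<q} \<times> {..<q})) (%y. f (fbm A Z (Z^H) (hoe q y)))"
   using nn_integral_PiM_affine[OF _ s, of "%_. 1" "%y. f (fbm A Z (Z^H) (hoe q y))" "%_. 0"]
    m_comp[OF herm.e_meas fb] by simp
  also have "... = h3 A Z" unfolding h3_def by (rule herm.nn_L[OF fb, symmetric])
  finally show ?thesis unfolding A_def Z_def .
 qed
 have h3z: "(%Z. h3 A Z) : bm (mm p q)" if "A : hermS p" for A using measurable_Pair2[OF h3, of A] that by (simp add: meas_LC)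
 have "nn (LH (p + q)) (%X. f X) = (nn (PL (I1 Un (I2 Un I3))) (%x. g x))" unfolding g_def I[symmetric] by (rule herm.nn_L[OF f])
 also have "... = nn (PL I1) (%x. (nn (PL (I2 Un I3)) (%w. g (merge I1 (I2 Un I3) (x, w)))))"
  by (rule product_nn_integral_fold) (use fin dis g in auto)
 also have "... = nn (PL I1) (%x. h2 (hoe p x))"
 proof (rule nn_cong)
  fix x assume x: "x : space (PL I1)"
  have "(%w. g (merge I1 (I2 Un I3) (x, w))) : bm (PL (I2 Un I3))" using measurable_Pair2[OF m_comp[OF measurable_merge g] x] by simp
  hence "nn (PL (I2 Un I3)) (%w. g (merge I1 (I2 Un I3) (x, w))) = nn (PL I2) (%z. (nn (PL I3) (%y. g (merge I1 (I2 Un I3) (x, merge I2 I3 (z, y))))))"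
   by (rule product_nn_integral_fold[OF dis(2) fin(2,3)])
  also have "... = nn (PL I2) (%z. h3 (hoe p x) (cross_mat p q z))" by (rule nn_cong) (rule key[OF x])
  also have "... = h2 (hoe p x)" unfolding h2_def I2_def by (rule crs.nn_L[symmetric], rule h3z) (simp add: hermitian_herm_of_entries)
  finally show "nn (PL (I2 Un I3)) (%w. g (merge I1 (I2 Un I3) (x, w))) = h2 (hoe p x)" .
 qed
 also have "... = nn (LH p) (%A. h2 A)" unfolding I1_def by (rule herm.nn_L[OF h2, symmetric])
 finally show ?thesis unfolding h2_def h3_def .
qed

text \<open>Along the line from \<open>Z\<close> in the direction of the partial identity, the rank
  can drop only if \<open>- t\<close> is an eigenvalue of the adjoint of the leading square block,
  hence for finitely many \<open>t\<close>. Averaging over \<open>t\<close> in the unit interval and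
  translation invariance make the exceptional set null.\<close>

lemma AE_full_rank: assumes pq: "p <= q" shows "AE Z in LC p q. pdm p (Z * Z^H)"
proof -
 interpret sigma_finite_measure "LC p q" by (rule crs.sigma_finite_L)
 interpret pair_sigma_finite "LC p q" "lborel :: real measure" ..
 define S where "S = {Z : Mat p q. ~ pdm p (Z * Z^H)}"
 have "Measurable.pred (mm p q) (%Z. pdm p (Z * Z^H))" by (rule pred_pos_def[OF mm_mult[OF mm_id mm_adj[OF mm_id mm_id] refl]])
 hence S[measurable]: "S : sets (mm p q)" unfolding S_def
  using predE[OF pred_intros_logic(2)[OF \<open>Measurable.pred (mm p q) (%Z. pdm p (Z * Z^H))\<close>]] by simp
 define T where "T t Z = Z + cx t .* mat p q (%(i, j). if i = j then 1 else 0)" for t :: real and Z :: "cmat"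
 have Tm: "(%x. T (snd x) (fst x)) : meas (LC p q \<Otimes>\<^sub>M lborel) (mm p q)"
 proof -
  have f: "fst : meas (LC p q \<Otimes>\<^sub>M lborel) (mm p q)" using measurable_fst[of "LC p q" "lborel :: real measure"] by (simp add: meas_LC)
  have "(%x. cx (snd x) .* mat p q (%(i, j). if i = j then 1 else 0)) : meas (LC p q \<Otimes>\<^sub>M lborel) (mm p q)" by (rule mbsI) simp_all
  thus ?thesis unfolding T_def by (intro mm_add[OF f]) simp_all
 qed
 have Si: "(Ind S :: cmat => ennreal) : bm (mm p q)" using S by simp
 have fin: "finite {t. T t Z : S}" if Z: "Z : Mat p q" for Z
 proof -
  define Z1 where "Z1 = block 0 0 p p Z"
  have Z1: "Z1^H : Mat p p" by (simp add: Z1_def)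
  have "eigenvalue (Z1^H) (cx (- t))" if t: "T t Z : S" for t
  proof -
   define Y where "Y = T t Z"
   have Y: "Y : Mat p q" using t by (simp add: Y_def S_def)
   note [simp] = MatD[OF Y]
   have "Herm p (Y * Y^H)" by (rule HermI) simp_all
   moreover have "~ pdm p (Y * Y^H)" using t by (simp add: Y_def S_def)
   ultimately obtain v where v: "v : Vec p" "v ~= 0\<^sub>v p" "~ 0 < Re (((Y * Y^H) *v v) .c v)" unfolding pos_def_mat_iff by blast
   have "((Y * Y^H) *v v) .c v = (Y^H *v v) .c (Y^H *v v)" using v(1) by (subst mult_vec_assoc) (simp_all add: cinner_adjoint)
   also have "... = cx (\<Sum>i<q. (cmod ((Y^H *v v) $ i))^2)" by (subst cinner_self_Re) simp
   finally have "(\<Sum>i<q. (cmod ((Y^H *v v) $ i))^2) <= 0" using v(3) by simp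
   hence "(\<Sum>i<q. (cmod ((Y^H *v v) $ i))^2) = 0" by (intro antisym sum_nonneg) auto
   hence z: "(Y^H *v v) $ i = 0" if "i < q" for i using that by (subst (asm) sum_nonneg_eq_0_iff) auto
   have "Z1^H *v v = cx (- t) \<cdot>\<^sub>v v"
   proof (rule eq_vecI)
    fix i assume "i < dim_vec (cx (- t) \<cdot>\<^sub>v v)"
    hence i: "i < p" "i < q" using v(1) pq by auto
    have "0 = (\<Sum>k<p. cnj (Y $$ (k, i)) * v $ k)" using z[OF i(2)] i v(1) by (simp add: sp_def at0L)
    also have "... = (\<Sum>k<p. cnj (Z $$ (k, i)) * v $ k + (if k = i then cx t * v $ i else 0))"
     using i Z by (intro sum.cong refl) (auto simp: Y_def T_def algebra_simps)
    also have "... = (\<Sum>k<p. cnj (Z $$ (k, i)) * v $ k) + cx t * v $ i" using i by (simp add: sum.distrib)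
    also have "(\<Sum>k<p. cnj (Z $$ (k, i)) * v $ k) = (Z1^H *v v) $ i" using i v(1) by (simp add: sp_def at0L Z1_def block_def)
    finally show "(Z1^H *v v) $ i = (cx (- t) \<cdot>\<^sub>v v) $ i" using i v(1) by (simp add: eq_neg_iff_add_eq_0)
   qed (use v(1) in \<open>simp add: Z1_def\<close>)
   thus ?thesis unfolding eigenvalue_def eigenvector_def using v(1,2) Z1 by (intro exI[of _ v]) simp
  qed
  hence "(%t. cx (- t)) ` {t. T t Z : S} <= spectrum (Z1^H)" by (auto simp: spectrum_def)
  hence "finite ((%t. cx (- t)) ` {t. T t Z : S})" using card_finite_spectrum(1)[OF Z1] finite_subset by blast
  thus ?thesis by (rule finite_imageD) (simp add: inj_on_def)
 qed
 have "emeasure (LC p q) S = nn (lborel :: real measure) (%t. emeasure (LC p q) S * Ind {0..1} t)" by (subst nn_cmult) simp_all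
 also have "... = nn (lborel :: real measure) (%t. (nn (LC p q) (%Z. Ind S (T t Z) * Ind {0..1} t)))"
 proof (rule nn_cong)
  fix t :: real
  have "nn (LC p q) (%Z. Ind S (T t Z) * Ind {0..1} t) = nn (LC p q) (%Z. Ind S Z * Ind {0..1} t)" unfolding T_def by (rule crs.nn_translate) auto
  also have "... = emeasure (LC p q) S * Ind {0..1} t" by (subst nn_integral_multc) (simp_all add: meas_LC crs.sets_L)
  finally show "emeasure (LC p q) S * Ind {0..1} t = nn (LC p q) (%Z. Ind S (T t Z) * Ind {0..1} t)" by simp
 qed
 also have "... = nn (LC p q) (%Z. (nn (lborel :: real measure) (%t. Ind S (T t Z) * Ind {0..1} t)))"
 proof (rule Fubini')
  show "(%(Z, t). Ind S (T t Z) * Ind {0..1} t :: ennreal) : bm (LC p q \<Otimes>\<^sub>M (lborel :: real measure))" unfolding case_prod_beta'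
   by (rule bm_times[OF m_comp[OF Tm Si]]) simp
 qed
 also have "... = nn (LC p q) (%Z. 0)"
 proof (rule nn_cong)
  fix Z assume "Z : space (LC p q)"
  hence "finite {t. T t Z : S}" by (intro fin) simp
  hence "AE t in (lborel :: real measure). t \<notin> {t. T t Z : S}" by (intro AE_not_in) (simp add: null_setsI finite_imp_null_set_lborel)
  thus "nn (lborel :: real measure) (%t. Ind S (T t Z) * Ind {0..1} t) = 0"
   by (subst nn_integral_cong_AE[where v = "%_. 0"]) (auto simp: indicator_def elim!: eventually_mono)
 qed
 finally have "emeasure (LC p q) S = 0" by simp
 moreover have "{Z : space (LC p q). ~ pdm p (Z * Z^H)} <= S" by (auto simp: S_def)
 moreover have "S : sets (LC p q)" using S by (simp add: crs.sets_L)
 ultimately show ?thesis by (intro AE_I[of _ _ S])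
qed

section \<open>Wishart integrals\<close>

text \<open>The inverse, expressed by \<open>isq\<close> so that its measurability is
  inherited.\<close>

definition winv :: "nat => cmat => cmat" where
 "winv p W = isq p W * isq p W"

lemma winv_props: assumes W: "pdm p W"
 shows "W * winv p W = 1m p" "winv p W * W = 1m p" "(winv p W)^H = winv p W" "nr (winv p W) = p" "nc (winv p W) = p"
proof -
 define S T where "S = isqrt p W" and "T = sqrt_mat p W"
 note [simp] = pd_dims(2-4)[OF isqrt_pd[OF W], folded S_def] pd_dims(2-4)[OF sqrt_pd[OF W], folded T_def] pd_dims(3,4)[OF W]
 note TS = sqrt_isqrt[OF W, folded S_def T_def] and TT = sqrt_mult_self[OF W, folded T_def]
 have w: "winv p W = S * S" using W by (simp add: winv_def isq_def S_def)
 show d: "nr (winv p W) = p" "nc (winv p W) = p" "(winv p W)^H = winv p W" by (simp_all add: w)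
 have "W * (S * S) = T * T * (S * S)" unfolding TT ..
 also have "... = 1m p" by (simp add: m_assoc m_cancel[OF TS] TS)
 finally show 1: "W * winv p W = 1m p" unfolding w .
 show "winv p W * W = 1m p" by (rule mm_lr_inv[OF _ _ 1]) (use d in simp_all)
qed

lemma winv_eq: assumes W: "pdm p W" and V: "V : Mat p p" "W * V = 1m p" shows "winv p W = V"
 by (rule left_inverse_unique[OF winv_props(2)[OF W] V(2)]) (use winv_props(4,5)[OF W] V(1) pd_dims(3,4)[OF W] in simp_all)

lemma mm_winv: "f : meas M (mm p p) ==> (%w. winv p (f w)) : meas M (mm p p)" unfolding winv_def by (intro mm_mult[OF mm_isq mm_isq]) auto

lemma pd_det: assumes "pdm p W" shows "0 < Re (det W)" "cx (Re (det W)) = det W" using pos_def_det[OF assms] by simp_all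

lemma pd_det_congr: assumes W: "pdm p W" and D: "D : Mat p p" "E : Mat p p" "D * E = 1m p"
 shows "Re (det (D * W * D^H)) = Re (det (D * D^H)) * Re (det W)" "0 < Re (det (D * D^H))"
proof -
 note [simp] = MatD[OF D(1)]
 have "pdm p (D * 1m p * D^H)" by (rule pd_congr_inv[OF pd_one D])
 hence DD: "pdm p (D * D^H)" by simp
 show "0 < Re (det (D * D^H))" by (rule pd_det(1)[OF DD])
 have "det (D * W * D^H) = det (D * D^H) * det W" using det_congr[OF D(1) pd_dims(1)[OF W]] det_mult[of D p "D^H"] by (simp add: mult_ac)
 also have "... = cx (Re (det (D * D^H)) * Re (det W))" by (simp add: pd_det(2)[OF DD] pd_det(2)[OF W])
 finally show "Re (det (D * W * D^H)) = Re (det (D * D^H)) * Re (det W)" by simp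
qed

text \<open>The density of the invariant measures: with \<open>k = p\<close> on Hermitian matrices
  it is invariant under congruence, and with \<open>k = q\<close>, evaluated at
  \<open>Z * Z^H\<close>, under left multiplication of \<open>p \<times> q\<close> matrices.\<close>

definition wgt :: "nat => nat => cmat => ennreal" where
 "wgt p k W = (if pdm p W then ennreal (1 / Re (det W) ^ k) else 0)"

lemma wgt_meas: "f : meas M (mm p p) ==> (%w. wgt p k (f w)) : bm M"
proof -
 assume f: "f : meas M (mm p p)"
 note [measurable] = pred_pos_def[OF f] measurable_det[OF f]
 show ?thesis unfolding wgt_def by measurable
qed

lemma wgt_congr: assumes W: "W : Mat p p" and D: "D : Mat p p" "E : Mat p p" "D * E = 1m p"
 shows "ennreal (Re (det (D * D^H)) ^ k) * wgt p k (D * W * D^H) = wgt p k W"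
proof (cases "pdm p W")
 case True
 note d = pd_det_congr[OF True D] and p = pd_congr_inv[OF True D]
 show ?thesis using True p d pd_det(1)[OF True] by (simp add: wgt_def power_mult_distrib flip: ennreal_mult)
next
 case False
 thus ?thesis using pd_congr_iff[OF W D] by (simp add: wgt_def)
qed

text \<open>The Jacobian of \<open>Z \<mapsto> D * Z\<close> is compensated by the factor that the
  weight acquires.\<close>

lemma LC_inv_left: assumes D: "D : Mat p p" "E : Mat p p" "D * E = 1m p" and f: "f : bm (mm p q)"
 shows "nn (LC p q) (%Z. wgt p q (Z * Z^H) * f (D * Z)) = nn (LC p q) (%Z. wgt p q (Z * Z^H) * f Z)"
proof -
 let ?a = "Re (det (D * D^H)) ^ q"
 have wm: "(%Z. wgt p q (Z * Z^H)) : bm (mm p q)" by (rule wgt_meas[OF mm_mult[OF mm_id mm_adj[OF mm_id mm_id] refl]])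
 have "nn (LC p q) (%Z. wgt p q (Z * Z^H) * f Z) = ennreal ?a * nn (LC p q) (%Z. wgt p q (D * Z * (D * Z)^H) * f (D * Z))"
  by (rule nn_LC_left[OF D, symmetric]) (rule bm_times[OF wm f])
 also have "... = nn (LC p q) (%Z. ennreal ?a * (wgt p q (D * Z * (D * Z)^H) * f (D * Z)))" by (rule nn_cmult[symmetric])
   (use bm_times[OF m_comp[OF mult_left_meas[OF D(1)] wm] m_comp[OF mult_left_meas[OF D(1)] f]] in \<open>simp only: meas_LC\<close>)
 also have "... = nn (LC p q) (%Z. wgt p q (Z * Z^H) * f (D * Z))"
 proof (rule nn_cong)
  fix Z assume "Z : space (LC p q)"
  hence Z: "Z : Mat p q" by simp
  have "D * Z * (D * Z)^H = D * (Z * Z^H) * D^H" using Z D(1) by (simp add: m_assoc)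
  moreover have "Z * Z^H : Mat p p" using Z by simp
  ultimately show "ennreal ?a * (wgt p q (D * Z * (D * Z)^H) * f (D * Z)) = wgt p q (Z * Z^H) * f (D * Z)"
   using wgt_congr[OF _ D, of "Z * Z^H" q] by (simp add: mult.assoc[symmetric])
 qed
 finally show ?thesis by simp
qed

text \<open>The invertible matrices are unimodular: for square \<open>Z\<close> the weight also
  compensates right multiplication. Singular \<open>Z\<close> have weight zero before and
  after.\<close>

lemma LC_inv_right: assumes D: "D : Mat p p" "E : Mat p p" "D * E = 1m p" and f: "f : bm (mm p p)"
 shows "nn (LC p p) (%Z. wgt p p (Z * Z^H) * f (Z * D)) = nn (LC p p) (%Z. wgt p p (Z * Z^H) * f Z)"
proof -
 let ?a = "Re (det (D * D^H)) ^ p"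
 note [simp] = MatD[OF D(1)]
 have wm: "(%Z. wgt p p (Z * Z^H)) : bm (mm p p)" by (rule wgt_meas[OF mm_mult[OF mm_id mm_adj[OF mm_id mm_id] refl]])
 have "pdm p (D * 1m p * D^H)" by (rule pd_congr_inv[OF pd_one D])
 hence DD: "pdm p (D * D^H)" by simp
 have key: "ennreal ?a * wgt p p (Z * D * (Z * D)^H) = wgt p p (Z * Z^H)" if Z: "Z : Mat p p" for Z
 proof (cases "det Z = 0")
  case True
  have "det (Z * D * (Z * D)^H) = 0" "det (Z * Z^H) = 0" using Z True D(1) by (simp_all add: det_mult[of _ p])
  hence "~ pdm p (Z * D * (Z * D)^H)" "~ pdm p (Z * Z^H)" using pd_det(1) by force+
  thus ?thesis by (simp add: wgt_def)
 next
  case False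
  from det_inverse_exists[OF Z False] obtain Y where Y: "Y : Mat p p" "Z * Y = 1m p" by blast
  have e: "Z * D * (Z * D)^H = Z * (D * D^H) * Z^H" "Z * Z^H = Z * 1m p * Z^H" using Z by (simp_all add: m_assoc)
  have r: "Re (det (Z * D * (Z * D)^H)) = Re (det (Z * Z^H)) * Re (det (D * D^H))" unfolding e(1) by (rule pd_det_congr(1)[OF DD Z Y])
  have p: "pdm p (Z * D * (Z * D)^H)" "pdm p (Z * Z^H)" unfolding e(1) by (rule pd_congr_inv[OF DD Z Y], subst e(2), rule pd_congr_inv[OF pd_one Z Y])
  show ?thesis using p pd_det(1)[OF DD] pd_det(1)[OF p(2)] by (simp add: wgt_def r power_mult_distrib flip: ennreal_mult)
 qed
 have "nn (LC p p) (%Z. wgt p p (Z * Z^H) * f Z) = ennreal ?a * nn (LC p p) (%Z. wgt p p (Z * D * (Z * D)^H) * f (Z * D))"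
  by (rule nn_LC_right[OF D, symmetric]) (rule bm_times[OF wm f])
 also have "... = nn (LC p p) (%Z. ennreal ?a * (wgt p p (Z * D * (Z * D)^H) * f (Z * D)))" by (rule nn_cmult[symmetric])
   (use bm_times[OF m_comp[OF mult_right_meas[OF D(1)] wm] m_comp[OF mult_right_meas[OF D(1)] f]] in \<open>simp only: meas_LC\<close>)
 also have "... = nn (LC p p) (%Z. wgt p p (Z * Z^H) * f (Z * D))"
  by (rule nn_cong) (use key in \<open>simp add: mult.assoc[symmetric] del: carrier_iff\<close>)
 finally show ?thesis by simp
qed

lemma LH_inv: assumes D: "D : Mat p p" "E : Mat p p" "D * E = 1m p" and f: "f : bm (mm p p)"
 shows "nn (LH p) (%W. wgt p p W * f (D * W * D^H)) = nn (LH p) (%W. wgt p p W * f W)"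
proof -
 let ?a = "Re (det (D * D^H)) ^ p"
 have id: "(%X. X) : meas (mbs p p (hermS p)) (mm p p)" by (rule herm_mm) simp
 have wm: "(%W. wgt p p W) : bm (mbs p p (hermS p))" by (rule wgt_meas[OF id])
 have fm: "(%W. f W) : bm (mbs p p (hermS p))" by (rule m_comp[OF id f])
 have "nn (LH p) (%W. wgt p p W * f W) = ennreal ?a * nn (LH p) (%W. wgt p p (D * W * D^H) * f (D * W * D^H))"
  by (rule nn_LH_congr[OF D, symmetric]) (rule bm_times[OF wm fm])
 also have "... = nn (LH p) (%W. ennreal ?a * (wgt p p (D * W * D^H) * f (D * W * D^H)))" by (rule nn_cmult[symmetric])
   (use bm_times[OF m_comp[OF congr_meas[OF D(1)] wm] m_comp[OF congr_meas[OF D(1)] fm]] in \<open>simp only: meas_LH\<close>)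
 also have "... = nn (LH p) (%W. wgt p p W * f (D * W * D^H))"
 proof (rule nn_cong)
  fix W assume "W : space (LH p)"
  hence "W : Mat p p" using HermD(1)[of p W] by simp
  from wgt_congr[OF this D, of p] show "ennreal ?a * (wgt p p (D * W * D^H) * f (D * W * D^H)) = wgt p p W * f (D * W * D^H)"
   by (simp add: mult.assoc[symmetric])
 qed
 finally show ?thesis by simp
qed

text \<open>The inverse of a square matrix through its positive part, which keeps it measurable and
  total.\<close>

definition minv :: "nat => cmat => cmat" where
 "minv p Y = Y^H * winv p (Y * Y^H)"

lemma minv_props: assumes Y: "Y : Mat p p" and P: "pdm p (Y * Y^H)" shows "Y * minv p Y = 1m p" "minv p Y * Y = 1m p" "minv p Y : Mat p p"
proof -
 note [simp] = MatD[OF Y] winv_props(4,5)[OF P]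
 show c: "minv p Y : Mat p p" by (simp add: minv_def)
 have "Y * minv p Y = Y * Y^H * winv p (Y * Y^H)" by (simp add: minv_def m_assoc)
 thus 1: "Y * minv p Y = 1m p" unfolding winv_props(1)[OF P] .
 show "minv p Y * Y = 1m p" by (rule mm_lr_inv[OF Y c 1])
qed

lemma mm_minv: "f : meas M (mm p p) ==> (%w. minv p (f w)) : meas M (mm p p)"
 unfolding minv_def by (intro mm_mult[OF mm_adj mm_winv[OF mm_mult[OF _ mm_adj]]]) auto

abbreviation nY :: "nat => (cmat => ennreal) => ennreal" where
 "nY p f \<equiv> nn (LC p p) (%Y. wgt p p (Y * Y^H) * f Y)"

abbreviation mq :: "nat => cmat => cmat" where "mq p Y \<equiv> minv p Y * (minv p Y)^H"

text \<open>Fubini against the Haar measure \<open>det(Y Y\<^sup>\<dagger>)\<^sup>-\<^sup>p dY\<close> of the group of invertible matrices.\<close>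

lemma invariant_unique: assumes s: "sigma_finite_measure s" and u: "u : bm s" and w: "w : measurable s (mm p p)"
  and pd: "!!t. t : space s ==> u t ~= 0 ==> pdm p (w t)" and inv: "!!D E f. D : Mat p p ==> E : Mat p p ==> D * E = 1m p ==> f : bm (mm p p) ==>
    (nn s (%t. u t * f (D * w t * D^H))) = nn s (%t. u t * f (w t))" and f: "f : bm (mm p p)" and g: "g : bm (mm p p)"
 shows "nn s (%t. u t * g (w t)) * nY p (%Y. f (Y * Y^H))
  = nn s (%t. u t * f (w t)) * nY p (%Y. g (mq p Y))"
proof -
 let ?a = "%Y. g (mq p Y)"
 interpret T: sigma_finite_measure s by fact
 interpret C: sigma_finite_measure "LC p p" by (rule crs.sigma_finite_L)
 interpret pair_sigma_finite s "LC p p" ..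
 let ?P = "s \<Otimes>\<^sub>M LC p p"
 have m1: "(%x. w (fst x)) : meas ?P (mm p p)" by (rule m_comp[OF measurable_fst w])
 have m2: "snd : meas ?P (mm p p)" using measurable_snd[of s "LC p p"] by (simp only: meas_LC)
 have yy: "(%Y. Y * Y^H) : meas (mm p p) (mm p p)" by (rule mm_mult[OF mm_id mm_adj[OF mm_id mm_id] refl])
 have wm: "(%Y. wgt p p (Y * Y^H)) : bm (mm p p)" by (rule wgt_meas[OF yy])
 have u1: "(%x. u (fst x)) : bm ?P" by (rule m_comp[OF measurable_fst u])
 have w2: "(%x. wgt p p (snd x * (snd x)^H)) : bm ?P" by (rule m_comp[OF m2 wm])
 have c1: "(%x. snd x * w (fst x) * (snd x)^H) : meas ?P (mm p p)" by (intro mm_mult[OF mm_mult[OF m2 m1 refl] mm_adj[OF m2 m2] refl])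
 have c2: "(%x. minv p (snd x) * w (fst x) * (minv p (snd x))^H) : meas ?P (mm p p)"
  by (intro mm_mult[OF mm_mult[OF mm_minv[OF m2] m1 refl] mm_adj[OF mm_minv[OF m2] mm_minv[OF m2]] refl])
 have wd: "w t : Mat p p" if "t : space s" for t using mbsD(2)[OF w that] .
 have ug: "(%t. u t * g (w t)) : bm s" "(%t. u t * f (w t)) : bm s" by (intro bm_times u m_comp[OF w g] m_comp[OF w f])+
 have B1: "(%(t, Y). (u t * g (w t)) * (wgt p p (Y * Y^H) * f (Y * w t * Y^H))) : bm ?P" unfolding case_prod_beta'
  by (intro bm_times u1 w2 m_comp[OF m1 g] m_comp[OF c1 f])
 have B2: "(%(t, Y). (u t * f (w t)) * (wgt p p (Y * Y^H) * g (minv p Y * w t * (minv p Y)^H))) : bm ?P" unfolding case_prod_beta'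
  by (intro bm_times u1 w2 m_comp[OF m1 f] m_comp[OF c2 g])
 define S where "S t = sqrt_mat p (w t)" for t
 define SI where "SI t = isqrt p (w t)" for t
 have S: "S t : Mat p p" "SI t : Mat p p" "S t * SI t = 1m p" "S t * S t = w t" "(S t)^H = S t" "SI t * w t * SI t = 1m p" "(SI t)^H = SI t"
  if "t : space s" "u t ~= 0" for t
  using pd[OF that] by (simp_all only: S_def SI_def sqrt_mult_self sqrt_isqrt inv_sqrt_cancel pd_dims(1,2)[OF sqrt_pd] pd_dims(1,2)[OF isqrt_pd])
 have "nn s (%t. u t * g (w t)) * nY p (%Y. f (Y * Y^H))
  = nn s (%t. (u t * g (w t)) * nY p (%Y. f (Y * Y^H)))" by (rule nn_integral_multc[OF ug(1), symmetric])
 also have "... = nn s (%t. (nn (LC p p) (%Y. (u t * g (w t)) * (wgt p p (Y * Y^H) * f (Y * w t * Y^H)))))"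
 proof (rule nn_cong)
  fix t assume t: "t : space s"
  show "(u t * g (w t)) * nY p (%Y. f (Y * Y^H))
   = nn (LC p p) (%Y. (u t * g (w t)) * (wgt p p (Y * Y^H) * f (Y * w t * Y^H)))"
  proof (cases "u t = 0")
   case False
   note S = S[OF t False]
   note [simp] = MatD[OF S(1)]
   have fm: "(%Y. f (Y * Y^H)) : bm (mm p p)" by (rule m_comp[OF yy f])
   \<comment> \<open>Right invariance replaces \<open>Y\<close> by \<open>Y\<close> times the square
     root of \<open>w t\<close>.\<close>
   have "nY p (%Y. f (Y * Y^H)) = nY p (%Y. f (Y * S t * (Y * S t)^H))" by (rule LC_inv_right[OF S(1-3) fm, symmetric])
   also have "... = nY p (%Y. f (Y * w t * Y^H))"
   proof (rule nn_cong)
    fix Y assume "Y : space (LC p p)"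
    hence Y: "nr Y = p" "nc Y = p" by simp_all
    have "Y * S t * (Y * S t)^H = Y * (S t * S t) * Y^H" using Y by (simp add: m_assoc S(5))
    thus "wgt p p (Y * Y^H) * f (Y * S t * (Y * S t)^H) = wgt p p (Y * Y^H) * f (Y * w t * Y^H)" unfolding S(4) by simp
   qed
   finally show ?thesis by (simp only:) (rule nn_cmult[symmetric], simp only: meas_LC,
     intro bm_times wm m_comp[OF mm_mult[OF mm_mult[OF mm_id mm_const refl] mm_adj[OF mm_id mm_id] refl] f] wd[OF t])
  qed simp
 qed
 also have "... = nn (LC p p) (%Y. (nn s (%t. (u t * g (w t)) * (wgt p p (Y * Y^H) * f (Y * w t * Y^H)))))" by (rule Fubini'[OF B1, symmetric])
 \<comment> \<open>For fixed \<open>Y\<close> the assumed invariance moves the congruence by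
   \<open>Y\<close> off \<open>f\<close> and places the inverse congruence on
   \<open>g\<close>.\<close>
 also have "... = nn (LC p p) (%Y. (nn s (%t. (u t * f (w t)) * (wgt p p (Y * Y^H) * g (minv p Y * w t * (minv p Y)^H)))))"
 proof (rule nn_cong)
  fix Y assume "Y : space (LC p p)"
  hence Y: "Y : Mat p p" by simp
  show "nn s (%t. (u t * g (w t)) * (wgt p p (Y * Y^H) * f (Y * w t * Y^H)))
   = nn s (%t. (u t * f (w t)) * (wgt p p (Y * Y^H) * g (minv p Y * w t * (minv p Y)^H)))"
  proof (cases "pdm p (Y * Y^H)")
   case True
   note mi = minv_props[OF Y True]
   note [simp] = MatD[OF Y] MatD[OF mi(3)]
   define c where "c = wgt p p (Y * Y^H)"
   define h where "h W = c * (f W * g (minv p Y * W * (minv p Y)^H))" for W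
   have h: "h : bm (mm p p)" unfolding h_def
    by (intro bm_times f borel_measurable_const m_comp[OF mm_mult[OF mm_mult[OF mm_const mm_id refl] mm_const refl] g]) (use mi in simp_all)
   have "(minv p Y * Y)^H = 1m p" unfolding mi(2) by simp
   hence mi': "Y^H * (minv p Y)^H = 1m p" by simp
   have "nn s (%t. (u t * g (w t)) * (c * f (Y * w t * Y^H))) = nn s (%t. u t * h (Y * w t * Y^H))"
   proof (rule nn_cong)
    fix t assume "t : space s"
    hence [simp]: "nr (w t) = p" "nc (w t) = p" using wd by auto
    have "minv p Y * (Y * w t * Y^H) * (minv p Y)^H = w t" by (simp add: m_assoc m_cancel[OF mi(2)] mi')
    thus "(u t * g (w t)) * (c * f (Y * w t * Y^H)) = u t * h (Y * w t * Y^H)" by (simp add: h_def mult_ac)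
   qed
   also have "... = nn s (%t. u t * h (w t))" by (rule inv[OF Y mi(3,1) h])
   also have "... = nn s (%t. (u t * f (w t)) * (c * g (minv p Y * w t * (minv p Y)^H)))" by (rule nn_cong) (simp add: h_def mult_ac)
   finally show ?thesis unfolding c_def .
  qed (simp add: wgt_def)
 qed
 also have "... = nn s (%t. (nn (LC p p) (%Y. (u t * f (w t)) * (wgt p p (Y * Y^H) * g (minv p Y * w t * (minv p Y)^H)))))" by (rule Fubini'[OF B2])
 also have "... = nn s (%t. (u t * f (w t)) * nY p ?a)"
 proof (rule nn_cong)
  fix t assume t: "t : space s"
  have gm: "(%Y. g (minv p Y * w t * (minv p Y)^H)) : bm (mm p p)"
   by (rule m_comp[OF mm_mult[OF mm_mult[OF mm_minv[OF mm_id] mm_const refl] mm_adj[OF mm_minv[OF mm_id] mm_minv[OF mm_id]] refl] g]) (rule wd[OF t])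
  show "nn (LC p p) (%Y. (u t * f (w t)) * (wgt p p (Y * Y^H) * g (minv p Y * w t * (minv p Y)^H)))
   = (u t * f (w t)) * nY p ?a"
  proof (cases "u t = 0")
   case False
   note S = S[OF t False]
   note [simp] = MatD[OF S(1)] MatD[OF S(2)] MatD[OF wd[OF t]]
   \<comment> \<open>Left invariance with the square root of \<open>w t\<close> removes
     \<open>w t\<close> from between the two inverses.\<close>
   have "nY p (%Y. g (minv p Y * w t * (minv p Y)^H))
    = nY p (%Y. g (minv p (S t * Y) * w t * (minv p (S t * Y))^H))" by (rule LC_inv_left[OF S(1-3) gm, symmetric])
   also have "... = nY p ?a"
   proof (rule nn_cong)
    fix Y assume "Y : space (LC p p)"
    hence Y: "Y : Mat p p" by simp
    show "wgt p p (Y * Y^H) * g (minv p (S t * Y) * w t * (minv p (S t * Y))^H) = wgt p p (Y * Y^H) * g (mq p Y)"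
    proof (cases "pdm p (Y * Y^H)")
     case True
     note mi = minv_props[OF Y True]
     note [simp] = MatD[OF Y] MatD[OF mi(3)]
     have "S t * Y * (S t * Y)^H = S t * (Y * Y^H) * (S t)^H" by (simp add: m_assoc)
     hence P: "pdm p (S t * Y * (S t * Y)^H)" using pd_congr_inv[OF True S(1-3)] by simp
     have SY: "S t * Y : Mat p p" by simp
     note mi2 = minv_props[OF SY P]
     have inv: "S t * Y * (minv p Y * SI t) = 1m p" by (simp add: m_assoc m_cancel[OF mi(1)] S(3))
     have e: "minv p (S t * Y) = minv p Y * SI t" by (rule left_inverse_unique[OF mi2(2) inv]) (use MatD[OF mi2(3)] in simp_all)
     have "minv p (S t * Y) * w t * (minv p (S t * Y))^H = minv p Y * (SI t * w t * SI t) * (minv p Y)^H" unfolding e by (simp add: m_assoc S(7))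
     thus ?thesis unfolding S(6) by simp
    qed (simp add: wgt_def)
   qed
   finally have eq: "nY p (%Y. g (minv p Y * w t * (minv p Y)^H)) = nY p ?a" .
   show ?thesis unfolding eq[symmetric] by (rule nn_cmult) (use bm_times[OF wm gm] in \<open>simp only: meas_LC\<close>)
  qed simp
 qed
 also have "... = nn s (%t. u t * f (w t)) * nY p ?a" by (rule nn_integral_multc[OF ug(2)])
 finally show ?thesis .
qed

section \<open>Finiteness and positivity of the invariant measures\<close>

lemma det_bound: assumes A: "A : Mat p p" and b: "!!i j. i < p ==> j < p ==> cmod (A $$ (i, j)) <= C" shows "cmod (det A) <= fact p * C ^ p"
proof -
 have "cmod (det A) <= (\<Sum>v | v permutes {0..<p}. cmod (signof v * (\<Prod>i = 0..<p. A $$ (i, v i))))"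
  using A unfolding det_def by (simp add: sum_norm_le norm_sum)
 also have "... <= (\<Sum>v | v permutes {0..<p}. C ^ p)"
 proof (rule sum_mono)
  fix v assume "v : {v. v permutes {0..<p}}"
  hence v: "v i < p" if "i < p" for i using permutes_in_image[of v "{0..<p}" i] that by simp
  have "cmod (signof v * (\<Prod>i = 0..<p. A $$ (i, v i))) = (\<Prod>i = 0..<p. cmod (A $$ (i, v i)))" by (simp add: norm_mult prod_norm sign_def)
  also have "... <= (\<Prod>i = 0..<p. C)" by (rule prod_mono) (use b v in auto)
  finally show "cmod (signof v * (\<Prod>i = 0..<p. A $$ (i, v i))) <= C ^ p" by simp
 qed
 also have "... = fact p * C ^ p" using card_permutations[of "{0..<p}" p] by simp
 finally show ?thesis .
qed

text \<open>An exhaustion of the positive cone by sets on which both a matrix and its inverse are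
  bounded, so that the invariant density is bounded as well.\<close>

definition KK :: "nat => nat => cmat set" where
 "KK p C = {W : Mat p p. pdm p W &
   (ALL i:{..<p}. ALL j:{..<p}. cmod (W $$ (i, j)) <= real C & cmod (winv p W $$ (i, j)) <= real C)}"

lemma KK_sets: "KK p C : sets (mm p p)"
proof -
 have c: "Measurable.pred (mm p p) (%W. cmod (W $$ (i, j)) <= real C & cmod (winv p W $$ (i, j)) <= real C)" if "i < p" "j < p" for i j
 proof -
  note [measurable] = m_comp[OF mbsD(1)[OF mm_id that] borel_measurable_norm] m_comp[OF mbsD(1)[OF mm_winv[OF mm_id] that] borel_measurable_norm]
  show ?thesis by measurable
 qed
 have "Measurable.pred (mm p p) (%W. pdm p W & (ALL i:{..<p}. ALL j:{..<p}. cmod (W $$ (i, j)) <= real C & cmod (winv p W $$ (i, j)) <= real C))"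
  by (rule pred_intros_logic(3)[OF pred_pos_def[OF mm_id]], intro pred_intros_finite c) auto
 from predE[OF this] show ?thesis by (simp add: KK_def)
qed

lemma KK_ex: assumes W: "pdm p W" shows "EX C. ALL C'>=C. W : KK p C'"
proof -
 define s where "s = (\<Sum>i<p. \<Sum>j<p. cmod (W $$ (i, j)) + cmod (winv p W $$ (i, j)))"
 have b: "cmod (W $$ (i, j)) + cmod (winv p W $$ (i, j)) <= s" if "i < p" "j < p" for i j
 proof -
  have "cmod (W $$ (i, j)) + cmod (winv p W $$ (i, j)) <= (\<Sum>j<p. cmod (W $$ (i, j)) + cmod (winv p W $$ (i, j)))"
   by (rule member_le_sum) (use that in auto)
  also have "... <= s" unfolding s_def
   by (rule member_le_sum[of i "{..<p}" "%i. \<Sum>j<p. cmod (W $$ (i, j)) + cmod (winv p W $$ (i, j))"]) (use that in \<open>auto intro!: sum_nonneg add_nonneg_nonneg\<close>)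
  finally show ?thesis .
 qed
 obtain C :: nat where C: "s <= real C" using real_arch_simple by blast
 have "W : KK p C'" if "C' >= C" for C'
 proof -
  have sC: "s <= real C'" using C that by linarith
  have "cmod (W $$ (i, j)) <= real C' & cmod (winv p W $$ (i, j)) <= real C'" if "i < p" "j < p" for i j
   using b[OF that] sC norm_ge_zero[of "W $$ (i, j)"] norm_ge_zero[of "winv p W $$ (i, j)"] by linarith
  thus ?thesis using W pd_dims(1)[OF W] by (simp add: KK_def)
 qed
 thus ?thesis by blast
qed

lemma KK_mono: assumes "C <= C'" shows "KK p C <= KK p C'"
proof
 fix W assume W: "W : KK p C"
 have r: "real C <= real C'" using assms by simp
 have b: "cmod (W $$ (i, j)) <= real C" "cmod (winv p W $$ (i, j)) <= real C" if "i < p" "j < p" for i j using W that unfolding KK_def by blast+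
 show "W : KK p C'" using W order_trans[OF b(1) r] order_trans[OF b(2) r] unfolding KK_def by blast
qed

lemma inv_det_bound: assumes W: "pdm p W" and V: "V : Mat p p" "W * V = 1m p" and b: "!!i j. i < p ==> j < p ==> cmod (V $$ (i, j)) <= C"
 shows "1 / Re (det W) <= fact p * C ^ p"
proof -
 note d = pd_det[OF W]
 have "det W * det V = 1" using det_mult[OF pd_dims(1)[OF W] V(1)] V(2) by simp
 hence "cx (Re (det W)) * det V = 1" unfolding d(2) .
 hence "det V = cx (1 / Re (det W))" using d(1) by (simp add: field_simps)
 hence "cmod (det V) = 1 / Re (det W)" using d(1) by (simp add: norm_divide)
 thus ?thesis using det_bound[OF V(1) b] by simp
qed

text \<open>Uniqueness up to a constant needs a test function with finite nonzero integrals; the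
  indicator of a large \<open>KK p C\<close> is one. If its Hermitian integrals all vanished, the
  positive cone would be null, yet its translates by multiples of the identity cover all Hermitian
  matrices. On the group side almost everywhere full rank plays this role.\<close>

lemma wishart_bounds: shows "EX C. 0 < nn (LH p) (%W. wgt p p W * Ind (KK p C) W) & (nn (LH p) (%W. wgt p p W * Ind (KK p C) W)) < \<infinity>
  & 0 < nY p (%Y. Ind (KK p C) (mq p Y))
  & (nY p (%Y. Ind (KK p C) (mq p Y))) < \<infinity>"
proof -
 let ?a = "mbs p p (hermS p)"
 define a where "a C = nn (LH p) (%W. wgt p p W * Ind (KK p C) W)" for C
 define l where "l C = nY p (%Y. Ind (KK p C) (mq p Y))" for C
 have id: "(%X. X) : meas ?a (mm p p)" by (rule herm_mm) simp
 have Ki: "(Ind (KK p C) :: cmat => ennreal) : bm (mm p p)" for C using KK_sets[of p C] by simp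
 have am: "(%W. wgt p p W * Ind (KK p C) W) : bm (LH p)" for C unfolding meas_LH by (intro bm_times wgt_meas id m_comp[OF id Ki])
 have lm: "(%Y. wgt p p (Y * Y^H) * Ind (KK p C) (mq p Y)) : bm (LC p p)" for C
  unfolding meas_LC by (intro bm_times wgt_meas m_comp[OF _ Ki] mm_mult[OF mm_id mm_adj[OF mm_id mm_id] refl]
   mm_mult[OF mm_minv[OF mm_id] mm_adj[OF mm_minv[OF mm_id] mm_minv[OF mm_id]] refl])
 have mono: "a C <= a C'" "l C <= l C'" if "C <= C'" for C C'
  unfolding a_def l_def using KK_mono[OF that, of p] by (auto intro!: nn_integral_mono mult_left_mono simp: indicator_def)
 have af: "a C < \<infinity>" for C
 proof -
  define G where "G = {W : hermS p. ALL i:{..<p}. ALL j:{..<p}. cmod (W $$ (i, j)) <= real C}"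
  have "Measurable.pred ?a (%W. ALL i:{..<p}. ALL j:{..<p}. cmod (W $$ (i, j)) <= real C)"
  proof (intro pred_intros_finite)
   fix i j assume "i : {..<p}" "j : {..<p}"
   hence [measurable]: "(%W. cmod (W $$ (i, j))) : bm ?a" by (intro m_comp[OF measurable_entry borel_measurable_norm]) auto
   show "Measurable.pred ?a (%W. cmod (W $$ (i, j)) <= real C)" by measurable
  qed auto
  from predE[OF this] have G: "G : sets ?a" by (simp add: G_def)
  have "a C <= nn (LH p) (%W. ennreal ((fact p * real C ^ p) ^ p) * Ind G W)" unfolding a_def
  proof (rule nn_integral_mono)
   fix W assume "W : space (LH p)"
   show "wgt p p W * Ind (KK p C) W <= ennreal ((fact p * real C ^ p) ^ p) * Ind G W"
   proof (cases "W : KK p C")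
    case True
    hence W: "pdm p W" by (simp add: KK_def)
    have b: "cmod (W $$ (i, j)) <= real C" "cmod (winv p W $$ (i, j)) <= real C" if "i < p" "j < p" for i j using True that by (auto simp: KK_def)
    have "1 / Re (det W) <= fact p * real C ^ p" by (rule inv_det_bound[OF W _ winv_props(1)[OF W]]) (use b winv_props(4,5)[OF W] in auto)
    hence "(1 / Re (det W)) ^ p <= (fact p * real C ^ p) ^ p" by (rule power_mono) (use pd_det(1)[OF W] in simp)
    moreover have "W : G" using pd_herm[OF W] b by (simp add: G_def)
    ultimately show ?thesis using True W by (simp add: wgt_def power_one_over ennreal_leI)
   qed simp
  qed
  also have "... = ennreal ((fact p * real C ^ p) ^ p) * emeasure (LH p) G"
   by (rule nn_integral_cmult_indicator) (use G in \<open>simp add: herm.sets_L\<close>)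
  also have "... < \<infinity>" using herm.emeasure_finite[OF G, of "real C"] by (auto simp: G_def ennreal_mult_less_top)
  finally show ?thesis .
 qed
 have lf: "l C < \<infinity>" for C
 proof -
  \<comment> \<open>The diagonal of \<open>Y^H * Y\<close>, the inverse of \<open>mq p Y\<close>,
    bounds the squared entries of \<open>Y\<close> by \<open>C\<close>, which is at most
    \<open>(C + 1)^2\<close>.\<close>
  define G where "G = {Y : Mat p p. ALL i:{..<p}. ALL j:{..<p}. cmod (Y $$ (i, j)) <= real C + 1}"
  have "Measurable.pred (mm p p) (%W. ALL i:{..<p}. ALL j:{..<p}. cmod (W $$ (i, j)) <= real C + 1)"
  proof (intro pred_intros_finite)
   fix i j assume "i : {..<p}" "j : {..<p}"
   hence [measurable]: "(%W. cmod (W $$ (i, j))) : bm (mm p p)" by (intro m_comp[OF measurable_entry borel_measurable_norm]) auto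
   show "Measurable.pred (mm p p) (%W. cmod (W $$ (i, j)) <= real C + 1)" by measurable
  qed auto
  from predE[OF this] have G: "G : sets (mm p p)" by (simp add: G_def)
  have "l C <= nn (LC p p) (%Y. ennreal ((fact p * real C ^ p) ^ p) * Ind G Y)" unfolding l_def
  proof (rule nn_integral_mono)
   fix Y assume "Y : space (LC p p)"
   hence Y: "Y : Mat p p" by simp
   show "wgt p p (Y * Y^H) * Ind (KK p C) (mq p Y) <= ennreal ((fact p * real C ^ p) ^ p) * Ind G Y"
   proof (cases "pdm p (Y * Y^H) & mq p Y : KK p C")
    case True
    hence P: "pdm p (Y * Y^H)" and K: "mq p Y : KK p C" by blast+
    note mi = minv_props[OF Y P]
    note [simp] = MatD[OF Y] MatD[OF mi(3)]
    define W0 where "W0 = mq p Y"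
    have W0: "pdm p W0" using K by (simp add: KK_def W0_def)
    have b: "cmod (W0 $$ (i, j)) <= real C" "cmod (winv p W0 $$ (i, j)) <= real C" if "i < p" "j < p" for i j
     using K that by (auto simp: KK_def W0_def)
    have "(minv p Y)^H * Y^H = (Y * minv p Y)^H" by simp
    hence mY: "(minv p Y)^H * Y^H = 1m p" unfolding mi(1) by simp
    have WV: "W0 * (Y^H * Y) = 1m p" by (simp add: W0_def m_assoc m_cancel[OF mY] mi(2))
    have wi: "winv p W0 = Y^H * Y" by (rule winv_eq[OF W0 _ WV]) simp
    have dW: "det (Y * Y^H) * det W0 = 1"
     using det_mult[of W0 p "Y^H * Y"] det_mult[of "Y^H" p Y] det_mult[of Y p "Y^H"] WV by (simp add: W0_def mult_ac)
    have "cmod (Y $$ (i, j)) <= real C + 1" if ij: "i < p" "j < p" for i j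
    proof -
     have "(Y^H * Y) $$ (j, j) = cx (\<Sum>r<p. (cmod (Y $$ (r, j)))^2)"
      using ij by (simp add: sp_def at0L complex_norm_square mult.commute del: of_real_power)
     hence "cmod ((Y^H * Y) $$ (j, j)) = (\<Sum>r<p. (cmod (Y $$ (r, j)))^2)" by (simp only: norm_of_real) (simp add: sum_nonneg)
     moreover have "(cmod (Y $$ (i, j)))^2 <= (\<Sum>r<p. (cmod (Y $$ (r, j)))^2)" by (rule member_le_sum) (use ij in auto)
     ultimately have "(cmod (Y $$ (i, j)))^2 <= real C" using b(2)[OF ij(2,2)] unfolding wi by linarith
     also have "real C <= (real C + 1)^2" by (simp add: power2_eq_square algebra_simps)
     finally show ?thesis by (rule power2_le_imp_le) simp
    qed
    hence YG: "Y : G" using Y by (simp add: G_def)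
    have YW: "1 / Re (det (Y * Y^H)) <= fact p * real C ^ p"
    proof -
     have "cx (Re (det (Y * Y^H))) * det W0 = 1" using dW unfolding pd_det(2)[OF P] .
     hence "det W0 = cx (1 / Re (det (Y * Y^H)))" using pd_det(1)[OF P] by (simp add: field_simps)
     hence "cmod (det W0) = 1 / Re (det (Y * Y^H))" using pd_det(1)[OF P] by (simp add: norm_divide)
     thus ?thesis using det_bound[OF pd_dims(1)[OF W0] b(1)] by simp
    qed
    hence "(1 / Re (det (Y * Y^H))) ^ p <= (fact p * real C ^ p) ^ p" by (rule power_mono) (use pd_det(1)[OF P] in simp)
    thus ?thesis using P K YG by (simp add: wgt_def power_one_over ennreal_leI)
   next
    case False
    thus ?thesis by (auto simp: wgt_def)
   qed
  qed
  also have "... = ennreal ((fact p * real C ^ p) ^ p) * emeasure (LC p p) G"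
   by (rule nn_integral_cmult_indicator) (use G in \<open>simp add: crs.sets_L\<close>)
  also have "... < \<infinity>" using crs.emeasure_finite[OF G, of "real C + 1"] by (auto simp: G_def ennreal_mult_less_top)
  finally show ?thesis .
 qed
 have ap: "EX C. 0 < a C"
 proof (rule ccontr)
  assume "\<nexists>C. 0 < a C"
  hence a0: "a C = 0" for C by (simp add: zero_less_iff_neq_zero)
  define P where "P = {W : hermS p. pdm p W}"
  have P: "P : sets ?a" using predE[OF pred_pos_def[OF id]] by (simp add: P_def)
  have "AE W in LH p. ALL C. wgt p p W * Ind (KK p C) W = 0" unfolding AE_all_countable using a0 nn_integral_0_iff_AE[OF am] by (simp add: a_def)
  hence "AE W in LH p. W \<notin> P"
  proof (rule eventually_mono)
   fix W assume h: "ALL C. wgt p p W * Ind (KK p C) W = 0"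
   show "W \<notin> P"
   proof
    assume "W : P"
    hence W: "pdm p W" by (simp add: P_def)
    from KK_ex[OF W] obtain C where "W : KK p C" by blast
    thus False using h[rule_format, of C] W zero_less_power[OF pd_det(1)[OF W], of p] by (simp add: wgt_def ennreal_eq_0_iff)
   qed
  qed
  hence P0: "emeasure (LH p) P = 0" by (subst (asm) AE_iff_measurable[of P]) (use P in \<open>auto simp: herm.sets_L P_def\<close>)
  \<comment> \<open>Translates of the cone: each is null if the cone is, and a sufficiently large
    multiple of the identity moves any given Hermitian matrix into the cone.\<close>
  define Q where "Q t = {W : hermS p. W + cx (real t) .* 1m p : P}" for t
  have th: "cx (real t) .* 1m p : hermS p" for t using hermitian_smult[OF hermitian_one[of p], of "real t"] by simp
  have Qm: "Q t : sets ?a" for t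
  proof -
   have "(%W. W + cx (real t) .* 1m p) -` P Int space ?a : sets ?a"
    by (rule measurable_sets[OF herm.add_meas[OF measurable_ident_sets[OF refl] herm.const_meas[OF th]] P])
   thus ?thesis by (simp add: Q_def vimage_def Int_def conj_commute)
  qed
  have "emeasure (LH p) (Q t) = 0" for t
  proof -
   have "emeasure (LH p) (Q t) = nn (LH p) (%W. Ind (Q t) W)" using Qm[of t] by (simp add: herm.sets_L)
   also have "... = nn (LH p) (%W. Ind P (W + cx (real t) .* 1m p))" by (intro nn_cong) (simp add: Q_def indicator_def)
   also have "... = nn (LH p) (%W. Ind P W)" by (rule herm.nn_translate[OF _ th]) (use P in simp)
   also have "... = 0" using P P0 by (simp add: herm.sets_L)
   finally show ?thesis .
  qed
  hence "emeasure (LH p) (\<Union>t. Q t) = 0" using Qm by (intro emeasure_UN_eq_0) (auto simp: herm.sets_L)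
  moreover have "(\<Union>t. Q t) = hermS p"
  proof (intro equalityI subsetI)
   fix W assume "W : hermS p"
   hence W: "Herm p W" by simp
   note [simp] = HermD(3,4)[OF W]
   from pos_def_perturb[OF pd_one hermitian_smult[OF W, of "-1"]] obtain e where e: "e > 0"
    "pdm p (1m p - cx e .* (cx (-1) .* W))" by blast
   obtain t :: nat where t: "1 / e < real t" using reals_Archimedean2 by blast
   have "W + cx (real t) .* 1m p = cx (1 / e) .* (1m p - cx e .* (cx (-1) .* W))
    + cx (real t - 1 / e) .* 1m p" by (rule eq_matI) (use e in \<open>simp_all add: algebra_simps\<close>)
   moreover have "pdm p ..." using t e by (intro pos_def_add pos_def_smult pd_one) auto
   ultimately have pdt: "pdm p (W + cx (real t) .* 1m p)" by (simp only:)
   have "W : Q t" using W pdt pd_herm[OF pdt] by (simp add: Q_def P_def)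
   thus "W : (\<Union>t. Q t)" by blast
  qed (auto simp: Q_def)
  moreover have "0 < emeasure (LH p) (hermS p)"
   by (rule herm.emeasure_pos[of _ _ "0m p p" 1]) (use sets.top[of "mbs p p (hermS p)"] in \<open>auto intro: hermitian_zero hermitian_add\<close>)
  ultimately show False by simp
 qed
 have lp: "EX C. 0 < l C"
 proof (rule ccontr)
  assume "\<nexists>C. 0 < l C"
  hence l0: "l C = 0" for C by (simp add: zero_less_iff_neq_zero)
  have "AE Y in LC p p. ALL C. wgt p p (Y * Y^H) * Ind (KK p C) (mq p Y) = 0"
   unfolding AE_all_countable using l0 nn_integral_0_iff_AE[OF lm] by (simp add: l_def)
  moreover have "AE Y in LC p p. pdm p (Y * Y^H)" by (rule AE_full_rank) simp
  moreover have "AE Y in LC p p. Y : Mat p p" by (rule AE_I2) simp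
  ultimately have "AE Y in LC p p. False"
  proof eventually_elim
   case (elim Y)
   note mi = minv_props[OF elim(3,2)]
   have "pdm p (minv p Y * 1m p * (minv p Y)^H)" by (rule pd_congr_inv[OF pd_one mi(3) elim(3) mi(2)])
   hence "pdm p (mq p Y)" using mi(3) by simp
   from KK_ex[OF this] obtain C where "mq p Y : KK p C" by blast
   thus ?case using elim(1)[rule_format, of C] elim(2) zero_less_power[OF pd_det(1)[OF elim(2)], of p] by (simp add: wgt_def ennreal_eq_0_iff)
  qed
  hence "emeasure (LC p p) (Mat p p) = 0" by (subst (asm) AE_iff_measurable[OF _ refl]) (use sets.top[of "LC p p"] in \<open>auto simp del: carrier_iff\<close>)
  moreover have "0 < emeasure (LC p p) (Mat p p)" by (rule crs.emeasure_pos[of _ _ _ "0m p p" 1]) (use sets.top[of "mm p p"] in auto)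
  ultimately show False by simp
 qed
 from ap obtain C1 where C1: "0 < a C1" by blast
 from lp obtain C2 where C2: "0 < l C2" by blast
 have "0 < a (max C1 C2)" "0 < l (max C1 C2)"
  using order_less_le_trans[OF C1 mono(1)[of C1 "max C1 C2"]] order_less_le_trans[OF C2 mono(2)[of C2 "max C1 C2"]] by auto
 thus ?thesis using af lf unfolding a_def l_def by blast
qed

text \<open>Two measures on the positive cone are invariant under all congruences: the image of
  \<open>det (Z * Z^H)^(- q)\<close> times Lebesgue measure under
  \<open>Z \<mapsto> Z * Z^H\<close>, and \<open>det W^(- p)\<close> times Lebesgue measure. By
  \<open>invariant_unique\<close> they are proportional, and removing the weights leaves the power
  \<open>q - p\<close>. The constant is kept as a ratio of two integrals.\<close>

lemma wishart: assumes pq: "p <= q" shows "EX c. ALL f:bm (mm p p). (nn (LC p q) (%Z. f (Z * Z^H)))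
  = c * nn (LH p) (%W. (if pdm p W then ennreal (Re (det W) ^ (q - p)) * f W else 0))"
proof -
 from wishart_bounds[of p] obtain C where a: "0 < nn (LH p) (%W. wgt p p W * Ind (KK p C) W)" "nn (LH p) (%W. wgt p p W * Ind (KK p C) W) < \<infinity>"
  and l: "0 < nY p (%Y. Ind (KK p C) (mq p Y))"
   "nY p (%Y. Ind (KK p C) (mq p Y)) < \<infinity>" by blast
 define A2 where "A2 F = nn (LH p) (%W. wgt p p W * F W)" for F
 define A1 where "A1 F = nn (LC p q) (%Z. wgt p q (Z * Z^H) * F (Z * Z^H))" for F
 define \<Lambda> where "\<Lambda> F = nY p (%Y. F (Y * Y^H))" for F
 define g :: "cmat => ennreal" where "g = Ind (KK p C)"
 define l0 where "l0 = nY p (%Y. g (mq p Y))"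
 have g: "g : bm (mm p p)" using KK_sets[of p C] by (simp add: g_def)
 have id: "(%X. X) : meas (mbs p p (hermS p)) (mm p p)" by (rule herm_mm) simp
 have yy: "(%Y. Y * Y^H) : meas (mm p q) (mm p p)" by (rule mm_mult[OF mm_id mm_adj[OF mm_id mm_id] refl])
 have 1: "A1 g * \<Lambda> F = A1 F * l0" if F: "F : bm (mm p p)" for F unfolding A1_def \<Lambda>_def l0_def
 proof (rule invariant_unique[OF crs.sigma_finite_L _ _ _ _ F g])
  show "(%Z. wgt p q (Z * Z^H)) : bm (LC p q)" unfolding meas_LC by (rule wgt_meas[OF yy])
  show "(%Z. Z * Z^H) : meas (LC p q) (mm p p)" unfolding meas_LC by (rule yy)
  show "pdm p (Z * Z^H)" if "wgt p q (Z * Z^H) ~= 0" for Z using that by (auto simp: wgt_def split: if_splits)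
  fix D E :: "cmat" and f :: "cmat => ennreal"
  assume D: "D : Mat p p" "E : Mat p p" "D * E = 1m p" and f: "f : bm (mm p p)"
  have "nn (LC p q) (%Z. wgt p q (Z * Z^H) * f (D * (Z * Z^H) * D^H)) = nn (LC p q) (%Z. wgt p q (Z * Z^H) * f (D * Z * (D * Z)^H))"
  proof (rule nn_cong)
   fix Z assume "Z : space (LC p q)"
   hence "D * Z * (D * Z)^H = D * (Z * Z^H) * D^H" using D(1) by (simp add: m_assoc)
   thus "wgt p q (Z * Z^H) * f (D * (Z * Z^H) * D^H) = wgt p q (Z * Z^H) * f (D * Z * (D * Z)^H)" by simp
  qed
  also have "... = nn (LC p q) (%Z. wgt p q (Z * Z^H) * f (Z * Z^H))" by (rule LC_inv_left[OF D, of "%Z. f (Z * Z^H)"]) (rule m_comp[OF yy f])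
  finally show "nn (LC p q) (%Z. wgt p q (Z * Z^H) * f (D * (Z * Z^H) * D^H)) = nn (LC p q) (%Z. wgt p q (Z * Z^H) * f (Z * Z^H))" .
 qed
 have 2: "A2 g * \<Lambda> F = A2 F * l0" if F: "F : bm (mm p p)" for F unfolding A2_def \<Lambda>_def l0_def
 proof (rule invariant_unique[OF herm.sigma_finite_L _ _ _ _ F g])
  show "(%Z. wgt p p Z) : bm (LH p)" unfolding meas_LH by (rule wgt_meas[OF id])
  show "(%Z. Z) : meas (LH p) (mm p p)" unfolding meas_LH by (rule id)
  show "pdm p Z" if "wgt p p Z ~= 0" for Z using that by (auto simp: wgt_def split: if_splits)
 qed (rule LH_inv)
 have Ag: "A2 g ~= 0" "A2 g ~= \<infinity>" "l0 ~= 0" "l0 ~= \<infinity>" using a l by (auto simp: A2_def l0_def g_def)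
 define c where "c = A1 g / A2 g"
 have 3: "A1 F = c * A2 F" if F: "F : bm (mm p p)" for F
 proof -
  have "l0 * (A2 g * A1 F) = l0 * (A1 g * A2 F)" using 1[OF F] 2[OF F] by (metis mult.assoc mult.commute)
  hence "A2 g * A1 F = A1 g * A2 F" using Ag by (simp add: ennreal_mult_cancel_left)
  also have "A1 g = A2 g * c" unfolding c_def using Ag by (simp add: ennreal_times_divide mult.commute[of "A2 g"] mult_divide_eq_ennreal)
  finally have "A2 g * A1 F = A2 g * (c * A2 F)" by (simp only: mult.assoc)
  thus ?thesis using Ag by (simp add: ennreal_mult_cancel_left)
 qed
 show ?thesis
 proof (intro exI[of _ c] ballI)
  fix f :: "cmat => ennreal" assume f: "f : bm (mm p p)"
  define F where "F W = (if pdm p W then ennreal (Re (det W) ^ q) * f W else 0)" for W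
  have F: "F : bm (mm p p)"
  proof -
   note [measurable] = f pred_pos_def[OF mm_id] measurable_det[OF mm_id]
   show ?thesis unfolding F_def by measurable
  qed
  have "nn (LC p q) (%Z. f (Z * Z^H)) = A1 F" unfolding A1_def
  proof (rule nn_integral_cong_AE, rule eventually_mono[OF AE_full_rank[OF pq]])
   fix Z assume P: "pdm p (Z * Z^H)"
   have "ennreal (1 / Re (det (Z * Z^H)) ^ q) * ennreal (Re (det (Z * Z^H)) ^ q) = 1" using pd_det(1)[OF P] by (simp flip: ennreal_mult)
   thus "f (Z * Z^H) = wgt p q (Z * Z^H) * F (Z * Z^H)" using P by (simp add: wgt_def F_def mult.assoc[symmetric])
  qed
  also have "... = c * A2 F" by (rule 3[OF F])
  also have "A2 F = nn (LH p) (%W. (if pdm p W then ennreal (Re (det W) ^ (q - p)) * f W else 0))" unfolding A2_def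
  proof (rule nn_cong)
   fix W
   show "wgt p p W * F W = (if pdm p W then ennreal (Re (det W) ^ (q - p)) * f W else 0)"
   proof (cases "pdm p W")
    case True
    note d = pd_det(1)[OF True]
    have "ennreal (1 / Re (det W) ^ p) * ennreal (Re (det W) ^ q) = ennreal (Re (det W) ^ (q - p))"
     using d pq by (simp add: power_diff flip: ennreal_mult)
    thus ?thesis using True by (simp add: wgt_def F_def mult.assoc[symmetric])
   qed (simp add: wgt_def)
  qed
  finally show "nn (LC p q) (%Z. f (Z * Z^H)) = c * nn (LH p) (%W. (if pdm p W then ennreal (Re (det W) ^ (q - p)) * f W else 0))" .
 qed
qed

section \<open>Measurability of canonical moments\<close>

declare One_nat_def [simp del] add_2_eq_Suc' [simp del]

lemma pred_in01: assumes f: "f : meas M (mm p p)" shows "Measurable.pred M (%w. in01 p (f w))"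
 by (intro pred_intros_logic pred_pos_def f mm_minus[OF mm_const f]) auto

lemma mm_cong: "f : meas M (mm p q) ==> (!!w. w : space M ==> g w = f w) ==> g : meas M (mm p q)" by (subst measurable_cong)

lemma mm_inv_sqrt:
 "f : meas M (mm p p) ==> (!!w. w : space M ==> pdm p (f w)) ==> (%w. isqrt p (f w)) : meas M (mm p p)"
 by (rule mm_cong[OF mm_isq], assumption, unfold isq_def, rule if_P[symmetric])

lemma mm_sqrt:
 "f : meas M (mm p p) ==> (!!w. w : space M ==> pdm p (f w)) ==> (%w. sqrt_mat p (f w)) : meas M (mm p p)"
 unfolding sqrt_mat_def by (rule mm_mult[OF _ mm_inv_sqrt refl])

context
 fixes M :: "'w measure" and p :: nat and A W :: "'w => cmat" assumes A: "A : meas M (mm p p)" and W: "W : meas M (mm p p)"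
  and A01: "!!z. z : space M ==> in01 p (A z)" and W01: "!!z. z : space M ==> in01 p (W z)"
begin

lemma mm_range_aux: shows mm_compl: "(%z. 1m p - A z) : meas M (mm p p)" "(%z. 1m p - W z) : meas M (mm p p)"
  and mm_range: "(%z. A z * (1m p - A z)) : meas M (mm p p)"
 using mm_minus[OF mm_const A, of "1m p" p p] mm_minus[OF mm_const W, of "1m p" p p] mm_mult[OF A mm_minus[OF mm_const A, of "1m p" p p]] by simp_all

lemma mm_rsq: "(%z. rsq p (A z)) : meas M (mm p p)" unfolding rsq_def by (rule mm_sqrt[OF mm_range]) (rule range_pd[OF A01])

lemma mm_sqrtW: "(%z. sqrt_mat p (W z)) : meas M (mm p p)" "(%z. sqrt_mat p (1m p - W z)) : meas M (mm p p)"
 by (rule mm_sqrt[OF W], use W01 in blast, rule mm_sqrt[OF mm_compl(2)], use W01 in blast)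

lemma mm_dmat: "(%z. dmat p (A z) (W z)) : meas M (mm p p)" unfolding dmat_def by (intro mm_mult[OF mm_mult[OF mm_rsq mm_sqrtW(1)] mm_sqrtW(2)]) auto

lemma mm_dinv: "(%z. dinv p (A z) (W z)) : meas M (mm p p)" unfolding dinv_def
 by (intro mm_mult[OF mm_mult[OF mm_inv_sqrt[OF mm_compl(2)] mm_inv_sqrt[OF W]] mm_inv_sqrt[OF mm_range]] range_pd[OF A01] refl)
  (use W01 in blast)+

lemma mm_phi: assumes m: "!!i. (%z. m z i) : meas M (mm p p)" shows "(%z. Phi p (A z) (W z) (m z) j) : meas M (mm p p) &
  (ALL i. (%z. snd (phi p (A z) (W z) (m z) j) i) : meas M (mm p p))"
proof (induction j)
 case 0
 show ?case by (simp add: mm_const)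
next
 case (Suc j)
 have U: "(%z. Phi p (A z) (W z) (m z) j) : meas M (mm p p)" and g: "(%z. snd (phi p (A z) (W z) (m z) j) i) : meas M (mm p p)" for i
  using Suc by blast+
 have w: "(%z. sqrt_mat p (W z) * rsq p (A z)) : meas M (mm p p)" by (rule mm_mult[OF mm_sqrtW(1) mm_rsq refl])
 have a: "(%z. sqrt_mat p (W z) * (1m p - A z) * sqrt_mat p (W z)) : meas M (mm p p)"
  by (rule mm_mult[OF mm_mult[OF mm_sqrtW(1) mm_compl(1) refl] mm_sqrtW(1) refl])
 have d: "(%z. 1m p - sqrt_mat p (1m p - W z)) : meas M (mm p p)" by (rule mm_minus[OF mm_const mm_sqrtW(2)]) auto
 note mu = mm_mult[where m = p and k = p and k' = p and n = p, OF _ _ refl] and ad = mm_add[where m = p and k = p and k' = p and n = p, OF _ _ refl refl]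
  and mi = mm_minus[where m = p and k = p and k' = p and n = p, OF _ _ refl refl]
 show ?case
 proof (intro conjI allI)
  show "(%z. Phi p (A z) (W z) (m z) (Suc j)) : meas M (mm p p)" unfolding phi.simps Let_def fst_conv by (intro ad mu A U mm_adj[OF w w] g)
  show "(%z. snd (phi p (A z) (W z) (m z) (Suc j)) i) : meas M (mm p p)" for i
   unfolding phi.simps Let_def snd_conv by (rule ad[OF mi[OF mi[OF ad[OF ad]]]]) (intro mu mm_sqrtW mm_rsq mm_compl U g m d)+
 qed
qed

end

lemma mm_wmat: assumes m: "!!i. (%w. m w i) : meas M (mm p p)" and A01: "!!w. w : space M ==> in01 p (m w 1)"
 shows "(%w. wmat p (m w)) : meas M (mm p p)"
proof -
 have R: "(%w. isqrt p (m w 1 * (1m p - m w 1))) : meas M (mm p p)"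
  by (rule mm_inv_sqrt[OF mm_mult[OF m mm_minus[OF mm_const m]] range_pd[OF A01]]) auto
 show ?thesis unfolding wmat_def Let_def by (intro mm_mult[OF mm_mult[OF R mm_minus[OF m mm_mult[OF m m]]] R]) auto
qed

lemma mm_mtil: assumes m: "!!i. (%w. m w i) : meas M (mm p p)" and A01: "!!w. w : space M ==> in01 p (m w 1)"
  and W01: "!!w. w : space M ==> in01 p (wmat p (m w))" shows "(%w. mtil p (m w) j) : meas M (mm p p)"
proof (induction j rule: less_induct)
 case (less j)
 note W = mm_wmat[where m = m, OF m A01]
 show ?case
 proof (cases "j = 0")
  case True
  thus ?thesis by (simp add: mtil.simps[of p _ 0] mm_const)
 next
  case False
  have t: "(%w. if i < j then mtil p (m w) i else 0m p p) : meas M (mm p p)" for i using less by (cases "i < j") (auto simp: mm_const)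
  have d: "(%w. dinv p (m w 1) (wmat p (m w))) : meas M (mm p p)" by (rule mm_dinv[OF m W A01 W01])
  have ph: "(%w. Phi p (m w 1) (wmat p (m w)) (%i. if i < j then mtil p (m w) i else 0m p p) (j + 2)) : meas M (mm p p)"
   by (rule cj1[OF mm_phi[OF m W A01 W01, of "%w i. if i < j then mtil p (m w) i else 0m p p"]]) (assumption | rule t)+
  have "(%w. dinv p (m w 1) (wmat p (m w)) * (m w (j + 2) - Phi p (m w 1) (wmat p (m w)) (%i. if i < j then mtil p (m w) i else 0m p p) (j + 2))
    * (dinv p (m w 1) (wmat p (m w)))^H) : meas M (mm p p)" by (intro mm_mult[OF mm_mult[OF d mm_minus[OF m ph]] mm_adj[OF d d]]) auto
  thus ?thesis by (rule mm_cong) (subst mtil.simps, simp add: False)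
 qed
qed

lemma mm_sandwich:
 "f : meas M (mm p p) ==> g : meas M (mm p p) ==> (%w. sandwich p (f w) (g w)) : meas M (mm p p)"
 unfolding sandwich_def by (intro mm_mult[OF mm_mult[OF mm_isq _ refl] mm_isq refl])

text \<open>The measurability rules for \<open>wmat\<close> and \<open>mtil\<close> ask for
  admissible arguments at every sample point. These moments serve as default values off the event on
  which the given ones are admissible.\<close>

lemma fallback_moments:
 "EX K. (ALL j. K j : Mat p p) & in01 p (K 1) & in01 p (wmat p K)"
proof -
 define h :: "cmat" where "h = cx (1 / 2) .* 1m p"
 have "1m p - h = h" by (rule eq_matI) (simp_all add: h_def)
 hence h: "in01 p h" using pos_def_smult[OF pd_one, of "1 / 2" p] by (simp add: h_def)
 note r = rsq_isqrt[OF h]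
 note [simp] = pd_dims(3,4)[OF cj1[OF h]] pd_dims(3,4)[OF rsq_pd[OF h]] pd_dims(3,4)[OF isqrt_pd[OF range_pd[OF h]]]
 define K where "K j = (if j = 2 then h * h + rsq p h * h * rsq p h else h)" for j :: nat
 have K12: "K 1 = h" "K 2 = h * h + rsq p h * h * rsq p h" by (simp_all add: K_def)
 have "K 2 - h * h = rsq p h * h * rsq p h" unfolding K12 by simp
 hence "wmat p K = h" unfolding wmat_def Let_def K12(1) by (simp add: m_assoc m_cancel[OF r(2)] r(1))
 thus ?thesis using h K12(1) by (intro exI[of _ K]) (auto simp: K_def)
qed

lemma mm_cm: assumes "D : meas M (mm p p)" "!!i. (%w. m w i) : meas M (mm p p)" shows "(%w. cm p (D w) (m w) k) : meas M (mm p p)" using assms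
proof (induction k arbitrary: D m rule: less_induct)
 case (less k)
 note D = less.prems(1) and m = less.prems(2)
 note mu = mm_mult[where m = p and k = p and k' = p and n = p, OF _ _ refl]
  and mi = mm_minus[where m = p and k = p and k' = p and n = p, OF _ _ refl refl]
 note one = mm_const[of "1m p" p p, simplified]
 consider "k = 0" | "k = Suc 0" | "k = Suc (Suc 0)" | j where "k = Suc (Suc (Suc j))" by (metis not0_implies_Suc)
 thus ?case
 proof cases
  case 1
  thus ?thesis by (simp add: mm_const)
 next
  case 2
  show ?thesis unfolding 2 cm.simps by (intro mm_sandwich mu D m mm_adj[OF D D])
 next
  case 3
  show ?thesis unfolding 3 cm.simps by (intro mm_if pred_in01 mm_sandwich mu D m mm_adj[OF D D] mi one mm_const) simp_all
 next
  case (4 j)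
  from fallback_moments[of p] obtain K where K: "!!i. K i : Mat p p" "in01 p (K 1)" "in01 p (wmat p K)" by blast
  \<comment> \<open>Patching takes two rounds: the event that \<open>wmat\<close> is admissible can
    be shown measurable only after the first moment has been made admissible everywhere.\<close>
  define m1 where "m1 w i = (if in01 p (m w 1) then m w i else K i)" for w i
  have m1: "(%w. m1 w i) : meas M (mm p p)" for i unfolding m1_def by (intro mm_if pred_in01 m mm_const K)
  have A1: "in01 p (m1 w 1)" for w using K by (simp add: m1_def)
  note w1 = mm_wmat[where m = m1, OF m1 A1]
  define P where "P w <-> in01 p (m w 1) & in01 p (wmat p (m1 w))" for w
  have m1e: "m1 w = m w" if "in01 p (m w 1)" for w using that by (auto simp: m1_def)
  have P: "Measurable.pred M P" unfolding P_def[abs_def] by (rule pred_intros_logic(3)[OF pred_in01[OF m] pred_in01[OF w1]])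
  have Pe: "P w <-> in01 p (m w 1) & in01 p (wmat p (m w))" for w
  proof (cases "in01 p (m w 1)")
   case True
   show ?thesis unfolding P_def m1e[OF True] ..
  next
   case False
   thus ?thesis unfolding P_def by blast
  qed
  define m2 where "m2 w i = (if P w then m w i else K i)" for w i
  have m2: "(%w. m2 w i) : meas M (mm p p)" for i unfolding m2_def by (intro mm_if P m mm_const K)
  have m2e: "m2 w = (if P w then m w else K)" for w by (auto simp: m2_def)
  have A2: "in01 p (m2 w 1)" "in01 p (wmat p (m2 w))" for w using K Pe[of w] unfolding m2e by (cases "P w"; simp)+
  have dm: "(%w. D w * dmat p (m2 w 1) (wmat p (m2 w))) : meas M (mm p p)" by (rule mu[OF D mm_dmat[OF m2 mm_wmat[where m = m2, OF m2 A2(1)] A2]])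
  have c: "(%w. cm p (D w * dmat p (m2 w 1) (wmat p (m2 w))) (mtil p (m2 w)) (Suc j)) : meas M (mm p p)"
   by (rule less.IH[OF _ dm mm_mtil[where m = m2, OF m2 A2]]) (simp add: 4)
  have "(%w. if P w then cm p (D w * dmat p (m2 w 1) (wmat p (m2 w))) (mtil p (m2 w)) (Suc j) else 0m p p) : meas M (mm p p)"
   by (rule mm_if[OF P c mm_const]) simp
  thus ?thesis
  proof (rule mm_cong)
   fix w
   show "cm p (D w) (m w) k = (if P w then cm p (D w * dmat p (m2 w 1) (wmat p (m2 w))) (mtil p (m2 w)) (Suc j) else 0m p p)"
    unfolding 4 cm.simps Pe[symmetric] by (simp add: m2e)
  qed
 qed
qed

declare One_nat_def [simp] add_2_eq_Suc' [simp]

section \<open>The recursion step of the Jacobi ensemble\<close>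

lemma jw_eq: "jw m a b X = (if in01 m X then ennreal (Re (det X) powr a * Re (det (1m m - X)) powr b) else 0)"
 unfolding JUE_weight_def loewner_01_iff ..

lemma jw_meas: "f : meas M (mm m m) ==> (%w. jw m a b (f w)) : bm M"
proof -
 assume f: "f : meas M (mm m m)"
 note [measurable] = pred_in01[OF f] measurable_det[OF f] measurable_det[OF mm_minus[OF mm_const[OF one_carrier_mat] f refl refl]]
 show ?thesis unfolding jw_eq by measurable
qed

lemma unitary_congr_det: "unitm m U ==> X : Mat m m ==> det (U * X * U^H) = det X"
 using det_congr[of U m X] unitD(1)[of m U] det_unitary[of m U] by (simp add: mult_ac)

lemma jw_unitary: assumes U: "unitm m U" and X: "X : Mat m m" shows "jw m a b (U * X * U^H) = jw m a b X"
proof -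
 note [simp] = unitD(4,5)[OF U] MatD[OF X]
 have c: "U : Mat m m" "U^H : Mat m m" "1m m - X : Mat m m" by simp_all
 have e: "1m m - U * X * U^H = U * (1m m - X) * U^H" using unitD(3)[OF U] by (simp add: m_distrib)
 show ?thesis unfolding jw_eq e unitary_congr_det[OF U X] unitary_congr_det[OF U c(3)]
  pd_congr_iff[OF X c(1,2) unitD(3)[OF U]] pd_congr_iff[OF c(3,1,2) unitD(3)[OF U]] ..
qed

text \<open>With \<open>S\<close> the inverse root of \<open>G * G^H\<close>, the product
  \<open>S * G\<close> is unitary. A ratio formed after conjugation by \<open>G\<close> is therefore
  a unitary conjugate of the original one, by a unitary that depends on \<open>G\<close>
  alone.\<close>

lemma sandwich_unitary: assumes G: "G : Mat p p" "E : Mat p p" "G * E = 1m p"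
 shows "EX U. unitm p U & (ALL W:Mat p p. sandwich p (G * G^H) (G * W * G^H) = U * W * U^H)"
proof -
 note [simp] = MatD[OF G(1)]
 have "pdm p (G * 1m p * G^H)" by (rule pd_congr_inv[OF pd_one G])
 hence P: "pdm p (G * G^H)" by simp
 define S where "S = isqrt p (G * G^H)"
 note [simp] = pd_dims(2-4)[OF isqrt_pd[OF P], folded S_def]
 have "(S * G) * (S * G)^H = S * (G * G^H) * S" by (simp add: m_assoc)
 also have "... = 1m p" unfolding S_def by (rule inv_sqrt_cancel[OF P])
 finally have U: "unitm p (S * G)" by (intro unitary_matI') simp_all
 have "sandwich p (G * G^H) (G * W * G^H) = (S * G) * W * (S * G)^H" if "W : Mat p p" for W
  using P that by (simp add: sandwich_def isq_def S_def[symmetric] m_assoc)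
 thus ?thesis using U by blast
qed

definition mo :: "nat => nat => cmat => nat => cmat" where
 "mo p N X j = block 0 0 p p (mpow N X j)"

lemma mm_mo: "f : meas M (mm N N) ==> p <= N ==> (%w. mo p N (f w) j) : meas M (mm p p)" unfolding mo_def by (rule mm_block[OF mm_mpow mm_mpow]) auto

lemma cm_ind_meas: assumes f: "f : meas M (mm N N)" and "p <= N" "D : Mat p p" "B : sets (mm p p)"
 shows "(%w. Ind B (cm p D (mo p N (f w)) k) :: ennreal) : bm M"
proof (rule m_comp[OF mm_cm])
 show "(%w. D) : meas M (mm p p)" by (rule mm_const) fact
 show "(%w. mo p N (f w) i) : meas M (mm p p)" for i by (rule mm_mo) fact+
 show "(Ind B :: cmat => ennreal) : bm (mm p p)" using assms(4) by simp
qed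

abbreviation bstep :: "nat => nat => cmat => cmat => cmat => cmat" where
 "bstep p q A Z Y \<equiv> blk p A Z (lowb p q A (Z * Z^H) (isqrt p (Z * Z^H) * Z) Y)"

abbreviation nstep :: "nat => nat => (cmat => ennreal) => cmat => ennreal" where
 "nstep p q h A \<equiv> nn (LC p q) (%Z. (if in01 p (Z * Z^H) then ennreal (Re (det (1m p - Z * Z^H)) ^ q) *
  nn (LH q) (%Y. h (bstep p q A Z Y)) else 0))"

text \<open>Substitution in the block decomposition: the cross block becomes
  \<open>rsq p A * Z\<close>, with Jacobian \<open>det (A * (1 - A))^q\<close>, and the lower right
  block is shifted and rescaled by \<open>bmat\<close>, with Jacobian \<open>det (1 - W)^q\<close>.
  The support of \<open>h\<close> confines \<open>A\<close> and \<open>W\<close> to the open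
  interval from 0 to 1.\<close>

lemma step_integral: assumes pq: "p <= q" and h: "h : bm (mm (p + q) (p + q))" and h0: "!!X. h X ~= 0 ==> in01 (p + q) X"
 shows "nn (LH (p + q)) (%X. h X) = nn (LH p) (%A. (if in01 p A then ennreal ((Re (det A) * Re (det (1m p - A))) ^ q) *
   (nstep p q h A) else 0))"
proof -
 let ?a = "mbs q q (hermS q)"
 interpret SF: sigma_finite_measure "LH q" by (rule herm.sigma_finite_L)
 have hh: "(%X. h X) : bm (mbs (p + q) (p + q) (hermS (p + q)))" by (rule m_comp[OF herm_mm h]) simp
 have up: "in01 p A" if "h (fbm A Z (Z^H) F) ~= 0" "A : Mat p p" "Z : Mat p q" "F : Mat q q" for A Z F
 proof -
  note X = h0[OF that(1)]
  have 1: "block 0 0 p p (fbm A Z (Z^H) F) = A" by (rule block_four_block) (use that in simp_all)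
  have "block 0 0 p p (1m (p + q) - fbm A Z (Z^H) F) = 1m p - A" by (rule eq_matI) (use that in \<open>auto simp: block_def\<close>)
  thus ?thesis using pos_def_upper_left[OF cj1[OF X]] pos_def_upper_left[OF cj2[OF X]] 1 by simp
 qed
 show ?thesis unfolding nn_LH_block[OF hh]
 proof (rule nn_cong)
  fix A assume "A : space (LH p)"
  hence Ah: "Herm p A" by simp
  note Ac = HermD(1)[OF Ah]
  define g where "g Z = nn (LH q) (%F. h (fbm A Z (Z^H) F))" for Z
  have fst: "fst : meas (LC p q \<Otimes>\<^sub>M LH q) (mm p q)" "snd : meas (LC p q \<Otimes>\<^sub>M LH q) ?a"
   using measurable_fst[of "LC p q" "LH q"] measurable_snd[of "LC p q" "LH q"] by (simp_all only: meas_LC meas_LH)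
  have "(%x. h (fbm A (fst x) ((fst x)^H) (snd x))) : bm (LC p q \<Otimes>\<^sub>M LH q)"
   by (rule m_comp[OF block_meas[OF _ fst] hh]) (use Ah in \<open>auto intro: measurable_const\<close>)
  hence "(%(Z, F). h (fbm A Z (Z^H) F)) : bm (LC p q \<Otimes>\<^sub>M LH q)" by (simp add: case_prod_beta')
  from SF.borel_measurable_nn_integral[OF this] have g: "g : bm (mm p q)" unfolding g_def[abs_def] by (simp only: meas_LC)
  show "nn (LC p q) (%Z. (nn (LH q) (%F. h (fbm A Z (Z^H) F)))) = (if in01 p A then ennreal ((Re (det A) * Re (det (1m p - A))) ^ q) *
   (nstep p q h A) else 0)"
  proof (cases "in01 p A")
   case False
   have "nn (LC p q) (%Z. (nn (LH q) (%F. h (fbm A Z (Z^H) F)))) = nn (LC p q) (%Z. (nn (LH q) (%F. 0)))"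
    by (intro nn_cong) (use up[OF _ Ac] False in \<open>auto dest: HermD(3,4)\<close>)
   thus ?thesis unfolding if_not_P[OF False] by simp
  next
   case True
   define r where "r = rsq p A"
   note r = rsq_pd[OF True, folded r_def]
   note [simp] = pd_dims(2-4)[OF r] MatD[OF Ac]
   have ri: "r * isqrt p (A * (1m p - A)) = 1m p" unfolding r_def by (rule rsq_isqrt(1)[OF True])
   have dr: "Re (det (r * r^H)) = Re (det A) * Re (det (1m p - A))"
   proof -
    have "det (r * r^H) = det A * det (1m p - A)" using rsq_self[OF True, folded r_def] det_mult[of A p "1m p - A"] by simp
    also have "... = cx (Re (det A) * Re (det (1m p - A)))" using pd_det(2)[OF cj1[OF True]] pd_det(2)[OF cj2[OF True]] by simp
    finally show ?thesis by simp
   qed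
   have "nn (LC p q) (%Z. g Z) = ennreal ((Re (det A) * Re (det (1m p - A))) ^ q) * nn (LC p q) (%Z. g (r * Z))"
    using nn_LC_left[OF _ _ ri g] pd_dims(1)[OF isqrt_pd[OF range_pd[OF True]]] unfolding dr by simp
   also have "nn (LC p q) (%Z. g (r * Z)) = nstep p q h A"
   proof (rule nn_integral_cong_AE)
    have "AE Z in LC p q. Z : Mat p q" by (rule AE_I2) simp
    with AE_full_rank[OF pq]
    show "AE Z in LC p q. g (r * Z) = (if in01 p (Z * Z^H) then ennreal (Re (det (1m p - Z * Z^H)) ^ q) *
     (nn (LH q) (%Y. h (bstep p q A Z Y))) else 0)"
    proof eventually_elim
     case (elim Z)
     note Z = elim(2) and P = elim(1)
     note [simp] = MatD[OF Z]
     define W where "W = Z * Z^H"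
     have gz: "g (r * Z) = nn (LH q) (%F. h (blk p A Z F))" unfolding g_def blk_def r_def[symmetric] by (simp add: r_def[symmetric])
     show ?case
     proof (cases "in01 p W")
      case False
      have "h (blk p A Z F) = 0" if "F : hermS q" for F
      proof (rule ccontr)
       assume n: "h (blk p A Z F) ~= 0"
       have F: "F : Mat q q" using that HermD(1) by blast
       have "pdm q (1m q - Z^H * Z)" using blk_imp_contraction[OF True Z F] h0[OF n] by blast
       from contraction_adjoint[OF Z this] show False using False P by (simp add: W_def)
      qed
      hence "g (r * Z) = nn (LH q) (%F. 0)" unfolding gz by (intro nn_cong) simp
      moreover have "~ in01 p (Z * Z^H)" using False by (simp only: W_def simp_thms)
      ultimately show ?thesis by (simp only: if_False nn_integral_const mult_zero_left)
     next
      case W: True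
      define V where "V = isqrt p W * Z"
      note [simp] = pd_dims(2-4)[OF isqrt_pd[OF cj1[OF W]]] pd_dims(2-4)[OF sqrt_pd[OF cj1[OF W]]]
      have "V * V^H = isqrt p W * (Z * Z^H) * isqrt p W" by (simp add: V_def m_assoc)
      hence "V * V^H = isqrt p W * W * isqrt p W" unfolding W_def[symmetric] .
      hence V: "coiso p q V" unfolding coiso_def inv_sqrt_cancel[OF cj1[OF W]] by (simp add: V_def)
      have ZV: "sqrt_mat p W * V = Z" by (simp add: V_def m_cancel[OF sqrt_isqrt[OF cj1[OF W]]])
      define B where "B = bmat p q W V"
      define G0 where "G0 = Z^H * (1m p - A) * Z"
      \<comment> \<open>Only identities about \<open>W\<close>, \<open>V\<close> and
        \<open>B\<close> are taken from \<open>step_identities\<close> here; the zero matrix stands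
        in for \<open>Y\<close>.\<close>
      have z0: "Herm q (0m q q)" by (rule hermitian_zero)
      note st = step_identities[OF True W V z0, folded B_def, unfolded ZV]
      from st(6) obtain C where C: "C : Mat q q" "B * C = 1m q" by blast
      have Bh: "Herm q B" unfolding B_def by (rule bmat_props(1)[OF W V])
      note [simp] = HermD(2-4)[OF Bh] HermD(2)[OF Ah]
      have G0: "G0 : hermS q" unfolding G0_def using Herm_congr[of p "1m p - A" "Z^H" q] Herm_minus[OF hermitian_one Ah] by simp
      have dB: "Re (det (B * B^H)) = Re (det (1m p - W))" using st(5) det_mult[of B q "B^H"] by simp
      have k: "(%F. h (blk p A Z F)) : bm ?a"
      proof -
       have "(%F. fbm A (r * Z) ((r * Z)^H) F) : meas ?a (mbs (p + q) (p + q) (hermS (p + q)))"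
        by (rule block_meas) (use Ah in \<open>auto intro: measurable_const\<close>)
       moreover have "fbm A (r * Z) ((r * Z)^H) F = blk p A Z F" for F by (simp add: blk_def r_def[symmetric])
       ultimately show ?thesis using m_comp[OF _ hh] by simp
      qed
      have k2: "(%F. h (blk p A Z (F + G0))) : bm ?a" by (rule m_comp[OF herm.add_meas[OF measurable_ident_sets[OF refl] herm.const_meas[OF G0]] k])
      \<comment> \<open>The lower end \<open>G0\<close> of the interval for the lower right block is
        removed by a translation; the congruence by \<open>B\<close> then rescales its length to
        one.\<close>
      have "g (r * Z) = nn (LH q) (%F. h (blk p A Z (F + G0)))" unfolding gz by (rule herm.nn_translate[OF k G0, symmetric])
      also have "... = ennreal (Re (det (1m p - W)) ^ q) * nn (LH q) (%Y. h (blk p A Z (B * Y * B^H + G0)))"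
       using nn_LH_congr[OF _ C k2] unfolding dB by simp
      also have "nn (LH q) (%Y. h (blk p A Z (B * Y * B^H + G0))) = nn (LH q) (%Y. h (blk p A Z (lowb p q A W V Y)))"
      proof (rule nn_cong)
       fix Y assume "Y : space (LH q)"
       hence Y: "nr Y = q" "nc Y = q" using HermD(3,4)[of q Y] by auto
       have "B * Y * B^H + G0 = lowb p q A W V Y" unfolding lowb_def ZV B_def[symmetric] G0_def by (intro eq_matI) (simp_all add: Y del: index_mm(1))
       thus "h (blk p A Z (B * Y * B^H + G0)) = h (blk p A Z (lowb p q A W V Y))" by simp
      qed
      finally show ?thesis using W unfolding V_def W_def by (simp only: if_True simp_thms)
     qed
    qed
   qed
   finally show ?thesis using True unfolding g_def by (simp only: if_True simp_thms)
  qed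
 qed
qed

declare One_nat_def [simp del] add_2_eq_Suc' [simp del]

text \<open>The determinants factor as \<open>det X = det A * det (1 - W) * det Y\<close> and
  \<open>det (1 - X) = det (1 - A) * det (1 - W) * det (1 - Y)\<close>. Both contain
  \<open>det (1 - W)\<close>, whence its exponent \<open>a + b\<close>. Everything the recursion
  needs about \<open>X\<close> is expressed by \<open>A\<close>, \<open>W\<close> and the moments of
  \<open>Y\<close>.\<close>

lemma blk_values: assumes A: "in01 p A" and W: "in01 p W" and V: "coiso p q V" and Y: "Herm q Y"
 defines "X == blk p A (sqrt_mat p W * V) (lowb p q A W V Y)"
 shows "jw (p + q) a b X = ennreal (Re (det A) powr a * Re (det (1m p - A)) powr b * Re (det (1m p - W)) powr (a + b)) * jw q a b Y"
  "mo p (p + q) X 0 = 1m p" "mo p (p + q) X 1 = A" "mo p (p + q) X 2 = A * A + rsq p A * W * rsq p A"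
  "wmat p (mo p (p + q) X) = W" "mtil p (mo p (p + q) X) j = vmom q V Y j"
proof -
 let ?a = "Re (det A) powr a * Re (det (1m p - A)) powr b * Re (det (1m p - W)) powr (a + b)"
 let ?b = "mo p (p + q) X"
 let ?c = "det (1m p - W)"
 note st = step_identities[OF A W V Y]
 note in01X = blk_step_in01[OF A W V Y, folded X_def]
 have F: "lowb p q A W V Y : Mat q q" using HermD(1)[OF st(9)] .
 define B where "B = bmat p q W V"
 note [simp] = HermD(2-4)[OF Y] pd_dims(2-4)[OF cj1[OF A]] pd_dims(2-4)[OF cj1[OF W]] pd_dims(2-4)[OF rsq_pd[OF A]]
  coisoD(2-4)[OF V] pd_dims(2-4)[OF isqrt_pd[OF range_pd[OF A]]] pd_dims(2-4)[OF sqrt_pd[OF cj1[OF W]]]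
 note da = pd_det[OF cj1[OF A]] pd_det[OF cj2[OF A]] pd_det[OF cj2[OF W]]
 have Bc: "B : Mat q q" using st(8) by (simp add: B_def)
 show "jw (p + q) a b X = ennreal ?a * jw q a b Y"
 proof (cases "in01 q Y")
  case True
  note dy = pd_det[OF cj1[OF True]] pd_det[OF cj2[OF True]]
  have "det X = det A * (det B * det Y * det (B^H))"
   unfolding X_def blk_pos_def(2)[OF A st(7) F] st(1) B_def[symmetric] using det_congr[OF Bc, of Y] by simp
  also have "... = det A * det (1m p - W) * det Y" using st(5) by (simp add: B_def mult_ac)
  also have "... = cx (Re (det A) * Re ?c * Re (det Y))" by (simp add: da dy)
  finally have 1: "Re (det X) = Re (det A) * Re ?c * Re (det Y)" by simp
  have "det (1m (p + q) - X) = det (1m p - A) * (det B * det (1m q - Y) * det (B^H))"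
   unfolding X_def blk_compl(2)[OF A st(7) F] st(2) B_def[symmetric] using det_congr[OF Bc, of "1m q - Y"] by simp
  also have "... = det (1m p - A) * det (1m p - W) * det (1m q - Y)" using st(5) by (simp add: B_def mult_ac)
  also have "... = cx (Re (det (1m p - A)) * Re ?c * Re (det (1m q - Y)))" by (simp add: da dy)
  finally have 2: "Re (det (1m (p + q) - X)) = Re (det (1m p - A)) * Re ?c * Re (det (1m q - Y))" by simp
  have pw: "(x * w * y) powr a * (x' * w * y') powr b = (x powr a * x' powr b * w powr (a + b)) * (y powr a * y' powr b)"
   if "0 < x" "0 < x'" "0 < w" "0 < y" "0 < y'" for x x' w y y' :: real using that by (simp add: powr_mult powr_add mult_ac)
  have in1: "in01 (p + q) X" using in01X(1) True by blast
  have "jw (p + q) a b X = ennreal (Re (det X) powr a * Re (det (1m (p + q) - X)) powr b)" unfolding jw_eq by (rule if_P[OF in1])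
  also have "... = ennreal (?a * (Re (det Y) powr a * Re (det (1m q - Y)) powr b))"
   unfolding 1 2 by (subst pw[OF da(1) da(3) da(5) dy(1) dy(3)]) (rule refl)
  also have "... = ennreal ?a * jw q a b Y" unfolding jw_eq if_P[OF True] by (rule ennreal_mult) auto
  finally show ?thesis .
 next
  case False
  hence "~ in01 (p + q) X" using in01X(1) by blast
  thus ?thesis using False unfolding jw_eq by (simp only: if_False mult_zero_right)
 qed
 define m where "m = vmom q V Y"
 have m: "m i : Mat p p" "m 0 = 1m p" for i by (simp_all add: m_def vmom_def)
 have Yc: "Y : Mat q q" by simp
 have ph: "mo p (p + q) X i = Phi p A W m i" for i unfolding mo_def m_def X_def by (rule phi_blk(1)[OF A W V Yc, symmetric])
 show 0: "mo p (p + q) X 0 = 1m p" unfolding ph by (rule phi_012(1)[where m = m, OF A W m(2,1)])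
 show 1: "mo p (p + q) X 1 = A" unfolding ph by (rule phi_012(2)[where m = m, OF A W m(2,1)])
 define Z where "Z = sqrt_mat p W * V"
 have Zc: "Z : Mat p q" using st(7) by (simp add: Z_def)
 note [simp] = MatD[OF Zc] MatD[OF F]
 have Xb: "X = fbm A (rsq p A * Z) (Z^H * rsq p A) (lowb p q A W V Y)" by (simp add: X_def blk_def Z_def)
 have Xc: "X : Mat (p + q) (p + q)" using HermD(1)[OF in01X(2)] .
 show 2: "mo p (p + q) X 2 = A * A + rsq p A * W * rsq p A"
 proof -
  have Ac: "A : Mat p p" and rz: "rsq p A * Z : Mat p q" "Z^H * rsq p A : Mat q p" by simp_all
  have "mpow (p + q) X 2 = X * X" using Xc by (simp add: numeral_2_eq_2)
  hence "mo p (p + q) X 2 = A * block 0 0 p p X + rsq p A * Z * block p 0 q p X"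
   unfolding mo_def using block_mult(1)[OF Ac rz F, of X] Xc Xb[symmetric] by simp
  also have "block 0 0 p p X = A" unfolding Xb by (rule block_four_block(1)[OF Ac rz F])
  also have "block p 0 q p X = Z^H * rsq p A" unfolding Xb by (rule block_four_block(2)[OF Ac rz F])
  also have "rsq p A * Z * (Z^H * rsq p A) = rsq p A * (Z * Z^H) * rsq p A" by (simp add: m_assoc)
  also have "Z * Z^H = W" using st(4) by (simp only: Z_def)
  finally show ?thesis .
 qed
 show wm: "wmat p ?b = W"
 proof -
  have "mo p (p + q) X 2 - A * A = rsq p A * W * rsq p A" unfolding 2 by simp
  thus ?thesis unfolding wmat_def Let_def 1 by (simp add: m_assoc m_cancel[OF rsq_isqrt(2)[OF A]] rsq_isqrt(1)[OF A])
 qed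
 have A': "in01 p (mo p (p + q) X 1)" and W': "in01 p (wmat p ?b)" using A W unfolding 1 wm by blast+
 have "mtil p ?b j = m j"
 proof (rule mtil_unique[where k = j and m = m and M = "mo p (p + q) X", OF A' W' m])
  show "mo p (p + q) X (i + 2) = Phi p (mo p (p + q) X 1) (wmat p ?b) m (i + 2)" for i unfolding 1 wm by (rule ph)
 qed simp
 thus "mtil p ?b j = vmom q V Y j" by (simp add: m_def)
qed

text \<open>The frame \<open>V^H\<close> is completed to a unitary matrix, whose adjoint carries it
  to the coordinate frame. Moments in an arbitrary frame are thus upper left blocks of powers of a
  unitary conjugate.\<close>

lemma vmom_rotate: assumes V: "coiso p q V" and pq: "p <= q" shows "EX Q. unitm q Q & (ALL Y:Mat q q. ALL i. vmom q V Y i = mo p q (Q * Y * Q^H) i)"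
proof -
 note [simp] = coisoD(2,3)[OF V]
 have Vd: "V^H : Mat q p" by simp
 have "(V^H)^H * V^H = 1m p" using coisoD(4)[OF V] by simp
 from isometry_extend[OF Vd this pq] obtain U where U: "unitm q U" and UV: "ALL i<q. ALL j<p. U $$ (i, j) = V^H $$ (i, j)" by blast
 note [simp] = unitD(4,5)[OF U]
 have UE: "U * (ecol p q)^H = V^H" by (rule eq_matI) (use UV pq in \<open>simp_all add: mult_ecol_adj[of _ q] del: index_mm(1)\<close>)
 have "(U * (ecol p q)^H)^H = V" unfolding UE by simp
 hence VE: "ecol p q * U^H = V" by simp
 have "vmom q V Y i = mo p q (U^H * Y * (U^H)^H) i" if Y: "Y : Mat q q" for Y i
 proof -
  note [simp] = MatD[OF Y]
  have pw: "mpow q (U^H * Y * U) i = U^H * mpow q Y i * U" by (induction i) (simp_all add: unitD(2)[OF U] m_assoc m_cancel[OF unitD(3)[OF U]])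
  have c: "U^H * Y * U : Mat q q" by simp
  have "mo p q (U^H * Y * (U^H)^H) i = vmom q (ecol p q) (U^H * Y * U) i" unfolding mo_def adjoint_adjoint by (rule vmom_ecol[OF c pq, symmetric])
  also have "... = (ecol p q * U^H) * mpow q Y i * (U * (ecol p q)^H)" unfolding vmom_def pw by (simp add: m_assoc)
  also have "... = vmom q V Y i" unfolding VE UE vmom_def ..
  finally show ?thesis by simp
 qed
 thus ?thesis using unitary_adjoint[OF U] by blast
qed

declare One_nat_def [simp] add_2_eq_Suc' [simp]

section \<open>Joint law of the canonical moments\<close>

text \<open>The parameters as functions of the running index, odd and even cases interleaved, so
  that peeling two moments is the index shift \<open>k + 2\<close>. Real arithmetic avoids truncated
  subtraction.\<close>

definition jac_a :: "nat => nat => real => nat => real" where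
 "jac_a p n a k = (if odd k then real p * (real n - real (Suc k div 2)) + a else real p * (real n - real (k div 2) - 1))"

definition jac_b :: "nat => nat => real => real => nat => real" where
 "jac_b p n a b k = (if odd k then real p * (real n - real (Suc k div 2)) + b else real p * (real n - real (k div 2)) + a + b)"

lemma jac_shift: "jac_a p (Suc n) a (k + 2) = jac_a p n a k" "jac_b p (Suc n) a b (k + 2) = jac_b p n a b k" by (simp_all add: jac_a_def jac_b_def)

definition JI :: "nat => real => real => cmat set => ennreal" where
 "JI p a b B = nn (LH p) (%X. jw p a b X * Ind B X)"

lemma JI_meas: assumes "B : sets (mm p p)" "D : Mat p p" shows "(%X. jw p a b X * Ind B (D * X * D^H)) : bm (mbs p p (hermS p))"
proof -
 have id: "(%X. X) : meas (mbs p p (hermS p)) (mm p p)" by (rule herm_mm) simp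
 have Bi: "(Ind B :: cmat => ennreal) : bm (mm p p)" using assms(1) by simp
 show ?thesis by (rule bm_times[OF jw_meas[OF id] m_comp[OF herm_mm[OF congr_meas[OF assms(2)]] Bi]])
qed

lemma JI_unitary: assumes U: "unitm p U" and B: "B : sets (mm p p)" shows "nn (LH p) (%X. jw p a b X * Ind B (U * X * U^H)) = JI p a b B"
proof -
 have "nn (LH p) (%X. jw p a b X * Ind B (U * X * U^H))
  = nn (LH p) (%X. jw p a b (U * X * U^H) * Ind B (U * X * U^H))"
  by (rule nn_cong) (use jw_unitary[OF U] HermD(1) in \<open>simp del: carrier_iff\<close>)
 also have "... = nn (LH p) (%X. jw p a b X * Ind B X)"
 proof (rule nn_LH_unitary[OF U, of "%X. jw p a b X * Ind B X"])
  have id: "(%X. X) : meas (mbs p p (hermS p)) (mm p p)" by (rule herm_mm) simp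
  have Bi: "(Ind B :: cmat => ennreal) : bm (mm p p)" using B by simp
  show "(%X. jw p a b X * Ind B X) : bm (mbs p p (hermS p))" by (rule bm_times[OF jw_meas[OF id] m_comp[OF id Bi]])
 qed
 finally show ?thesis unfolding JI_def .
qed

lemma prod_split2:
 fixes g :: "nat => ennreal" assumes "n >= 1" shows "(\<Prod>k\<in>{1..2 * Suc n - 1}. g k) = g 1 * g 2 * (\<Prod>k\<in>{1..2 * n - 1}. g (k + 2))"
proof -
 let ?a = "insert 2 ((%k. k + 2) ` {1..2 * n - 1})"
 have e: "{1..2 * Suc n - 1} = insert 1 ?a"
 proof (intro equalityI subsetI)
  fix k assume k: "k : {1..2 * Suc n - 1}"
  show "k : insert 1 ?a"
  proof (cases "k <= 2")
   case False
   hence "k = (k - 2) + 2" "k - 2 : {1..2 * n - 1}" using k by auto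
   thus ?thesis by blast
  qed (use k in auto)
 qed (use assms in auto)
 have "(\<Prod>k\<in>(%k. k + 2) ` {1..2 * n - 1}. g k) = (\<Prod>k\<in>{1..2 * n - 1}. g (k + 2))" by (subst prod.reindex) (auto simp: inj_on_def)
 thus ?thesis unfolding e by (subst prod.insert, simp, force, subst prod.insert, simp, force, simp add: mult.assoc)
qed

text \<open>The joint law, unnormalized and tested on product sets, for all invertible
  \<open>D\<close> at once. One constant serves every \<open>D\<close> and \<open>B\<close>: in the
  induction step \<open>D\<close> is multiplied by a matrix depending on \<open>A\<close> and
  \<open>W\<close>, and the inner result has to leave the integrals over these two.\<close>

lemma moments_law: assumes n: "n >= 1" shows "EX c. ALL D E B. D : Mat p p --> E : Mat p p --> D * E = 1m p --> (ALL k. B k : sets (mm p p)) -->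
  (nn (LH (n * p)) (%X. jw (n * p) a b X * (\<Prod>k\<in>{1..2 * n - 1}. Ind (B k) (cm p D (mo p (n * p) X) k))))
   = c * (\<Prod>k\<in>{1..2 * n - 1}. JI p (jac_a p n a k) (jac_b p n a b k) (B k))" using n
proof (induction n rule: nat_induct_at_least)
 case base
 show ?case
 proof (intro exI[of _ 1] allI impI)
  fix D E :: "cmat" and B :: "nat => cmat set"
  assume D: "D : Mat p p" "E : Mat p p" "D * E = 1m p" and B: "ALL k. B k : sets (mm p p)"
  from sandwich_unitary[OF D] obtain U where U: "unitm p U" and sU: "ALL W:Mat p p. sandwich p (D * D^H) (D * W * D^H) = U * W * U^H" by blast
  have cmU: "cm p D (mo p (1 * p) X) 1 = U * X * U^H" if "X : hermS p" for X
  proof -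
   have X: "X : Mat p p" using that HermD(1) by blast
   note [simp] = MatD[OF X]
   have "mo p (1 * p) X 1 = X" unfolding mo_def by (rule eq_matI) (simp_all add: block_def)
   thus ?thesis using sU[rule_format, OF X] by simp
  qed
  have s1: "{1..2 * 1 - 1} = {1::nat}" by auto
  have j1: "jac_a p 1 a 1 = a" "jac_b p 1 a b 1 = b" by (simp_all add: jac_a_def jac_b_def)
  have "nn (LH (1 * p)) (%X. jw (1 * p) a b X * (\<Prod>k\<in>{1..2 * 1 - 1}. Ind (B k) (cm p D (mo p (1 * p) X) k)))
   = nn (LH p) (%X. jw p a b X * Ind (B 1) (U * X * U^H))" unfolding s1 mult_1 by (rule nn_cong) (use cmU in simp)
  also have "... = JI p a b (B 1)" using B by (intro JI_unitary[OF U]) blast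
  finally show "nn (LH (1 * p)) (%X. jw (1 * p) a b X * (\<Prod>k\<in>{1..2 * 1 - 1}. Ind (B k) (cm p D (mo p (1 * p) X) k)))
   = 1 * (\<Prod>k\<in>{1..2 * 1 - 1}. JI p (jac_a p 1 a k) (jac_b p 1 a b k) (B k))" unfolding s1 by (simp add: j1[simplified])
 qed
next
 case (Suc n)
 define q where "q = n * p"
 have pq: "p <= q" using Suc.hyps by (simp add: q_def)
 from Suc.IH obtain c where IH: "!!D E B. D : Mat p p ==> E : Mat p p ==> D * E = 1m p ==> (!!k. B k : sets (mm p p)) ==>
  (nn (LH q) (%X. jw q a b X * (\<Prod>k\<in>{1..2 * n - 1}. Ind (B k) (cm p D (mo p q X) k))))
   = c * (\<Prod>k\<in>{1..2 * n - 1}. JI p (jac_a p n a k) (jac_b p n a b k) (B k))" unfolding q_def by blast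
 from wishart[OF pq] obtain c' where wish: "!!f. f : bm (mm p p) ==> (nn (LC p q) (%Z. f (Z * Z^H)))
  = c' * nn (LH p) (%W. (if pdm p W then ennreal (Re (det W) ^ (q - p)) * f W else 0))" by blast
 have Nq: "Suc n * p = p + q" by (simp add: q_def)
 show ?case unfolding Nq
 proof (intro exI[of _ "c' * c"] allI impI)
  fix D E :: "cmat" and B :: "nat => cmat set"
  assume D: "D : Mat p p" "E : Mat p p" "D * E = 1m p" and "ALL k. B k : sets (mm p p)"
  hence B: "B k : sets (mm p p)" for k by blast
  note [simp] = MatD[OF D(1)] MatD[OF D(2)]
  from sandwich_unitary[OF D] obtain U1 where U1: "unitm p U1"
   and sU1: "!!W. W : Mat p p ==> sandwich p (D * D^H) (D * W * D^H) = U1 * W * U1^H" by blast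
  define h where "h X = jw (p + q) a b X * (\<Prod>k\<in>{1..2 * Suc n - 1}. Ind (B k) (cm p D (mo p (p + q) X) k))" for X
  have h: "h : bm (mm (p + q) (p + q))"
   unfolding h_def by (intro bm_times borel_measurable_prod_ennreal jw_meas[OF mm_id] cm_ind_meas[OF mm_id _ D(1) B]) auto
  have h0: "in01 (p + q) X" if "h X ~= 0" for X
  proof (rule ccontr)
   assume F: "~ in01 (p + q) X"
   have "jw (p + q) a b X = 0" unfolding jw_eq if_not_P[OF F] ..
   thus False using that by (simp add: h_def)
  qed
  define \<Omega> where "\<Omega> = (\<Prod>k\<in>{1..2 * n - 1}. JI p (jac_a p n a k) (jac_b p n a b k) (B (k + 2)))"
  define i1 :: "cmat => ennreal" where "i1 A = Ind (B 1) (U1 * A * U1^H)" for A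
  define KA where "KA A = Re (det A) powr a * Re (det (1m p - A)) powr b" for A
  \<comment> \<open>\<open>q = n * p\<close> is the size that remains after one step from
    \<open>Suc n\<close> blocks; the exponents are those produced by the Jacobians of that
    step.\<close>
  have a1: "jac_a p (Suc n) a 1 = real q + a" "jac_b p (Suc n) a b 1 = real q + b" by (simp_all add: jac_a_def jac_b_def q_def)
  have a2: "jac_a p (Suc n) a 2 = real (q - p)" "jac_b p (Suc n) a b 2 = real q + (a + b)"
   using pq by (simp_all add: jac_a_def jac_b_def q_def of_nat_diff algebra_simps)
  have inner: "nstep p q h A
   = ennreal (KA A) * i1 A * (c' * (c * \<Omega>) * JI p (jac_a p (Suc n) a 2) (jac_b p (Suc n) a b 2) (B 2))" if A: "in01 p A" for A
  proof -
   define r where "r = rsq p A"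
   note rp = rsq_pd[OF A, folded r_def]
   note [simp] = pd_dims(2-4)[OF rp] pd_dims(2-4)[OF cj1[OF A]] pd_dims(2-4)[OF isqrt_pd[OF range_pd[OF A]]]
   have Ac: "A : Mat p p" by simp
   have ri: "r * isqrt p (A * (1m p - A)) = 1m p" unfolding r_def by (rule rsq_isqrt(1)[OF A])
   have G: "D * r : Mat p p" "isqrt p (A * (1m p - A)) * E : Mat p p"
    "D * r * (isqrt p (A * (1m p - A)) * E) = 1m p" by (simp_all add: m_assoc m_cancel[OF ri] D(3))
   \<comment> \<open>The interval for the second moment has conjugated length
     \<open>D * r * (D * r)^H\<close>, so the second canonical moment is \<open>W\<close> conjugated
     by a unitary that is fixed once \<open>D\<close> and \<open>A\<close> are.\<close>
   from sandwich_unitary[OF G] obtain U2 where U2: "unitm p U2"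
    and sU2: "!!W. W : Mat p p ==> sandwich p (D * r * (D * r)^H) (D * r * W * (D * r)^H) = U2 * W * U2^H" by blast
   define i2 :: "cmat => ennreal" where "i2 W = Ind (B 2) (U2 * W * U2^H)" for W
   have Yint: "nn (LH q) (%Y. h (bstep p q A Z Y))
    = ennreal (KA A * Re (det (1m p - Z * Z^H)) powr (a + b)) * (i1 A * i2 (Z * Z^H)) * (c * \<Omega>)"
    if Z: "Z : Mat p q" and W0: "in01 p (Z * Z^H)" for Z
   proof -
    note [simp] = MatD[OF Z]
    define W where "W = Z * Z^H"
    define V where "V = isqrt p W * Z"
    have W: "in01 p W" using W0 unfolding W_def .
    note [simp] = pd_dims(2-4)[OF isqrt_pd[OF cj1[OF W]]] pd_dims(2-4)[OF cj1[OF W]]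
    have Wc: "W : Mat p p" by simp
    have "V * V^H = isqrt p W * (Z * Z^H) * isqrt p W" by (simp add: V_def m_assoc)
    hence "V * V^H = isqrt p W * W * isqrt p W" unfolding W_def[symmetric] .
    hence V: "coiso p q V" unfolding coiso_def inv_sqrt_cancel[OF cj1[OF W]] by (simp add: V_def)
    have ZV: "sqrt_mat p W * V = Z" using pd_dims(3,4)[OF sqrt_pd[OF cj1[OF W]]] by (simp add: V_def m_cancel[OF sqrt_isqrt[OF cj1[OF W]]])
    \<comment> \<open>\<open>Q\<close> comes from \<open>V\<close>, which is fixed with
      \<open>Z\<close>; in the integral over \<open>Y\<close> it is therefore absorbed by unitary
      invariance.\<close>
    from vmom_rotate[OF V pq] obtain Q where Q: "unitm q Q" and VQ: "!!Y i. Y : Mat q q ==> vmom q V Y i = mo p q (Q * Y * Q^H) i" by blast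
    define K where "K = dmat p A W"
    note Dp = dinv_props[OF A W, folded K_def]
    note [simp] = Dp(1-4)
    have DK: "D * K : Mat p p" "dinv p A W * E : Mat p p" "D * K * (dinv p A W * E) = 1m p" by (simp_all add: m_assoc m_cancel[OF Dp(6)] D(3))
    define w where "w = ennreal (KA A * Re (det (1m p - W)) powr (a + b))"
    define pr where "pr Y = (\<Prod>k\<in>{1..2 * n - 1}. Ind (B (k + 2)) (cm p (D * K) (mo p q Y) k) :: ennreal)" for Y
    have hY: "h (blk p A Z (lowb p q A W V Y)) = w * (i1 A * i2 W) * (jw q a b (Q * Y * Q^H) * pr (Q * Y * Q^H))" if "Y : hermS q" for Y
    proof -
     have Yh: "Herm q Y" using that by simp
     have Yc: "Y : Mat q q" using HermD(1)[OF Yh] .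
     define X where "X = blk p A Z (lowb p q A W V Y)"
     note bv = blk_values[OF A W V Yh, unfolded ZV, folded X_def]
     define M where "M = mo p (p + q) X"
     have M: "M 1 = A" "M 2 = A * A + r * W * r" "wmat p M = W" "mtil p M = mo p q (Q * Y * Q^H)" using bv(3-6) VQ[OF Yc] by (auto simp: M_def r_def)
     have c1: "cm p D M 1 = U1 * A * U1^H" unfolding One_nat_def cm.simps M(1)[unfolded One_nat_def] using sU1[OF Ac] M(1) by simp
     have c2: "cm p D M 2 = U2 * W * U2^H"
     proof -
      have e1: "D * (A * (1m p - A)) * D^H = D * r * (D * r)^H" unfolding rsq_self[OF A, folded r_def, symmetric] by (simp add: m_assoc)
      have "M 2 - A * A = r * W * r" unfolding M(2) by simp
      hence e2: "D * (M 2 - A * A) * D^H = D * r * W * (D * r)^H" by (simp only:) (simp add: m_assoc)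
      have "cm p D M (Suc (Suc 0)) = sandwich p (D * (A * (1m p - A)) * D^H) (D * (M 2 - A * A) * D^H)" unfolding cm.simps M(1) by (rule if_P[OF A])
      thus ?thesis unfolding e1 e2 sU2[OF Wc] by (simp add: numeral_2_eq_2)
     qed
     have c3: "cm p D M (k + 2) = cm p (D * K) (mo p q (Q * Y * Q^H)) k" if kk: "k : {1..2 * n - 1}" for k
     proof -
      obtain j where k: "k = Suc j" using kk by (cases k) auto
      have "cm p D M (Suc (Suc (Suc j))) = cm p (D * K) (mtil p M) (Suc j)" unfolding cm.simps M(1,3) K_def by (rule if_P) (use A W in blast)
      thus ?thesis unfolding k M(4) by simp
     qed
     have "h X = (ennreal (KA A * Re (det (1m p - W)) powr (a + b)) * jw q a b Y) * (i1 A * i2 W * pr (Q * Y * Q^H))"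
      unfolding h_def prod_split2[OF Suc.hyps] M_def[symmetric] c1 c2 bv(1) i1_def i2_def pr_def KA_def
      by (intro arg_cong2[of _ _ _ _ "(*)"] refl prod.cong) (simp only: c3)
     thus ?thesis unfolding X_def[symmetric] w_def jw_unitary[OF Q Yc] by (simp only: mult_ac)
    qed
    have prm: "(%Y. jw q a b Y * pr Y) : bm (mbs q q (hermS q))"
    proof -
     have id: "(%X. X) : meas (mbs q q (hermS q)) (mm q q)" by (rule herm_mm) simp
     show ?thesis unfolding pr_def by (intro bm_times borel_measurable_prod_ennreal jw_meas[OF id] cm_ind_meas[OF id pq DK(1) B])
    qed
    have prm': "(%Y. jw q a b (Q * Y * Q^H) * pr (Q * Y * Q^H)) : bm (LH q)" unfolding meas_LH by (rule m_comp[OF congr_meas[OF unitD(1)[OF Q]] prm])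
    have "nn (LH q) (%Y. h (blk p A Z (lowb p q A W V Y))) = nn (LH q) (%Y. w * (i1 A * i2 W) * (jw q a b (Q * Y * Q^H) * pr (Q * Y * Q^H)))"
     by (rule nn_cong) (use hY in simp)
    also have "... = w * (i1 A * i2 W) * nn (LH q) (%Y. jw q a b (Q * Y * Q^H) * pr (Q * Y * Q^H))" by (rule nn_cmult[OF prm'])
    also have "nn (LH q) (%Y. jw q a b (Q * Y * Q^H) * pr (Q * Y * Q^H)) = nn (LH q) (%Y. jw q a b Y * pr Y)" by (rule nn_LH_unitary[OF Q prm])
    \<comment> \<open>The induction hypothesis is applied with the conjugation \<open>D * K\<close>;
      its constant is the same for all \<open>A\<close> and \<open>W\<close>.\<close>
    also have "... = c * \<Omega>" unfolding pr_def \<Omega>_def by (rule IH[OF DK]) (rule B)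
    finally show ?thesis unfolding w_def V_def W_def .
   qed
   define t where "t W = (if in01 p W then ennreal (Re (det (1m p - W)) ^ q) * (ennreal (KA A * Re (det (1m p - W)) powr (a + b)) * (i1 A * i2 W) * (c * \<Omega>)) else 0)" for W
   have t: "t : bm (mm p p)"
   proof -
    have Bi: "(Ind (B 2) :: cmat => ennreal) : bm (mm p p)" using B[of 2] by simp
    have i2m: "i2 : bm (mm p p)" unfolding i2_def
     by (rule m_comp[OF mm_mult[OF mult_left_meas[OF unitD(1)[OF U2]] mm_const[OF adjoint_carrier[OF unitD(1)[OF U2]]] refl] Bi])
    note [measurable] = i2m pred_in01[OF mm_id] measurable_det[OF mm_minus[OF mm_const[OF one_carrier_mat] mm_id refl refl]]
    show ?thesis unfolding t_def by measurable
   qed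
   have "nstep p q h A = nn (LC p q) (%Z. t (Z * Z^H))"
   proof (rule nn_cong)
    fix Z assume "Z : space (LC p q)"
    hence Z: "Z : Mat p q" by simp
    show "(if in01 p (Z * Z^H) then ennreal (Re (det (1m p - Z * Z^H)) ^ q) *
     (nn (LH q) (%Y. h (bstep p q A Z Y))) else 0) = t (Z * Z^H)"
    proof (cases "in01 p (Z * Z^H)")
     case True
     show ?thesis unfolding t_def if_P[OF True] Yint[OF Z True] ..
    next
     case False
     show ?thesis unfolding t_def if_not_P[OF False] ..
    qed
   qed
   also have "... = c' * nn (LH p) (%W. (if pdm p W then ennreal (Re (det W) ^ (q - p)) * t W else 0))" by (rule wish[OF t])
   also have "nn (LH p) (%W. (if pdm p W then ennreal (Re (det W) ^ (q - p)) * t W else 0))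
    = nn (LH p) (%W. (ennreal (KA A) * i1 A * (c * \<Omega>)) * (jw p (jac_a p (Suc n) a 2) (jac_b p (Suc n) a b 2) W * i2 W))"
   proof (rule nn_cong)
    fix W
    show "(if pdm p W then ennreal (Re (det W) ^ (q - p)) * t W else 0)
     = (ennreal (KA A) * i1 A * (c * \<Omega>)) * (jw p (jac_a p (Suc n) a 2) (jac_b p (Suc n) a b 2) W * i2 W)"
    proof (cases "in01 p W")
     case True
     note d = pd_det(1)[OF cj1[OF True]] pd_det(1)[OF cj2[OF True]]
     have kn: "0 <= KA A" by (simp add: KA_def)
     have "ennreal (Re (det W) ^ (q - p)) * (ennreal (Re (det (1m p - W)) ^ q) * ennreal (KA A * Re (det (1m p - W)) powr (a + b)))
      = ennreal (KA A) * ennreal (Re (det W) powr real (q - p) * Re (det (1m p - W)) powr (real q + (a + b)))"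
      using d kn by (simp add: powr_realpow powr_add mult_ac flip: ennreal_mult)
     thus ?thesis unfolding t_def jw_eq if_P[OF True] if_P[OF cj1[OF True]] a2 by (simp only: mult.assoc[symmetric]) (simp only: mult_ac)
    next
     case False
     thus ?thesis unfolding t_def jw_eq if_not_P[OF False] by simp
    qed
   qed
   also have "... = (ennreal (KA A) * i1 A * (c * \<Omega>)) * nn (LH p) (%W. jw p (jac_a p (Suc n) a 2) (jac_b p (Suc n) a b 2) W * i2 W)"
    unfolding i2_def by (rule nn_cmult) (use JI_meas[OF B unitD(1)[OF U2]] in \<open>simp only: meas_LH\<close>)
   also have "nn (LH p) (%W. jw p (jac_a p (Suc n) a 2) (jac_b p (Suc n) a b 2) W * i2 W) = JI p (jac_a p (Suc n) a 2) (jac_b p (Suc n) a b 2) (B 2)"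
    unfolding i2_def by (rule JI_unitary[OF U2 B])
   finally show ?thesis by (simp only: mult_ac)
  qed
  define C where "C = c' * (c * \<Omega>) * JI p (jac_a p (Suc n) a 2) (jac_b p (Suc n) a b 2) (B 2)"
  define L where "L A = (if in01 p A then ennreal ((Re (det A) * Re (det (1m p - A))) ^ q) *
    (nstep p q h A) else 0)" for A
  have "nn (LH (p + q)) (%X. h X) = nn (LH p) (%A. L A)" unfolding L_def by (rule step_integral[OF pq h h0])
  also have "... = nn (LH p) (%A. C * (jw p (jac_a p (Suc n) a 1) (jac_b p (Suc n) a b 1) A * i1 A))"
  proof (rule nn_cong)
   fix A
   show "L A = C * (jw p (jac_a p (Suc n) a 1) (jac_b p (Suc n) a b 1) A * i1 A)"
   proof (cases "in01 p A")
    case True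
    note d = pd_det(1)[OF cj1[OF True]] pd_det(1)[OF cj2[OF True]]
    have "ennreal ((Re (det A) * Re (det (1m p - A))) ^ q) * ennreal (KA A)
     = ennreal (Re (det A) powr (real q + a) * Re (det (1m p - A)) powr (real q + b))"
     using d by (simp add: KA_def powr_realpow powr_add power_mult_distrib mult_ac flip: ennreal_mult)
    thus ?thesis unfolding L_def jw_eq a1 if_P[OF True] inner[OF True] C_def[symmetric] by (simp only: mult.assoc[symmetric]) (simp only: mult_ac)
   next
    case False
    thus ?thesis unfolding L_def jw_eq if_not_P[OF False] by simp
   qed
  qed
  also have "... = C * nn (LH p) (%A. jw p (jac_a p (Suc n) a 1) (jac_b p (Suc n) a b 1) A * i1 A)"
   unfolding i1_def by (rule nn_cmult) (use JI_meas[OF B unitD(1)[OF U1]] in \<open>simp only: meas_LH\<close>)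
  also have "nn (LH p) (%A. jw p (jac_a p (Suc n) a 1) (jac_b p (Suc n) a b 1) A * i1 A) = JI p (jac_a p (Suc n) a 1) (jac_b p (Suc n) a b 1) (B 1)"
   unfolding i1_def by (rule JI_unitary[OF U1 B])
  also have "C * JI p (jac_a p (Suc n) a 1) (jac_b p (Suc n) a b 1) (B 1)
   = c' * c * (\<Prod>k\<in>{1..2 * Suc n - 1}. JI p (jac_a p (Suc n) a k) (jac_b p (Suc n) a b k) (B k))"
   unfolding prod_split2[OF Suc.hyps] jac_shift C_def \<Omega>_def by (simp only: mult_ac)
  finally show "nn (LH (p + q)) (%X. jw (p + q) a b X * (\<Prod>k\<in>{1..2 * Suc n - 1}. Ind (B k) (cm p D (mo p (p + q) X) k)))
   = c' * c * (\<Prod>k\<in>{1..2 * Suc n - 1}. JI p (jac_a p (Suc n) a k) (jac_b p (Suc n) a b k) (B k))" unfolding h_def .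
 qed
qed

section \<open>Passage to probability distributions\<close>

lemma isq_hermitian: "(isq p R)^H = isq p R" "nr (isq p R) = p" "nc (isq p R) = p" using pd_dims(2-4)[OF isqrt_pd[of p R]] by (auto simp: isq_def)

lemma hermitian_sandwich: "Herm p H ==> Herm p (sandwich p R H)"
 unfolding sandwich_def using Herm_congr[of p H "isq p R" p] isq_hermitian[of p R] by simp

lemma mo_props: assumes X: "Herm N X" and pN: "p <= N" shows "Herm p (mo p N X j)" "mo p N X j : Mat p p" "mo p N X 0 = 1m p"
proof -
 have "Herm (p + (N - p)) (mpow N X j)" using hermitian_mpow[OF X] pN by simp
 from hermitian_blocks(1)[OF this] show "Herm p (mo p N X j)" by (simp add: mo_def)
 thus "mo p N X j : Mat p p" by (rule HermD(1))
 show "mo p N X 0 = 1m p" by (rule eq_matI) (use pN in \<open>auto simp: mo_def block_def\<close>)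
qed

text \<open>Required because the canonical moments take values in \<open>herm_borel\<close>. The
  symmetry is visible in the description by moment bounds in \<open>cm_eq\<close>, where numerator
  and denominator are formed from Hermitian matrices.\<close>

lemma cm_hermitian: assumes X: "Herm N X" and pN: "p <= N" and k: "k >= 1" shows "Herm p (cm p (1m p) (mo p N X) k)"
proof -
 note m = mo_props[OF X pN]
 have "(EX L U. mbd p k (mo p N X) L U & cm p (1m p) (mo p N X) k = sandwich p (1m p * (U - L) * (1m p)^H) (1m p * (mo p N X k - L) * (1m p)^H))
  | (~ (EX L U. mbd p k (mo p N X) L U) & cm p (1m p) (mo p N X) k = 0m p p)"
  by (rule cm_eq[where M = "mo p N X" and E = "1m p", OF m(2,3)]) (use k in simp_all)
 thus ?thesis
 proof (elim disjE exE conjE)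
  fix L U assume b: "mbd p k (mo p N X) L U" and
   c: "cm p (1m p) (mo p N X) k = sandwich p (1m p * (U - L) * (1m p)^H) (1m p * (mo p N X k - L) * (1m p)^H)"
  have "Herm p L" using b by (auto simp: moment_bounds_def loewner_less_def)
  hence "Herm p (1m p * (mo p N X k - L) * (1m p)^H)" using Herm_congr[OF Herm_minus[OF m(1)], of L "1m p"] by simp
  thus ?thesis unfolding c by (rule hermitian_sandwich)
 qed (simp add: hermitian_zero)
qed

text \<open>The Hermitian matrices form a measurable set of matrices, and \<open>g\<close> is a
  measurable retraction onto it.\<close>

lemma herm_sets_mm: assumes "B : sets (herm_borel p)" shows "B : sets (mm p p)"
proof -
 define g :: "cmat => cmat" where "g X = (if Herm p X then X else 0m p p)" for X
 have hp: "Measurable.pred (mm p p) (%X. Herm p X)" by (rule pred_hermitian[OF mm_id])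
 have g: "g : meas (mm p p) (herm_borel p)" by (rule mm_herm_borel) (auto simp: g_def[abs_def] hermitian_zero intro!: mm_if hp mm_const)
 have B: "B <= hermS p" using sets.sets_into_space[OF assms] by (simp add: herm_borel_mbs)
 have "B = (g -` B Int space (mm p p)) Int {X : space (mm p p). Herm p X}" using B by (auto simp: g_def dest: HermD(3,4))
 also have "... : sets (mm p p)" using measurable_sets[OF g assms] predE[OF hp] by (rule sets.Int)
 finally show ?thesis .
qed

lemma JUE_emeasure: assumes B: "B : sets (herm_borel p)" shows "emeasure (JUE p a b) B = JI p a b B / JI p a b (hermS p)"
proof -
 have id: "(%X. X) : meas (mbs p p (hermS p)) (mm p p)" by (rule herm_mm) simp
 have w: "(%X. jw p a b X) : bm (LH p)" unfolding meas_LH by (rule jw_meas[OF id])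
 have Z: "nn (LH p) (%Y. jw p a b Y) = JI p a b (hermS p)" unfolding JI_def by (rule nn_cong) simp
 have BL: "B : sets (LH p)" using B by (simp add: herm.sets_L herm_borel_mbs)
 have "emeasure (JUE p a b) B = nn (LH p) (%X. jw p a b X / JI p a b (hermS p) * Ind B X)"
  unfolding JUE_def herm_lebesgue_L Z by (rule emeasure_density) (use w BL in auto)
 also have "... = nn (LH p) (%X. jw p a b X * Ind B X / JI p a b (hermS p))" by (simp add: divide_ennreal_def mult_ac)
 also have "... = JI p a b B / JI p a b (hermS p)" unfolding JI_def by (rule nn_integral_divide) (use w BL in auto)
 finally show ?thesis .
qed

lemma sets_JUE: "sets (JUE p a b) = sets (herm_borel p)" by (simp add: JUE_def herm_lebesgue_def)

lemma ennreal_mult_one: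
 fixes x y :: ennreal assumes e: "x * y = 1" shows "x ~= 0 & x ~= \<top>"
proof (intro conjI notI)
 assume "x = \<top>"
 thus False using e by (cases "y = 0") (simp_all add: ennreal_top_mult)
qed (use e in simp)

text \<open>A factor of a finite product equal to one is neither zero nor infinite, so division by
  each \<open>T k\<close> is legitimate and the unknown constant \<open>r\<close> cancels.\<close>

lemma ennreal_prod_one:
 fixes T J :: "nat => ennreal" assumes K: "finite K" and one: "r * (\<Prod>k\<in>K. T k) = 1"
 shows "r * (\<Prod>k\<in>K. J k) = (\<Prod>k\<in>K. J k / T k)"
proof -
 have T: "T k ~= 0 & T k ~= \<top>" if k: "k : K" for k
 proof -
  have e: "T k * (r * (\<Prod>k\<in>K - {k}. T k)) = 1" using one prod.remove[OF K k, of T] by (simp add: mult_ac)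
  show ?thesis by (rule ennreal_mult_one[OF e])
 qed
 have "(\<Prod>k\<in>K. J k) = (\<Prod>k\<in>K. T k * (J k / T k))"
  by (intro prod.cong refl) (use T in \<open>simp add: ennreal_times_divide mult.commute[of "T _"] mult_divide_eq_ennreal\<close>)
 also have "... = (\<Prod>k\<in>K. T k) * (\<Prod>k\<in>K. J k / T k)" by (rule prod.distrib)
 finally have "r * (\<Prod>k\<in>K. J k) = r * (\<Prod>k\<in>K. T k) * (\<Prod>k\<in>K. J k / T k)" by (simp add: mult.assoc)
 thus ?thesis unfolding one by simp
qed

theorem theorem4p2:
  fixes n p N :: nat and a b :: real
    and M :: "'w measure" and X :: "'w \<Rightarrow> complex mat" and \<U> :: "nat \<Rightarrow> 'w \<Rightarrow> complex mat"
  assumes "n \<ge> 1" and "p \<ge> 1" and "N = n * p" and "a \<ge> 0" and "b \<ge> 0"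
    and "prob_space M"
    and "X \<in> measurable M (herm_borel N)"
    and "distr M (herm_borel N) X = JUE N a b"
    and "\<And>k \<omega>. \<U> k \<omega> = canonical_moment p (spectral_matrix_measure p N (X \<omega>)) k"
  shows "prob_space.indep_vars M (\<lambda>_. herm_borel p) \<U> {1..2 * n - 1}
    \<and> (\<forall>k\<in>{1..n - 1}.
         distr M (herm_borel p) (\<U> (2 * k - 1))
           = JUE p (real p * (real n - real k) + a) (real p * (real n - real k) + b)
       \<and> distr M (herm_borel p) (\<U> (2 * k))
           = JUE p (real p * (real n - real k - 1)) (real p * (real n - real k) + a + b))
    \<and> distr M (herm_borel p) (\<U> (2 * n - 1)) = JUE p a b"
proof -
 let ?a = "herm_borel p"
 interpret prob_space M by fact
 define K where "K = {1..2 * n - 1}"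
 have K: "finite K" "K ~= {}" using assms(1) by (auto simp: K_def)
 have pN: "p <= N" using assms(1,3) by simp
 have Xh: "Herm N (X \<omega>)" if "\<omega> : space M" for \<omega> using measurable_space[OF assms(7) that] by (simp add: herm_borel_mbs)
 have Uc: "\<U> k \<omega> = cm p (1m p) (mo p N (X \<omega>)) k" if "\<omega> : space M" "k : K" for k \<omega>
  unfolding assms(9) mo_def[abs_def] using canonical_moment_spectral[OF Xh[OF that(1)] pN, of k] that(2) by (simp add: K_def mo_def[abs_def])
 have Um: "\<U> k : meas M ?a" if k: "k : K" for k
 proof (rule mm_herm_borel)
  have "(%\<omega>. cm p (1m p) (mo p N (X \<omega>)) k) : meas M (mm p p)" by (rule mm_cm[OF mm_const mm_mo[OF herm_borel_mm[OF assms(7)] pN]]) simp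
  thus "\<U> k : meas M (mm p p)" by (rule mm_cong) (rule Uc[OF _ k])
  show "Herm p (\<U> k \<omega>)" if "\<omega> : space M" for \<omega>
   unfolding Uc[OF that k] using k by (intro cm_hermitian[OF Xh[OF that] pN]) (simp add: K_def)
 qed
 define \<alpha> \<beta> where "\<alpha> = jac_a p n a" and "\<beta> = jac_b p n a b"
 have one: "(1m p :: cmat) : Mat p p" "1m p * 1m p = (1m p :: cmat)" by simp_all
 from moments_law[OF assms(1), of p a b] obtain c where c: "!!B. (!!k. B k : sets (mm p p)) ==>
  (nn (LH N) (%X. jw N a b X * (\<Prod>k\<in>K. Ind (B k) (cm p (1m p) (mo p N X) k)))) = c * (\<Prod>k\<in>K. JI p (\<alpha> k) (\<beta> k) (B k))"
  using one unfolding assms(3)[symmetric] K_def[symmetric] \<alpha>_def[symmetric] \<beta>_def[symmetric] by blast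
 define Z where "Z = nn (LH N) (%Y. jw N a b Y)"
 have idN: "(%X. X) : meas (mbs N N (hermS N)) (mm N N)" by (rule herm_mm) simp
 have joint: "emeasure M (\<Inter>k\<in>K. \<U> k -` B k Int space M) = c / Z * (\<Prod>k\<in>K. JI p (\<alpha> k) (\<beta> k) (B k))"
  if B: "!!k. B k : sets ?a" for B
 proof -
  have Bm: "B k : sets (mm p p)" for k by (rule herm_sets_mm[OF B])
  define g where "g X = (\<Prod>k\<in>K. Ind (B k) (cm p (1m p) (mo p N X) k) :: ennreal)" for X
  have g: "g : bm (mbs N N (hermS N))" unfolding g_def[abs_def] by (intro borel_measurable_prod_ennreal cm_ind_meas[OF idN pN one(1) Bm])
  have w: "(%X. jw N a b X) : bm (mbs N N (hermS N))" by (rule jw_meas[OF idN])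
  have S: "(\<Inter>k\<in>K. \<U> k -` B k Int space M) : sets M" using K Um B by (intro sets.finite_INT) (auto intro: measurable_sets)
  have "emeasure M (\<Inter>k\<in>K. \<U> k -` B k Int space M) = nn M (%\<omega>. Ind (\<Inter>k\<in>K. \<U> k -` B k Int space M) \<omega>)"
   using S by simp
  also have "... = nn M (%\<omega>. g (X \<omega>))"
  proof (rule nn_cong)
   fix \<omega> assume w: "\<omega> : space M"
   have "g (X \<omega>) = (\<Prod>k\<in>K. Ind (B k) (\<U> k \<omega>))" unfolding g_def using Uc[OF w] by (intro prod.cong) simp_all
   also have "... = (if ALL k:K. \<U> k \<omega> : B k then 1 else 0)" using K(1) by (auto simp: indicator_def prod_zero_iff)
   finally show "Ind (\<Inter>k\<in>K. \<U> k -` B k Int space M) \<omega> = g (X \<omega>)" using w K(2) by (auto simp: indicator_def)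
  qed
  also have "... = nn (distr M (herm_borel N) X) (%x. g x)"
   by (rule nn_integral_distr[OF assms(7), symmetric]) (use g in \<open>simp add: herm_borel_mbs\<close>)
  also have "... = nn (LH N) (%x. jw N a b x / Z * g x)" unfolding assms(8) JUE_def herm_lebesgue_L Z_def[symmetric]
   by (rule nn_integral_density) (use w g in \<open>simp_all add: meas_LH\<close>)
  also have "... = nn (LH N) (%x. jw N a b x * g x / Z)" by (simp add: divide_ennreal_def mult_ac)
  also have "... = nn (LH N) (%x. jw N a b x * g x) / Z" by (rule nn_integral_divide) (use bm_times[OF w g] in \<open>simp only: meas_LH\<close>)
  also have "... = c / Z * (\<Prod>k\<in>K. JI p (\<alpha> k) (\<beta> k) (B k))"
   unfolding g_def c[of B, OF Bm] by (simp add: divide_ennreal_def mult_ac)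
  finally show ?thesis .
 qed
 have top: "hermS p : sets ?a" using sets.top[of "herm_borel p"] by (simp add: herm_borel_mbs)
 have Uspace: "\<U> k -` hermS p Int space M = space M" if "k : K" for k using measurable_space[OF Um[OF that]] by (auto simp: herm_borel_mbs)
 have "c / Z * (\<Prod>k\<in>K. JI p (\<alpha> k) (\<beta> k) (hermS p)) = emeasure M (\<Inter>k\<in>K. \<U> k -` hermS p Int space M)"
  by (rule joint[symmetric]) (rule top)
 also have "(\<Inter>k\<in>K. \<U> k -` hermS p Int space M) = space M" using Uspace K(2) by simp
 \<comment> \<open>With the full space in every position the joint formula says that the constant
   times all total masses is one. This also excludes zero or infinite total mass for each
   ensemble.\<close>
 finally have r1: "c / Z * (\<Prod>k\<in>K. JI p (\<alpha> k) (\<beta> k) (hermS p)) = 1" using emeasure_space_1 by simp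
 have joint': "emeasure M (\<Inter>k\<in>K. \<U> k -` B k Int space M) = (\<Prod>k\<in>K. emeasure (JUE p (\<alpha> k) (\<beta> k)) (B k))"
  if B: "!!k. B k : sets ?a" for B unfolding joint[of B, OF B] JUE_emeasure[OF B] by (rule ennreal_prod_one[OF K(1) r1])
 have JUE1: "emeasure (JUE p (\<alpha> k) (\<beta> k)) (hermS p) = 1" if k: "k : K" for k
 proof -
  have e: "JI p (\<alpha> k) (\<beta> k) (hermS p) * (c / Z * (\<Prod>j\<in>K - {k}. JI p (\<alpha> j) (\<beta> j) (hermS p))) = 1"
   using r1 prod.remove[OF K(1) k, of "%k. JI p (\<alpha> k) (\<beta> k) (hermS p)"] by (simp add: mult_ac)
  show ?thesis unfolding JUE_emeasure[OF top] using ennreal_mult_one[OF e] by (simp add: ennreal_divide_self less_top zero_less_iff_neq_zero)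
 qed
 have single: "emeasure M (\<U> k -` B Int space M) = emeasure (JUE p (\<alpha> k) (\<beta> k)) B" if k: "k : K" and B: "B : sets ?a" for k B
 proof -
  \<comment> \<open>A marginal is the joint law with the full space in all other positions.\<close>
  define B' where "B' j = (if j = k then B else hermS p)" for j
  have B': "B' j : sets ?a" for j using B top by (simp add: B'_def)
  have "(\<Inter>j\<in>K. \<U> j -` B' j Int space M) = \<U> k -` B Int space M"
  proof (intro equalityI subsetI)
   fix \<omega> assume w: "\<omega> : \<U> k -` B Int space M"
   have "\<omega> : \<U> j -` B' j Int space M" if "j : K" for j using w Uspace[OF that] by (cases "j = k") (auto simp: B'_def)
   thus "\<omega> : (\<Inter>j\<in>K. \<U> j -` B' j Int space M)" by blast
  next
   fix \<omega> assume "\<omega> : (\<Inter>j\<in>K. \<U> j -` B' j Int space M)"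
   hence "\<omega> : \<U> k -` B' k Int space M" using k by blast
   thus "\<omega> : \<U> k -` B Int space M" by (simp add: B'_def)
  qed
  hence "emeasure M (\<U> k -` B Int space M) = (\<Prod>j\<in>K. emeasure (JUE p (\<alpha> j) (\<beta> j)) (B' j))" using joint'[of B', OF B'] by simp
  also have "... = emeasure (JUE p (\<alpha> k) (\<beta> k)) (B' k) * (\<Prod>j\<in>K - {k}. emeasure (JUE p (\<alpha> j) (\<beta> j)) (B' j))"
   by (rule prod.remove[OF K(1) k])
  also have "(\<Prod>j\<in>K - {k}. emeasure (JUE p (\<alpha> j) (\<beta> j)) (B' j)) = 1" by (intro prod.neutral ballI) (simp add: B'_def JUE1)
  finally show ?thesis by (simp add: B'_def)
 qed
 have law: "distr M ?a (\<U> k) = JUE p (\<alpha> k) (\<beta> k)" if k: "k : K" for k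
 proof (rule measure_eqI)
  show "sets (distr M ?a (\<U> k)) = sets (JUE p (\<alpha> k) (\<beta> k))" by (simp add: sets_JUE)
  fix B assume "B : sets (distr M ?a (\<U> k))"
  hence B: "B : sets ?a" by simp
  show "emeasure (distr M ?a (\<U> k)) B = emeasure (JUE p (\<alpha> k) (\<beta> k)) B"
   unfolding emeasure_distr[OF Um[OF k] B] by (rule single[OF k B])
 qed
 have indep: "indep_vars (%_. herm_borel p) \<U> K" unfolding indep_vars_def2
 proof (intro conjI ballI Um)
  show "indep_sets (%i. {\<U> i -` A Int space M |A. A : sets ?a}) K"
  proof (subst indep_sets_finite[OF K(2,1)])
   show "{\<U> i -` A Int space M |A. A : sets ?a} <= events" if "i : K" for i using Um[OF that] by (auto intro: measurable_sets)
   show "space M : {\<U> i -` A Int space M |A. A : sets ?a}" if "i : K" for i using Uspace[OF that] top by blast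
   show "ALL A:Pi K (%i. {\<U> i -` A Int space M |A. A : sets ?a}). prob (\<Inter> (A ` K)) = (\<Prod>j\<in>K. prob (A j))"
   proof
    fix A assume A: "A : Pi K (%i. {\<U> i -` A Int space M |A. A : sets ?a})"
    have "ALL i. EX B. B : sets ?a & (i : K --> A i = \<U> i -` B Int space M)"
    proof
     fix i
     show "EX B. B : sets ?a & (i : K --> A i = \<U> i -` B Int space M)"
     proof (cases "i : K")
      case True
      from Pi_mem[OF A True] show ?thesis by blast
     next
      case False
      with top show ?thesis by blast
     qed
    qed
    then obtain B where B: "!!i. B i : sets ?a" and AB: "!!i. i : K ==> A i = \<U> i -` B i Int space M" by metis
    have "\<Inter> (A ` K) = (\<Inter>k\<in>K. \<U> k -` B k Int space M)" using AB by auto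
    hence "emeasure M (\<Inter> (A ` K)) = (\<Prod>k\<in>K. emeasure (JUE p (\<alpha> k) (\<beta> k)) (B k))" using joint'[of B, OF B] by simp
    also have "... = (\<Prod>k\<in>K. emeasure M (A k))" by (intro prod.cong refl) (simp add: AB single[OF _ B])
    finally have "ennreal (prob (\<Inter> (A ` K))) = ennreal (\<Prod>j\<in>K. prob (A j))" by (simp add: emeasure_eq_measure prod_ennreal)
    thus "prob (\<Inter> (A ` K)) = (\<Prod>j\<in>K. prob (A j))" by (simp add: prod_nonneg)
   qed
  qed
 qed
 have odd_k: "\<alpha> (2 * k - 1) = real p * (real n - real k) + a" "\<beta> (2 * k - 1) = real p * (real n - real k) + b" if "k >= 1" for k
 proof -
  have "odd (2 * k - 1)" "Suc (2 * k - 1) div 2 = k" using that by auto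
  thus "\<alpha> (2 * k - 1) = real p * (real n - real k) + a" "\<beta> (2 * k - 1) = real p * (real n - real k) + b"
   by (simp_all add: \<alpha>_def \<beta>_def jac_a_def jac_b_def)
 qed
 have even_k: "\<alpha> (2 * k) = real p * (real n - real k - 1)" "\<beta> (2 * k) = real p * (real n - real k) + a + b" for k
  by (simp_all add: \<alpha>_def \<beta>_def jac_a_def jac_b_def)
 show ?thesis
 proof (intro conjI ballI)
  show "indep_vars (%_. herm_borel p) \<U> {1..2 * n - 1}" using indep unfolding K_def .
  fix k assume k: "k : {1..n - 1}"
  hence "2 * k - 1 : K" "2 * k : K" "k >= 1" unfolding K_def by auto
  thus "distr M ?a (\<U> (2 * k - 1)) = JUE p (real p * (real n - real k) + a) (real p * (real n - real k) + b)"
   "distr M ?a (\<U> (2 * k)) = JUE p (real p * (real n - real k - 1)) (real p * (real n - real k) + a + b)"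
   using law[of "2 * k - 1"] law[of "2 * k"] odd_k[of k] even_k[of k] by simp_all
 next
  have "2 * n - 1 : K" using assms(1) unfolding K_def by auto
  from law[OF this] show "distr M ?a (\<U> (2 * n - 1)) = JUE p a b" using odd_k[OF assms(1)] by simp
 qed
qed

end
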